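(* Let $n\in\mathbb{N}$ and $p\in[1,n)$. Let $D_1$ and $D_2$ be Jordan domains in $\mathbb{R}^n$ with $\bar D_1\subset D_2$, and let $B_1$ and $B_2$ be balls in $\mathbb{R}^n$ with $\bar B_1\subset B_2$. If $f:\bar D_2\setminus D_1\to\bar B_2\setminus B_1$ is a homeomorphism of class $LW^p_2$ such that $f(\partial D_i)=\partial B_i$ for $i=1,2$, then there exist a homeomorphism $F:\bar D_2\to\bar B_2$ of class $LW^p_2$ and a neighborhood $N$ of $\partial D_2$ such that $F|(N\cap\bar D_2)=f|(N\cap\bar D_2)$ (in particular $N\cap \bar D_2$ is contained in the domain of $f$).
   Context: Balls are open Euclidean balls. A bounded domain (open connected set) $D\subset\mathbb{R}^n$ is a Jordan domain if its boundary $\partial D$ is homeomorphic to $\mathbb{S}^{n-1}$. A homeomorphism $f:\Omega\to\Omega'$ between open subsets of $\mathbb{R}^n$ is locally bi-Lipschitz if for each $z\in\Omega$ there are a neighborhood $O$ of $z$ and $L\ge 1$ such that $L^{-1}|x-y|\le|f(x)-f(y)|\le L|x-y|$ for all $x,y\in O$. For $p\in[1,\infty)$, $W^{2,p}_{\mathrm{loc}}(\Omega;\Omega')$ is the set of maps $f:\Omega\to\Omega'$ each of whose components lies in $L^p_{\mathrm{loc}}(\Omega)$ and has weak derivatives of orders up to $2$ in $L^p_{\mathrm{loc}}(\Omega)$. A locally bi-Lipschitz homeomorphism $f:\Omega\to\Omega'$ is of class $LW^p_2$ if $f\in W^{2,p}_{\mathrm{loc}}(\Omega;\Omega')$ and $f^{-1}\in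 W^{2,p}_{\mathrm{loc}}(\Omega';\Omega)$. If $K,K'\subset\mathbb{R}^n$ are closed sets, a homeomorphism $f:K\to K'$ is of class $LW^p_2$ if the restriction of $f$ to the interior of $K$ (as a homeomorphism onto its image) is of class $LW^p_2$. *)

theory Defs
  imports "HOL-Analysis.Analysis"
begin

definition jordan_domain :: "(real^'n) set \<Rightarrow> bool" where
  "jordan_domain D \<longleftrightarrow>
     open D \<and> connected D \<and> bounded D \<and> frontier D homeomorphic sphere (0 :: real^'n) 1"

definition partial_deriv :: "'n \<Rightarrow> (real^'n \<Rightarrow> real) \<Rightarrow> real^'n \<Rightarrow> real" where
  "partial_deriv i \<phi> x = frechet_derivative \<phi> (at x) (axis i 1)"

text \<open>A partial derivative of order k is indexed by a list of k coordinate directions, instead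
  of a multi-index of weight k; for smooth functions the order of the list is irrelevant.\<close>

primrec iter_partial :: "'n list \<Rightarrow> (real^'n \<Rightarrow> real) \<Rightarrow> real^'n \<Rightarrow> real" where
  "iter_partial [] \<phi> = \<phi>"
| "iter_partial (i # js) \<phi> = partial_deriv i (iter_partial js \<phi>)"

text \<open>Differentiability (hence continuity) of all iterated partial derivatives is the same as
  being infinitely often continuously differentiable; it also ensures that the total function
  \<open>frechet_derivative\<close> is only used where a derivative exists.\<close>

definition smooth :: "(real^'n \<Rightarrow> real) \<Rightarrow> bool" where
  "smooth \<phi> \<longleftrightarrow> (\<forall>js x. iter_partial js \<phi> differentiable (at x))"

definition test_function :: "(real^'n) set \<Rightarrow> (real^'n \<Rightarrow> real) \<Rightarrow> bool" where
  "test_function \<Omega> \<phi> \<longleftrightarrow>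
     smooth \<phi> \<and> compact (closure {x. \<phi> x \<noteq> 0}) \<and> closure {x. \<phi> x \<noteq> 0} \<subseteq> \<Omega>"

text \<open>Here and below \<open>\<Omega>\<close> is meant to be open, and a map on \<open>\<Omega>\<close> is a total function whose values
  outside \<open>\<Omega>\<close> are irrelevant.\<close>

definition Lp_loc :: "real \<Rightarrow> (real^'n) set \<Rightarrow> (real^'n \<Rightarrow> real) \<Rightarrow> bool" where
  "Lp_loc p \<Omega> u \<longleftrightarrow>
     u \<in> borel_measurable (lebesgue_on \<Omega>) \<and>
     (\<forall>K. compact K \<and> K \<subseteq> \<Omega> \<longrightarrow> set_integrable lebesgue K (\<lambda>x. \<bar>u x\<bar> powr p))"

definition weak_deriv ::
  "(real^'n) set \<Rightarrow> 'n list \<Rightarrow> (real^'n \<Rightarrow> real) \<Rightarrow> (real^'n \<Rightarrow> real) \<Rightarrow> bool" where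
  "weak_deriv \<Omega> js u v \<longleftrightarrow>
     Lp_loc 1 \<Omega> u \<and> Lp_loc 1 \<Omega> v \<and>
     (\<forall>\<phi>. test_function \<Omega> \<phi> \<longrightarrow>
        (LINT x:\<Omega>|lebesgue. u x * iter_partial js \<phi> x) =
        (-1) ^ length js * (LINT x:\<Omega>|lebesgue. v x * \<phi> x))"

definition sobolev_loc :: "nat \<Rightarrow> real \<Rightarrow> (real^'n) set \<Rightarrow> (real^'n \<Rightarrow> real) \<Rightarrow> bool" where
  "sobolev_loc k p \<Omega> u \<longleftrightarrow>
     Lp_loc p \<Omega> u \<and> (\<forall>js. length js \<le> k \<longrightarrow> (\<exists>v. weak_deriv \<Omega> js u v \<and> Lp_loc p \<Omega> v))"

definition sobolev_loc_map ::
  "nat \<Rightarrow> real \<Rightarrow> (real^'n) set \<Rightarrow> (real^'n) set \<Rightarrow> (real^'n \<Rightarrow> real^'n) \<Rightarrow> bool" where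
  "sobolev_loc_map k p \<Omega> \<Omega>' f \<longleftrightarrow> f ` \<Omega> \<subseteq> \<Omega>' \<and> (\<forall>i. sobolev_loc k p \<Omega> (\<lambda>x. f x $ i))"

definition locally_bilipschitz :: "(real^'n) set \<Rightarrow> (real^'n \<Rightarrow> real^'n) \<Rightarrow> bool" where
  "locally_bilipschitz \<Omega> f \<longleftrightarrow>
     (\<forall>z\<in>\<Omega>. \<exists>U L. open U \<and> z \<in> U \<and> U \<subseteq> \<Omega> \<and> L \<ge> 1 \<and>
        (\<forall>x\<in>U. \<forall>y\<in>U. (1 / L) * norm (x - y) \<le> norm (f x - f y) \<and>
                      norm (f x - f y) \<le> L * norm (x - y)))"

definition LW2 ::
  "real \<Rightarrow> (real^'n) set \<Rightarrow> (real^'n) set \<Rightarrow> (real^'n \<Rightarrow> real^'n) \<Rightarrow> bool" where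
  "LW2 p \<Omega> \<Omega>' f \<longleftrightarrow>
     (\<exists>g. homeomorphism \<Omega> \<Omega>' f g \<and> locally_bilipschitz \<Omega> f \<and>
          sobolev_loc_map 2 p \<Omega> \<Omega>' f \<and> sobolev_loc_map 2 p \<Omega>' \<Omega> g)"

text \<open>For closed \<open>K\<close>, \<open>K'\<close>. The image of the interior is open by invariance of domain.\<close>

definition LW2_closed ::
  "real \<Rightarrow> (real^'n) set \<Rightarrow> (real^'n) set \<Rightarrow> (real^'n \<Rightarrow> real^'n) \<Rightarrow> bool" where
  "LW2_closed p K K' f \<longleftrightarrow>
     (\<exists>g. homeomorphism K K' f g) \<and> LW2 p (interior K) (f ` interior K) f"

end

(* The homeomorphism f is extended by a quantitative version of the Brown-Mazur argument for the
   generalised Schoenflies theorem. After shrinking the hole B1, let V be the region of D2 bounded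
   by the preimage under f of a small sphere. A large round ball about a point a of V is compressed
   into V by a map k that is the identity deep inside V; k is obtained by conjugating a contraction
   with f, after f has been used to turn the exterior of V inside out. Conjugating radial
   contractions by k, and by the transported map f k f^-1, gives homeomorphisms of the two domains
   that coincide with the similarities r and r' of the same ratio near V and its image. They
   modify f to a map F0 from the complement of r V onto the complement of r'(f V) that still equals
   f near the boundary, and F := r'^i F0 r^-i on the i-th shell, F a := c, is a homeomorphism.
   F is of class LW away from a because the class is local and closed under composition and
   inversion (chain rule for weak derivatives, by mollification). At a, self-similarity makes F
   Lipschitz with bounded first derivatives and second derivatives of order 1 / |x - a|, whose
   p-th power is integrable as p < n, and points are removable in dimension at least 2. *)

theory Submission
  imports Defs "HOL-Computational_Algebra.Polynomial"
begin

section \<open>Smooth functions\<close>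

text \<open>The set \<open>D1\<close> has no known shape, so it cannot be contracted directly, and
  an infinite swindle by itself gives no control of Lipschitz constants at its limit point. One
  common ratio \<open>l\<close> for all shells cures the second problem: every estimate at the
  centre becomes a geometric series. The seams close for the following reason. Let X be the region
  below a level of \<open>f\<close> and Y the ball that fills its image. The compressions satisfy
  \<Psi> k = r on X and \<Phi> \<kappa> = r' on Y, where \<kappa> = f k f^-1 is extended by the
  identity over the hole. As f carries the complement of k X to that of \<kappa> Y, the map F0 =
  \<Phi> f \<Psi>^-1 carries the complement of r X to that of r' Y, and F0 (r u) = \<Phi> f (k u) =
  \<Phi> (\<kappa> (f u)) = r' (f u) for u near the boundary of X: exactly the value that the
  self-similar continuation prescribes. Consecutive shells therefore agree on open overlaps. Since 1
  \<le> p < n forces n \<ge> 2, the dimension bound for removing a point comes for free.\<close>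

lemma partial_deriv_eq:
  assumes "(\<phi> has_derivative D) (at x)"
  shows "partial_deriv i \<phi> x = D (axis i 1)" using frechet_derivative_at[OF assms] by (simp add: partial_deriv_def)

text \<open>\<open>iter_partial\<close> adds new derivatives on the outside, whereas the product and
  quotient rules call for an induction that replaces the function by its first derivative. This
  recursion peels off the innermost derivative; \<open>iter_partial_snoc\<close> reconciles the
  two.\<close>

primrec smooth_upto :: "nat \<Rightarrow> (real^'n \<Rightarrow> real) \<Rightarrow> bool" where
  "smooth_upto 0 \<phi> \<longleftrightarrow> (\<forall>x. \<phi> differentiable at x)"
| "smooth_upto (Suc n) \<phi> \<longleftrightarrow> (\<forall>x. \<phi> differentiable at x) \<and> (\<forall>i. smooth_upto n (partial_deriv i \<phi>))"

lemma iter_partial_snoc: "iter_partial (js @ [i]) \<phi> = iter_partial js (partial_deriv i \<phi>)" by (induction js) auto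

lemma smooth_upto_iff:
  "smooth_upto n \<phi> \<longleftrightarrow> (\<forall>js x. length js \<le> n \<longrightarrow> iter_partial js \<phi> differentiable at x)"
proof (induction n arbitrary: \<phi>)
  case (Suc n)
  show ?case
  proof
    assume L: "smooth_upto (Suc n) \<phi>"
    show "\<forall>js x. length js \<le> Suc n \<longrightarrow> iter_partial js \<phi> differentiable at x"
    proof (intro allI impI)
      fix js :: "'a list" and x assume "length js \<le> Suc n"
      then show "iter_partial js \<phi> differentiable at x"
        using L Suc by (cases js rule: rev_exhaust) (auto simp: iter_partial_snoc)
    qed
  next
    assume R: "\<forall>js x. length js \<le> Suc n \<longrightarrow> iter_partial js \<phi> differentiable at x"
    have "iter_partial js (partial_deriv i \<phi>) differentiable at x" if "length js \<le> n" for js i x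
      using R[rule_format, of "js @ [i]" x] that by (simp add: iter_partial_snoc)
    then show "smooth_upto (Suc n) \<phi>" using R[rule_format, of "[]"] Suc by simp
  qed
qed simp

lemma smooth_iff_upto: "smooth \<phi> \<longleftrightarrow> (\<forall>n. smooth_upto n \<phi>)" unfolding smooth_def smooth_upto_iff by auto

lemma smooth_upto_mono: "smooth_upto n \<phi> \<Longrightarrow> m \<le> n \<Longrightarrow> smooth_upto m \<phi>" unfolding smooth_upto_iff by auto

lemma smooth_upto_differentiable: "smooth_upto n \<phi> \<Longrightarrow> \<phi> differentiable at x" by (cases n) auto

lemma smooth_differentiable: "smooth \<phi> \<Longrightarrow> \<phi> differentiable at x"
  by (simp add: smooth_iff_upto smooth_upto_differentiable)

lemma smooth_has_derivative:
  "smooth \<phi> \<Longrightarrow> (\<phi> has_derivative frechet_derivative \<phi> (at x)) (at x)"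
  by (simp add: smooth_differentiable flip: frechet_derivative_works)

lemma smooth_partial: "smooth \<phi> \<Longrightarrow> smooth (partial_deriv i \<phi>)"
  unfolding smooth_iff_upto by (metis smooth_upto.simps(2))

lemma smooth_continuous: "smooth \<phi> \<Longrightarrow> continuous_on S \<phi>"
  by (meson continuous_at_imp_continuous_on differentiable_imp_continuous_within smooth_differentiable)

lemma smooth_upto_const: "smooth_upto n (\<lambda>x. c)"
proof (induction n arbitrary: c)
  case (Suc n)
  have "partial_deriv i (\<lambda>x::real^'a. c) = (\<lambda>x. 0)" for i using partial_deriv_eq[OF has_derivative_const] by auto
  then show ?case using Suc by simp
qed simp

lemma partial_deriv_add:
  assumes "f differentiable at x" "g differentiable at x"
  shows "partial_deriv i (\<lambda>x. f x + g x) x = partial_deriv i f x + partial_deriv i g x"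
  using assms by (auto simp: frechet_derivative_works partial_deriv_def
      intro!: partial_deriv_eq[unfolded partial_deriv_def] derivative_eq_intros)

lemma partial_deriv_mult:
  assumes "f differentiable at x" "g differentiable at x"
  shows "partial_deriv i (\<lambda>x. f x * g x) x = f x * partial_deriv i g x + partial_deriv i f x * g x"
  using assms by (auto simp: frechet_derivative_works partial_deriv_def
      intro!: partial_deriv_eq[unfolded partial_deriv_def] derivative_eq_intros)

lemma partial_deriv_inverse:
  assumes "f differentiable at x" "f x \<noteq> 0"
  shows "partial_deriv i (\<lambda>x. inverse (f x)) x = - (inverse (f x) * (inverse (f x) * partial_deriv i f x))"
  using assms by (auto simp: frechet_derivative_works partial_deriv_def
      intro!: partial_deriv_eq[unfolded partial_deriv_def] derivative_eq_intros)

lemma smooth_upto_add: "smooth_upto n f \<Longrightarrow> smooth_upto n g \<Longrightarrow> smooth_upto n (\<lambda>x. f x + g x)"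
proof (induction n arbitrary: f g)
  case (Suc n)
  then have "partial_deriv i (\<lambda>x. f x + g x) = (\<lambda>x. partial_deriv i f x + partial_deriv i g x)" for i
    by (auto simp: partial_deriv_add)
  then show ?case using Suc by (simp add: differentiable_add)
qed (simp add: differentiable_add)

lemma smooth_upto_mult: "smooth_upto n f \<Longrightarrow> smooth_upto n g \<Longrightarrow> smooth_upto n (\<lambda>x. f x * g x)"
proof (induction n arbitrary: f g)
  case (Suc n)
  then have "partial_deriv i (\<lambda>x. f x * g x) = (\<lambda>x. f x * partial_deriv i g x + partial_deriv i f x * g x)" for i
    by (auto simp: partial_deriv_mult)
  moreover have "smooth_upto n f" "smooth_upto n g" using Suc.prems smooth_upto_mono le_SucI order_refl by blast+
  ultimately show ?case using Suc by (auto intro!: smooth_upto_add differentiable_mult)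
qed (simp add: differentiable_mult)

lemma smooth_upto_inverse:
  "smooth_upto n f \<Longrightarrow> (\<And>x. f x \<noteq> 0) \<Longrightarrow> smooth_upto n (\<lambda>x. inverse (f x))"
proof (induction n arbitrary: f)
  case 0 then show ?case by (simp add: differentiable_inverse)
next
  case (Suc n)
  have *: "partial_deriv i (\<lambda>x. inverse (f x)) = (\<lambda>x. (-1) * (inverse (f x) * (inverse (f x) * partial_deriv i f x)))" for i
    using Suc.prems by (auto simp: partial_deriv_inverse)
  have "smooth_upto n f" using Suc.prems smooth_upto_mono le_SucI order_refl by blast+
  then have "smooth_upto n (\<lambda>x. inverse (f x))" using Suc by auto
  then show ?case unfolding smooth_upto.simps * using Suc.prems
    by (intro conjI allI smooth_upto_mult smooth_upto_const differentiable_inverse) auto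
qed

lemma smooth_const: "smooth (\<lambda>x. c)"
  and smooth_add: "smooth f \<Longrightarrow> smooth g \<Longrightarrow> smooth (\<lambda>x. f x + g x)"
  and smooth_mult: "smooth f \<Longrightarrow> smooth g \<Longrightarrow> smooth (\<lambda>x. f x * g x)"
  and smooth_inverse: "smooth f \<Longrightarrow> (\<And>x. f x \<noteq> 0) \<Longrightarrow> smooth (\<lambda>x. inverse (f x))"
  by (auto simp: smooth_iff_upto smooth_upto_const smooth_upto_add smooth_upto_mult smooth_upto_inverse)

lemma smooth_minus: "smooth f \<Longrightarrow> smooth (\<lambda>x. - f x)" using smooth_mult[OF smooth_const[of "-1"]] by simp

lemma smooth_diff: "smooth f \<Longrightarrow> smooth g \<Longrightarrow> smooth (\<lambda>x. f x - g x)"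
  using smooth_add[of f "\<lambda>x. - g x"] smooth_minus[of g] by simp

lemma has_derivative_norm_sq:
  "((\<lambda>x::real^'n. (norm (x - a))\<^sup>2) has_derivative (\<lambda>h. 2 * ((x - a) \<bullet> h))) (at x)" unfolding power2_norm_eq_inner
  by (auto intro!: derivative_eq_intros simp: inner_commute)

lemma smooth_nth: "smooth (\<lambda>x::real^'n. x $ i)"
proof -
  have d: "((\<lambda>x::real^'n. x $ i) has_derivative (\<lambda>x. x $ i)) (at x)" for x
    by (rule bounded_linear_imp_has_derivative) (rule bounded_linear_vec_nth)
  have "partial_deriv j (\<lambda>x::real^'n. x $ i) = (\<lambda>x. axis j 1 $ i)" for j using partial_deriv_eq[OF d] by auto
  then have "smooth_upto n (\<lambda>x::real^'n. x $ i)" for n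
    using d by (cases n) (auto simp: differentiable_def smooth_upto_const)
  then show ?thesis by (simp add: smooth_iff_upto)
qed

lemma smooth_norm_sq: "smooth (\<lambda>x::real^'n. (norm (x - a))\<^sup>2)"
proof -
  have "partial_deriv j (\<lambda>x::real^'n. (norm (x - a))\<^sup>2) = (\<lambda>x. 2 * (x $ j + - (a $ j)))" for j
    using partial_deriv_eq[OF has_derivative_norm_sq] by (auto simp: inner_axis)
  moreover have "smooth_upto n (\<lambda>x::real^'n. 2 * (x $ j + - (a $ j)))" for n j
    using smooth_nth[of j, unfolded smooth_iff_upto]
    by (intro smooth_upto_mult smooth_upto_const smooth_upto_add) auto
  moreover have "(\<lambda>x::real^'n. (norm (x - a))\<^sup>2) differentiable at x" for x
    using has_derivative_norm_sq by (auto simp: differentiable_def)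
  ultimately have "smooth_upto n (\<lambda>x::real^'n. (norm (x - a))\<^sup>2)" for n by (cases n) auto
  then show ?thesis by (simp add: smooth_iff_upto)
qed

text \<open>The derivative of \<open>exp_cutoff p\<close> has the same form, so all these functions are smooth.\<close>

definition exp_cutoff :: "real poly \<Rightarrow> real \<Rightarrow> real" where
  "exp_cutoff p x = (if x > 0 then poly p (1 / x) * exp (- (1 / x)) else 0)"

definition exp_cutoff_deriv :: "real poly \<Rightarrow> real poly" where
  "exp_cutoff_deriv p = [:0, 0, 1:] * (p - pderiv p)"

lemma poly_exp_tendsto_0: "((\<lambda>y::real. poly p y * exp (- y)) \<longlongrightarrow> 0) at_top"
proof (induction p)
  case (pCons a p)
  have 1: "((\<lambda>y::real. exp (- y)) \<longlongrightarrow> 0) at_top"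
    using tendsto_power_div_exp_0[of 0] by (simp add: exp_minus field_simps)
  have "((\<lambda>y::real. y * poly p y * exp (- y)) \<longlongrightarrow> 0) at_top" for p
  proof -
    have "((\<lambda>y::real. \<Sum>i\<le>degree p. coeff p i * (y ^ Suc i / exp y)) \<longlongrightarrow> (\<Sum>i\<le>degree p. coeff p i * 0)) at_top"
      by (intro tendsto_intros tendsto_power_div_exp_0)
    moreover have "(\<lambda>y::real. y * poly p y * exp (- y)) = (\<lambda>y. \<Sum>i\<le>degree p. coeff p i * (y ^ Suc i / exp y))"
      by (auto simp: poly_altdef exp_minus field_simps sum_distrib_left sum_divide_distrib)
    ultimately show ?thesis by simp
  qed
  from tendsto_add[OF tendsto_mult_left[OF 1, of a] this[of p]] show ?case by (simp add: algebra_simps)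
qed simp

lemma has_derivative_exp_cutoff:
  "(exp_cutoff p has_real_derivative exp_cutoff (exp_cutoff_deriv p) x) (at x)"
proof -
  consider "x > 0" | "x < 0" | "x = 0" by linarith
  then show ?thesis
  proof cases
    case 1
    have "((\<lambda>x. poly p (1 / x) * exp (- (1 / x))) has_real_derivative exp_cutoff (exp_cutoff_deriv p) x) (at x)"
      using 1 by (auto intro!: derivative_eq_intros simp: exp_cutoff_def exp_cutoff_deriv_def
          power2_eq_square field_simps)
    then show ?thesis
      by (rule has_field_derivative_transform_within_open[where S="{0<..}"]) (use 1 in \<open>auto simp: exp_cutoff_def\<close>)
  next
    case 2
    have "((\<lambda>x. 0) has_real_derivative exp_cutoff (exp_cutoff_deriv p) x) (at x)"
      using 2 by (auto simp: exp_cutoff_def)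
    then show ?thesis
      by (rule has_field_derivative_transform_within_open[where S="{..<0}"]) (use 2 in \<open>auto simp: exp_cutoff_def\<close>)
  next
    case 3
    have r: "((\<lambda>h. exp_cutoff p h / h) \<longlongrightarrow> 0) (at_right 0)"
    proof -
      \<comment> \<open>Dividing by \<open>h\<close> multiplies the polynomial in 1/h by its
        variable, so the difference quotient at 0 is again a polynomial times a decaying
        exponential.\<close>
      have "((\<lambda>h::real. poly (pCons 0 p) (inverse h) * exp (- inverse h)) \<longlongrightarrow> 0) (at_right 0)"
        by (rule filterlim_compose[OF poly_exp_tendsto_0 filterlim_inverse_at_top_right])
      then show ?thesis by (rule filterlim_cong[THEN iffD1, rotated -1, OF _ refl refl])
          (auto simp: eventually_at_right_field exp_cutoff_def field_simps intro!: exI[of _ 1])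
    qed
    have l: "((\<lambda>h. exp_cutoff p h / h) \<longlongrightarrow> 0) (at_left 0)"
      by (rule tendsto_eventually) (auto simp: eventually_at_left_field exp_cutoff_def intro!: exI[of _ "-1"])
    from filterlim_split_at[OF l r] show ?thesis using 3 by (auto simp: DERIV_def exp_cutoff_def)
  qed
qed

lemma smooth_exp_cutoff:
  assumes "smooth \<phi>" shows "smooth (\<lambda>x. exp_cutoff p (\<phi> x))"
proof -
  have der: "((\<lambda>x. exp_cutoff p (\<phi> x)) has_derivative
      (\<lambda>h. exp_cutoff (exp_cutoff_deriv p) (\<phi> x) * frechet_derivative \<phi> (at x) h)) (at x)" for p x
    using has_derivative_compose[OF smooth_has_derivative[OF assms]
        has_derivative_exp_cutoff[of p "\<phi> x", unfolded has_field_derivative_def]] by simp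
  have "smooth_upto n (\<lambda>x. exp_cutoff p (\<phi> x))" for n
  proof (induction n arbitrary: p)
    case 0 then show ?case using der by (auto simp: differentiable_def)
  next
    case (Suc n)
    have "partial_deriv i (\<lambda>x. exp_cutoff p (\<phi> x)) =
        (\<lambda>x. exp_cutoff (exp_cutoff_deriv p) (\<phi> x) * partial_deriv i \<phi> x)" for i
      using partial_deriv_eq[OF der] by (auto simp: partial_deriv_def)
    moreover have "smooth_upto n (partial_deriv i \<phi>)" for i using assms smooth_partial smooth_iff_upto by blast
    ultimately show ?case using der[of p] Suc by (auto simp: differentiable_def intro!: smooth_upto_mult)
  qed
  then show ?thesis by (simp add: smooth_iff_upto)
qed

section \<open>Bump functions and radial plateaus\<close>

definition bump :: "real \<Rightarrow> real^'n \<Rightarrow> real^'n \<Rightarrow> real" where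
  "bump r a x = exp_cutoff 1 (r\<^sup>2 - (norm (x - a))\<^sup>2)"

lemma smooth_bump: "smooth (bump r a)"
  unfolding bump_def by (intro smooth_exp_cutoff smooth_diff smooth_const smooth_norm_sq)

lemma bump_nonneg: "bump r a x \<ge> 0" by (simp add: bump_def exp_cutoff_def)

lemma bump_pos_iff: "r > 0 \<Longrightarrow> bump r a x > 0 \<longleftrightarrow> x \<in> ball a r"
  using power_strict_mono[of "norm (x - a)" r 2] power_mono[of r "norm (x - a)" 2]
  by (cases "norm (x - a) < r") (auto simp: bump_def exp_cutoff_def dist_norm norm_minus_commute not_less)

text \<open>A smooth plateau, equal to 1 on the ball of radius \<open>r\<close> and to 0 off the
  ball of radius \<open>R\<close>. Of the two terms of the denominator the first is positive inside
  radius \<open>R\<close> and the second outside radius \<open>r\<close>, so for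
  \<open>r < R\<close> it never vanishes.\<close>

definition cutoff :: "real \<Rightarrow> real \<Rightarrow> real^'n \<Rightarrow> real^'n \<Rightarrow> real" where
  "cutoff r R a x = bump R a x * inverse (bump R a x + exp_cutoff 1 ((norm (x - a))\<^sup>2 - r\<^sup>2))"

lemma cutoff_denom_pos:
  assumes "0 < r" "r < R"
  shows "bump R a x + exp_cutoff 1 ((norm (x - a))\<^sup>2 - r\<^sup>2) > 0"
proof (cases "x \<in> ball a R")
  case True
  then show ?thesis using bump_pos_iff[of R a x] assms by (simp add: exp_cutoff_def add_pos_nonneg)
next
  case False
  then have "norm (x - a) > r" using assms by (simp add: dist_norm norm_minus_commute)
  then have "(norm (x - a))\<^sup>2 > r\<^sup>2" using assms by (intro power_strict_mono) auto
  then show ?thesis using bump_nonneg[of R a x] by (simp add: exp_cutoff_def add_nonneg_pos)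
qed

lemma smooth_cutoff: "0 < r \<Longrightarrow> r < R \<Longrightarrow> smooth (cutoff r R a)" unfolding cutoff_def
  by (intro smooth_mult smooth_inverse smooth_add smooth_bump smooth_exp_cutoff smooth_diff
      smooth_norm_sq smooth_const) (metis cutoff_denom_pos less_irrefl)

lemma cutoff_eq_1:
  assumes "0 < r" "r < R" "norm (x - a) \<le> r" shows "cutoff r R a x = 1"
proof -
  have "exp_cutoff 1 ((norm (x - a))\<^sup>2 - r\<^sup>2) = 0" using power_mono[OF assms(3), of 2] by (simp add: exp_cutoff_def)
  then show ?thesis using cutoff_denom_pos[OF assms(1,2), of a x] by (simp add: cutoff_def)
qed

lemma cutoff_eq_0:
  assumes "0 < R" "norm (x - a) \<ge> R" shows "cutoff r R a x = 0"
proof -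
  have "\<not> 0 < R\<^sup>2 - (norm (x - a))\<^sup>2" using power_mono[OF assms(2), of 2] assms(1) by linarith
  then show ?thesis by (simp add: cutoff_def bump_def exp_cutoff_def)
qed

lemma cutoff_bounds: "0 \<le> cutoff r R a x" "cutoff r R a x \<le> 1"
proof -
  have "exp_cutoff 1 ((norm (x - a))\<^sup>2 - r\<^sup>2) \<ge> 0" by (simp add: exp_cutoff_def)
  then show "0 \<le> cutoff r R a x" "cutoff r R a x \<le> 1"
    using bump_nonneg[of R a x] unfolding cutoff_def divide_inverse[symmetric]
    by (auto intro: divide_le_eq_1[THEN iffD2])
qed

section \<open>Test functions\<close>

lemma test_function_smooth: "test_function X \<phi> \<Longrightarrow> smooth \<phi>" by (simp add: test_function_def)

lemma test_function_mono: "test_function U \<phi> \<Longrightarrow> U \<subseteq> X \<Longrightarrow> test_function X \<phi>" by (auto simp: test_function_def)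

text \<open>Supports enter only through some compact set off which the function vanishes; the
  closure in the definition is dealt with here once and for all.\<close>

lemma test_function_I:
  assumes "smooth \<phi>" "compact K" "K \<subseteq> X" "\<And>x. x \<notin> K \<Longrightarrow> \<phi> x = 0"
  shows "test_function X \<phi>"
proof -
  have "closure {x. \<phi> x \<noteq> 0} \<subseteq> K" using assms by (intro closure_minimal compact_imp_closed) auto
  moreover have "compact (closure {x. \<phi> x \<noteq> 0})"
    using calculation assms(2) by (metis bounded_subset closed_closure compact_eq_bounded_closed)
  ultimately show ?thesis using assms(1,3) unfolding test_function_def by auto
qed

lemma test_function_compact:
  assumes "test_function X \<phi>"
  obtains K where "compact K" "K \<subseteq> X" "\<And>x. x \<notin> K \<Longrightarrow> \<phi> x = 0" "\<And>x i. x \<notin> K \<Longrightarrow> partial_deriv i \<phi> x = 0"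
proof
  let ?K = "closure {x. \<phi> x \<noteq> 0}"
  show "compact ?K" "?K \<subseteq> X" using assms by (auto simp: test_function_def)
  show z: "\<phi> x = 0" if "x \<notin> ?K" for x using that closure_subset[of "{x. \<phi> x \<noteq> 0}"] by auto
  fix x i assume x: "x \<notin> ?K"
  have 0: "((\<lambda>x::real^'a. 0::real) has_derivative (\<lambda>h. 0)) (at x)" by (rule has_derivative_const)
  have "(\<phi> has_derivative (\<lambda>h. 0)) (at x)"
  proof (rule has_derivative_transform_within_open[OF 0])
    show "open (- ?K)" "x \<in> - ?K" using x by auto
    show "0 = \<phi> y" if "y \<in> - ?K" for y using z[of y] that by (metis ComplD)
  qed
  from partial_deriv_eq[OF this] show "partial_deriv i \<phi> x = 0" by simp
qed

lemma test_function_partial: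
  assumes "test_function X \<phi>" shows "test_function X (partial_deriv i \<phi>)"
proof (rule test_function_compact[OF assms])
  fix K assume "compact K" "K \<subseteq> X" "\<And>x i. x \<notin> K \<Longrightarrow> partial_deriv i \<phi> x = 0"
  then show ?thesis using test_function_I[OF smooth_partial[OF test_function_smooth[OF assms]]] by blast
qed

lemma test_function_mult:
  assumes "test_function X \<phi>" "smooth \<psi>" shows "test_function X (\<lambda>x. \<phi> x * \<psi> x)"
proof (rule test_function_compact[OF assms(1)])
  fix K assume K: "compact K" "K \<subseteq> X" "\<And>x. x \<notin> K \<Longrightarrow> \<phi> x = 0"
  show ?thesis
    by (rule test_function_I[OF smooth_mult[OF test_function_smooth[OF assms(1)] assms(2)] K(1,2)]) (simp add: K(3))
qed

lemma test_function_bump: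
  assumes "0 < r" "cball a r \<subseteq> X" shows "test_function X (bump r a)"
proof (rule test_function_I[OF smooth_bump compact_cball])
  show "bump r a x = 0" if "x \<notin> cball a r" for x
    using bump_nonneg[of r a x] bump_pos_iff[of r a x] that assms(1) by (simp add: less_le)
qed (rule assms)

lemma test_function_continuous: "test_function X \<phi> \<Longrightarrow> continuous_on S \<phi>"
  by (simp add: smooth_continuous test_function_smooth)

lemma compact_support_bounded:
  fixes \<phi> :: "'a::metric_space \<Rightarrow> real"
  assumes "continuous_on UNIV \<phi>" "compact K" "\<And>x. x \<notin> K \<Longrightarrow> \<phi> x = 0"
  obtains B where "B > 0" "\<And>x. \<bar>\<phi> x\<bar> \<le> B"
proof -
  have "compact (\<phi> ` K)" using assms(1,2) by (meson compact_continuous_image continuous_on_subset subset_UNIV)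
  then obtain B where B: "\<And>x. x \<in> K \<Longrightarrow> \<bar>\<phi> x\<bar> \<le> B"
    using compact_imp_bounded[of "\<phi> ` K"] by (auto simp: bounded_iff)
  show ?thesis
  proof
    show "\<bar>B\<bar> + 1 > 0" by simp
    show "\<bar>\<phi> x\<bar> \<le> \<bar>B\<bar> + 1" for x using B[of x] assms(3)[of x] by (cases "x \<in> K") auto
  qed
qed

lemma test_function_bounded:
  assumes "test_function X \<phi>"
  obtains B where "B > 0" "\<And>x. \<bar>\<phi> x\<bar> \<le> B"
proof (rule test_function_compact[OF assms])
  fix K assume "compact K" and K: "\<And>x. x \<notin> K \<Longrightarrow> \<phi> x = 0"
  show ?thesis
    by (rule compact_support_bounded[OF test_function_continuous[OF assms] \<open>compact K\<close> K that])
qed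

section \<open>Mollification\<close>

lemma integral_lborel_translation:
  fixes f :: "'a::euclidean_space \<Rightarrow> real"
  shows "(LINT y|lborel. f (y + c)) = (LINT y|lborel. f y)"
proof (cases "f \<in> borel_measurable borel")
  case True
  then have "(LINT y|distr lborel borel ((+) c). f y) = (LINT y|lborel. f (c + y))" by (intro integral_distr) auto
  then show ?thesis by (simp add: lborel_distr_plus add.commute)
next
  \<comment> \<open>Neither integrand is measurable, so both integrals have the default value
    0.\<close>
  case False
  have "(\<lambda>y. f (y + c)) \<notin> borel_measurable borel"
  proof
    assume "(\<lambda>y. f (y + c)) \<in> borel_measurable borel"
    then have "(\<lambda>y. f ((y - c) + c)) \<in> borel_measurable borel" by (rule measurable_compose[rotated]) auto
    with False show False by simp
  qed
  then have "\<not> integrable lborel (\<lambda>y. f (y + c))" "\<not> integrable lborel f"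
    using False borel_measurable_integrable by force+
  then show ?thesis by (simp add: not_integrable_integral_eq)
qed

lemma integrable_compact_support:
  fixes \<phi> :: "'a::euclidean_space \<Rightarrow> real"
  assumes "continuous_on UNIV \<phi>" "compact K" "\<And>x. x \<notin> K \<Longrightarrow> \<phi> x = 0"
  shows "integrable lborel \<phi>"
proof -
  have "set_integrable lborel K \<phi>" unfolding set_integrable_def
    using borel_integrable_compact[OF assms(2) continuous_on_subset[OF assms(1) subset_UNIV]] by simp
  moreover have "(\<lambda>x. indicator K x *\<^sub>R \<phi> x) = \<phi>"
  proof
    show "indicator K x *\<^sub>R \<phi> x = \<phi> x" for x using assms(3)[of x] by (cases "x \<in> K") auto
  qed
  ultimately show ?thesis by (simp add: set_integrable_def)
qed

lemma test_function_integrable: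
  assumes "test_function X \<phi>" shows "integrable lborel \<phi>" by (rule test_function_compact[OF assms])
    (rule integrable_compact_support[OF test_function_continuous[OF assms]])

lemma integrable_bump: "r > 0 \<Longrightarrow> integrable lborel (bump r a)"
  by (rule test_function_integrable[OF test_function_bump[of r a UNIV]]) auto

lemma integral_bump_pos:
  assumes "r > 0" shows "(LINT y|lborel. bump r (0::real^'a) y) > 0"
proof -
  have "(LINT y|lborel. bump r (0::real^'a) y) \<noteq> 0"
  proof
    assume "(LINT y|lborel. bump r (0::real^'a) y) = 0"
    then have "AE y in lborel. bump r (0::real^'a) y = 0"
      using integral_nonneg_eq_0_iff_AE[OF integrable_bump[OF assms, of 0]] bump_nonneg by blast
    then have "AE y in lborel. y \<notin> ball (0::real^'a) r"
    proof eventually_elim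
      case (elim y)
      then show ?case using bump_pos_iff[OF assms, of 0 y] by simp
    qed
    then have "emeasure lborel (ball (0::real^'a) r) = 0"
      using AE_iff_null_sets[of "ball (0::real^'a) r" lborel] by (auto simp: null_sets_def)
    then show False using content_ball_pos[OF assms, of "0::real^'a"] by (simp add: measure_def)
  qed
  then show ?thesis using Bochner_Integration.integral_nonneg[of lborel "bump r (0::real^'a)"] bump_nonneg by (metis order_le_less)
qed

definition mollifier :: "real \<Rightarrow> real^'n \<Rightarrow> real^'n \<Rightarrow> real" where
  "mollifier r x y = bump r x y / (LINT y|lborel. bump r (0::real^'n) y)"

lemma mollifier_nonneg: "r > 0 \<Longrightarrow> mollifier r x y \<ge> 0"
  using integral_bump_pos[of r, where 'a='a] bump_nonneg[of r x y] by (simp add: mollifier_def less_imp_le)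

lemma mollifier_eq_0: "r > 0 \<Longrightarrow> y \<notin> ball x r \<Longrightarrow> mollifier r x y = 0"
  using bump_pos_iff[of r x y] bump_nonneg[of r x y] by (simp add: mollifier_def order_le_less)

lemma mollifier_sym: "mollifier r x y = mollifier r y x" by (simp add: mollifier_def bump_def norm_minus_commute)

lemma test_function_mollifier: "r > 0 \<Longrightarrow> cball x r \<subseteq> X \<Longrightarrow> test_function X (mollifier r x)"
  using test_function_mult[OF test_function_bump smooth_const[of "inverse (LINT y|lborel. bump r (0::real^'n) y)"], of r x X]
  by (simp add: mollifier_def[abs_def] divide_inverse)

lemma test_function_mollifier_UNIV: "r > 0 \<Longrightarrow> test_function UNIV (mollifier r x)"
  by (rule test_function_mollifier) auto

lemma integrable_mollifier: "r > 0 \<Longrightarrow> integrable lborel (mollifier r x)"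
  by (rule test_function_integrable[OF test_function_mollifier_UNIV])

lemma mollifier_translate: "mollifier r x y = mollifier r 0 (y - x)" by (simp add: mollifier_def bump_def)

lemma integral_mollifier: "r > 0 \<Longrightarrow> (LINT y|lborel. mollifier r x y) = 1"
  using integral_lborel_translation[of "\<lambda>y. mollifier r 0 y" "-x"] integral_bump_pos[of r, where 'a='a]
  by (simp add: mollifier_translate[of r x]) (simp add: mollifier_def)

definition moll :: "real \<Rightarrow> (real^'n \<Rightarrow> real) \<Rightarrow> real^'n \<Rightarrow> real" where
  "moll r w x = (LINT y|lborel. mollifier r x y * w y)"

lemma mollifier_bounded:
  assumes "r > 0" obtains B where "B > 0" "\<And>x y :: real^'n. \<bar>mollifier r x y\<bar> \<le> B"
proof (rule test_function_bounded[OF test_function_mollifier_UNIV[OF assms, of 0]])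
  fix B assume "0 < B" "\<And>x::real^'n. \<bar>mollifier r 0 x\<bar> \<le> B"
  with that show ?thesis by (metis mollifier_translate)
qed

lemma continuous_mollifier: "r > 0 \<Longrightarrow> continuous_on UNIV (mollifier r x)"
  by (rule test_function_continuous[OF test_function_mollifier_UNIV])

lemma measurable_mollifier2: "(\<lambda>(x, y). mollifier r x y) \<in> borel_measurable (borel \<Otimes>\<^sub>M borel)"
  if "r > 0"
proof -
  have "(\<lambda>p. mollifier r 0 (snd p - fst p)) \<in> borel_measurable (borel \<Otimes>\<^sub>M borel)"
    using borel_measurable_continuous_onI[OF continuous_mollifier[OF that, of 0]] by measurable
  then show ?thesis by (simp add: mollifier_translate[symmetric] case_prod_beta')
qed

lemma integrable_bounded_mult:
  fixes w \<phi> :: "'a \<Rightarrow> real"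
  assumes "integrable M w" "\<phi> \<in> borel_measurable M" "\<And>x. \<bar>\<phi> x\<bar> \<le> B"
  shows "integrable M (\<lambda>y. \<phi> y * w y)"
proof (rule Bochner_Integration.integrable_bound[of _ "\<lambda>y. B * w y"])
  show "AE y in M. norm (\<phi> y * w y) \<le> norm (B * w y)"
    using assms(3) order_trans[OF abs_ge_zero assms(3)] by (auto simp: abs_mult intro!: mult_right_mono order_trans[OF assms(3)])
qed (use assms in auto)

lemma integrable_mollifier_mult:
  assumes "r > 0" "integrable lborel w" shows "integrable lborel (\<lambda>y. mollifier r x y * w y)"
proof (rule mollifier_bounded[OF assms(1)])
  fix B assume "\<And>x y::real^'a. \<bar>mollifier r x y\<bar> \<le> B"
  then show ?thesis using assms borel_measurable_continuous_onI[OF continuous_mollifier[OF assms(1), of x]]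
    by (intro integrable_bounded_mult) auto
qed

text \<open>\<open>w\<close> depends on the variable that Fubini integrates last: the inner integral
  of the absolute value is then \<open>\<bar>w x\<bar>\<close> because the kernel has mass 1. As the
  kernel is symmetric, mollification is the other iterated integral, see
  \<open>moll_alt\<close>.\<close>

lemma integrable_mollifier_pair:
  fixes w :: "real^'n \<Rightarrow> real"
  assumes "r > 0" "integrable lborel w"
  shows "integrable (lborel \<Otimes>\<^sub>M lborel) (\<lambda>(x, y). mollifier r x y * w x)"
proof (rule lborel_pair.Fubini_integrable)
  have [measurable]: "w \<in> borel_measurable borel" using assms(2) by simp
  note measurable_mollifier2[OF assms(1), where 'a='n, measurable]
  have "(\<lambda>p::(real^'n) \<times> (real^'n). (\<lambda>(x, y). mollifier r x y) p * w (fst p)) \<in> borel_measurable (borel \<Otimes>\<^sub>M borel)"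
    by measurable
  then show "(\<lambda>(x, y). mollifier r x y * w x) \<in> borel_measurable (lborel \<Otimes>\<^sub>M lborel)" by (simp add: case_prod_beta')
  have "(\<integral>y. norm (mollifier r x y * w x) \<partial>lborel) = \<bar>w x\<bar>" for x
    using mollifier_nonneg[OF assms(1), of x] integral_mollifier[OF assms(1), of x] by (simp add: abs_mult)
  then show "integrable lborel (\<lambda>x. \<integral>y. norm (case (x, y) of (x, y) \<Rightarrow> mollifier r x y * w x) \<partial>lborel)"
    using assms(2) by simp
  show "AE x in lborel. integrable lborel (\<lambda>y. case (x, y) of (x, y) \<Rightarrow> mollifier r x y * w x)"
    using integrable_mollifier[OF assms(1)] by (intro AE_I2) auto
qed

lemma moll_alt: "moll r w y = (LINT x|lborel. mollifier r x y * w x)" by (simp add: moll_def mollifier_sym)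

lemma integrable_moll: "r > 0 \<Longrightarrow> integrable lborel w \<Longrightarrow> integrable lborel (moll r w)"
  unfolding moll_alt[abs_def] using lborel_pair.integrable_snd[OF integrable_mollifier_pair] by blast

text \<open>Averaging against a symmetric probability kernel does not increase the mean, by Fubini.
  The bound is uniform in \<open>r\<close>, which is what the density argument of
  \<open>moll_tendsto_L1\<close> requires.\<close>

lemma moll_contraction:
  assumes "r > 0" "integrable lborel w"
  shows "(LINT x|lborel. \<bar>moll r w x\<bar>) \<le> (LINT x|lborel. \<bar>w x\<bar>)"
proof -
  have "(LINT x|lborel. \<bar>moll r w x\<bar>) \<le> (LINT x|lborel. moll r (\<lambda>x. \<bar>w x\<bar>) x)"
  proof (rule integral_mono)
    fix x
    have "\<bar>moll r w x\<bar> \<le> (LINT y|lborel. norm (mollifier r x y * w y))"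
      using Bochner_Integration.integral_norm_bound[of lborel "\<lambda>y. mollifier r x y * w y"] unfolding moll_def by simp
    then show "\<bar>moll r w x\<bar> \<le> moll r (\<lambda>x. \<bar>w x\<bar>) x"
      using mollifier_nonneg[OF assms(1), of x] by (simp add: moll_def abs_mult)
  next
    show "integrable lborel (moll r (\<lambda>x. \<bar>w x\<bar>))" using assms by (intro integrable_moll) auto
  qed (use assms integrable_moll in auto)
  also have "\<dots> = (LINT x|lborel. LINT y|lborel. mollifier r x y * \<bar>w x\<bar>)"
    unfolding moll_alt using assms by (intro lborel_pair.Fubini_integral integrable_mollifier_pair) auto
  also have "\<dots> = (LINT x|lborel. \<bar>w x\<bar>)"
  proof (rule Bochner_Integration.integral_cong[OF refl])
    show "(LINT y|lborel. mollifier r x y * \<bar>w x\<bar>) = \<bar>w x\<bar>" for x using integral_mollifier[OF assms(1), of x] by simp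
  qed
  finally show ?thesis .
qed

lemma moll_diff:
  assumes "r > 0" "integrable lborel v" "integrable lborel w"
  shows "moll r (\<lambda>y. v y - w y) x = moll r v x - moll r w x" unfolding moll_def right_diff_distrib
  by (rule Bochner_Integration.integral_diff) (intro integrable_mollifier_mult assms)+

lemma moll_minus_value:
  assumes "r > 0" "integrable lborel w"
  shows "moll r w x - c = (LINT y|lborel. mollifier r x y * (w y - c))"
  using Bochner_Integration.integral_diff[OF integrable_mollifier_mult[OF assms]
      integrable_mult_left[OF integrable_mollifier[OF assms(1), of x], of c], of x] integral_mollifier[OF assms(1), of x]
  by (simp add: moll_def right_diff_distrib)

text \<open>The value at \<open>x\<close> is an average over \<open>ball x r\<close>. With
  \<open>c = 0\<close> this transfers essential bounds; with \<open>c\<close> the value at the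
  centre it gives convergence for continuous functions.\<close>

lemma moll_bound:
  assumes "r > 0" "integrable lborel w" "AE y in lborel. y \<in> ball x r \<longrightarrow> \<bar>w y - c\<bar> \<le> M"
  shows "\<bar>moll r w x - c\<bar> \<le> M"
proof -
  have "\<bar>moll r w x - c\<bar> \<le> (LINT y|lborel. norm (mollifier r x y * (w y - c)))"
    using Bochner_Integration.integral_norm_bound[of lborel "\<lambda>y. mollifier r x y * (w y - c)"]
    unfolding moll_minus_value[OF assms(1,2)] real_norm_def .
  also have "\<dots> \<le> (LINT y|lborel. mollifier r x y * M)"
  proof (rule integral_mono_AE)
    show "AE y in lborel. norm (mollifier r x y * (w y - c)) \<le> mollifier r x y * M" using assms(3)
    proof eventually_elim
      case (elim y)
      then show ?case using mollifier_nonneg[OF assms(1), of x y] mollifier_eq_0[OF assms(1), of y x]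
        by (cases "y \<in> ball x r") (auto simp: abs_mult mult_left_mono)
    qed
    have "integrable lborel (\<lambda>y. mollifier r x y * w y - mollifier r x y * c)"
      by (intro Bochner_Integration.integrable_diff integrable_mollifier_mult integrable_mult_left
          integrable_mollifier assms)
    then show "integrable lborel (\<lambda>y. norm (mollifier r x y * (w y - c)))"
      by (intro Bochner_Integration.integrable_norm) (simp add: right_diff_distrib)
  qed (use integrable_mollifier[OF assms(1)] in auto)
  also have "\<dots> = M" using integral_mollifier[OF assms(1), of x] by simp
  finally show ?thesis .
qed

text \<open>Induction over integrable functions: an indicator is squeezed between a closed and an
  open set and replaced by a Urysohn function; sums and dominated limits follow.\<close>

lemma L1_dense_continuous:
  fixes w :: "'a::euclidean_space \<Rightarrow> real"
  assumes "integrable lborel w" "e > 0"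
  shows "\<exists>g. continuous_on UNIV g \<and> integrable lborel g \<and> (LINT x|lborel. \<bar>w x - g x\<bar>) < e" using assms
proof (induction arbitrary: e)
  case (base A c)
  \<comment> \<open>The Urysohn function differs from the indicator only on \<open>A - T\<close> and
    \<open>U - A\<close>, each of measure below \<open>e'\<close>; the added 1 covers
    \<open>c = 0\<close>.\<close>
  define e' where "e' = e / (2 * (\<bar>c\<bar> + 1))"
  have e': "e' > 0" and ce: "\<bar>c\<bar> * (2 * e') < e" using base by (auto simp: e'_def field_simps)
  have A: "A \<in> sets lebesgue" "A \<in> sets borel" using base by auto
  obtain T where T: "closed T" "T \<subseteq> A" "A - T \<in> lmeasurable" "emeasure lebesgue (A - T) < ennreal e'"
    using sets_lebesgue_inner_closed[OF A(1) e'] by blast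
  obtain U where U: "open U" "A \<subseteq> U" "U - A \<in> lmeasurable" "emeasure lebesgue (U - A) < ennreal e'"
    using sets_lebesgue_outer_open[OF A(1) e'] by blast
  have disj: "closed (- U)" "- U \<inter> T = {}" using T U by auto
  obtain f :: "'a \<Rightarrow> real" where f: "continuous_on UNIV f" "\<And>x. f x \<in> closed_segment 0 1"
      "\<And>x. x \<in> - U \<Longrightarrow> f x = 0" "\<And>x. x \<in> T \<Longrightarrow> f x = 1" by (rule Urysohn[OF disj(1) T(1) disj(2), of 0 "1::real"]) blast
  have f01: "0 \<le> f x" "f x \<le> 1" for x using f(2)[of x] by (auto simp: closed_segment_eq_real_ivl)
  let ?d = "\<lambda>x. indicator A x * c - f x * c"
  have b: "\<bar>c\<bar> * f x \<le> \<bar>c\<bar>" "\<bar>c - f x * c\<bar> \<le> \<bar>c\<bar>" for x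
  proof -
    show "\<bar>c\<bar> * f x \<le> \<bar>c\<bar>" using f01[of x] by (intro mult_left_le) auto
    have "c - f x * c = c * (1 - f x)" by (simp add: algebra_simps)
    then have "\<bar>c - f x * c\<bar> = \<bar>c\<bar> * (1 - f x)" using f01[of x] by (simp add: abs_mult)
    also have "\<dots> \<le> \<bar>c\<bar>" using f01[of x] by (intro mult_left_le) auto
    finally show "\<bar>c - f x * c\<bar> \<le> \<bar>c\<bar>" .
  qed
  have le: "\<bar>?d x\<bar> \<le> \<bar>c\<bar> * (indicator (A - T) x + indicator (U - A) x)" for x
    using f(3,4)[of x] f01[of x] T(2) U(2) b[of x] by (cases "x \<in> A"; cases "x \<in> T"; cases "x \<in> U")
      (auto simp: abs_mult mult.commute[of _ "\<bar>c\<bar>"])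
  have AT: "A - T \<in> sets borel" "U - A \<in> sets borel" using T U A by auto
  then have em: "emeasure lborel (A - T) < ennreal e'" "emeasure lborel (U - A) < ennreal e'" using T(4) U(4) by auto
  then have i: "integrable lborel (\<lambda>x. \<bar>c\<bar> * (indicator (A - T) x + indicator (U - A) x))"
    using AT by (intro integrable_mult_right Bochner_Integration.integrable_add integrable_real_indicator)
      (auto intro: less_trans)
  have id: "integrable lborel ?d"
  proof (rule Bochner_Integration.integrable_bound[OF i])
    show "?d \<in> borel_measurable lborel" using borel_measurable_continuous_onI[OF f(1)] A(2) by simp
  qed (use le in \<open>auto intro: order_trans[OF _ abs_ge_self]\<close>)
  have "(LINT x|lborel. \<bar>?d x\<bar>) \<le> (LINT x|lborel. \<bar>c\<bar> * (indicator (A - T) x + indicator (U - A) x))"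
    using id i le by (intro integral_mono) auto
  also have "\<dots> = \<bar>c\<bar> * (measure lborel (A - T) + measure lborel (U - A))"
    using AT em by (subst integral_mult_right_zero, subst Bochner_Integration.integral_add)
      (auto intro!: integrable_real_indicator intro: less_trans)
  also have "\<dots> \<le> \<bar>c\<bar> * (2 * e')"
  proof -
    have "measure lborel (A - T) \<le> e'" "measure lborel (U - A) \<le> e'"
      using em e' by (auto simp: measure_def enn2real_leI less_imp_le)
    then show ?thesis by (intro mult_left_mono) auto
  qed
  also have "\<dots> < e" by (rule ce)
  finally have lt: "(LINT x|lborel. \<bar>?d x\<bar>) < e" .
  have ia: "integrable lborel (\<lambda>x. indicator A x * c)" using base by (auto intro!: integrable_real_indicator)
  have "integrable lborel (\<lambda>x. f x * c)" using Bochner_Integration.integrable_diff[OF ia id] by simp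
  moreover have "continuous_on UNIV (\<lambda>x. f x * c)" using f(1) by (intro continuous_intros)
  ultimately show ?case by (intro exI[of _ "\<lambda>x. f x * c"] conjI) (use lt in simp_all)
next
  case (add f g)
  have e2: "e / 2 > 0" using add.prems by simp
  from add(3)[OF e2] obtain a where a: "continuous_on UNIV a" "integrable lborel a" "(LINT x|lborel. \<bar>f x - a x\<bar>) < e/2"
    by blast
  from add(4)[OF e2] obtain b where b: "continuous_on UNIV b" "integrable lborel b" "(LINT x|lborel. \<bar>g x - b x\<bar>) < e/2"
    by blast
  have "(LINT x|lborel. \<bar>(f x + g x) - (a x + b x)\<bar>) \<le> (LINT x|lborel. \<bar>f x - a x\<bar> + \<bar>g x - b x\<bar>)"
    using add a b by (intro integral_mono) auto
  also have "\<dots> < e" using add a b by simp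
  finally show ?case using a b by (intro exI[of _ "\<lambda>x. a x + b x"]) (auto intro: continuous_on_add)
next
  case (lim f s)
  \<comment> \<open>The induction rule bounds the approximants by twice the absolute value of
    \<open>f\<close>, hence the factor 3 in the dominating function.\<close>
  have "(\<lambda>i. LINT x|lborel. norm (s i x - f x)) \<longlonglongrightarrow> integral\<^sup>L (lborel :: 'a measure) (\<lambda>x. 0)"
  proof (rule integral_dominated_convergence[where w="\<lambda>x. 3 * \<bar>f x\<bar>"])
    show "AE x in lborel. (\<lambda>i. norm (s i x - f x)) \<longlonglongrightarrow> 0"
    proof (rule AE_I2)
      fix x :: 'a assume "x \<in> space lborel"
      from lim(2)[OF this] show "(\<lambda>i. norm (s i x - f x)) \<longlonglongrightarrow> 0" by (intro tendsto_norm_zero) (simp add: LIM_zero)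
    qed
    show "AE x in lborel. norm (norm (s i x - f x)) \<le> 3 * \<bar>f x\<bar>" for i
    proof (rule AE_I2)
      fix x :: 'a assume "x \<in> space lborel"
      from lim(3)[OF this, of i] show "norm (norm (s i x - f x)) \<le> 3 * \<bar>f x\<bar>" by auto
    qed
  qed (use lim in auto)
  then have "\<forall>\<^sub>F i in sequentially. (LINT x|lborel. norm (s i x - f x)) < e/2"
    using lim(6) by (intro order_tendstoD(2)) auto
  then obtain i where i: "(LINT x|lborel. norm (s i x - f x)) < e/2" by (auto simp: eventually_sequentially)
  obtain g where g: "continuous_on UNIV g" "integrable lborel g" "(LINT x|lborel. \<bar>s i x - g x\<bar>) < e/2"
    using lim(5)[of "e/2" i] lim(6) by auto
  have "(LINT x|lborel. \<bar>f x - g x\<bar>) \<le> (LINT x|lborel. norm (s i x - f x) + \<bar>s i x - g x\<bar>)"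
    using lim(1)[of i] lim(4) g by (intro integral_mono) auto
  also have "\<dots> < e" using lim(1)[of i] lim(4) g i by simp
  finally show ?case using g by auto
qed

lemma moll_tendsto_continuous:
  fixes g :: "real^'n \<Rightarrow> real"
  assumes "continuous_on UNIV g" "integrable lborel g" "e > 0"
  obtains \<delta> where "\<delta> > 0" "\<And>r x. 0 < r \<Longrightarrow> r < \<delta> \<Longrightarrow> x \<in> ball 0 R \<Longrightarrow> \<bar>moll r g x - g x\<bar> \<le> e"
proof -
  have "uniformly_continuous_on (cball 0 (R + 1)) g"
    using assms(1) by (intro compact_uniformly_continuous) (auto intro: continuous_on_subset)
  then obtain d where d: "d > 0" "\<And>x y. x \<in> cball 0 (R + 1) \<Longrightarrow> y \<in> cball 0 (R + 1) \<Longrightarrow> dist y x < d \<Longrightarrow> dist (g y) (g x) < e"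
    unfolding uniformly_continuous_on_def using assms(3) by metis
  show ?thesis
  proof (rule that[of "min d 1"])
    fix r :: real and x :: "real^'n" assume r: "0 < r" "r < min d 1" and x: "x \<in> ball 0 R"
    have "\<bar>g y - g x\<bar> \<le> e" if "y \<in> ball x r" for y
    proof -
      have "norm y \<le> norm x + r"
        using norm_triangle_ineq[of x "y - x"] that by (simp add: dist_norm norm_minus_commute)
      then show ?thesis using d(2)[of x y] that r x by (auto simp: dist_norm norm_minus_commute)
    qed
    then show "\<bar>moll r g x - g x\<bar> \<le> e" by (intro moll_bound r assms(2)) auto
  qed (use d(1) in auto)
qed

text \<open>For a continuous \<open>g\<close> close to \<open>w\<close> in the mean, the error
  splits into \<open>moll r (w - g)\<close>, \<open>moll r g - g\<close> and \<open>g - w\<close>.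
  Contraction bounds the first, and the second is uniformly small on a ball; the restriction to a
  ball gives the constant \<open>e1\<close> a finite integral.\<close>

lemma moll_tendsto_L1:
  fixes w :: "real^'n \<Rightarrow> real"
  assumes "integrable lborel w"
  shows "(\<lambda>k. LINT x:ball 0 R|lborel. \<bar>moll (1 / Suc k) w x - w x\<bar>) \<longlonglongrightarrow> 0"
proof (rule LIMSEQ_I)
  fix e :: real assume e: "e > 0"
  define m where "m = measure lborel (ball (0::real^'n) R)"
  define e1 where "e1 = e / (4 * (m + 1))"
  have m: "m \<ge> 0" by (simp add: m_def)
  then have "0 \<le> e * m" using e by simp
  then have e1: "e1 > 0" "e1 * m < e / 3" using e m by (auto simp: e1_def field_simps add_nonneg_pos)
  obtain g where g: "continuous_on UNIV g" "integrable lborel g" "(LINT x|lborel. \<bar>w x - g x\<bar>) < e/3"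
    using L1_dense_continuous[OF assms, of "e/3"] e by auto
  obtain \<delta> where \<delta>: "\<delta> > 0" "\<And>r x. 0 < r \<Longrightarrow> r < \<delta> \<Longrightarrow> x \<in> ball 0 R \<Longrightarrow> \<bar>moll r g x - g x\<bar> \<le> e1"
    using moll_tendsto_continuous[OF g(1,2) e1(1)] by metis
  obtain N where N: "inverse (real (Suc N)) < \<delta>" using reals_Archimedean[OF \<delta>(1)] by auto
  have "norm ((LINT x:ball 0 R|lborel. \<bar>moll (1 / Suc k) w x - w x\<bar>) - 0) < e" if "k \<ge> N" for k
  proof -
    define r where "r = 1 / real (Suc k)"
    have "inverse (real (Suc k)) \<le> inverse (real (Suc N))" using that by (intro le_imp_inverse_le) auto
    then have r: "0 < r" "r < \<delta>" using N by (auto simp: r_def inverse_eq_divide)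
    let ?I = "\<lambda>x. indicator (ball (0::real^'n) R) x :: real"
    have ind: "integrable lborel ?I"
      using emeasure_bounded_finite[OF bounded_ball] by (intro integrable_real_indicator) auto
    have int: "integrable lborel (moll r w)" "integrable lborel (moll r g)" using integrable_moll r assms g by auto
    have le: "?I x * \<bar>moll r w x - w x\<bar> \<le> \<bar>moll r (\<lambda>y. w y - g y) x\<bar> + (?I x * e1 + \<bar>w x - g x\<bar>)" for x
      using \<delta>(2)[OF r, of x] moll_diff[OF r(1) assms g(2), of x] by (auto simp: indicator_def)
    have "(LINT x:ball 0 R|lborel. \<bar>moll r w x - w x\<bar>) \<le>
        (LINT x|lborel. \<bar>moll r (\<lambda>y. w y - g y) x\<bar> + (?I x * e1 + \<bar>w x - g x\<bar>))" unfolding set_lebesgue_integral_def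
    proof (rule integral_mono)
      show "integrable lborel (\<lambda>x. ?I x *\<^sub>R \<bar>moll r w x - w x\<bar>)" using int assms
        by (intro integrable_mult_indicator integrable_abs Bochner_Integration.integrable_diff) auto
      show "integrable lborel (\<lambda>x. \<bar>moll r (\<lambda>y. w y - g y) x\<bar> + (?I x * e1 + \<bar>w x - g x\<bar>))"
        using r assms g ind by (intro Bochner_Integration.integrable_add integrable_abs integrable_moll
            integrable_mult_left Bochner_Integration.integrable_diff) auto
    qed (use le in simp)
    also have "\<dots> = (LINT x|lborel. \<bar>moll r (\<lambda>y. w y - g y) x\<bar>) + (m * e1 + (LINT x|lborel. \<bar>w x - g x\<bar>))"
      using r assms g ind integrable_moll[OF r(1), of "\<lambda>y. w y - g y"] by (simp add: m_def)
    also have "\<dots> < e"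
      using moll_contraction[OF r(1), of "\<lambda>y. w y - g y"] assms g e1 by (simp add: mult.commute)
    finally show ?thesis by (simp add: r_def set_lebesgue_integral_def)
  qed
  then show "\<exists>no. \<forall>n\<ge>no. norm ((LINT x:ball 0 R|lborel. \<bar>moll (1 / Suc n) w x - w x\<bar>) - 0) < e" by blast
qed

section \<open>Continuously differentiable functions\<close>

text \<open>The gradient is carried as a second argument instead of being taken from
  \<open>frechet_derivative\<close>, so that product, chain and mollification rules hand over
  explicit candidates for weak derivatives.\<close>

definition C1 :: "(real^'n \<Rightarrow> real) \<Rightarrow> ('n \<Rightarrow> real^'n \<Rightarrow> real) \<Rightarrow> bool" where
  "C1 v g \<longleftrightarrow> (\<forall>x. (v has_derivative (\<lambda>h. \<Sum>i\<in>UNIV. h $ i * g i x)) (at x)) \<and> (\<forall>i. continuous_on UNIV (g i))"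

lemma C1_has_derivative: "C1 v g \<Longrightarrow> (v has_derivative (\<lambda>h. \<Sum>i\<in>UNIV. h $ i * g i x)) (at x)"
  and C1_grad_continuous: "C1 v g \<Longrightarrow> continuous_on S (g i)" by (auto simp: C1_def intro: continuous_on_subset)

lemma C1_continuous: "C1 v g \<Longrightarrow> continuous_on S v"
  by (meson C1_has_derivative continuous_at_imp_continuous_on has_derivative_continuous)

lemma linear_sum_axis:
  fixes D :: "real^'n \<Rightarrow> real"
  assumes "linear D" shows "D h = (\<Sum>i\<in>UNIV. h $ i * D (axis i 1))"
proof -
  have "D h = D (\<Sum>i\<in>UNIV. h $ i *\<^sub>R axis i 1)" using basis_expansion[of h] by (simp add: scalar_mult_eq_scaleR)
  also have "\<dots> = (\<Sum>i\<in>UNIV. h $ i * D (axis i 1))" using assms by (simp add: linear_sum linear_cmul)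
  finally show ?thesis .
qed

lemma smooth_C1: "smooth \<phi> \<Longrightarrow> C1 \<phi> (\<lambda>i. partial_deriv i \<phi>)" unfolding C1_def
proof (intro conjI allI)
  fix x assume s: "smooth \<phi>"
  have "linear (frechet_derivative \<phi> (at x))" by (rule has_derivative_linear[OF smooth_has_derivative[OF s]])
  then have "frechet_derivative \<phi> (at x) = (\<lambda>h. \<Sum>i\<in>UNIV. h $ i * partial_deriv i \<phi> x)"
    unfolding partial_deriv_def by (intro ext linear_sum_axis)
  then show "(\<phi> has_derivative (\<lambda>h. \<Sum>i\<in>UNIV. h $ i * partial_deriv i \<phi> x)) (at x)"
    using smooth_has_derivative[OF s, of x] by simp
qed (simp add: smooth_continuous smooth_partial)

lemma C1_mult:
  assumes "C1 u g" "C1 v h" shows "C1 (\<lambda>x. u x * v x) (\<lambda>i x. u x * h i x + g i x * v x)" unfolding C1_def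
proof (intro conjI allI)
  fix x
  have "((\<lambda>x. u x * v x) has_derivative
      (\<lambda>d. u x * (\<Sum>i\<in>UNIV. d $ i * h i x) + (\<Sum>i\<in>UNIV. d $ i * g i x) * v x)) (at x)"
    using C1_has_derivative[OF assms(1), of x] C1_has_derivative[OF assms(2), of x] by (rule has_derivative_mult)
  then show "((\<lambda>x. u x * v x) has_derivative (\<lambda>d. \<Sum>i\<in>UNIV. d $ i * (u x * h i x + g i x * v x))) (at x)"
    by (simp add: sum_distrib_left sum_distrib_right sum.distrib algebra_simps)
qed (intro continuous_intros C1_continuous[OF assms(1)] C1_continuous[OF assms(2)]
      C1_grad_continuous[OF assms(1)] C1_grad_continuous[OF assms(2)])

lemma C1_lipschitz_convex:
  fixes v :: "real^'n \<Rightarrow> real"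
  assumes "\<And>x. x \<in> S \<Longrightarrow> (v has_derivative (\<lambda>h. \<Sum>i\<in>UNIV. h $ i * g i x)) (at x)" "convex S"
    and "\<And>x i. x \<in> S \<Longrightarrow> \<bar>g i x\<bar> \<le> M" "x \<in> S" "y \<in> S"
  shows "\<bar>v x - v y\<bar> \<le> real CARD('n) * M * norm (x - y)"
proof -
  have "norm (v x - v y) \<le> (real CARD('n) * M) * norm (x - y)"
  proof (rule differentiable_bound[OF assms(2) has_derivative_at_withinI[OF assms(1)]])
    fix x assume x: "x \<in> S"
    have M: "M \<ge> 0" by (rule order_trans[OF abs_ge_zero assms(3)[OF x]])
    show "onorm (\<lambda>h. \<Sum>i\<in>UNIV. h $ i * g i x) \<le> real CARD('n) * M"
    proof (rule onorm_le)
      fix h :: "real^'n"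
      have "norm (\<Sum>i\<in>UNIV. h $ i * g i x) \<le> (\<Sum>i\<in>(UNIV::'n set). M * norm h)"
      proof (rule sum_norm_le)
        fix i
        show "norm (h $ i * g i x) \<le> M * norm h"
          using mult_mono[OF assms(3)[OF x, of i] component_le_norm_cart[of h i] M] by (simp add: abs_mult mult.commute)
      qed
      then show "norm (\<Sum>i\<in>UNIV. h $ i * g i x) \<le> real CARD('n) * M * norm h" by simp
    qed
  qed (use assms in auto)
  then show ?thesis by simp
qed

lemma C1_lipschitz:
  fixes v :: "real^'n \<Rightarrow> real"
  assumes "C1 v g" "\<And>x i. \<bar>g i x\<bar> \<le> M"
  shows "\<bar>v x - v y\<bar> \<le> real CARD('n) * M * norm (x - y)"
  using C1_lipschitz_convex[of UNIV v g M x y] assms by (auto simp: C1_def)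

lemma compact_support_bounded_all:
  fixes g :: "'i::finite \<Rightarrow> 'a::metric_space \<Rightarrow> real"
  assumes "\<And>i. continuous_on UNIV (g i)" "compact K" "\<And>x i. x \<notin> K \<Longrightarrow> g i x = 0"
  obtains B where "B \<ge> 0" "\<And>x i. \<bar>g i x\<bar> \<le> B"
proof -
  have "\<exists>B. \<forall>x. \<bar>g i x\<bar> \<le> B" for i by (rule compact_support_bounded[OF assms(1)[of i] assms(2,3)]) auto
  then obtain B where B: "\<And>i x. \<bar>g i x\<bar> \<le> B i" by metis
  have "B i \<ge> 0" for i using order_trans[OF abs_ge_zero B] .
  then have le: "B i \<le> sum B UNIV" for i by (intro member_le_sum) auto
  show ?thesis
  proof (rule that[of "sum B UNIV"])
    show "sum B UNIV \<ge> 0" by (rule sum_nonneg) (rule \<open>\<And>i. B i \<ge> 0\<close>)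
    show "\<bar>g i x\<bar> \<le> sum B UNIV" for x i by (rule order_trans[OF B le])
  qed
qed

lemma test_function_lipschitz:
  fixes \<phi> :: "real^'n \<Rightarrow> real"
  assumes "test_function X \<phi>"
  obtains B where "B \<ge> 0" "\<And>x y. \<bar>\<phi> x - \<phi> y\<bar> \<le> B * norm (x - y)"
proof (rule test_function_compact[OF assms])
  fix K assume K: "compact K" "\<And>x i. x \<notin> K \<Longrightarrow> partial_deriv i \<phi> x = 0"
  have c: "\<And>i. continuous_on UNIV (partial_deriv i \<phi>)"
    using assms by (simp add: smooth_continuous smooth_partial test_function_smooth)
  show ?thesis
  proof (rule compact_support_bounded_all[OF c K])
    fix B assume B: "B \<ge> 0" "\<And>x i. \<bar>partial_deriv i \<phi> x\<bar> \<le> B"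
    show ?thesis
      using that[of "real CARD('n) * B"] B C1_lipschitz[OF smooth_C1[OF test_function_smooth[OF assms]]] by simp
  qed
qed

lemma test_function_partials_lipschitz:
  fixes \<phi> :: "real^'n \<Rightarrow> real"
  assumes "test_function X \<phi>"
  obtains B where "B \<ge> 0" "\<And>x y i. \<bar>partial_deriv i \<phi> x - partial_deriv i \<phi> y\<bar> \<le> B * norm (x - y)"
proof -
  have "\<exists>B\<ge>0. \<forall>x y. \<bar>partial_deriv i \<phi> x - partial_deriv i \<phi> y\<bar> \<le> B * norm (x - y)" for i
    by (rule test_function_lipschitz[OF test_function_partial[OF assms, of i]]) blast
  then obtain B where B: "\<And>i. B i \<ge> 0" "\<And>i x y. \<bar>partial_deriv i \<phi> x - partial_deriv i \<phi> y\<bar> \<le> B i * norm (x - y)"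
    by metis
  have "B i * c \<le> sum B UNIV * c" if "c \<ge> 0" for i c using B(1) that by (intro mult_right_mono member_le_sum) auto
  then have *: "\<bar>partial_deriv i \<phi> x - partial_deriv i \<phi> y\<bar> \<le> sum B UNIV * norm (x - y)" for i x y
    by (rule order_trans[OF B(2)[of i x y]]) simp
  show ?thesis by (rule that[OF _ *]) (simp add: sum_nonneg B(1))
qed

text \<open>A Taylor remainder that is uniform in the base point \<open>z\<close>. It permits
  differentiating \<open>moll r w\<close> under the integral sign when \<open>w\<close> is merely
  integrable.\<close>

lemma test_function_second_order:
  fixes \<phi> :: "real^'n \<Rightarrow> real"
  assumes "test_function X \<phi>"
  obtains C where "C \<ge> 0" "\<And>z h. \<bar>\<phi> (z + h) - \<phi> z - (\<Sum>i\<in>UNIV. h $ i * partial_deriv i \<phi> z)\<bar> \<le> C * (norm h)\<^sup>2"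
proof (rule test_function_partials_lipschitz[OF assms])
  fix B assume B: "B \<ge> 0" "\<And>x y i. \<bar>partial_deriv i \<phi> x - partial_deriv i \<phi> y\<bar> \<le> B * norm (x - y)"
  show ?thesis
  proof (rule that[of "real CARD('n) * B"])
    fix z h :: "real^'n"
    define f where "f x = \<phi> x - (\<Sum>i\<in>UNIV. x $ i * partial_deriv i \<phi> z)" for x
    have l: "((\<lambda>x. \<Sum>i\<in>UNIV. x $ i * partial_deriv i \<phi> z) has_derivative
        (\<lambda>h. \<Sum>i\<in>UNIV. h $ i * partial_deriv i \<phi> z)) (at x)" for x
      by (intro bounded_linear_imp_has_derivative bounded_linear_sum bounded_linear_mult_const bounded_linear_vec_nth)
    have d: "(f has_derivative (\<lambda>h. \<Sum>i\<in>UNIV. h $ i * (partial_deriv i \<phi> x - partial_deriv i \<phi> z))) (at x)" for x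
      using has_derivative_diff[OF C1_has_derivative[OF smooth_C1[OF test_function_smooth[OF assms]]] l, of x]
      by (simp add: f_def[abs_def] algebra_simps sum_subtractf)
    have "\<bar>f (z + h) - f z\<bar> \<le> real CARD('n) * (B * norm h) * norm (z + h - z)"
    proof (rule C1_lipschitz_convex[OF d, of "cball z (norm h)"])
      fix x i assume "x \<in> cball z (norm h)"
      then have "B * norm (x - z) \<le> B * norm h"
        using B(1) by (intro mult_left_mono) (auto simp: dist_norm norm_minus_commute)
      then show "\<bar>partial_deriv i \<phi> x - partial_deriv i \<phi> z\<bar> \<le> B * norm h" by (rule order_trans[OF B(2)])
    qed (auto simp: dist_norm)
    then show "\<bar>\<phi> (z + h) - \<phi> z - (\<Sum>i\<in>UNIV. h $ i * partial_deriv i \<phi> z)\<bar> \<le> real CARD('n) * B * (norm h)\<^sup>2"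
      by (simp add: f_def algebra_simps sum.distrib power2_eq_square)
  qed (use B in simp)
qed

text \<open>By translation invariance every difference quotient of a compactly supported function
  has integral 0, and dominated convergence carries this over to the partial derivative.\<close>

lemma C1_integral_zero:
  fixes F :: "real^'n \<Rightarrow> real"
  assumes C1: "C1 F G" and K: "compact K" "\<And>x. x \<notin> K \<Longrightarrow> F x = 0" "\<And>x i. x \<notin> K \<Longrightarrow> G i x = 0"
  shows "(LINT x|lborel. G i x) = 0"
proof -
  obtain B where B: "B \<ge> 0" "\<And>x i. \<bar>G i x\<bar> \<le> B"
    using compact_support_bounded_all[of G K thesis, OF C1_grad_continuous[OF C1] K(1,3)] by blast
  define L where "L = real CARD('n) * B"
  have L: "\<bar>F x - F y\<bar> \<le> L * norm (x - y)" for x y using C1_lipschitz[OF C1 B(2)] by (simp add: L_def)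
  obtain R where R: "\<And>x. x \<in> K \<Longrightarrow> norm x \<le> R" using compact_imp_bounded[OF K(1)] by (auto simp: bounded_iff)
  have intF: "integrable lborel F" by (rule integrable_compact_support[OF C1_continuous[OF C1] K(1,2)])
  \<comment> \<open>The shifts have length at most 1, so all difference quotients are supported in
    the ball of radius \<open>R + 1\<close>, where the Lipschitz constant dominates them.\<close>
  define c where "c n = (1 / real (Suc n)) *\<^sub>R axis i (1::real)" for n :: nat
  have nc: "norm (c n) = 1 / real (Suc n)" for n by (simp add: c_def norm_axis_1)
  define s where "s n y = (F (y + c n) - F y) * real (Suc n)" for n y
  have s0: "(LINT y|lborel. s n y) = 0" for n
  proof -
    have "integrable lborel (\<lambda>y. F (y + c n))"
    proof (rule integrable_compact_support)
      show "continuous_on UNIV (\<lambda>y. F (y + c n))"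
        by (intro continuous_on_compose2[OF C1_continuous[OF C1, of UNIV]] continuous_intros) auto
      show "compact ((\<lambda>x. x - c n) ` K)" using K(1) by (intro compact_continuous_image continuous_intros)
      show "F (x + c n) = 0" if "x \<notin> (\<lambda>x. x - c n) ` K" for x
        using that by (intro K(2)) (metis add_diff_cancel_right' image_eqI)
    qed
    then have "(LINT y|lborel. F (y + c n) - F y) = 0" using intF by (simp add: integral_lborel_translation)
    then show ?thesis by (simp add: s_def)
  qed
  have "(\<lambda>n. LINT y|lborel. s n y) \<longlonglongrightarrow> (LINT x|lborel. G i x)"
  proof (rule integral_dominated_convergence)
    show "G i \<in> borel_measurable lborel" using borel_measurable_continuous_onI[OF C1_grad_continuous[OF C1]] by simp
    have [measurable]: "F \<in> borel_measurable borel"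
      using borel_measurable_continuous_onI[OF C1_continuous[OF C1]] by simp
    show "s n \<in> borel_measurable lborel" for n unfolding s_def by measurable
    show "integrable lborel (\<lambda>y. L * indicator (cball (0::real^'n) (R + 1)) y)"
      using emeasure_bounded_finite[OF bounded_cball] by (intro integrable_mult_right integrable_real_indicator) auto
    show "AE y in lborel. norm (s n y) \<le> L * indicator (cball 0 (R + 1)) y" for n
    proof (rule AE_I2)
      fix y :: "real^'n"
      show "norm (s n y) \<le> L * indicator (cball 0 (R + 1)) y"
      proof (cases "y \<in> cball 0 (R + 1)")
        case True
        have "\<bar>F (y + c n) - F y\<bar> * real (Suc n) \<le> (L * norm (c n)) * real (Suc n)"
          using L[of "y + c n" y] by (intro mult_right_mono) auto
        then show ?thesis using True by (simp add: s_def abs_mult nc)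
      next
        case False
        have "norm y \<le> norm (y + c n) + norm (c n)" by (metis add_diff_cancel_right' norm_triangle_ineq4)
        moreover have "norm (c n) \<le> 1" by (simp add: nc)
        ultimately have "y \<notin> K" "y + c n \<notin> K" using False R[of y] R[of "y + c n"] by auto
        then show ?thesis using False by (simp add: s_def K(2))
      qed
    qed
    show "AE y in lborel. (\<lambda>n. s n y) \<longlonglongrightarrow> G i y"
    proof (rule AE_I2)
      fix y :: "real^'n"
      have l: "((\<lambda>t. y + t *\<^sub>R axis i (1::real)) has_derivative (\<lambda>t. t *\<^sub>R axis i 1)) (at 0)"
        by (auto intro!: derivative_eq_intros)
      have "((\<lambda>t. F (y + t *\<^sub>R axis i 1)) has_derivative (\<lambda>t. \<Sum>j\<in>UNIV. (t *\<^sub>R axis i 1) $ j * G j y)) (at 0)"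
        by (rule has_derivative_compose[OF l]) (use C1_has_derivative[OF C1, of y] in simp)
      moreover have "(\<Sum>j\<in>UNIV. (t *\<^sub>R axis i 1) $ j * G j y) = t * G i y" for t :: real
        by (simp add: axis_def if_distrib[of "\<lambda>x. _ * x * _"] if_distrib[of "\<lambda>x. x * _"] sum.delta' cong: if_cong)
      ultimately have "((\<lambda>t. F (y + t *\<^sub>R axis i 1)) has_real_derivative G i y) (at 0)"
        by (simp add: has_field_derivative_def mult_commute_abs)
      then have t: "((\<lambda>t. (F (y + t *\<^sub>R axis i 1) - F y) / t) \<longlongrightarrow> G i y) (at 0)" by (simp add: DERIV_def)
      have f: "filterlim (\<lambda>n. 1 / real (Suc n)) (at 0) sequentially"
        using lim_1_over_n LIMSEQ_Suc[OF lim_1_over_n] by (auto simp: filterlim_at)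
      from filterlim_compose[OF t f] show "(\<lambda>n. s n y) \<longlonglongrightarrow> G i y" by (simp add: s_def c_def)
    qed
  qed
  then have "(LINT x|lborel. G i x) = 0" using LIMSEQ_unique[OF _ tendsto_const[of 0]] by (simp add: s0)
  then show ?thesis .
qed

lemma C1_integral_by_parts:
  fixes v :: "real^'n \<Rightarrow> real"
  assumes "C1 v g" "test_function X \<phi>"
  shows "(LINT x|lborel. v x * partial_deriv i \<phi> x) = - (LINT x|lborel. g i x * \<phi> x)"
proof (rule test_function_compact[OF assms(2)])
  fix K assume K: "compact K" "\<And>x. x \<notin> K \<Longrightarrow> \<phi> x = 0" "\<And>x i. x \<notin> K \<Longrightarrow> partial_deriv i \<phi> x = 0"
  have s: "smooth \<phi>" using assms(2) by (rule test_function_smooth)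
  have "(LINT x|lborel. v x * partial_deriv i \<phi> x + g i x * \<phi> x) = 0"
    using C1_integral_zero[OF C1_mult[OF assms(1) smooth_C1[OF s]] K(1)] K(2,3) by simp
  moreover have "integrable lborel (\<lambda>x. v x * partial_deriv i \<phi> x)" by (rule integrable_compact_support[OF _ K(1)])
      (auto simp: K intro!: continuous_on_mult C1_continuous[OF assms(1)] smooth_continuous[OF smooth_partial[OF s]])
  moreover have "integrable lborel (\<lambda>x. g i x * \<phi> x)" by (rule integrable_compact_support[OF _ K(1)])
      (auto simp: K intro!: continuous_on_mult C1_grad_continuous[OF assms(1)] smooth_continuous[OF s])
  ultimately show ?thesis by simp
qed

text \<open>The derivative falls on the kernel, so this makes sense for every integrable
  \<open>w\<close>. By \<open>partial_mollifier\<close> it is minus the pairing of \<open>w\<close>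
  with a derivative of the test function \<open>mollifier r x\<close>, the form in which weak
  derivatives enter.\<close>

definition moll_grad :: "real \<Rightarrow> (real^'n \<Rightarrow> real) \<Rightarrow> 'n \<Rightarrow> real^'n \<Rightarrow> real" where
  "moll_grad r w i x = (LINT y|lborel. partial_deriv i (mollifier r 0) (x - y) * w y)"

lemma partial_mollifier:
  assumes "r > 0"
  shows "partial_deriv i (mollifier r 0) (x - y) = - partial_deriv i (mollifier r x) (y :: real^'n)"
proof -
  let ?m = "mollifier r (0 :: real^'n)" and ?D = "frechet_derivative (mollifier r (0::real^'n)) (at (x - y))"
  have d: "(?m has_derivative ?D) (at (x - y))"
    by (rule smooth_has_derivative[OF test_function_smooth[OF test_function_mollifier_UNIV[OF assms]]])
  have l: "((\<lambda>z. x - z) has_derivative (\<lambda>h. - h)) (at y)" by (auto intro!: derivative_eq_intros)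
  have eq: "mollifier r x = (\<lambda>z. ?m (x - z))" by (auto simp: mollifier_def bump_def norm_minus_commute)
  have "(mollifier r x has_derivative (\<lambda>h. ?D (- h))) (at y)" unfolding eq by (rule has_derivative_compose[OF l d])
  from partial_deriv_eq[OF this] partial_deriv_eq[OF d]
  show ?thesis using linear_neg[OF has_derivative_linear[OF d]] by simp
qed

lemma integrable_moll_grad:
  assumes "r > 0" "integrable lborel w"
  shows "integrable lborel (\<lambda>y. partial_deriv i (mollifier r 0) (x - y) * w (y :: real^'n))"
proof (rule test_function_bounded[OF test_function_partial[OF test_function_mollifier_UNIV[OF assms(1), of 0], of i]])
  fix B assume "\<And>z::real^'n. \<bar>partial_deriv i (mollifier r 0) z\<bar> \<le> B"
  moreover have "continuous_on UNIV (\<lambda>y. partial_deriv i (mollifier r (0::real^'n)) (x - y))"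
    by (rule continuous_on_compose2[OF smooth_continuous[OF smooth_partial[OF test_function_smooth[OF
              test_function_mollifier_UNIV[OF assms(1)]]], of UNIV]]) (auto intro!: continuous_intros)
  ultimately show ?thesis
    using assms(2) by (intro integrable_bounded_mult) (auto intro: borel_measurable_continuous_onI)
qed

lemma C1_moll:
  fixes w :: "real^'n \<Rightarrow> real"
  assumes "r > 0" "integrable lborel w"
  shows "C1 (moll r w) (moll_grad r w)" unfolding C1_def
proof (intro conjI allI)
  let ?m = "mollifier r (0 :: real^'n)"
  have test: "test_function UNIV ?m" using assms(1) by (rule test_function_mollifier_UNIV)
  have moll: "moll r w x = (LINT y|lborel. ?m (x - y) * w y)" for x
    by (simp add: moll_def mollifier_def bump_def norm_minus_commute)
  have im: "integrable lborel (\<lambda>y. ?m (x - y) * w y)" for x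
    using integrable_mollifier_mult[OF assms, of x] by (simp add: mollifier_def bump_def norm_minus_commute)
  note ig = integrable_moll_grad[OF assms]
  define W where "W = (LINT y|lborel. \<bar>w y\<bar>)"
  have iW: "integrable lborel (\<lambda>y. c * \<bar>w y\<bar>)" for c using assms(2) by simp
  {
    fix x
    show "(moll r w has_derivative (\<lambda>h. \<Sum>i\<in>UNIV. h $ i * moll_grad r w i x)) (at x)"
    proof (rule test_function_second_order[OF test])
      fix C assume C: "C \<ge> 0"
        "\<And>z h. \<bar>?m (z + h) - ?m z - (\<Sum>i\<in>UNIV. h $ i * partial_deriv i ?m z)\<bar> \<le> C * (norm h)\<^sup>2"
      have err: "\<bar>moll r w (x + h) - moll r w x - (\<Sum>i\<in>UNIV. h $ i * moll_grad r w i x)\<bar> \<le> C * W * (norm h)\<^sup>2" for h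
      proof -
        let ?e = "\<lambda>y. (?m (x - y + h) - ?m (x - y) - (\<Sum>i\<in>UNIV. h $ i * partial_deriv i ?m (x - y))) * w y"
        have e: "?e = (\<lambda>y. ?m (x + h - y) * w y - ?m (x - y) * w y
            - (\<Sum>i\<in>UNIV. h $ i * (partial_deriv i ?m (x - y) * w y)))" by (auto simp: algebra_simps sum_distrib_left)
        have isum: "integrable lborel (\<lambda>y. \<Sum>i\<in>UNIV. h $ i * (partial_deriv i ?m (x - y) * w y))"
          by (intro Bochner_Integration.integrable_sum integrable_mult_right ig)
        have ie: "integrable lborel ?e" unfolding e by (intro Bochner_Integration.integrable_diff im isum)
        have "(LINT y|lborel. ?e y) = moll r w (x + h) - moll r w x - (\<Sum>i\<in>UNIV. h $ i * moll_grad r w i x)"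
          unfolding e
          by (subst Bochner_Integration.integral_diff[OF Bochner_Integration.integrable_diff[OF im im] isum],
              subst Bochner_Integration.integral_diff[OF im im],
              subst Bochner_Integration.integral_sum[OF integrable_mult_right[OF ig]]) (simp add: moll moll_grad_def)
        moreover have "\<bar>LINT y|lborel. ?e y\<bar> \<le> (LINT y|lborel. (C * (norm h)\<^sup>2) * \<bar>w y\<bar>)"
        proof -
          have "norm (LINT y|lborel. ?e y) \<le> (LINT y|lborel. norm (?e y))"
            by (rule Bochner_Integration.integral_norm_bound)
          also have "\<dots> \<le> (LINT y|lborel. (C * (norm h)\<^sup>2) * \<bar>w y\<bar>)" using ie iW C(2)[of "x - _" h]
            by (intro integral_mono Bochner_Integration.integrable_norm) (auto simp: abs_mult intro!: mult_right_mono)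
          finally show ?thesis by simp
        qed
        ultimately show ?thesis by (simp add: W_def mult_ac)
      qed
      have bl: "bounded_linear (\<lambda>h::real^'n. \<Sum>i\<in>UNIV. h $ i * moll_grad r w i x)"
        by (intro bounded_linear_sum bounded_linear_mult_const bounded_linear_vec_nth)
      show ?thesis
      proof (rule has_derivativeI_sandwich[of 1 _ _ _ _ "\<lambda>y. C * W * norm (y - x)"])
        fix y :: "real^'n" assume "y \<noteq> x"
        then show "norm (moll r w y - moll r w x - (\<Sum>i\<in>UNIV. (y - x) $ i * moll_grad r w i x)) / norm (y - x)
            \<le> C * W * norm (y - x)" using err[of "y - x"] by (simp add: divide_le_eq power2_eq_square mult.assoc)
      next
        have "((\<lambda>y. C * W * norm (y - x)) \<longlongrightarrow> C * W * norm (x - x)) (at x)" by (intro tendsto_intros)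
        then show "((\<lambda>y. C * W * norm (y - x)) \<longlongrightarrow> 0) (at x)" by simp
      qed (use bl in auto)
    qed
  }
  fix i
  show "continuous_on UNIV (moll_grad r w i)"
  proof (rule test_function_lipschitz[OF test_function_partial[OF test, of i]])
    fix B assume B: "B \<ge> 0" "\<And>x y. \<bar>partial_deriv i ?m x - partial_deriv i ?m y\<bar> \<le> B * norm (x - y)"
    have "\<bar>moll_grad r w i x - moll_grad r w i x'\<bar> \<le> B * W * norm (x - x')" for x x'
    proof -
      have "norm (moll_grad r w i x - moll_grad r w i x') \<le>
          (LINT y|lborel. norm (partial_deriv i ?m (x - y) * w y - partial_deriv i ?m (x' - y) * w y))"
        unfolding moll_grad_def Bochner_Integration.integral_diff[OF ig ig, symmetric]
        by (rule Bochner_Integration.integral_norm_bound)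
      also have "\<dots> \<le> (LINT y|lborel. (B * norm (x - x')) * \<bar>w y\<bar>)"
      proof (intro integral_mono Bochner_Integration.integrable_norm Bochner_Integration.integrable_diff ig iW)
        fix y
        have "\<bar>partial_deriv i ?m (x - y) - partial_deriv i ?m (x' - y)\<bar> * \<bar>w y\<bar> \<le> (B * norm (x - x')) * \<bar>w y\<bar>"
          using B(2)[of "x - y" "x' - y"] by (intro mult_right_mono) auto
        then show "norm (partial_deriv i ?m (x - y) * w y - partial_deriv i ?m (x' - y) * w y) \<le> (B * norm (x - x')) * \<bar>w y\<bar>"
          by (simp add: left_diff_distrib[symmetric] abs_mult)
      qed
      finally show ?thesis by (simp add: W_def mult_ac)
    qed
    then have "(B * W)-lipschitz_on UNIV (moll_grad r w i)"
      using B(1) by (intro lipschitz_onI) (auto simp: dist_norm W_def)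
    then show ?thesis by (rule lipschitz_on_continuous_on)
  qed
qed

section \<open>Local integrability\<close>

definition Lp_ball :: "real \<Rightarrow> real^'n \<Rightarrow> real \<Rightarrow> (real^'n \<Rightarrow> real) \<Rightarrow> bool" where
  "Lp_ball p x r u \<longleftrightarrow> u \<in> borel_measurable (lebesgue_on (ball x r)) \<and>
     integrable (lebesgue_on (ball x r)) (\<lambda>y. \<bar>u y\<bar> powr p)"

lemma measurable_lebesgue_on_mono:
  "u \<in> borel_measurable (lebesgue_on S) \<Longrightarrow> T \<subseteq> S \<Longrightarrow> T \<in> sets lebesgue \<Longrightarrow> S \<in> sets lebesgue \<Longrightarrow>
    u \<in> borel_measurable (lebesgue_on T)" using measurable_restrict_mono by blast

lemma integrable_lebesgue_on_mono:
  fixes u :: "'a::euclidean_space \<Rightarrow> real"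
  assumes "integrable (lebesgue_on S) u" "T \<subseteq> S" "T \<in> sets lebesgue" "S \<in> sets lebesgue"
  shows "integrable (lebesgue_on T) u" using assms set_integrable_subset[of lebesgue S u T]
  by (simp add: integrable_restrict_space set_integrable_def)

lemma Lp_ball_mono: "Lp_ball p x r u \<Longrightarrow> ball y s \<subseteq> ball x r \<Longrightarrow> Lp_ball p y s u" unfolding Lp_ball_def
  by (auto intro: measurable_lebesgue_on_mono integrable_lebesgue_on_mono)

lemma measurable_lebesgue_on_cover:
  assumes "open X" "\<And>x. x \<in> X \<Longrightarrow> \<exists>U. open U \<and> x \<in> U \<and> U \<subseteq> X \<and> u \<in> borel_measurable (lebesgue_on U)"
  shows "u \<in> borel_measurable (lebesgue_on (X :: 'a::euclidean_space set))"
proof -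
  obtain U where U: "\<And>x. x \<in> X \<Longrightarrow> open (U x) \<and> x \<in> U x \<and> U x \<subseteq> X \<and> u \<in> borel_measurable (lebesgue_on (U x))"
    using assms(2) by metis
  obtain \<F> where F: "\<F> \<subseteq> U ` X" "countable \<F>" "\<Union>\<F> = \<Union>(U ` X)" using Lindelof[of "U ` X"] U by blast
  have cov: "X = \<Union>\<F>" using F(3) U by auto
  show ?thesis
  proof (rule measurable_piecewise_restrict[OF F(2)])
    show "X' \<inter> space (lebesgue_on X) \<in> sets (lebesgue_on X)" if "X' \<in> \<F>" for X'
      using that F(1) U assms(1) by (auto simp: sets_restrict_space_iff)
    show "space (lebesgue_on X) \<subseteq> \<Union>\<F>" using cov by simp
    show "u \<in> borel_measurable (restrict_space (lebesgue_on X) X')" if mem: "X' \<in> \<F>" for X'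
    proof -
      obtain x where x: "x \<in> X" "X' = U x" using mem F(1) by auto
      then have "restrict_space (lebesgue_on X) X' = lebesgue_on X'"
        using U[OF x(1)] by (subst restrict_restrict_space) (auto simp: assms(1) inf.absorb2)
      then show ?thesis using U[OF x(1)] x(2) by simp
    qed
  qed
qed

lemma Lp_loc_imp_ball:
  assumes "Lp_loc p X u" "cball x r \<subseteq> X" "open X"
  shows "Lp_ball p x r u"
proof -
  have "set_integrable lebesgue (cball x r) (\<lambda>x. \<bar>u x\<bar> powr p)"
    using assms(1,2) compact_cball by (auto simp: Lp_loc_def)
  then have i: "integrable (lebesgue_on (cball x r)) (\<lambda>x. \<bar>u x\<bar> powr p)"
    by (simp add: integrable_restrict_space set_integrable_def)
  have m: "u \<in> borel_measurable (lebesgue_on X)" using assms(1) by (simp add: Lp_loc_def)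
  have s: "ball x r \<subseteq> X" by (rule order_trans[OF ball_subset_cball assms(2)])
  have l: "ball x r \<in> sets lebesgue" "cball x r \<in> sets lebesgue" "X \<in> sets lebesgue" using assms(3) by auto
  show ?thesis unfolding Lp_ball_def
    using measurable_lebesgue_on_mono[OF m s l(1,3)] integrable_lebesgue_on_mono[OF i ball_subset_cball l(1,2)] by blast
qed

text \<open>Compact sets are covered by finitely many balls, and measurability on \<open>X\<close>
  follows from a countable subcover. From here on local integrability is checked one ball at a
  time.\<close>

lemma Lp_loc_iff_ball:
  assumes "open X"
  shows "Lp_loc p X u \<longleftrightarrow> (\<forall>x\<in>X. \<exists>r>0. ball x r \<subseteq> X \<and> Lp_ball p x r u)"
proof
  assume L: "Lp_loc p X u"
  show "\<forall>x\<in>X. \<exists>r>0. ball x r \<subseteq> X \<and> Lp_ball p x r u"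
  proof
    fix x assume "x \<in> X"
    then obtain r where r: "r > 0" "cball x r \<subseteq> X" using assms open_contains_cball by blast
    have "ball x r \<subseteq> X" by (rule order_trans[OF ball_subset_cball r(2)])
    then show "\<exists>r>0. ball x r \<subseteq> X \<and> Lp_ball p x r u" using Lp_loc_imp_ball[OF L r(2) assms] r(1) by blast
  qed
next
  assume R: "\<forall>x\<in>X. \<exists>r>0. ball x r \<subseteq> X \<and> Lp_ball p x r u"
  then obtain r where r: "\<And>x. x \<in> X \<Longrightarrow> r x > 0 \<and> ball x (r x) \<subseteq> X \<and> Lp_ball p x (r x) u" by metis
  have meas: "u \<in> borel_measurable (lebesgue_on X)"
  proof (rule measurable_lebesgue_on_cover[OF assms])
    fix x assume "x \<in> X"
    from r[OF this] show "\<exists>U. open U \<and> x \<in> U \<and> U \<subseteq> X \<and> u \<in> borel_measurable (lebesgue_on U)"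
      by (intro exI[of _ "ball x (r x)"]) (auto simp: Lp_ball_def)
  qed
  show "Lp_loc p X u" unfolding Lp_loc_def
  proof (intro conjI meas allI impI)
    fix K assume K: "compact K \<and> K \<subseteq> X"
    have cov: "K \<subseteq> (\<Union>x\<in>K. ball x (r x))"
    proof
      fix x assume "x \<in> K"
      then have "x \<in> ball x (r x)" using r K by auto
      then show "x \<in> (\<Union>x\<in>K. ball x (r x))" using \<open>x \<in> K\<close> by blast
    qed
    obtain F where F: "F \<subseteq> K" "finite F" "K \<subseteq> (\<Union>x\<in>F. ball x (r x))"
      using K by (auto intro: compactE_image[OF _ open_ball cov])
    have "set_integrable lebesgue (\<Union>x\<in>F. ball x (r x)) (\<lambda>x. \<bar>u x\<bar> powr p)"
    proof (rule set_integrable_UN[OF F(2)])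
      fix x assume "x \<in> F"
      then have "Lp_ball p x (r x) u" using F(1) K r by blast
      then show "set_integrable lebesgue (ball x (r x)) (\<lambda>x. \<bar>u x\<bar> powr p)"
        by (simp add: Lp_ball_def integrable_restrict_space set_integrable_def)
    qed auto
    then show "set_integrable lebesgue K (\<lambda>x. \<bar>u x\<bar> powr p)"
      by (rule set_integrable_subset) (use F(3) K in \<open>auto simp: compact_imp_closed\<close>)
  qed
qed

lemma Lp_loc_subset: "Lp_loc p X u \<Longrightarrow> U \<subseteq> X \<Longrightarrow> open U \<Longrightarrow> open X \<Longrightarrow> Lp_loc p U u"
  unfolding Lp_loc_def by (auto intro: measurable_lebesgue_on_mono)

lemma Lp_loc_local:
  assumes "open X" "\<And>x. x \<in> X \<Longrightarrow> \<exists>U. open U \<and> x \<in> U \<and> Lp_loc p U u"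
  shows "Lp_loc p X u" unfolding Lp_loc_iff_ball[OF assms(1)]
proof
  fix x assume x: "x \<in> X"
  then obtain U where U: "open U" "x \<in> U" "Lp_loc p U u" using assms(2) by blast
  then obtain r where r: "r > 0" "cball x r \<subseteq> U \<inter> X" using x assms(1) open_contains_cball[of "U \<inter> X"] by blast
  then have s: "ball x r \<subseteq> X" "cball x r \<subseteq> U" using order_trans[OF ball_subset_cball r(2)] by auto
  show "\<exists>r>0. ball x r \<subseteq> X \<and> Lp_ball p x r u" using Lp_loc_imp_ball[OF U(3) s(2) U(1)] s(1) r(1) by blast
qed

lemma Lp_ball_1: "Lp_ball 1 x r u \<longleftrightarrow> integrable (lebesgue_on (ball x r)) u"
  unfolding Lp_ball_def by (auto simp: integrable_abs_iff intro: borel_measurable_integrable)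

lemma Lp_loc_measurable: "Lp_loc p X u \<Longrightarrow> u \<in> borel_measurable (lebesgue_on X)" by (simp add: Lp_loc_def)

lemma finite_measure_lebesgue_on_ball: "finite_measure (lebesgue_on (ball (x::'a::euclidean_space) r))"
  using emeasure_bounded_finite[OF bounded_ball, of x r]
  by (intro finite_measureI) (simp add: emeasure_restrict_space)

lemma Lp_ball_imp_1:
  assumes "1 \<le> p" "Lp_ball p x r u" shows "Lp_ball 1 x r u"
proof -
  interpret finite_measure "lebesgue_on (ball x r)" by (rule finite_measure_lebesgue_on_ball)
  have "integrable (lebesgue_on (ball x r)) u"
  proof (rule Bochner_Integration.integrable_bound)
    show "integrable (lebesgue_on (ball x r)) (\<lambda>y. 1 + \<bar>u y\<bar> powr p)" using assms(2) by (auto simp: Lp_ball_def)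
    show "AE y in lebesgue_on (ball x r). norm (u y) \<le> norm (1 + \<bar>u y\<bar> powr p)"
    proof (rule AE_I2)
      fix y
      have "\<bar>u y\<bar> \<le> 1 + \<bar>u y\<bar> powr p"
      proof (cases "\<bar>u y\<bar> \<le> 1")
        case False
        then have "\<bar>u y\<bar> powr 1 \<le> \<bar>u y\<bar> powr p" using assms(1) by (intro powr_mono) auto
        then show ?thesis using False by simp
      qed (simp add: add_increasing2)
      then show "norm (u y) \<le> norm (1 + \<bar>u y\<bar> powr p)" by simp
    qed
  qed (use assms in \<open>auto simp: Lp_ball_def\<close>)
  then show ?thesis by (simp add: Lp_ball_1)
qed

lemma Lp_loc_imp_1: "1 \<le> p \<Longrightarrow> open X \<Longrightarrow> Lp_loc p X u \<Longrightarrow> Lp_loc 1 X u"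
  unfolding Lp_loc_iff_ball using Lp_ball_imp_1 by blast

lemma Lp_loc_cong_AE:
  assumes "open X" "Lp_loc p X u" "AE x in lebesgue_on X. u x = v x" "v \<in> borel_measurable (lebesgue_on X)"
  shows "Lp_loc p X v" unfolding Lp_loc_def
proof (intro conjI assms(4) allI impI)
  fix K assume K: "compact K \<and> K \<subseteq> X"
  have X: "X \<in> sets lebesgue" and Ks: "K \<in> sets lebesgue" using assms(1) K by (auto simp: compact_imp_closed)
  have "set_integrable lebesgue K (\<lambda>x. \<bar>u x\<bar> powr p)" using assms(2) K by (auto simp: Lp_loc_def)
  then have i: "integrable (lebesgue_on K) (\<lambda>x. \<bar>u x\<bar> powr p)"
    using Ks by (simp add: integrable_restrict_space set_integrable_def)
  have ae: "AE x in lebesgue. x \<in> X \<longrightarrow> u x = v x" using assms(3) X by (simp add: AE_restrict_space_iff)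
  have "integrable (lebesgue_on K) (\<lambda>x. \<bar>v x\<bar> powr p)"
  proof (rule Bochner_Integration.integrable_bound[OF i])
    have "v \<in> borel_measurable (lebesgue_on K)" using measurable_lebesgue_on_mono[OF assms(4)] K Ks X by auto
    then show "(\<lambda>x. \<bar>v x\<bar> powr p) \<in> borel_measurable (lebesgue_on K)" by simp
    have "AE x in lebesgue_on K. u x = v x"
      using ae K by (simp add: AE_restrict_space_iff Ks) (auto elim!: eventually_mono)
    then show "AE x in lebesgue_on K. norm (\<bar>v x\<bar> powr p) \<le> norm (\<bar>u x\<bar> powr p)" by eventually_elim simp
  qed
  then show "set_integrable lebesgue K (\<lambda>x. \<bar>v x\<bar> powr p)"
    using Ks by (simp add: integrable_restrict_space set_integrable_def)
qed

lemma Lp_ball_add: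
  assumes "1 \<le> p" "Lp_ball p x r u" "Lp_ball p x r v" shows "Lp_ball p x r (\<lambda>y. u y + v y)" unfolding Lp_ball_def
proof
  show m: "(\<lambda>y. u y + v y) \<in> borel_measurable (lebesgue_on (ball x r))" using assms by (auto simp: Lp_ball_def)
  show "integrable (lebesgue_on (ball x r)) (\<lambda>y. \<bar>u y + v y\<bar> powr p)"
  proof (rule Bochner_Integration.integrable_bound)
    show "integrable (lebesgue_on (ball x r)) (\<lambda>y. 2 powr p * (\<bar>u y\<bar> powr p + \<bar>v y\<bar> powr p))"
      using assms by (auto simp: Lp_ball_def)
    show "AE y in lebesgue_on (ball x r). norm (\<bar>u y + v y\<bar> powr p) \<le> norm (2 powr p * (\<bar>u y\<bar> powr p + \<bar>v y\<bar> powr p))"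
    proof (rule AE_I2)
      fix y
      have "\<bar>u y + v y\<bar> powr p \<le> (2 * max \<bar>u y\<bar> \<bar>v y\<bar>) powr p" using assms(1) by (intro powr_mono2) auto
      also have "\<dots> = 2 powr p * (max \<bar>u y\<bar> \<bar>v y\<bar> powr p)" by (simp add: powr_mult)
      also have "\<dots> \<le> 2 powr p * (\<bar>u y\<bar> powr p + \<bar>v y\<bar> powr p)" by (intro mult_left_mono) (auto simp: max_def)
      finally show "norm (\<bar>u y + v y\<bar> powr p) \<le> norm (2 powr p * (\<bar>u y\<bar> powr p + \<bar>v y\<bar> powr p))" by simp
    qed
  qed (use m in simp)
qed

lemma Lp_loc_add:
  assumes "1 \<le> p" "open X" "Lp_loc p X u" "Lp_loc p X v" shows "Lp_loc p X (\<lambda>y. u y + v y)"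
  unfolding Lp_loc_iff_ball[OF assms(2)]
proof
  fix x assume "x \<in> X"
  then obtain r where r: "r > 0" "cball x r \<subseteq> X" using assms(2) open_contains_cball by blast
  have "Lp_ball p x r (\<lambda>y. u y + v y)"
    by (intro Lp_ball_add Lp_loc_imp_ball[OF assms(3) r(2) assms(2)] Lp_loc_imp_ball[OF assms(4) r(2) assms(2)] assms(1))
  then show "\<exists>r>0. ball x r \<subseteq> X \<and> Lp_ball p x r (\<lambda>y. u y + v y)"
    using r(1) order_trans[OF ball_subset_cball r(2)] by blast
qed

lemma Lp_loc_zero: "open X \<Longrightarrow> Lp_loc p X (\<lambda>x. 0)" by (simp add: Lp_loc_def set_integrable_def)

lemma Lp_loc_sum:
  assumes "1 \<le> p" "open X" "finite I" "\<And>i. i \<in> I \<Longrightarrow> Lp_loc p X (u i)" shows "Lp_loc p X (\<lambda>y. \<Sum>i\<in>I. u i y)"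
  using assms(3,4) by (induction I) (auto intro!: Lp_loc_add Lp_loc_zero assms(1,2))

section \<open>Locally essentially bounded functions\<close>

definition Linf_loc :: "(real^'n) set \<Rightarrow> (real^'n \<Rightarrow> real) \<Rightarrow> bool" where
  "Linf_loc X u \<longleftrightarrow> u \<in> borel_measurable (lebesgue_on X) \<and>
     (\<forall>x\<in>X. \<exists>r>0. \<exists>B. AE y in lebesgue. y \<in> ball x r \<longrightarrow> \<bar>u y\<bar> \<le> B)"

lemma Linf_loc_measurable: "Linf_loc X u \<Longrightarrow> u \<in> borel_measurable (lebesgue_on X)" by (simp add: Linf_loc_def)

text \<open>The bound is made nonnegative and valid for all smaller radii, so that several such
  bounds can be used on one common ball.\<close>

lemma Linf_loc_obtain:
  assumes "Linf_loc X u" "x \<in> X"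
  obtains r B where "r > 0" "B \<ge> 0" "\<And>s. s \<le> r \<Longrightarrow> AE y in lebesgue. y \<in> ball x s \<longrightarrow> \<bar>u y\<bar> \<le> B"
proof -
  obtain r B where rB: "r > 0" "AE y in lebesgue. y \<in> ball x r \<longrightarrow> \<bar>u y\<bar> \<le> B" using assms by (auto simp: Linf_loc_def)
  have "AE y in lebesgue. y \<in> ball x s \<longrightarrow> \<bar>u y\<bar> \<le> \<bar>B\<bar>" if "s \<le> r" for s
    using rB(2) by eventually_elim (use that in auto)
  then show ?thesis using that[of r "\<bar>B\<bar>"] rB(1) by auto
qed

lemma Linf_loc_mult:
  assumes "Linf_loc X u" "Linf_loc X v" shows "Linf_loc X (\<lambda>x. u x * v x)" unfolding Linf_loc_def
proof (intro conjI ballI)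
  show "(\<lambda>x. u x * v x) \<in> borel_measurable (lebesgue_on X)" using assms by (auto simp: Linf_loc_def)
  fix x assume x: "x \<in> X"
  obtain r B where r: "r > 0" "B \<ge> 0" "\<And>s. s \<le> r \<Longrightarrow> AE y in lebesgue. y \<in> ball x s \<longrightarrow> \<bar>u y\<bar> \<le> B"
    using Linf_loc_obtain[OF assms(1) x] by blast
  obtain s C where s: "s > 0" "C \<ge> 0" "\<And>t. t \<le> s \<Longrightarrow> AE y in lebesgue. y \<in> ball x t \<longrightarrow> \<bar>v y\<bar> \<le> C"
    using Linf_loc_obtain[OF assms(2) x] by blast
  have "AE y in lebesgue. y \<in> ball x (min r s) \<longrightarrow> \<bar>u y * v y\<bar> \<le> B * C"
    using r(3)[OF min.cobounded1[of r s]] s(3)[OF min.cobounded2[of r s]]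
    by eventually_elim (simp add: abs_mult mult_mono r(2))
  then show "\<exists>r>0. \<exists>B. AE y in lebesgue. y \<in> ball x r \<longrightarrow> \<bar>u y * v y\<bar> \<le> B"
    using r(1) s(1) by (intro exI[of _ "min r s"]) auto
qed

lemma Linf_loc_add:
  assumes "Linf_loc X u" "Linf_loc X v" shows "Linf_loc X (\<lambda>x. u x + v x)" unfolding Linf_loc_def
proof (intro conjI ballI)
  show "(\<lambda>x. u x + v x) \<in> borel_measurable (lebesgue_on X)" using assms by (auto simp: Linf_loc_def)
  fix x assume x: "x \<in> X"
  obtain r B where r: "r > 0" "\<And>s. s \<le> r \<Longrightarrow> AE y in lebesgue. y \<in> ball x s \<longrightarrow> \<bar>u y\<bar> \<le> B"
    using Linf_loc_obtain[OF assms(1) x] by blast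
  obtain s C where s: "s > 0" "\<And>t. t \<le> s \<Longrightarrow> AE y in lebesgue. y \<in> ball x t \<longrightarrow> \<bar>v y\<bar> \<le> C"
    using Linf_loc_obtain[OF assms(2) x] by blast
  have "AE y in lebesgue. y \<in> ball x (min r s) \<longrightarrow> \<bar>u y + v y\<bar> \<le> B + C"
    using r(2)[OF min.cobounded1[of r s]] s(2)[OF min.cobounded2[of r s]]
  proof eventually_elim
    case (elim y)
    then show ?case using abs_triangle_ineq[of "u y" "v y"] by linarith
  qed
  then show "\<exists>r>0. \<exists>B. AE y in lebesgue. y \<in> ball x r \<longrightarrow> \<bar>u y + v y\<bar> \<le> B"
    using r(1) s(1) by (intro exI[of _ "min r s"]) auto
qed

lemma Linf_loc_sum:
  assumes "finite I" "\<And>i. i \<in> I \<Longrightarrow> Linf_loc X (u i)" shows "Linf_loc X (\<lambda>y. \<Sum>i\<in>I. u i y)" using assms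
proof (induction I)
  case empty
  show ?case by (auto simp: Linf_loc_def intro: exI[of _ 1] exI[of _ 0])
qed (auto intro: Linf_loc_add)

lemma continuous_on_measurable_lebesgue:
  "continuous_on X u \<Longrightarrow> open X \<Longrightarrow> (u :: real^'n \<Rightarrow> real) \<in> borel_measurable (lebesgue_on X)"
  by (rule continuous_imp_measurable_on_sets_lebesgue) auto

lemma continuous_imp_Linf_loc:
  assumes "continuous_on X u" "open X" shows "Linf_loc X u" unfolding Linf_loc_def
proof (intro conjI ballI continuous_on_measurable_lebesgue assms)
  fix x assume "x \<in> X"
  then have "isCont u x" using assms by (simp add: continuous_on_eq_continuous_at)
  then obtain r where r: "r > 0" "\<And>y. dist y x < r \<Longrightarrow> dist (u y) (u x) < 1"
    unfolding continuous_at_eps_delta by (metis zero_less_one)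
  have "\<bar>u y\<bar> \<le> \<bar>u x\<bar> + 1" if "y \<in> ball x r" for y using r(2)[of y] that by (simp add: dist_commute dist_real_def)
  then show "\<exists>r>0. \<exists>B. AE y in lebesgue. y \<in> ball x r \<longrightarrow> \<bar>u y\<bar> \<le> B"
    using r(1) by (intro exI[of _ r] exI[of _ "\<bar>u x\<bar> + 1"] conjI AE_I2) auto
qed

lemma Lp_loc_mult_Linf:
  assumes "0 \<le> p" "open X" "Linf_loc X b" "Lp_loc p X u" shows "Lp_loc p X (\<lambda>x. b x * u x)"
  unfolding Lp_loc_iff_ball[OF assms(2)]
proof
  fix x assume x: "x \<in> X"
  obtain r B where r: "r > 0" "B \<ge> 0" "\<And>s. s \<le> r \<Longrightarrow> AE y in lebesgue. y \<in> ball x s \<longrightarrow> \<bar>b y\<bar> \<le> B"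
    using Linf_loc_obtain[OF assms(3) x] by blast
  obtain t where t: "t > 0" "cball x t \<subseteq> X" using x assms(2) open_contains_cball by blast
  define s where "s = min r t"
  have s: "s > 0" "s \<le> r" "cball x s \<subseteq> X" using r(1) t by (auto simp: s_def subset_eq)
  have sb: "ball x s \<subseteq> X" by (rule order_trans[OF ball_subset_cball s(3)])
  have L: "Lp_ball p x s u" by (rule Lp_loc_imp_ball[OF assms(4) s(3) assms(2)])
  have bm: "b \<in> borel_measurable (lebesgue_on (ball x s))"
    using measurable_lebesgue_on_mono[OF Linf_loc_measurable[OF assms(3)] sb] assms(2) by auto
  have "Lp_ball p x s (\<lambda>x. b x * u x)" unfolding Lp_ball_def
  proof
    show m: "(\<lambda>x. b x * u x) \<in> borel_measurable (lebesgue_on (ball x s))" using L bm by (auto simp: Lp_ball_def)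
    show "integrable (lebesgue_on (ball x s)) (\<lambda>y. \<bar>b y * u y\<bar> powr p)"
    proof (rule Bochner_Integration.integrable_bound)
      show "integrable (lebesgue_on (ball x s)) (\<lambda>y. B powr p * \<bar>u y\<bar> powr p)" using L by (auto simp: Lp_ball_def)
      have "AE y in lebesgue_on (ball x s). \<bar>b y\<bar> \<le> B" using r(3)[OF s(2)] by (simp add: AE_restrict_space_iff)
      then show "AE y in lebesgue_on (ball x s). norm (\<bar>b y * u y\<bar> powr p) \<le> norm (B powr p * \<bar>u y\<bar> powr p)"
        by eventually_elim (use assms(1) r(2) in \<open>auto simp: abs_mult powr_mult intro!: mult_right_mono powr_mono2\<close>)
    qed (use m in simp)
  qed
  then show "\<exists>r>0. ball x r \<subseteq> X \<and> Lp_ball p x r (\<lambda>x. b x * u x)" using s(1) sb by blast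
qed

lemma Linf_loc_imp_Lp_loc:
  assumes "0 \<le> p" "open X" "Linf_loc X b" shows "Lp_loc p X b"
proof -
  have "set_integrable lebesgue K (\<lambda>x. \<bar>1::real\<bar> powr p)" if "compact K" for K :: "(real^'a) set"
    using that emeasure_bounded_finite[OF compact_imp_bounded[OF that]]
    by (auto simp: set_integrable_def compact_imp_closed intro!: integrable_real_indicator)
  then have "Lp_loc p X (\<lambda>x. 1)" by (simp add: Lp_loc_def)
  from Lp_loc_mult_Linf[OF assms this] show ?thesis by simp
qed

lemma measurable_lebesgue_on_AE:
  fixes u v :: "'a::euclidean_space \<Rightarrow> real"
  assumes "u \<in> borel_measurable (lebesgue_on U)" "AE y in lebesgue. y \<in> U \<longrightarrow> u y = v y" "U \<in> sets lebesgue"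
  shows "v \<in> borel_measurable (lebesgue_on U)"
proof -
  have "(\<lambda>y. indicator U y *\<^sub>R u y) \<in> borel_measurable lebesgue"
    using assms(1,3) by (subst (asm) borel_measurable_restrict_space_iff) auto
  moreover have "AE y in lebesgue. indicator U y *\<^sub>R u y = indicator U y *\<^sub>R v y"
    using assms(2) by eventually_elim (auto simp: indicator_def)
  ultimately have "(\<lambda>y. indicator U y *\<^sub>R v y) \<in> borel_measurable lebesgue" by (rule borel_measurable_AE)
  then show ?thesis using assms(3) by (subst borel_measurable_restrict_space_iff) auto
qed

lemma Lp_loc_AE:
  assumes "open X" "Lp_loc p X u" "AE y in lebesgue. y \<in> X \<longrightarrow> u y = v y"
  shows "Lp_loc p X v"
proof (rule Lp_loc_cong_AE[OF assms(1,2)])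
  show "AE y in lebesgue_on X. u y = v y" using assms(1,3) by (simp add: AE_restrict_space_iff)
  show "v \<in> borel_measurable (lebesgue_on X)"
    using measurable_lebesgue_on_AE[OF Lp_loc_measurable[OF assms(2)] assms(3)] assms(1) by simp
qed

text \<open>By Lindelof countably many of the sets \<open>U\<close> suffice, and countably many null
  sets have a null union.\<close>

lemma AE_lebesgue_cover:
  assumes "\<And>x. x \<in> X \<Longrightarrow> \<exists>U. open U \<and> x \<in> U \<and> (AE y in lebesgue. y \<in> U \<longrightarrow> P y)"
  shows "AE y in lebesgue. y \<in> (X :: 'a::euclidean_space set) \<longrightarrow> P y"
proof -
  have "\<forall>x\<in>X. \<exists>U. open U \<and> x \<in> U \<and> (AE y in lebesgue. y \<in> U \<longrightarrow> P y)" using assms by blast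
  from bchoice[OF this] obtain U where U0: "\<forall>x\<in>X. open (U x) \<and> x \<in> U x \<and> (AE y in lebesgue. y \<in> U x \<longrightarrow> P y)" ..
  then have U: "\<And>x. x \<in> X \<Longrightarrow> open (U x) \<and> x \<in> U x \<and> (AE y in lebesgue. y \<in> U x \<longrightarrow> P y)" by (rule bspec)
  obtain \<F> where F: "\<F> \<subseteq> U ` X" "countable \<F>" "\<Union>\<F> = \<Union>(U ` X)" using Lindelof[of "U ` X"] U by blast
  have "AE y in lebesgue. y \<in> V \<longrightarrow> P y" if "V \<in> \<F>" for V using that F(1) U by auto
  then have "AE y in lebesgue. \<forall>V\<in>\<F>. y \<in> V \<longrightarrow> P y" by (subst AE_ball_countable[OF F(2)]) auto
  then show ?thesis
  proof eventually_elim
    case (elim y)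
    show ?case
    proof
      assume y: "y \<in> X"
      then have "y \<in> \<Union>\<F>" using F(3) U[OF y] by blast
      then show "P y" using elim by auto
    qed
  qed
qed

section \<open>Weak derivatives\<close>

lemma integrable_lebesgue_on_iff:
  fixes u :: "'a::euclidean_space \<Rightarrow> real"
  assumes "S \<in> sets lebesgue"
  shows "integrable (lebesgue_on S) u \<longleftrightarrow> integrable lebesgue (\<lambda>x. indicator S x * u x)"
  using assms by (simp add: integrable_restrict_space)

lemma integral_lebesgue_on_eq:
  fixes u :: "'a::euclidean_space \<Rightarrow> real"
  assumes "S \<in> sets lebesgue"
  shows "(LINT x|lebesgue_on S. u x) = (LINT x|lebesgue. indicator S x * u x)"
  using assms by (simp add: integral_restrict_space)

text \<open>Weak derivatives are tested in the completed measure, while mollification and Fubini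
  live on \<open>lborel\<close>. The function is cut off outside \<open>S\<close> and replaced by a
  Borel function that agrees with it almost everywhere.\<close>

lemma borel_representative:
  fixes u :: "real^'n \<Rightarrow> real"
  assumes "integrable (lebesgue_on S) u" "S \<in> sets lebesgue"
  obtains w where "integrable lborel w" "AE x in lebesgue. indicator S x * u x = w x"
proof -
  have i: "integrable lebesgue (\<lambda>x. indicator S x * u x)" using assms by (simp add: integrable_lebesgue_on_iff)
  obtain w where w: "w \<in> borel_measurable lborel" "AE x in lborel. indicator S x * u x = w x"
    using completion_ex_borel_measurable_real[OF borel_measurable_integrable[OF i]] by blast
  have ae: "AE x in lebesgue. indicator S x * u x = w x" by (rule AE_completion[OF w(2)])
  have "w \<in> borel_measurable lebesgue" by (rule measurable_completion[OF w(1)])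
  then have "integrable lebesgue w" using integrable_cong_AE_imp[OF i _ ae] by blast
  then have "integrable lborel w" using integrable_completion[OF w(1)] by simp
  then show ?thesis using that ae by blast
qed

lemma integral_mult_representative:
  fixes \<phi> :: "real^'n \<Rightarrow> real"
  assumes "integrable lborel w" "AE x in lebesgue. indicator S x * u x = w x"
    and "integrable (lebesgue_on S) u" "S \<in> sets lebesgue"
    and "continuous_on UNIV \<phi>" "\<And>x. x \<notin> S \<Longrightarrow> \<phi> x = 0"
  shows "(LINT x|lebesgue. u x * \<phi> x) = (LINT x|lborel. \<phi> x * w x)"
proof -
  have m: "\<phi> \<in> borel_measurable borel" by (rule borel_measurable_continuous_onI[OF assms(5)])
  have "(LINT x|lebesgue. u x * \<phi> x) = (LINT x|lebesgue. (indicator S x * u x) * \<phi> x)"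
  proof (rule Bochner_Integration.integral_cong[OF refl])
    show "u x * \<phi> x = indicator S x * u x * \<phi> x" for x using assms(6)[of x] by (cases "x \<in> S") auto
  qed
  also have "\<dots> = (LINT x|lebesgue. \<phi> x * w x)"
  proof (rule integral_cong_AE)
    have "integrable lebesgue (\<lambda>x. indicator S x * u x)" using assms(3,4) by (simp add: integrable_lebesgue_on_iff)
    note this[THEN borel_measurable_integrable]
    moreover have "\<phi> \<in> borel_measurable lebesgue" using m by (intro measurable_completion) auto
    ultimately show "(\<lambda>x. indicator S x * u x * \<phi> x) \<in> borel_measurable lebesgue" by (rule borel_measurable_times)
    show "(\<lambda>x. \<phi> x * w x) \<in> borel_measurable lebesgue" using m assms(1) by (intro measurable_completion) auto
    show "AE x in lebesgue. indicator S x * u x * \<phi> x = \<phi> x * w x" using assms(2) by eventually_elim simp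
  qed
  also have "\<dots> = (LINT x|lborel. \<phi> x * w x)" using m assms(1) by (intro integral_completion) auto
  finally show ?thesis .
qed

lemma test_mult_integrable:
  assumes "Lp_loc 1 X u" "test_function X \<phi>" "open X"
  shows "integrable lebesgue (\<lambda>x. u x * \<phi> x)"
proof (rule test_function_compact[OF assms(2)])
  fix K assume K: "compact K" "K \<subseteq> X" "\<And>x. x \<notin> K \<Longrightarrow> \<phi> x = 0"
  have Ks: "K \<in> sets lebesgue" using K(1) by (simp add: compact_imp_closed)
  have "set_integrable lebesgue K (\<lambda>x. \<bar>u x\<bar> powr 1)" using assms(1) K by (auto simp: Lp_loc_def)
  then have "integrable (lebesgue_on K) (\<lambda>x. \<bar>u x\<bar>)"
    using Ks by (simp add: integrable_restrict_space set_integrable_def)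
  moreover have "u \<in> borel_measurable (lebesgue_on K)"
    using measurable_lebesgue_on_mono[OF Lp_loc_measurable[OF assms(1)] K(2) Ks] assms(3) by simp
  ultimately have u: "integrable (lebesgue_on K) u" by (simp add: integrable_abs_iff)
  show ?thesis
  proof (rule test_function_bounded[OF assms(2)])
    fix B assume B: "\<And>x. \<bar>\<phi> x\<bar> \<le> B"
    have "\<phi> \<in> borel_measurable (lebesgue_on K)"
      using continuous_imp_measurable_on_sets_lebesgue[OF test_function_continuous[OF assms(2)] Ks] .
    from integrable_bounded_mult[OF u this B]
    have "integrable lebesgue (\<lambda>x. indicator K x * (\<phi> x * u x))" using Ks by (simp add: integrable_lebesgue_on_iff)
    moreover have "indicator K x * (\<phi> x * u x) = u x * \<phi> x" for x using K(3)[of x] by (cases "x \<in> K") auto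
    ultimately show ?thesis by simp
  qed
qed

lemma weak_deriv_1_iff:
  assumes "open X"
  shows "weak_deriv X [i] u v \<longleftrightarrow> Lp_loc 1 X u \<and> Lp_loc 1 X v \<and>
    (\<forall>\<phi>. test_function X \<phi> \<longrightarrow> (LINT x|lebesgue. u x * partial_deriv i \<phi> x) = - (LINT x|lebesgue. v x * \<phi> x))"
proof -
  have "(LINT x:X|lebesgue. u x * partial_deriv i \<phi> x) = (LINT x|lebesgue. u x * partial_deriv i \<phi> x) \<and>
      (LINT x:X|lebesgue. v x * \<phi> x) = (LINT x|lebesgue. v x * \<phi> x)" if t: "test_function X \<phi>" for \<phi>
  proof (rule test_function_compact[OF t])
    fix K assume K: "K \<subseteq> X" "\<And>x. x \<notin> K \<Longrightarrow> \<phi> x = 0" "\<And>x i. x \<notin> K \<Longrightarrow> partial_deriv i \<phi> x = 0"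
    have e: "indicator X x *\<^sub>R (u x * partial_deriv i \<phi> x) = u x * partial_deriv i \<phi> x"
      "indicator X x *\<^sub>R (v x * \<phi> x) = v x * \<phi> x" for x using K(1) K(2)[of x] K(3)[of x] by (cases "x \<in> X"; auto)+
    show ?thesis unfolding set_lebesgue_integral_def e by simp
  qed
  then show ?thesis unfolding weak_deriv_def by auto
qed

lemma weak_derivD:
  assumes "weak_deriv X [i] u v" "open X"
  shows "Lp_loc 1 X u" "Lp_loc 1 X v"
    "test_function X \<phi> \<Longrightarrow> (LINT x|lebesgue. u x * partial_deriv i \<phi> x) = - (LINT x|lebesgue. v x * \<phi> x)"
  using assms by (auto simp: weak_deriv_1_iff)

lemma weak_deriv_subset:
  assumes "weak_deriv X [i] u v" "open X" "open U" "U \<subseteq> X"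
  shows "weak_deriv U [i] u v" using assms test_function_mono[OF _ assms(4)]
  by (auto simp: weak_deriv_1_iff intro: Lp_loc_subset)

lemma integral_mult_cong_AE:
  assumes "Lp_loc 1 X u" "AE y in lebesgue. y \<in> X \<longrightarrow> u y = v y" "open X" "test_function X \<phi>"
  shows "(LINT x|lebesgue. u x * \<phi> x) = (LINT x|lebesgue. v x * \<phi> x)"
proof (rule test_function_compact[OF assms(4)])
  fix K assume K: "K \<subseteq> X" "\<And>x. x \<notin> K \<Longrightarrow> \<phi> x = 0"
  show ?thesis
  proof (rule integral_cong_AE)
    show "(\<lambda>x. u x * \<phi> x) \<in> borel_measurable lebesgue" "(\<lambda>x. v x * \<phi> x) \<in> borel_measurable lebesgue"
      using test_mult_integrable[OF assms(1,4,3)] test_mult_integrable[OF Lp_loc_AE[OF assms(3,1,2)] assms(4,3)] by auto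
    show "AE x in lebesgue. u x * \<phi> x = v x * \<phi> x" using assms(2)
    proof eventually_elim
      case (elim x)
      then show ?case using K(1) K(2)[of x] by (cases "x \<in> K") auto
    qed
  qed
qed

lemma weak_deriv_cong_AE:
  assumes "weak_deriv X [i] u v" "open X"
    and "AE y in lebesgue. y \<in> X \<longrightarrow> u y = u' y" "AE y in lebesgue. y \<in> X \<longrightarrow> v y = v' y"
  shows "weak_deriv X [i] u' v'" unfolding weak_deriv_1_iff[OF assms(2)]
proof (intro conjI allI impI)
  note d = weak_derivD[OF assms(1,2)]
  show "Lp_loc 1 X u'" by (rule Lp_loc_AE[OF assms(2) d(1) assms(3)])
  show "Lp_loc 1 X v'" by (rule Lp_loc_AE[OF assms(2) d(2) assms(4)])
  fix \<phi> assume t: "test_function X \<phi>"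
  then show "(LINT x|lebesgue. u' x * partial_deriv i \<phi> x) = - (LINT x|lebesgue. v' x * \<phi> x)"
    using d(3)[OF t] integral_mult_cong_AE[OF d(1) assms(3,2) test_function_partial[OF t], of i]
      integral_mult_cong_AE[OF d(2) assms(4,2) t] by simp
qed

text \<open>Induction on the cover takes the place of a partition of unity: a plateau splits off the
  part of \<phi> near \<open>a\<close>, and the rest is supported in what the remaining balls
  cover.\<close>

lemma weak_deriv_finite_cover:
  assumes "finite F" "open X" "Lp_loc 1 X u" "Lp_loc 1 X v"
    and "\<And>x. x \<in> F \<Longrightarrow> r x > 0 \<and> weak_deriv (ball x (r x)) [i] u v"
    and "smooth \<phi>" "compact K" "K \<subseteq> X" "\<And>x. x \<notin> K \<Longrightarrow> \<phi> x = 0" "K \<subseteq> (\<Union>x\<in>F. ball x (r x / 2))"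
  shows "(LINT x|lebesgue. u x * partial_deriv i \<phi> x) = - (LINT x|lebesgue. v x * \<phi> x)" using assms(1,5-10)
proof (induction F arbitrary: \<phi> K)
  case empty
  then have "\<phi> = (\<lambda>x. 0)" by auto
  moreover have "partial_deriv i (\<lambda>x::real^'a. 0) = (\<lambda>x. 0)" using partial_deriv_eq[OF has_derivative_const] by auto
  ultimately show ?case by simp
next
  case (insert a F)
  \<comment> \<open>The plateau covers the half ball used in the cover, while its support, of three
    quarters of the radius, is compact inside the ball where the weak derivative is known.\<close>
  define ct where "ct = cutoff (r a / 2) (3 * r a / 4) a"
  have ra: "r a > 0" "weak_deriv (ball a (r a)) [i] u v" using insert.prems(1) by auto
  have sct: "smooth ct" unfolding ct_def using ra by (intro smooth_cutoff) auto
  define \<phi>1 where "\<phi>1 x = \<phi> x * ct x" for x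
  define \<phi>2 where "\<phi>2 x = \<phi> x * (1 - ct x)" for x
  have s: "smooth \<phi>1" "smooth \<phi>2"
    unfolding \<phi>1_def \<phi>2_def by (intro smooth_mult smooth_diff smooth_const insert.prems(2) sct)+
  have z1: "\<phi>1 x = 0" if "x \<notin> K \<inter> cball a (3 * r a / 4)" for x
    using that insert.prems(5)[of x] cutoff_eq_0[of "3 * r a / 4" x a "r a / 2"] ra
    by (auto simp: \<phi>1_def ct_def dist_norm norm_minus_commute)
  have t1: "test_function (ball a (r a)) \<phi>1" "test_function X \<phi>1"
  proof -
    have sub: "K \<inter> cball a (3 * r a / 4) \<subseteq> ball a (r a)" using ra(1) by auto
    show "test_function (ball a (r a)) \<phi>1"
      by (rule test_function_I[OF s(1) compact_Int[OF insert.prems(3) compact_cball] sub z1])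
    show "test_function X \<phi>1"
      by (rule test_function_I[OF s(1) compact_Int[OF insert.prems(3) compact_cball] le_infI1[OF insert.prems(4)] z1])
  qed
  have z2: "\<phi>2 x = 0" if "x \<notin> K - ball a (r a / 2)" for x
    using that insert.prems(5)[of x] cutoff_eq_1[of "r a / 2" "3 * r a / 4" x a] ra
    by (auto simp: \<phi>2_def ct_def dist_norm norm_minus_commute)
  have K2: "compact (K - ball a (r a / 2))" "K - ball a (r a / 2) \<subseteq> X"
    using insert.prems(3,4) by (auto intro: compact_diff)
  have t2: "test_function X \<phi>2" by (rule test_function_I[OF s(2) K2 z2])
  have 2: "(LINT x|lebesgue. u x * partial_deriv i \<phi>2 x) = - (LINT x|lebesgue. v x * \<phi>2 x)"
    by (rule insert.IH[OF _ s(2) K2 z2]) (use insert.prems(1,6) in auto)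
  have 1: "(LINT x|lebesgue. u x * partial_deriv i \<phi>1 x) = - (LINT x|lebesgue. v x * \<phi>1 x)"
    by (rule weak_derivD(3)[OF ra(2) open_ball t1(1)])
  have sum: "\<phi> = (\<lambda>x. \<phi>1 x + \<phi>2 x)" by (auto simp: \<phi>1_def \<phi>2_def algebra_simps)
  have "partial_deriv i \<phi> x = partial_deriv i \<phi>1 x + partial_deriv i \<phi>2 x" for x
    unfolding sum by (rule partial_deriv_add) (auto intro: smooth_differentiable s)
  then have "(LINT x|lebesgue. u x * partial_deriv i \<phi> x) =
      (LINT x|lebesgue. u x * partial_deriv i \<phi>1 x) + (LINT x|lebesgue. u x * partial_deriv i \<phi>2 x)"
    using test_mult_integrable[OF assms(3) test_function_partial[OF t1(2)] assms(2)]
      test_mult_integrable[OF assms(3) test_function_partial[OF t2] assms(2)] by (simp add: distrib_left)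
  moreover have "(LINT x|lebesgue. v x * \<phi> x) = (LINT x|lebesgue. v x * \<phi>1 x) + (LINT x|lebesgue. v x * \<phi>2 x)"
    using test_mult_integrable[OF assms(4) t1(2) assms(2)] test_mult_integrable[OF assms(4) t2 assms(2)]
    by (simp add: sum distrib_left)
  ultimately show ?case using 1 2 by simp
qed

lemma weak_deriv_local:
  assumes "open X" "\<And>x. x \<in> X \<Longrightarrow> \<exists>U. open U \<and> x \<in> U \<and> weak_deriv U [i] u v"
  shows "weak_deriv X [i] u v"
proof -
  have Lu: "Lp_loc 1 X u" and Lv: "Lp_loc 1 X v"
  proof -
    show "Lp_loc 1 X u"
    proof (rule Lp_loc_local[OF assms(1)])
      fix x assume "x \<in> X"
      from assms(2)[OF this] obtain U where U: "open U" "x \<in> U" "weak_deriv U [i] u v" by blast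
      show "\<exists>U. open U \<and> x \<in> U \<and> Lp_loc 1 U u" by (intro exI[of _ U] conjI U weak_derivD(1)[OF U(3,1)])
    qed
    show "Lp_loc 1 X v"
    proof (rule Lp_loc_local[OF assms(1)])
      fix x assume "x \<in> X"
      from assms(2)[OF this] obtain U where U: "open U" "x \<in> U" "weak_deriv U [i] u v" by blast
      show "\<exists>U. open U \<and> x \<in> U \<and> Lp_loc 1 U v" by (intro exI[of _ U] conjI U weak_derivD(2)[OF U(3,1)])
    qed
  qed
  have "\<exists>r>0. ball x r \<subseteq> X \<and> weak_deriv (ball x r) [i] u v" if x: "x \<in> X" for x
  proof -
    obtain U where U: "open U" "x \<in> U" "weak_deriv U [i] u v" using assms(2)[OF x] by blast
    then obtain r where "r > 0" "ball x r \<subseteq> U \<inter> X" using x assms(1) open_contains_ball[of "U \<inter> X"] by blast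
    then show ?thesis using weak_deriv_subset[OF U(3,1) open_ball, of x r] by auto
  qed
  then have "\<forall>x\<in>X. \<exists>r>0. ball x r \<subseteq> X \<and> weak_deriv (ball x r) [i] u v" by blast
  from bchoice[OF this] obtain r where r0: "\<forall>x\<in>X. r x > 0 \<and> ball x (r x) \<subseteq> X \<and> weak_deriv (ball x (r x)) [i] u v" ..
  then have r: "\<And>x. x \<in> X \<Longrightarrow> r x > 0 \<and> ball x (r x) \<subseteq> X \<and> weak_deriv (ball x (r x)) [i] u v" by (rule bspec)
  show ?thesis unfolding weak_deriv_1_iff[OF assms(1)]
  proof (intro conjI Lu Lv allI impI)
    fix \<phi> assume t: "test_function X \<phi>"
    show "(LINT x|lebesgue. u x * partial_deriv i \<phi> x) = - (LINT x|lebesgue. v x * \<phi> x)"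
    proof (rule test_function_compact[OF t])
      fix K assume K: "compact K" "K \<subseteq> X" "\<And>x. x \<notin> K \<Longrightarrow> \<phi> x = 0"
      have cov: "K \<subseteq> (\<Union>x\<in>K. ball x (r x / 2))"
      proof
        fix x assume x: "x \<in> K"
        then have "x \<in> ball x (r x / 2)" using r K(2) by auto
        then show "x \<in> (\<Union>x\<in>K. ball x (r x / 2))" using x by blast
      qed
      obtain F where F: "F \<subseteq> K" "finite F" "K \<subseteq> (\<Union>x\<in>F. ball x (r x / 2))"
        by (rule compactE_image[OF K(1) open_ball cov])
      have "r x > 0 \<and> weak_deriv (ball x (r x)) [i] u v" if "x \<in> F" for x using r[of x] F(1) K(2) that by blast
      then show ?thesis by (rule weak_deriv_finite_cover[OF F(2) assms(1) Lu Lv _ test_function_smooth[OF t] K F(3)])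
    qed
  qed
qed

section \<open>Convergence in the mean\<close>

definition L1_conv :: "'a measure \<Rightarrow> (nat \<Rightarrow> 'a \<Rightarrow> real) \<Rightarrow> ('a \<Rightarrow> real) \<Rightarrow> bool" where
  "L1_conv M s f \<longleftrightarrow> (\<forall>k. integrable M (s k)) \<and> integrable M f \<and> (\<lambda>k. LINT x|M. \<bar>s k x - f x\<bar>) \<longlonglongrightarrow> 0"

lemma L1_convD: "L1_conv M s f \<Longrightarrow> integrable M (s k)" "L1_conv M s f \<Longrightarrow> integrable M f"
    "L1_conv M s f \<Longrightarrow> (\<lambda>k. LINT x|M. \<bar>s k x - f x\<bar>) \<longlonglongrightarrow> 0" by (auto simp: L1_conv_def)

lemma L1_convI_bound:
  assumes "\<And>k. integrable M (s k)" "integrable M f" "\<And>k. (LINT x|M. \<bar>s k x - f x\<bar>) \<le> a k" "a \<longlonglongrightarrow> 0"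
  shows "L1_conv M s f" unfolding L1_conv_def
  by (intro conjI allI assms tendsto_sandwich[OF _ _ tendsto_const assms(4)])
    (use assms(3) in \<open>auto intro!: always_eventually\<close>)

lemma L1_conv_add:
  assumes "L1_conv M s f" "L1_conv M t g" shows "L1_conv M (\<lambda>k x. s k x + t k x) (\<lambda>x. f x + g x)"
proof (rule L1_convI_bound)
  note [simp] = L1_convD(1,2)[OF assms(1)] L1_convD(1,2)[OF assms(2)]
  show "integrable M (\<lambda>x. s k x + t k x)" for k by (intro Bochner_Integration.integrable_add) auto
  show "integrable M (\<lambda>x. f x + g x)" by (intro Bochner_Integration.integrable_add) auto
  show "(\<lambda>k. (LINT x|M. \<bar>s k x - f x\<bar>) + (LINT x|M. \<bar>t k x - g x\<bar>)) \<longlonglongrightarrow> 0"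
    using tendsto_add[OF L1_convD(3)[OF assms(1)] L1_convD(3)[OF assms(2)]] by simp
  show "(LINT x|M. \<bar>s k x + t k x - (f x + g x)\<bar>) \<le> (LINT x|M. \<bar>s k x - f x\<bar>) + (LINT x|M. \<bar>t k x - g x\<bar>)" for k
  proof -
    have "(LINT x|M. \<bar>s k x + t k x - (f x + g x)\<bar>) \<le> (LINT x|M. \<bar>s k x - f x\<bar> + \<bar>t k x - g x\<bar>)"
      by (intro integral_mono) auto
    then show ?thesis by simp
  qed
qed

lemma L1_conv_zero: "L1_conv M (\<lambda>k x. 0) (\<lambda>x. 0)" by (simp add: L1_conv_def)

lemma L1_conv_sum:
  assumes "finite I" "\<And>i. i \<in> I \<Longrightarrow> L1_conv M (\<lambda>k. s k i) (f i)"
  shows "L1_conv M (\<lambda>k x. \<Sum>i\<in>I. s k i x) (\<lambda>x. \<Sum>i\<in>I. f i x)"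
  using assms by (induction I) (auto intro: L1_conv_zero L1_conv_add)

lemma L1_conv_subseq:
  assumes "L1_conv M s f" "strict_mono r" shows "L1_conv M (\<lambda>k. s (r k)) f"
  using assms LIMSEQ_subseq_LIMSEQ[OF L1_convD(3)[OF assms(1)] assms(2)] by (auto simp: L1_conv_def o_def)

lemma L1_conv_AE_subseq:
  assumes "L1_conv M s f"
  obtains r where "strict_mono r" "AE x in M. (\<lambda>k. s (r k) x) \<longlonglongrightarrow> f x"
proof -
  have "\<exists>r. strict_mono r \<and> (AE x in M. (\<lambda>n. s (r n) x - f x) \<longlonglongrightarrow> 0)"
    using L1_convD[OF assms] by (intro tendsto_L1_AE_subseq) auto
  then show ?thesis using that by (auto simp: LIM_zero_iff)
qed

lemma AE_subseq_tendsto: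
  "AE x in M. (\<lambda>k. s k x) \<longlonglongrightarrow> f x \<Longrightarrow> strict_mono r \<Longrightarrow> AE x in M. (\<lambda>k. s (r k) x) \<longlonglongrightarrow> f x"
  by (erule eventually_mono) (drule LIMSEQ_subseq_LIMSEQ, auto simp: o_def)

text \<open>Write \<open>b s - c f\<close> as \<open>b (s - f) + (b - c) f\<close>: the first term
  is small in the mean because \<open>b\<close> is bounded, the second tends to 0 by dominated
  convergence. Convergence of \<open>b\<close> almost everywhere suffices, and it can be arranged by
  passing to a subsequence.\<close>

lemma L1_conv_mult:
  assumes "L1_conv M s f" "AE x in M. (\<lambda>k. b k x) \<longlonglongrightarrow> c x"
    and [measurable]: "\<And>k. b k \<in> borel_measurable M" "c \<in> borel_measurable M"
    and "\<And>k. AE x in M. \<bar>b k x\<bar> \<le> B"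
  shows "L1_conv M (\<lambda>k x. b k x * s k x) (\<lambda>x. c x * f x)"
proof (rule L1_convI_bound)
  note [simp] = L1_convD(1,2)[OF assms(1)]
  have [measurable]: "\<And>k. s k \<in> borel_measurable M" "f \<in> borel_measurable M"
    using L1_convD(1,2)[OF assms(1)] by (auto intro: borel_measurable_integrable)
  have allB: "AE x in M. \<forall>k. \<bar>b k x\<bar> \<le> B" using assms(5) by (simp add: AE_all_countable)
  then have cB: "AE x in M. \<bar>c x\<bar> \<le> B" using assms(2)
  proof eventually_elim
    case (elim x)
    then show ?case using LIMSEQ_le_const2[OF tendsto_rabs[OF elim(2)]] by blast
  qed
  have bi: "integrable M (\<lambda>x. \<beta> x * h x)" if "integrable M h" "\<beta> \<in> borel_measurable M" "AE x in M. \<bar>\<beta> x\<bar> \<le> B" for \<beta> h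
  proof (rule Bochner_Integration.integrable_bound)
    show "integrable M (\<lambda>x. B * h x)" using that(1) by simp
    show "AE x in M. norm (\<beta> x * h x) \<le> norm (B * h x)" using that(3)
    proof eventually_elim
      case (elim x)
      then have "\<bar>\<beta> x\<bar> \<le> \<bar>B\<bar>" by linarith
      then show ?case by (simp add: abs_mult mult_right_mono)
    qed
  qed (use that borel_measurable_integrable in auto)
  show i1: "integrable M (\<lambda>x. b k x * s k x)" for k using assms by (intro bi) auto
  show i2: "integrable M (\<lambda>x. c x * f x)" using cB by (intro bi) auto
  have i3: "integrable M (\<lambda>x. b k x * f x)" for k using assms by (intro bi) auto
  have lim: "(\<lambda>k. LINT x|M. \<bar>b k x * f x - c x * f x\<bar>) \<longlonglongrightarrow> integral\<^sup>L M (\<lambda>x. 0)"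
  proof (rule integral_dominated_convergence)
    show "integrable M (\<lambda>x. 2 * B * \<bar>f x\<bar>)" by simp
    show "AE x in M. (\<lambda>k. \<bar>b k x * f x - c x * f x\<bar>) \<longlonglongrightarrow> 0" using assms(2)
    proof eventually_elim
      case (elim x)
      have "(\<lambda>k. \<bar>b k x * f x - c x * f x\<bar>) \<longlonglongrightarrow> \<bar>c x * f x - c x * f x\<bar>" by (intro tendsto_intros elim)
      then show ?case by simp
    qed
    show "AE x in M. norm \<bar>b k x * f x - c x * f x\<bar> \<le> 2 * B * \<bar>f x\<bar>" for k using allB cB
    proof eventually_elim
      case (elim x)
      then have "\<bar>b k x - c x\<bar> \<le> 2 * B" using abs_triangle_ineq4[of "b k x" "c x"] by (auto dest: spec[of _ k])
      then show ?case by (simp add: left_diff_distrib[symmetric] abs_mult mult_right_mono)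
    qed
  qed measurable
  show "(\<lambda>k. B * (LINT x|M. \<bar>s k x - f x\<bar>) + (LINT x|M. \<bar>b k x * f x - c x * f x\<bar>)) \<longlonglongrightarrow> 0"
    using tendsto_add[OF tendsto_mult_left[OF L1_convD(3)[OF assms(1)], of B] lim] by simp
  fix k
  have "(LINT x|M. \<bar>b k x * s k x - c x * f x\<bar>) \<le> (LINT x|M. B * \<bar>s k x - f x\<bar> + \<bar>b k x * f x - c x * f x\<bar>)"
  proof (rule integral_mono_AE)
    show "AE x in M. \<bar>b k x * s k x - c x * f x\<bar> \<le> B * \<bar>s k x - f x\<bar> + \<bar>b k x * f x - c x * f x\<bar>" using assms(5)[of k]
    proof eventually_elim
      case (elim x)
      have "\<bar>b k x * s k x - c x * f x\<bar> \<le> \<bar>b k x * (s k x - f x)\<bar> + \<bar>b k x * f x - c x * f x\<bar>"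
        by (simp add: algebra_simps)
      also have "\<bar>b k x * (s k x - f x)\<bar> \<le> B * \<bar>s k x - f x\<bar>" using elim by (simp add: abs_mult mult_right_mono)
      finally show ?case by simp
    qed
  qed (use i1 i2 i3 in auto)
  then show "(LINT x|M. \<bar>b k x * s k x - c x * f x\<bar>) \<le> B * (LINT x|M. \<bar>s k x - f x\<bar>) + (LINT x|M. \<bar>b k x * f x - c x * f x\<bar>)"
    using i2 i3[of k] by simp
qed

lemma integrable_imp_Lp_loc_1:
  assumes "integrable (lebesgue_on (ball a r)) u" shows "Lp_loc 1 (ball a r) u"
  unfolding Lp_loc_iff_ball[OF open_ball]
proof
  fix x assume "x \<in> ball a r"
  then obtain s where s: "s > 0" "ball x s \<subseteq> ball a r" using open_contains_ball open_ball by blast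
  have "Lp_ball 1 x s u" by (rule Lp_ball_mono[OF _ s(2)]) (simp add: Lp_ball_1 assms)
  then show "\<exists>s>0. ball x s \<subseteq> ball a r \<and> Lp_ball 1 x s u" using s by blast
qed

lemma L1_conv_pair:
  assumes "L1_conv M s f" "\<psi> \<in> borel_measurable M" "\<And>x. \<bar>\<psi> x\<bar> \<le> B"
  shows "(\<lambda>k. LINT x|M. s k x * \<psi> x) \<longlonglongrightarrow> (LINT x|M. f x * \<psi> x)"
proof -
  note i = L1_convD(1,2)[OF assms(1)]
  have iss: "integrable M (\<lambda>x. \<psi> x * s k x)" for k by (rule integrable_bounded_mult[OF i(1) assms(2,3)])
  have if': "integrable M (\<lambda>x. \<psi> x * f x)" by (rule integrable_bounded_mult[OF i(2) assms(2,3)])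
  have le: "\<bar>(LINT x|M. \<psi> x * s k x) - (LINT x|M. \<psi> x * f x)\<bar> \<le> B * (LINT x|M. \<bar>s k x - f x\<bar>)" for k
  proof -
    have "(LINT x|M. \<psi> x * s k x) - (LINT x|M. \<psi> x * f x) = (LINT x|M. \<psi> x * s k x - \<psi> x * f x)"
      by (rule Bochner_Integration.integral_diff[OF iss if', symmetric])
    also have "norm \<dots> \<le> (LINT x|M. norm (\<psi> x * s k x - \<psi> x * f x))" by (rule Bochner_Integration.integral_norm_bound)
    also have "\<dots> \<le> (LINT x|M. B * \<bar>s k x - f x\<bar>)"
    proof (rule integral_mono)
      show "integrable M (\<lambda>x. norm (\<psi> x * s k x - \<psi> x * f x))" using iss if' by simp
      show "integrable M (\<lambda>x. B * \<bar>s k x - f x\<bar>)" using i by simp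
      show "norm (\<psi> x * s k x - \<psi> x * f x) \<le> B * \<bar>s k x - f x\<bar>" for x
        using assms(3)[of x] by (simp add: right_diff_distrib[symmetric] abs_mult mult_right_mono)
    qed
    finally show ?thesis by simp
  qed
  have "(\<lambda>k. B * (LINT x|M. \<bar>s k x - f x\<bar>)) \<longlonglongrightarrow> B * 0" by (intro tendsto_intros L1_convD(3)[OF assms(1)])
  then have lim0: "(\<lambda>k. B * (LINT x|M. \<bar>s k x - f x\<bar>)) \<longlonglongrightarrow> 0" by simp
  have "(\<lambda>k. (LINT x|M. \<psi> x * s k x) - (LINT x|M. \<psi> x * f x)) \<longlonglongrightarrow> 0"
    by (rule Lim_null_comparison[OF always_eventually lim0]) (use le in simp)
  then have "(\<lambda>k. LINT x|M. \<psi> x * s k x) \<longlonglongrightarrow> (LINT x|M. \<psi> x * f x)" by (rule LIM_zero_cancel)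
  then show ?thesis by (simp only: mult.commute[of _ "\<psi> _"])
qed

lemma integral_test_lebesgue_on:
  fixes \<psi> u :: "'a::euclidean_space \<Rightarrow> real"
  assumes "\<And>x. x \<notin> S \<Longrightarrow> \<psi> x = 0" "S \<in> sets lebesgue"
  shows "(LINT x|lebesgue. u x * \<psi> x) = (LINT x|lebesgue_on S. u x * \<psi> x)"
  unfolding integral_lebesgue_on_eq[OF assms(2)]
proof (rule Bochner_Integration.integral_cong[OF refl])
  show "u x * \<psi> x = indicator S x * (u x * \<psi> x)" for x using assms(1)[of x] by (cases "x \<in> S") auto
qed

text \<open>Pairing with a bounded test function is continuous for convergence in the mean, so weak
  differentiation is a closed relation. The product and chain rules are passed to the limit through
  this fact.\<close>

lemma weak_deriv_L1_limit:
  assumes "\<And>k. weak_deriv (ball a r) [i] (v k) (g k)"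
    and "L1_conv (lebesgue_on (ball a r)) v u" "L1_conv (lebesgue_on (ball a r)) g V"
  shows "weak_deriv (ball a r) [i] u V" unfolding weak_deriv_1_iff[OF open_ball]
proof (intro conjI allI impI)
  show "Lp_loc 1 (ball a r) u" by (rule integrable_imp_Lp_loc_1[OF L1_convD(2)[OF assms(2)]])
  show "Lp_loc 1 (ball a r) V" by (rule integrable_imp_Lp_loc_1[OF L1_convD(2)[OF assms(3)]])
  fix \<phi> assume t: "test_function (ball a r) \<phi>"
  have tend: "(\<lambda>k. LINT x|lebesgue. s k x * \<psi> x) \<longlonglongrightarrow> (LINT x|lebesgue. f x * \<psi> x)"
    if "L1_conv (lebesgue_on (ball a r)) s f" "test_function (ball a r) \<psi>" for s f \<psi>
  proof (rule test_function_bounded[OF that(2)], rule test_function_compact[OF that(2)])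
    fix B K assume B: "\<And>x. \<bar>\<psi> x\<bar> \<le> B" and K: "K \<subseteq> ball a r" "\<And>x. x \<notin> K \<Longrightarrow> \<psi> x = 0"
    have z: "\<psi> x = 0" if "x \<notin> ball a r" for x using K(1) K(2)[of x] that by blast
    have bl: "ball a r \<in> sets lebesgue" by simp
    have "\<psi> \<in> borel_measurable (lebesgue_on (ball a r))"
      by (rule continuous_on_measurable_lebesgue[OF test_function_continuous[OF that(2)] open_ball])
    from L1_conv_pair[OF that(1) this B]
    have t: "(\<lambda>k. LINT x|lebesgue_on (ball a r). s k x * \<psi> x) \<longlonglongrightarrow> (LINT x|lebesgue_on (ball a r). f x * \<psi> x)" .
    have e: "(LINT x|lebesgue. h x * \<psi> x) = (LINT x|lebesgue_on (ball a r). h x * \<psi> x)" for h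
      by (rule integral_test_lebesgue_on[OF z bl])
    show ?thesis unfolding e by (rule t)
  qed
  have "(\<lambda>k. LINT x|lebesgue. v k x * partial_deriv i \<phi> x) \<longlonglongrightarrow> (LINT x|lebesgue. u x * partial_deriv i \<phi> x)"
    by (rule tend[OF assms(2) test_function_partial[OF t]])
  moreover have "(\<lambda>k. LINT x|lebesgue. v k x * partial_deriv i \<phi> x) \<longlonglongrightarrow> - (LINT x|lebesgue. V x * \<phi> x)"
    unfolding weak_derivD(3)[OF assms(1) open_ball t] by (intro tendsto_minus tend[OF assms(3) t])
  ultimately show "(LINT x|lebesgue. u x * partial_deriv i \<phi> x) = - (LINT x|lebesgue. V x * \<phi> x)"
    by (rule LIMSEQ_unique)
qed

lemma continuous_imp_Lp_loc:
  "continuous_on X u \<Longrightarrow> open X \<Longrightarrow> 0 \<le> p \<Longrightarrow> Lp_loc p X u" by (intro Linf_loc_imp_Lp_loc continuous_imp_Linf_loc)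

lemma C1_weak_deriv:
  assumes "C1 v g" "open X" shows "weak_deriv X [i] v (g i)" unfolding weak_deriv_1_iff[OF assms(2)]
proof (intro conjI allI impI)
  show "Lp_loc 1 X v" "Lp_loc 1 X (g i)"
    using C1_continuous[OF assms(1)] C1_grad_continuous[OF assms(1)] assms(2) by (auto intro: continuous_imp_Lp_loc)
  fix \<phi> assume t: "test_function X \<phi>"
  have "(LINT x|lebesgue. v x * partial_deriv i \<phi> x) = (LINT x|lborel. v x * partial_deriv i \<phi> x)"
    by (intro integral_completion) (auto intro!: borel_measurable_continuous_onI continuous_on_mult C1_continuous[OF assms(1)]
        smooth_continuous[OF smooth_partial[OF test_function_smooth[OF t]]])
  moreover have "(LINT x|lebesgue. g i x * \<phi> x) = (LINT x|lborel. g i x * \<phi> x)"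
    by (intro integral_completion) (auto intro!: borel_measurable_continuous_onI continuous_on_mult C1_grad_continuous[OF assms(1)]
        smooth_continuous[OF test_function_smooth[OF t]])
  ultimately show "(LINT x|lebesgue. v x * partial_deriv i \<phi> x) = - (LINT x|lebesgue. g i x * \<phi> x)"
    using C1_integral_by_parts[OF assms(1) t] by simp
qed

section \<open>Smooth approximation of a function together with its weak gradient\<close>

lemma L1_conv_cong_AE:
  assumes "L1_conv M s f" "\<And>k. AE x in M. s k x = s' k x" "AE x in M. f x = f' x"
    and "\<And>k. s' k \<in> borel_measurable M" "f' \<in> borel_measurable M"
  shows "L1_conv M s' f'" unfolding L1_conv_def
proof (intro conjI allI)
  note i = L1_convD(1,2)[OF assms(1)]
  show i1: "integrable M (s' k)" for k by (rule integrable_cong_AE_imp[OF i(1) assms(4)]) (use assms(2)[of k] in auto)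
  show i2: "integrable M f'" by (rule integrable_cong_AE_imp[OF i(2) assms(5)]) (use assms(3) in auto)
  have "(LINT x|M. \<bar>s' k x - f' x\<bar>) = (LINT x|M. \<bar>s k x - f x\<bar>)" for k
  proof (rule integral_cong_AE)
    show "(\<lambda>x. \<bar>s' k x - f' x\<bar>) \<in> borel_measurable M" by (intro borel_measurable_abs borel_measurable_diff assms)
    show "(\<lambda>x. \<bar>s k x - f x\<bar>) \<in> borel_measurable M"
      by (intro borel_measurable_abs borel_measurable_diff borel_measurable_integrable i)
    show "AE x in M. \<bar>s' k x - f' x\<bar> = \<bar>s k x - f x\<bar>" using assms(2)[of k] assms(3) by eventually_elim simp
  qed
  then show "(\<lambda>k. LINT x|M. \<bar>s' k x - f' x\<bar>) \<longlonglongrightarrow> 0" using L1_convD(3)[OF assms(1)] by simp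
qed

lemma integrable_lebesgue_on_of_lborel:
  fixes w :: "real^'n \<Rightarrow> real"
  assumes "integrable lborel w" "S \<in> sets lebesgue" shows "integrable (lebesgue_on S) w"
proof -
  have "integrable lebesgue w" using assms(1) by (simp add: integrable_completion)
  then show ?thesis
    using integrable_mult_indicator[OF assms(2), of w] by (simp add: integrable_lebesgue_on_iff[OF assms(2)])
qed

lemma moll_L1_conv:
  fixes w :: "real^'n \<Rightarrow> real"
  assumes "integrable lborel w"
  shows "L1_conv (lebesgue_on (ball a r)) (\<lambda>k. moll (1 / real (Suc (k + k0))) w) w"
proof (rule L1_convI_bound)
  have im: "integrable lborel (moll (1 / real (Suc k)) w)" for k by (intro integrable_moll assms) simp
  show "integrable (lebesgue_on (ball a r)) w" by (rule integrable_lebesgue_on_of_lborel[OF assms]) simp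
  show "integrable (lebesgue_on (ball a r)) (moll (1 / real (Suc (k + k0))) w)" for k
    by (rule integrable_lebesgue_on_of_lborel[OF im]) simp
  define R where "R = norm a + r"
  show "(\<lambda>k. LINT x:ball 0 R|lborel. \<bar>moll (1 / Suc (k + k0)) w x - w x\<bar>) \<longlonglongrightarrow> 0"
    by (rule LIMSEQ_ignore_initial_segment[OF moll_tendsto_L1[OF assms]])
  have sub: "x \<in> ball 0 R" if "x \<in> ball a r" for x
    using norm_triangle_ineq[of a "x - a"] that by (simp add: R_def dist_norm norm_minus_commute)
  fix k
  let ?d = "\<lambda>x. \<bar>moll (1 / Suc (k + k0)) w x - w x\<bar>"
  have id: "integrable lborel ?d" by (intro integrable_abs Bochner_Integration.integrable_diff im assms)
  have "(LINT x|lebesgue_on (ball a r). ?d x) = (LINT x|lebesgue. indicator (ball a r) x * ?d x)"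
    by (rule integral_lebesgue_on_eq) simp
  also have "\<dots> = (LINT x|lborel. indicator (ball a r) x * ?d x)"
    using borel_measurable_integrable[OF integrable_mult_indicator[OF _ id, of "ball a r"]]
    by (intro integral_completion) simp
  also have "\<dots> \<le> (LINT x|lborel. indicator (ball 0 R) x * ?d x)"
  proof (rule integral_mono)
    show "integrable lborel (\<lambda>x. indicator (ball a r) x * ?d x)"
      using integrable_mult_indicator[OF _ id, of "ball a r"] by simp
    show "integrable lborel (\<lambda>x. indicator (ball 0 R) x * ?d x)"
      using integrable_mult_indicator[OF _ id, of "ball 0 R"] by simp
    show "indicator (ball a r) x * ?d x \<le> indicator (ball 0 R) x * ?d x" for x
      using sub[of x] by (intro mult_right_mono) (auto simp: indicator_def)
  qed
  finally show "(LINT x|lebesgue_on (ball a r). ?d x) \<le> (LINT x:ball 0 R|lborel. ?d x)"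
    by (simp add: set_lebesgue_integral_def)
qed

lemma integrable_lborel_translation:
  fixes w :: "'a::euclidean_space \<Rightarrow> real"
  assumes "integrable lborel w" shows "integrable lborel (\<lambda>y. w (y + h))"
proof -
  have "integrable (distr lborel borel ((+) h)) w" using assms by (simp add: lborel_distr_plus)
  then have "integrable lborel (\<lambda>y. w (h + y))"
    using borel_measurable_integrable[OF assms] by (subst (asm) integrable_distr_eq) auto
  then show ?thesis by (simp add: add.commute)
qed

lemma C1_directional:
  assumes "C1 F G"
  shows "((\<lambda>t. (F (y + t *\<^sub>R axis i 1) - F y) / t) \<longlongrightarrow> G i y) (at 0)"
proof -
  have l: "((\<lambda>t. y + t *\<^sub>R axis i (1::real)) has_derivative (\<lambda>t. t *\<^sub>R axis i 1)) (at 0)"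
    by (auto intro!: derivative_eq_intros)
  have "((\<lambda>t. F (y + t *\<^sub>R axis i 1)) has_derivative (\<lambda>t. \<Sum>j\<in>UNIV. (t *\<^sub>R axis i 1) $ j * G j y)) (at 0)"
    by (rule has_derivative_compose[OF l]) (use C1_has_derivative[OF assms, of y] in simp)
  moreover have "(\<Sum>j\<in>UNIV. (t *\<^sub>R axis i 1) $ j * G j y) = t * G i y" for t :: real
    by (simp add: axis_def if_distrib[of "\<lambda>x. _ * x * _"] if_distrib[of "\<lambda>x. x * _"] sum.delta' cong: if_cong)
  ultimately have "((\<lambda>t. F (y + t *\<^sub>R axis i 1)) has_real_derivative G i y) (at 0)"
    by (simp add: has_field_derivative_def mult_commute_abs)
  then show ?thesis by (simp add: DERIV_def)
qed

text \<open>Difference quotients commute with mollification, so those of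
  \<open>moll \<epsilon> w\<close> are averages of those of \<open>w\<close> and keep the constant
  \<open>L\<close> without loss.\<close>

lemma moll_grad_lipschitz_bound:
  fixes w :: "real^'n \<Rightarrow> real"
  assumes "0 < \<epsilon>" "\<epsilon> \<le> r" "integrable lborel w" "x \<in> ball a r"
    and "\<And>y z. y \<in> ball a (2 * r) \<Longrightarrow> z \<in> ball a (2 * r) \<Longrightarrow> \<bar>w y - w z\<bar> \<le> L * norm (y - z)"
  shows "\<bar>moll_grad \<epsilon> w i x\<bar> \<le> L"
proof -
  \<comment> \<open>The distance from \<open>x\<close> to the boundary of \<open>ball a r\<close>:
    as \<epsilon> \<le> r, points of \<open>ball x \<epsilon>\<close> shifted by less than \<delta>
    stay in the doubled ball.\<close>
  define \<delta> where "\<delta> = r - dist a x"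
  have \<delta>: "\<delta> > 0" using assms(4) by (simp add: \<delta>_def)
  have it: "integrable lborel (\<lambda>y. w (y + h))" for h by (rule integrable_lborel_translation[OF assms(3)])
  have q: "\<bar>moll \<epsilon> w (x + h) - moll \<epsilon> w x\<bar> \<le> L * norm h" if h: "norm h < \<delta>" for h
  proof -
    have "moll \<epsilon> w (x + h) = (LINT y|lborel. mollifier \<epsilon> (x + h) (y + h) * w (y + h))"
      unfolding moll_def by (rule integral_lborel_translation[symmetric])
    also have "\<dots> = moll \<epsilon> (\<lambda>y. w (y + h)) x" by (simp add: moll_def mollifier_def bump_def)
    finally have "moll \<epsilon> w (x + h) - moll \<epsilon> w x = moll \<epsilon> (\<lambda>y. w (y + h) - w y) x"
      using moll_diff[OF assms(1) it assms(3)] by simp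
    moreover have "\<bar>moll \<epsilon> (\<lambda>y. w (y + h) - w y) x - 0\<bar> \<le> L * norm h"
    proof (rule moll_bound[OF assms(1)])
      show "integrable lborel (\<lambda>y. w (y + h) - w y)" using it assms(3) by simp
      show "AE y in lborel. y \<in> ball x \<epsilon> \<longrightarrow> \<bar>w (y + h) - w y - 0\<bar> \<le> L * norm h"
      proof (intro AE_I2 impI)
        fix y assume y: "y \<in> ball x \<epsilon>"
        have "dist a y \<le> dist a x + dist x y" "dist a (y + h) \<le> dist a y + norm h"
          using dist_triangle[of a y x] dist_triangle[of a "y + h" y] by (auto simp: dist_norm norm_minus_commute)
        then have "y \<in> ball a (2 * r)" "y + h \<in> ball a (2 * r)"
          using y h assms(2) \<delta> by (auto simp: \<delta>_def)
        from assms(5)[OF this(2,1)] show "\<bar>w (y + h) - w y - 0\<bar> \<le> L * norm h" by simp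
      qed
    qed
    ultimately show ?thesis by simp
  qed
  have lim: "((\<lambda>t. \<bar>(moll \<epsilon> w (x + t *\<^sub>R axis i 1) - moll \<epsilon> w x) / t\<bar>) \<longlongrightarrow> \<bar>moll_grad \<epsilon> w i x\<bar>) (at 0)"
    by (intro tendsto_rabs C1_directional C1_moll assms)
  show ?thesis
  proof (rule tendsto_upperbound[OF lim])
    have "\<forall>\<^sub>F t in at (0::real). \<bar>t\<bar> < \<delta> \<and> t \<noteq> 0"
      unfolding eventually_at by (intro exI[of _ \<delta>]) (use \<delta> in \<open>auto simp: dist_real_def\<close>)
    then show "\<forall>\<^sub>F t in at 0. \<bar>(moll \<epsilon> w (x + t *\<^sub>R axis i 1) - moll \<epsilon> w x) / t\<bar> \<le> L"
    proof eventually_elim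
      case (elim t)
      then show ?case using q[of "t *\<^sub>R axis i 1"] by (simp add: norm_axis_1 divide_le_eq)
    qed
  qed simp
qed

lemma AE_lebesgue_lborel: "(AE x in lebesgue. P x) \<Longrightarrow> (AE x in lborel. P (x :: 'a :: euclidean_space))"
  by (simp add: AE_completion_iff)

text \<open>These are the mollifications of \<open>u\<close>, cut off outside the doubled ball, at
  scales below \<open>r\<close>. For \<open>x\<close> in the inner ball the kernel is a test
  function on the doubled ball, so the gradient of the mollification is the mollification of
  \<open>V\<close>, and essential bounds and Lipschitz constants are inherited.\<close>

lemma weak_approx:
  fixes u :: "real^'n \<Rightarrow> real"
  assumes "open X" "\<And>i. weak_deriv X [i] u (V i)" "r > 0" "cball a (2 * r) \<subseteq> X"
  obtains v g where "\<And>k. C1 (v k) (g k)"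
    and "L1_conv (lebesgue_on (ball a r)) v u" "\<And>i. L1_conv (lebesgue_on (ball a r)) (\<lambda>k. g k i) (V i)"
    and "\<And>B k x. (AE y in lebesgue. y \<in> ball a (2 * r) \<longrightarrow> \<bar>u y\<bar> \<le> B) \<Longrightarrow> x \<in> ball a r \<Longrightarrow> \<bar>v k x\<bar> \<le> B"
    and "\<And>B i k x. (AE y in lebesgue. y \<in> ball a (2 * r) \<longrightarrow> \<bar>V i y\<bar> \<le> B) \<Longrightarrow> x \<in> ball a r \<Longrightarrow> \<bar>g k i x\<bar> \<le> B"
    and "\<And>L i k x. (\<And>y z. y \<in> ball a (2 * r) \<Longrightarrow> z \<in> ball a (2 * r) \<Longrightarrow> \<bar>u y - u z\<bar> \<le> L * norm (y - z))
      \<Longrightarrow> x \<in> ball a r \<Longrightarrow> \<bar>g k i x\<bar> \<le> L"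
proof -
  let ?S = "ball a (2 * r)"
  have S: "?S \<in> sets lebesgue" by simp
  have SO: "?S \<subseteq> X" by (rule order_trans[OF ball_subset_cball assms(4)])
  have brS: "ball a r \<subseteq> ?S" using assms(3) by (intro subset_ball) simp
  note d = weak_derivD[OF assms(2,1)]
  have iu: "integrable (lebesgue_on ?S) u" using Lp_loc_imp_ball[OF d(1) assms(4,1)] by (simp add: Lp_ball_1)
  have iV: "integrable (lebesgue_on ?S) (V i)" for i using Lp_loc_imp_ball[OF d(2) assms(4,1)] by (simp add: Lp_ball_1)
  obtain w where w: "integrable lborel w" "AE x in lebesgue. indicator ?S x * u x = w x"
    by (rule borel_representative[OF iu S])
  have "\<exists>W. integrable lborel W \<and> (AE x in lebesgue. indicator ?S x * V i x = W x)" for i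
    by (rule borel_representative[OF iV[of i] S]) (intro exI conjI)
  then have "\<forall>i. \<exists>W. integrable lborel W \<and> (AE x in lebesgue. indicator ?S x * V i x = W x)" ..
  from choice[OF this] obtain W where W0: "\<forall>i. integrable lborel (W i) \<and> (AE x in lebesgue. indicator ?S x * V i x = W i x)" ..
  have W: "integrable lborel (W i)" "AE x in lebesgue. indicator ?S x * V i x = W i x" for i
    using W0[THEN spec, of i] by auto
  obtain k0 where k0: "inverse (real (Suc k0)) < r" using reals_Archimedean[OF assms(3)] by auto
  define \<epsilon> where "\<epsilon> k = 1 / real (Suc (k + k0))" for k
  have \<epsilon>: "\<epsilon> k > 0" "\<epsilon> k < r" for k
  proof -
    show "\<epsilon> k > 0" by (simp add: \<epsilon>_def)
    have "inverse (real (Suc (k + k0))) \<le> inverse (real (Suc k0))" by (intro le_imp_inverse_le) auto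
    then show "\<epsilon> k < r" using k0 by (simp add: \<epsilon>_def inverse_eq_divide)
  qed
  have cS: "cball x (\<epsilon> k) \<subseteq> ?S" if "x \<in> ball a r" for x k
  proof
    fix y assume "y \<in> cball x (\<epsilon> k)"
    then show "y \<in> ?S" using that \<epsilon>(2)[of k] dist_triangle[of a y x] by simp
  qed
  have grad: "moll_grad (\<epsilon> k) w i x = moll (\<epsilon> k) (W i) x" if x: "x \<in> ball a r" for x k i
  proof -
    let ?\<phi> = "mollifier (\<epsilon> k) x"
    have t: "test_function ?S ?\<phi>" by (rule test_function_mollifier[OF \<epsilon>(1) cS[OF x]])
    show ?thesis
    proof (rule test_function_compact[OF t])
      fix K assume K: "K \<subseteq> ?S" "\<And>x. x \<notin> K \<Longrightarrow> ?\<phi> x = 0" "\<And>x i. x \<notin> K \<Longrightarrow> partial_deriv i ?\<phi> x = 0"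
      have z1: "?\<phi> y = 0" if "y \<notin> ?S" for y using K(1) K(2)[of y] that by blast
      have z2: "partial_deriv i ?\<phi> y = 0" if "y \<notin> ?S" for y using K(1) K(3)[of y i] that by blast
      have "moll_grad (\<epsilon> k) w i x = - (LINT y|lborel. partial_deriv i ?\<phi> y * w y)"
        by (simp add: moll_grad_def partial_mollifier[OF \<epsilon>(1)])
      also have "(LINT y|lborel. partial_deriv i ?\<phi> y * w y) = (LINT y|lebesgue. u y * partial_deriv i ?\<phi> y)"
        by (rule integral_mult_representative[OF w iu S _ z2, symmetric])
          (rule smooth_continuous[OF smooth_partial[OF test_function_smooth[OF t]]])
      also have "- \<dots> = (LINT y|lebesgue. V i y * ?\<phi> y)" using d(3)[OF test_function_mono[OF t SO], of i] by simp
      also have "\<dots> = (LINT y|lborel. ?\<phi> y * W i y)"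
        by (rule integral_mult_representative[OF W iV S _ z1]) (rule test_function_continuous[OF t])
      finally show ?thesis by (simp add: moll_def)
    qed
  qed
  define v where "v k = moll (\<epsilon> k) w" for k
  define g where "g k = moll_grad (\<epsilon> k) w" for k
  have C: "C1 (v k) (g k)" for k unfolding v_def g_def by (rule C1_moll[OF \<epsilon>(1) w(1)])
  have meas: "h \<in> borel_measurable (lebesgue_on (ball a r))" if "integrable (lebesgue_on ?S) h" for h :: "real^'n \<Rightarrow> real"
    by (rule measurable_lebesgue_on_mono[OF borel_measurable_integrable[OF that] brS]) auto
  have AEr: "AE x in lebesgue_on (ball a r). P x" if "AE x in lebesgue. x \<in> ball a r \<longrightarrow> P x" for P
    using that by (simp add: AE_restrict_space_iff)
  show ?thesis
  proof (rule that[OF C])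
    show "L1_conv (lebesgue_on (ball a r)) v u"
    proof (rule L1_conv_cong_AE[OF moll_L1_conv[OF w(1), of a r k0]])
      show "AE x in lebesgue_on (ball a r). moll (1 / real (Suc (k + k0))) w x = v k x" for k
        by (rule AE_I2) (simp add: v_def \<epsilon>_def)
      show "AE x in lebesgue_on (ball a r). w x = u x"
        by (rule AEr) (use w(2) brS in \<open>auto elim!: eventually_mono simp: subset_eq\<close>)
      show "v k \<in> borel_measurable (lebesgue_on (ball a r))" for k
        by (rule continuous_on_measurable_lebesgue[OF C1_continuous[OF C] open_ball])
    qed (rule meas[OF iu])
    show "L1_conv (lebesgue_on (ball a r)) (\<lambda>k. g k i) (V i)" for i
    proof (rule L1_conv_cong_AE[OF moll_L1_conv[OF W(1)[of i], of a r k0]])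
      show "AE x in lebesgue_on (ball a r). moll (1 / real (Suc (k + k0))) (W i) x = g k i x" for k
        by (rule AEr, intro AE_I2 impI, simp only: grad g_def) (simp add: \<epsilon>_def)
      show "AE x in lebesgue_on (ball a r). W i x = V i x"
        by (rule AEr) (use W(2)[of i] brS in \<open>auto elim!: eventually_mono simp: subset_eq\<close>)
      show "g k i \<in> borel_measurable (lebesgue_on (ball a r))" for k
        by (rule continuous_on_measurable_lebesgue[OF C1_grad_continuous[OF C] open_ball])
    qed (rule meas[OF iV])
    have bd: "\<bar>moll (\<epsilon> k) h' x\<bar> \<le> B" if x: "x \<in> ball a r" and h': "integrable lborel h'" "AE x in lebesgue. indicator ?S x * h x = h' x"
      and B: "AE y in lebesgue. y \<in> ?S \<longrightarrow> \<bar>h y\<bar> \<le> B" for h h' x B k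
    proof -
      have "AE y in lebesgue. y \<in> ball x (\<epsilon> k) \<longrightarrow> \<bar>h' y - 0\<bar> \<le> B" using h'(2) B
      proof eventually_elim
        case (elim y)
        show ?case
        proof
          assume "y \<in> ball x (\<epsilon> k)"
          then have "y \<in> ?S" using cS[OF x, of k] ball_subset_cball[of x "\<epsilon> k"] by blast
          then show "\<bar>h' y - 0\<bar> \<le> B" using elim by simp
        qed
      qed
      from moll_bound[OF \<epsilon>(1) h'(1) AE_lebesgue_lborel[OF this]] show ?thesis by simp
    qed
    show "\<bar>v k x\<bar> \<le> B" if "AE y in lebesgue. y \<in> ?S \<longrightarrow> \<bar>u y\<bar> \<le> B" "x \<in> ball a r" for B k x
      unfolding v_def by (rule bd[OF that(2) w that(1)])
    show "\<bar>g k i x\<bar> \<le> B" if "AE y in lebesgue. y \<in> ?S \<longrightarrow> \<bar>V i y\<bar> \<le> B" "x \<in> ball a r" for B k i x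
      unfolding g_def grad[OF that(2)] by (rule bd[OF that(2) W that(1)])
    show "\<bar>g k i x\<bar> \<le> L" if lip: "\<And>y z. y \<in> ?S \<Longrightarrow> z \<in> ?S \<Longrightarrow> \<bar>u y - u z\<bar> \<le> L * norm (y - z)" and x: "x \<in> ball a r" for L i k x
    proof -
      \<comment> \<open>\<open>w\<close> equals \<open>u\<close> only almost everywhere, whereas the
        Lipschitz bound is pointwise; the integral defining the gradient is therefore rewritten in
        terms of \<open>u\<close> itself.\<close>
      let ?f = "\<lambda>x. indicator ?S x * u x"
      have ae: "AE x in lborel. ?f x = w x" by (rule AE_lebesgue_lborel[OF w(2)])
      have "(max L 0)-lipschitz_on ?S u"
      proof (rule lipschitz_onI)
        fix y z assume yz: "y \<in> ?S" "z \<in> ?S"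
        have "\<bar>u y - u z\<bar> \<le> max L 0 * norm (y - z)" by (rule order_trans[OF lip[OF yz]]) (simp add: mult_right_mono)
        then show "dist (u y) (u z) \<le> max L 0 * dist y z" by (simp add: dist_norm)
      qed simp
      then have "continuous_on ?S u" by (rule lipschitz_on_continuous_on)
      then have fm: "?f \<in> borel_measurable lborel" using borel_measurable_continuous_on_indicator[of ?S u] by simp
      have fi: "integrable lborel ?f"
        by (rule integrable_cong_AE_imp[OF w(1) fm]) (use ae in \<open>auto elim: eventually_mono\<close>)
      have pm: "(\<lambda>y. partial_deriv i (mollifier (\<epsilon> k) (0::real^'n)) (x - y)) \<in> borel_measurable borel"
        by (intro borel_measurable_continuous_onI continuous_on_compose2[OF smooth_continuous[OF smooth_partial[OF test_function_smooth[OF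
              test_function_mollifier_UNIV[OF \<epsilon>(1)]]], of UNIV]]) (auto intro!: continuous_intros)
      have "moll_grad (\<epsilon> k) w i x = moll_grad (\<epsilon> k) ?f i x" unfolding moll_grad_def
      proof (rule integral_cong_AE)
        show "AE y in lborel. partial_deriv i (mollifier (\<epsilon> k) 0) (x - y) * w y = partial_deriv i (mollifier (\<epsilon> k) 0) (x - y) * ?f y"
          using ae by eventually_elim simp
      qed (use pm fm w(1) in auto)
      moreover have "\<bar>moll_grad (\<epsilon> k) ?f i x\<bar> \<le> L"
        by (rule moll_grad_lipschitz_bound[OF \<epsilon>(1) less_imp_le[OF \<epsilon>(2)] fi x]) (simp add: lip)
      ultimately show ?thesis by (simp add: g_def)
    qed
  qed
qed

text \<open>On a small ball the mollifications of \<open>z\<close> are pairings with test functions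
  and vanish identically; their limit in the mean is \<open>z\<close>.\<close>

lemma weak_fundamental_lemma:
  fixes z :: "real^'n \<Rightarrow> real"
  assumes "open X" "Lp_loc 1 X z" "\<And>\<phi>. test_function X \<phi> \<Longrightarrow> (LINT x|lebesgue. z x * \<phi> x) = 0"
  shows "AE x in lebesgue. x \<in> X \<longrightarrow> z x = 0"
proof (rule AE_lebesgue_cover)
  fix a assume "a \<in> X"
  then obtain r' where r': "r' > 0" "cball a r' \<subseteq> X" using assms(1) open_contains_cball by blast
  define r where "r = r' / 2"
  have r: "r > 0" "cball a (2 * r) \<subseteq> X" using r' by (auto simp: r_def)
  let ?S = "ball a (2 * r)"
  have S: "?S \<in> sets lebesgue" by simp
  have SO: "?S \<subseteq> X" by (rule order_trans[OF ball_subset_cball r(2)])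
  have iz: "integrable (lebesgue_on ?S) z" using Lp_loc_imp_ball[OF assms(2) r(2) assms(1)] by (simp add: Lp_ball_1)
  obtain w where w: "integrable lborel w" "AE x in lebesgue. indicator ?S x * z x = w x"
    by (rule borel_representative[OF iz S])
  obtain k0 where k0: "inverse (real (Suc k0)) < r" using reals_Archimedean[OF r(1)] by auto
  have 0: "moll (1 / real (Suc (k + k0))) w x = 0" if x: "x \<in> ball a r" for x k
  proof -
    define \<epsilon> where "\<epsilon> = 1 / real (Suc (k + k0))"
    have "inverse (real (Suc (k + k0))) \<le> inverse (real (Suc k0))" by (intro le_imp_inverse_le) auto
    then have \<epsilon>: "\<epsilon> > 0" "\<epsilon> < r" using k0 by (auto simp: \<epsilon>_def inverse_eq_divide)
    have c: "cball x \<epsilon> \<subseteq> ?S"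
    proof
      fix y assume "y \<in> cball x \<epsilon>"
      then show "y \<in> ?S" using x \<epsilon>(2) dist_triangle[of a y x] by simp
    qed
    have t: "test_function ?S (mollifier \<epsilon> x)" by (rule test_function_mollifier[OF \<epsilon>(1) c])
    have z: "mollifier \<epsilon> x y = 0" if "y \<notin> ?S" for y
      using mollifier_eq_0[OF \<epsilon>(1), of y x] c that ball_subset_cball[of x \<epsilon>] by blast
    have "moll \<epsilon> w x = (LINT y|lebesgue. z y * mollifier \<epsilon> x y)"
      unfolding moll_def by (rule integral_mult_representative[OF w iz S _ z, symmetric]) (rule test_function_continuous[OF t])
    also have "\<dots> = 0" by (rule assms(3)[OF test_function_mono[OF t SO]])
    finally show ?thesis by (simp add: \<epsilon>_def)
  qed
  have sp: "space (lebesgue_on (ball a r)) = ball a r" by simp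
  have "(LINT x|lebesgue_on (ball a r). \<bar>moll (1 / real (Suc (k + k0))) w x - w x\<bar>) = (LINT x|lebesgue_on (ball a r). \<bar>w x\<bar>)" for k
  proof (rule Bochner_Integration.integral_cong[OF refl])
    fix x assume "x \<in> space (lebesgue_on (ball a r))"
    then have "x \<in> ball a r" by simp
    from 0[OF this, of k] show "\<bar>moll (1 / real (Suc (k + k0))) w x - w x\<bar> = \<bar>w x\<bar>" by (simp del: of_nat_Suc)
  qed
  then have "(\<lambda>k::nat. LINT x|lebesgue_on (ball a r). \<bar>w x\<bar>) \<longlonglongrightarrow> 0"
    using L1_convD(3)[OF moll_L1_conv[OF w(1), of a r k0]] by simp
  then have I0: "(LINT x|lebesgue_on (ball a r). \<bar>w x\<bar>) = 0" using LIMSEQ_unique[OF tendsto_const] by blast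
  have iw: "integrable (lebesgue_on (ball a r)) (\<lambda>x. \<bar>w x\<bar>)"
    using integrable_lebesgue_on_of_lborel[OF w(1), of "ball a r"] by simp
  have "AE x in lebesgue_on (ball a r). \<bar>w x\<bar> = 0" using integral_nonneg_eq_0_iff_AE[OF iw] I0 by simp
  then have "AE x in lebesgue. x \<in> ball a r \<longrightarrow> w x = 0" by (simp add: AE_restrict_space_iff)
  then have "AE y in lebesgue. y \<in> ball a r \<longrightarrow> z y = 0" using w(2)
  proof eventually_elim
    case (elim y)
    then show ?case using r(1) by (auto simp: indicator_def split: if_splits)
  qed
  then show "\<exists>U. open U \<and> a \<in> U \<and> (AE y in lebesgue. y \<in> U \<longrightarrow> z y = 0)"
    using r(1) by (intro exI[of _ "ball a r"] conjI) auto
qed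

lemma weak_deriv_unique:
  assumes "open X" "weak_deriv X [i] u v" "weak_deriv X [i] u v'"
  shows "AE x in lebesgue. x \<in> X \<longrightarrow> v x = v' x"
proof -
  note d = weak_derivD[OF assms(2,1)] and d' = weak_derivD[OF assms(3,1)]
  have L: "Lp_loc 1 X (\<lambda>x. v x + (- 1) * v' x)"
    by (intro Lp_loc_add Lp_loc_mult_Linf continuous_imp_Linf_loc d(2) d'(2) assms(1)) auto
  have "AE x in lebesgue. x \<in> X \<longrightarrow> v x + (- 1) * v' x = 0"
  proof (rule weak_fundamental_lemma[OF assms(1) L])
    fix \<phi> assume t: "test_function X \<phi>"
    have "(LINT x|lebesgue. v x * \<phi> x) = (LINT x|lebesgue. v' x * \<phi> x)" using d(3)[OF t] d'(3)[OF t] by simp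
    then show "(LINT x|lebesgue. (v x + (- 1) * v' x) * \<phi> x) = 0"
      using test_mult_integrable[OF d(2) t assms(1)] test_mult_integrable[OF d'(2) t assms(1)]
      by (simp add: left_diff_distrib)
  qed
  then show ?thesis by eventually_elim auto
qed

text \<open>Local weak derivatives agree almost everywhere on overlaps. A countable subcover permits
  a choice at each point, namely the first piece that contains it, while all exceptional sets
  together remain null.\<close>

lemma weak_deriv_glue:
  fixes u :: "real^'n \<Rightarrow> real"
  assumes "open X" "\<And>x. x \<in> X \<Longrightarrow> \<exists>U v. open U \<and> x \<in> U \<and> weak_deriv U [i] u v"
  shows "\<exists>v. weak_deriv X [i] u v"
proof (cases "X = {}")
  case True
  then show ?thesis by (intro exI[of _ u] weak_deriv_local assms(1)) auto
next
  case False
  have "\<forall>x\<in>X. \<exists>p. open (fst p) \<and> x \<in> fst p \<and> weak_deriv (fst p) [i] u (snd p)"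
  proof
    fix x assume "x \<in> X"
    from assms(2)[OF this] obtain U v where "open U" "x \<in> U" "weak_deriv U [i] u v" by blast
    then show "\<exists>p. open (fst p) \<and> x \<in> fst p \<and> weak_deriv (fst p) [i] u (snd p)" by (intro exI[of _ "(U, v)"]) auto
  qed
  from bchoice[OF this] obtain P where P: "\<forall>x\<in>X. open (fst (P x)) \<and> x \<in> fst (P x) \<and> weak_deriv (fst (P x)) [i] u (snd (P x))" ..
  define U where "U x = fst (P x)" for x
  define V where "V x = snd (P x)" for x
  have U: "open (U x)" "x \<in> U x" "weak_deriv (U x) [i] u (V x)" if "x \<in> X" for x
    using bspec[OF P that] by (auto simp: U_def V_def)
  obtain \<F> where F: "\<F> \<subseteq> U ` X" "countable \<F>" "\<Union>\<F> = \<Union>(U ` X)" using Lindelof[of "U ` X"] U(1) by blast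
  obtain C where C: "countable C" "C \<subseteq> X" "\<F> = U ` C" using countable_subset_image[of \<F> U X] F by auto
  have "C \<noteq> {}" using False U(2) F(3) C(3) by auto
  define c where "c = from_nat_into C"
  have c: "c n \<in> X" for n using from_nat_into[OF \<open>C \<noteq> {}\<close>, of n] C(2) by (auto simp: c_def)
  have cov: "\<exists>n. x \<in> U (c n)" if x: "x \<in> X" for x
  proof -
    have "x \<in> \<Union>\<F>" using F(3) U(2)[OF x] x by blast
    then obtain y where "y \<in> C" "x \<in> U y" using C(3) by blast
    then show ?thesis using from_nat_into_surj[OF C(1), of y] by (auto simp: c_def)
  qed
  define v where "v y = V (c (LEAST n. y \<in> U (c n))) y" for y
  have eq: "AE y in lebesgue. y \<in> U (c m) \<longrightarrow> V (c m) y = v y" for m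
  proof -
    have "AE y in lebesgue. y \<in> U (c m) \<inter> U (c n) \<longrightarrow> V (c m) y = V (c n) y" for n
    proof -
      have o: "open (U (c m) \<inter> U (c n))" by (intro open_Int U(1) c)
      show ?thesis
        by (rule weak_deriv_unique[OF o weak_deriv_subset[OF U(3)[OF c[of m]] U(1)[OF c[of m]] o Int_lower1]
              weak_deriv_subset[OF U(3)[OF c[of n]] U(1)[OF c[of n]] o Int_lower2]])
    qed
    then have "AE y in lebesgue. \<forall>n. y \<in> U (c m) \<inter> U (c n) \<longrightarrow> V (c m) y = V (c n) y" by (simp add: AE_all_countable)
    then show ?thesis
    proof eventually_elim
      case (elim y)
      show ?case
      proof
        assume y: "y \<in> U (c m)"
        then have "y \<in> U (c (LEAST n. y \<in> U (c n)))" by (rule LeastI)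
        then show "V (c m) y = v y" using elim y by (auto simp: v_def)
      qed
    qed
  qed
  have "weak_deriv X [i] u v"
  proof (rule weak_deriv_local[OF assms(1)])
    fix x assume "x \<in> X"
    then obtain n where n: "x \<in> U (c n)" using cov by blast
    have "weak_deriv (U (c n)) [i] u v" by (rule weak_deriv_cong_AE[OF U(3)[OF c] U(1)[OF c] _ eq]) simp
    then show "\<exists>U. open U \<and> x \<in> U \<and> weak_deriv U [i] u v" using n U(1)[OF c] by blast
  qed
  then show ?thesis by (rule exI[of _ v])
qed

text \<open>Both factors are approximated by C1 functions. The bounds of the factors pass to the
  approximations, and along a common subsequence that converges almost everywhere
  \<open>L1_conv_mult\<close> applies to all three products.\<close>

lemma weak_deriv_mult:
  fixes u v :: "real^'n \<Rightarrow> real"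
  assumes "open X" "\<And>i. weak_deriv X [i] u (U i)" "\<And>i. weak_deriv X [i] v (V i)" "Linf_loc X u" "Linf_loc X v"
  shows "weak_deriv X [i] (\<lambda>x. u x * v x) (\<lambda>x. u x * V i x + v x * U i x)"
proof (rule weak_deriv_local[OF assms(1)])
  fix x assume x: "x \<in> X"
  obtain r1 B1 where r1: "r1 > 0" "B1 \<ge> 0" "\<And>s. s \<le> r1 \<Longrightarrow> AE y in lebesgue. y \<in> ball x s \<longrightarrow> \<bar>u y\<bar> \<le> B1"
    using Linf_loc_obtain[OF assms(4) x] by blast
  obtain r2 B2 where r2: "r2 > 0" "B2 \<ge> 0" "\<And>s. s \<le> r2 \<Longrightarrow> AE y in lebesgue. y \<in> ball x s \<longrightarrow> \<bar>v y\<bar> \<le> B2"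
    using Linf_loc_obtain[OF assms(5) x] by blast
  obtain r3 where r3: "r3 > 0" "cball x r3 \<subseteq> X" using x assms(1) open_contains_cball by blast
  \<comment> \<open>Halved so that the doubled ball of \<open>weak_approx\<close> stays within all
    three radii.\<close>
  define r where "r = min r1 (min r2 r3) / 2"
  have "cball x (2 * r) \<subseteq> cball x r3" by (rule subset_cball) (auto simp: r_def)
  then have r: "r > 0" "cball x (2 * r) \<subseteq> X" "2 * r \<le> r1" "2 * r \<le> r2" using r1(1) r2(1) r3 by (auto simp: r_def)
  let ?M = "lebesgue_on (ball x r)"
  show "\<exists>W. open W \<and> x \<in> W \<and> weak_deriv W [i] (\<lambda>y. u y * v y) (\<lambda>y. u y * V i y + v y * U i y)"
  proof (rule weak_approx[OF assms(1,2) r(1,2)], rule weak_approx[OF assms(1,3) r(1,2)])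
  fix a A b B
  assume a: "\<And>k. C1 (a k) (A k)" "L1_conv ?M a u" "\<And>i. L1_conv ?M (\<lambda>k. A k i) (U i)"
    "\<And>C k y. (AE y in lebesgue. y \<in> ball x (2 * r) \<longrightarrow> \<bar>u y\<bar> \<le> C) \<Longrightarrow> y \<in> ball x r \<Longrightarrow> \<bar>a k y\<bar> \<le> C"
    and b: "\<And>k. C1 (b k) (B k)" "L1_conv ?M b v" "\<And>i. L1_conv ?M (\<lambda>k. B k i) (V i)"
    "\<And>C k y. (AE y in lebesgue. y \<in> ball x (2 * r) \<longrightarrow> \<bar>v y\<bar> \<le> C) \<Longrightarrow> y \<in> ball x r \<Longrightarrow> \<bar>b k y\<bar> \<le> C"
  obtain \<rho> where \<rho>: "strict_mono \<rho>" "AE y in ?M. (\<lambda>k. a (\<rho> k) y) \<longlonglongrightarrow> u y" by (rule L1_conv_AE_subseq[OF a(2)])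
  obtain \<sigma> where \<sigma>: "strict_mono \<sigma>" "AE y in ?M. (\<lambda>k. b (\<rho> (\<sigma> k)) y) \<longlonglongrightarrow> v y"
    by (rule L1_conv_AE_subseq[OF L1_conv_subseq[OF b(2) \<rho>(1)]])
  define \<tau> where "\<tau> k = \<rho> (\<sigma> k)" for k
  have \<tau>: "strict_mono \<tau>" unfolding \<tau>_def using \<rho>(1) \<sigma>(1) by (simp add: strict_mono_def)
  have aAE: "AE y in ?M. (\<lambda>k. a (\<tau> k) y) \<longlonglongrightarrow> u y"
    unfolding \<tau>_def by (rule AE_subseq_tendsto[OF \<rho>(2) \<sigma>(1)])
  have bAE: "AE y in ?M. (\<lambda>k. b (\<tau> k) y) \<longlonglongrightarrow> v y" using \<sigma>(2) by (simp add: \<tau>_def)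
  have aB: "AE y in ?M. \<bar>a (\<tau> k) y\<bar> \<le> B1" for k by (rule AE_I2) (use a(4)[OF r1(3)[OF r(3)]] in simp)
  have bB: "AE y in ?M. \<bar>b (\<tau> k) y\<bar> \<le> B2" for k by (rule AE_I2) (use b(4)[OF r2(3)[OF r(4)]] in simp)
  have am: "a (\<tau> k) \<in> borel_measurable ?M" "b (\<tau> k) \<in> borel_measurable ?M" for k
    using continuous_on_measurable_lebesgue[OF C1_continuous[OF a(1)] open_ball]
      continuous_on_measurable_lebesgue[OF C1_continuous[OF b(1)] open_ball] by blast+
  have um: "u \<in> borel_measurable ?M" "v \<in> borel_measurable ?M"
    using borel_measurable_integrable[OF L1_convD(2)[OF a(2)]] borel_measurable_integrable[OF L1_convD(2)[OF b(2)]] by auto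
  have "weak_deriv (ball x r) [i] (\<lambda>y. u y * v y) (\<lambda>y. u y * V i y + v y * U i y)"
  proof (rule weak_deriv_L1_limit)
    show "weak_deriv (ball x r) [i] (\<lambda>y. a (\<tau> k) y * b (\<tau> k) y)
        (\<lambda>y. a (\<tau> k) y * B (\<tau> k) i y + b (\<tau> k) y * A (\<tau> k) i y)" for k
      using C1_weak_deriv[OF C1_mult[OF a(1)[of "\<tau> k"] b(1)[of "\<tau> k"]] open_ball, of x r i] by (simp add: mult.commute)
    show "L1_conv ?M (\<lambda>k y. a (\<tau> k) y * b (\<tau> k) y) (\<lambda>y. u y * v y)"
      by (rule L1_conv_mult[OF L1_conv_subseq[OF b(2) \<tau>] aAE am(1) um(1) aB])
    show "L1_conv ?M (\<lambda>k y. a (\<tau> k) y * B (\<tau> k) i y + b (\<tau> k) y * A (\<tau> k) i y) (\<lambda>y. u y * V i y + v y * U i y)"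
      by (rule L1_conv_add[OF L1_conv_mult[OF L1_conv_subseq[OF b(3) \<tau>] aAE am(1) um(1) aB]
            L1_conv_mult[OF L1_conv_subseq[OF a(3) \<tau>] bAE am(2) um(2) bB]])
  qed
  then show "\<exists>W. open W \<and> x \<in> W \<and> weak_deriv W [i] (\<lambda>y. u y * v y) (\<lambda>y. u y * V i y + v y * U i y)"
    using r(1) by (intro exI[of _ "ball x r"] conjI) auto
  qed
qed

lemma weak_deriv_lipschitz_ball:
  fixes u :: "real^'n \<Rightarrow> real"
  assumes "open X" "\<And>i. weak_deriv X [i] u (V i)" "x \<in> X"
    and r1: "r1 > 0" "\<forall>y\<in>ball x r1. \<forall>z\<in>ball x r1. \<bar>u y - u z\<bar> \<le> L * norm (y - z)"
  shows "\<exists>r>0. AE y in lebesgue. y \<in> ball x r \<longrightarrow> \<bar>V i y\<bar> \<le> L"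
proof -
  obtain r2 where r2: "r2 > 0" "cball x r2 \<subseteq> X" using assms(1,3) open_contains_cball by blast
  define r where "r = min r1 r2 / 2"
  have "cball x (2 * r) \<subseteq> cball x r2" "ball x (2 * r) \<subseteq> ball x r1" by (auto simp: r_def)
  then have r: "r > 0" "cball x (2 * r) \<subseteq> X" "ball x (2 * r) \<subseteq> ball x r1" using r1(1) r2 by (auto simp: r_def)
  show ?thesis
  proof (rule weak_approx[OF assms(1,2) r(1,2)])
    fix v g
    assume c: "\<And>i. L1_conv (lebesgue_on (ball x r)) (\<lambda>k. g k i) (V i)"
      and b: "\<And>L i k y. (\<And>y z. y \<in> ball x (2 * r) \<Longrightarrow> z \<in> ball x (2 * r) \<Longrightarrow> \<bar>u y - u z\<bar> \<le> L * norm (y - z))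
      \<Longrightarrow> y \<in> ball x r \<Longrightarrow> \<bar>g k i y\<bar> \<le> L"
    have gL: "\<bar>g k i y\<bar> \<le> L" if "y \<in> ball x r" for k y by (rule b[OF _ that]) (use r1(2) r(3) in blast)
    obtain \<rho> where \<rho>: "strict_mono \<rho>" "AE y in lebesgue_on (ball x r). (\<lambda>k. g (\<rho> k) i y) \<longlonglongrightarrow> V i y"
      by (rule L1_conv_AE_subseq[OF c])
    have "AE y in lebesgue_on (ball x r). y \<in> ball x r \<longrightarrow> \<bar>V i y\<bar> \<le> L" using \<rho>(2)
    proof eventually_elim
      case (elim y)
      show ?case
      proof
        assume "y \<in> ball x r"
        then show "\<bar>V i y\<bar> \<le> L" using gL by (intro LIMSEQ_le_const2[OF tendsto_rabs[OF elim]]) auto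
      qed
    qed
    then have "AE y in lebesgue. y \<in> ball x r \<longrightarrow> \<bar>V i y\<bar> \<le> L"
      by (auto simp: AE_restrict_space_iff elim: eventually_mono)
    then show ?thesis using r(1) by blast
  qed
qed

text \<open>The constant does not depend on the point, while the radius may. This yields one bound
  for the gradient on a punctured ball, up to the puncture.\<close>

lemma weak_deriv_lipschitz_AE:
  fixes u :: "real^'n \<Rightarrow> real"
  assumes "open X" "\<And>i. weak_deriv X [i] u (V i)"
    and "\<And>x. x \<in> X \<Longrightarrow> \<exists>r>0. \<forall>y\<in>ball x r. \<forall>z\<in>ball x r. \<bar>u y - u z\<bar> \<le> L * norm (y - z)"
  shows "AE y in lebesgue. y \<in> X \<longrightarrow> \<bar>V i y\<bar> \<le> L"
proof (rule AE_lebesgue_cover)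
  fix x assume x: "x \<in> X"
  from assms(3)[OF x] obtain r1 where r1: "r1 > 0" "\<forall>y\<in>ball x r1. \<forall>z\<in>ball x r1. \<bar>u y - u z\<bar> \<le> L * norm (y - z)" by blast
  from weak_deriv_lipschitz_ball[OF assms(1,2) x r1, of i] obtain r
    where r: "r > 0" "AE y in lebesgue. y \<in> ball x r \<longrightarrow> \<bar>V i y\<bar> \<le> L" by blast
  show "\<exists>U. open U \<and> x \<in> U \<and> (AE y in lebesgue. y \<in> U \<longrightarrow> \<bar>V i y\<bar> \<le> L)" by (rule exI[of _ "ball x r"]) (use r in auto)
qed

lemma weak_deriv_lipschitz_bound:
  fixes u :: "real^'n \<Rightarrow> real"
  assumes "open X" "\<And>i. weak_deriv X [i] u (V i)"
    and "\<And>x. x \<in> X \<Longrightarrow> \<exists>r>0. \<exists>L. \<forall>y\<in>ball x r. \<forall>z\<in>ball x r. \<bar>u y - u z\<bar> \<le> L * norm (y - z)"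
  shows "Linf_loc X (V i)" unfolding Linf_loc_def
proof (intro conjI ballI)
  show "V i \<in> borel_measurable (lebesgue_on X)" by (rule Lp_loc_measurable[OF weak_derivD(2)[OF assms(2,1)]])
  fix x assume x: "x \<in> X"
  obtain r1 L where r1: "r1 > 0" "\<forall>y\<in>ball x r1. \<forall>z\<in>ball x r1. \<bar>u y - u z\<bar> \<le> L * norm (y - z)"
    using assms(3)[OF x] by blast
  show "\<exists>r>0. \<exists>B. AE y in lebesgue. y \<in> ball x r \<longrightarrow> \<bar>V i y\<bar> \<le> B"
    using weak_deriv_lipschitz_ball[OF assms(1,2) x r1] by blast
qed

lemma weak_approx_ex:
  fixes u :: "real^'n \<Rightarrow> real"
  assumes "open X" "\<And>i. weak_deriv X [i] u (V i)" "r > 0" "cball a (2 * r) \<subseteq> X"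
    and "\<And>y. y \<in> ball a (2 * r) \<Longrightarrow> \<bar>u y\<bar> \<le> B"
  shows "\<exists>p. (\<forall>k. C1 (fst p k) (snd p k)) \<and> L1_conv (lebesgue_on (ball a r)) (fst p) u \<and>
    (\<forall>i. L1_conv (lebesgue_on (ball a r)) (\<lambda>k. snd p k i) (V i)) \<and> (\<forall>k. \<forall>x\<in>ball a r. \<bar>fst p k x\<bar> \<le> B)"
proof (rule weak_approx[OF assms(1-4)])
  fix v g
  assume a: "\<And>k. C1 (v k) (g k)" "L1_conv (lebesgue_on (ball a r)) v u" "\<And>i. L1_conv (lebesgue_on (ball a r)) (\<lambda>k. g k i) (V i)"
    and b: "\<And>B k x. (AE y in lebesgue. y \<in> ball a (2 * r) \<longrightarrow> \<bar>u y\<bar> \<le> B) \<Longrightarrow> x \<in> ball a r \<Longrightarrow> \<bar>v k x\<bar> \<le> B"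
  have "\<bar>v k x\<bar> \<le> B" if "x \<in> ball a r" for k x by (rule b[OF _ that]) (intro AE_I2 impI assms(5))
  then show ?thesis using a by (intro exI[of _ "(v, g)"]) auto
qed

section \<open>Composition with expanding maps\<close>

text \<open>Two points of a cube of side \<open>s\<close> are at distance at most n s in dimension
  n, so points of \<open>b\<close> that go there are at distance at most L n s from each other: the
  preimage lies in a cube with that half side. The open box on the right has the same measure as the
  closed one and can be summed over non-overlapping cubes.\<close>

lemma cube_preimage_measure:
  fixes F :: "'a::euclidean_space \<Rightarrow> 'a"
  assumes "L > 0" "\<And>y z. y \<in> b \<Longrightarrow> z \<in> b \<Longrightarrow> norm (y - z) \<le> L * norm (F y - F z)"
    and "\<And>i. i \<in> Basis \<Longrightarrow> (v - u) \<bullet> i = s" "s \<ge> 0"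
  shows "emeasure lborel (b \<inter> F -` cbox u v) \<le> ennreal ((2 * L * DIM('a)) ^ DIM('a)) * emeasure lborel (box u v)"
proof (cases "b \<inter> F -` cbox u v = {}")
  case False
  then obtain y0 where y0: "y0 \<in> b" "F y0 \<in> cbox u v" by auto
  define t where "t = L * (real DIM('a) * s)"
  have t: "t \<ge> 0" using assms(1,4) by (simp add: t_def)
  define e :: 'a where "e = (\<Sum>i\<in>Basis. t *\<^sub>R i)"
  have e: "e \<bullet> i = t" if "i \<in> Basis" for i using that by (simp add: e_def)
  have sub: "b \<inter> F -` cbox u v \<subseteq> cbox (y0 - e) (y0 + e)"
  proof
    fix y assume "y \<in> b \<inter> F -` cbox u v"
    then have y: "y \<in> b" "F y \<in> cbox u v" by auto
    have "\<bar>(F y - F y0) \<bullet> i\<bar> \<le> s" if "i \<in> Basis" for i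
      using y(2) y0(2) assms(3)[OF that] that by (auto simp: mem_box inner_diff_left abs_le_iff dest!: bspec[OF _ that])
    then have "norm (F y - F y0) \<le> (\<Sum>i\<in>(Basis::'a set). s)" by (intro order_trans[OF norm_le_l1] sum_mono)
    then have "L * norm (F y - F y0) \<le> t" using assms(1) by (simp add: t_def)
    then have n: "norm (y - y0) \<le> t" using assms(2)[OF y(1) y0(1)] by linarith
    have yb: "\<bar>y \<bullet> i - y0 \<bullet> i\<bar> \<le> t" if "i \<in> Basis" for i
      using Basis_le_norm[OF that, of "y - y0"] n by (simp add: inner_diff_left)
    show "y \<in> cbox (y0 - e) (y0 + e)" unfolding mem_box
    proof
      fix i :: 'a assume i: "i \<in> Basis"
      show "(y0 - e) \<bullet> i \<le> y \<bullet> i \<and> y \<bullet> i \<le> (y0 + e) \<bullet> i"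
        using yb[OF i] e[OF i] unfolding inner_diff_left inner_add_left abs_le_iff by linarith
    qed
  qed
  have "emeasure lborel (b \<inter> F -` cbox u v) \<le> emeasure lborel (cbox (y0 - e) (y0 + e))"
    by (rule emeasure_mono[OF sub]) simp
  also have "\<dots> = ennreal ((2 * t) ^ DIM('a))"
    using t by (simp add: emeasure_lborel_cbox_eq inner_diff_left inner_add_left e algebra_simps)
  also have "\<dots> = ennreal ((2 * L * DIM('a)) ^ DIM('a)) * ennreal (s ^ DIM('a))"
    using assms(1,4) by (subst ennreal_mult[symmetric]) (auto simp: t_def power_mult_distrib algebra_simps)
  also have "ennreal (s ^ DIM('a)) = emeasure lborel (box u v)"
  proof -
    have "u \<bullet> i \<le> v \<bullet> i" if "i \<in> Basis" for i using assms(3)[OF that] assms(4) by (simp add: inner_diff_left)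
    then show ?thesis using assms(3) by (subst emeasure_lborel_box) (auto simp: inner_diff_left)
  qed
  finally show ?thesis .
qed simp

lemma preimage_borel:
  assumes "open b" "continuous_on b F" "A \<in> sets borel" shows "b \<inter> F -` A \<in> sets borel"
proof -
  have "F -` A \<inter> space (restrict_space borel b) \<in> sets (restrict_space borel b)"
    by (rule measurable_sets[OF borel_measurable_continuous_on_restrict[OF assms(2)] assms(3)])
  then show ?thesis using assms(1) by (simp add: sets_restrict_space_iff space_restrict_space Int_commute)
qed

text \<open>The set is covered by non-overlapping dyadic cubes of almost the same total measure, and
  each of them obeys \<open>cube_preimage_measure\<close>.\<close>

lemma preimage_measure_le:
  fixes F :: "'a::euclidean_space \<Rightarrow> 'a"
  assumes "open b" "continuous_on b F" "L > 0"
    and exp: "\<And>y z. y \<in> b \<Longrightarrow> z \<in> b \<Longrightarrow> norm (y - z) \<le> L * norm (F y - F z)" and "bounded (F ` b)" "A \<in> sets borel"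
  shows "emeasure lborel (b \<inter> F -` A) \<le> ennreal ((2 * L * DIM('a)) ^ DIM('a)) * emeasure lborel A"
proof -
  let ?C = "(2 * L * DIM('a)) ^ DIM('a)"
  have C: "?C > 0" using assms(3) by simp
  obtain c where c: "c > 0" "\<And>y. y \<in> b \<Longrightarrow> norm (F y) \<le> c" using assms(5) by (auto simp: bounded_pos)
  define lo hi :: 'a where "lo = - (\<Sum>i\<in>Basis. c *\<^sub>R i)" and "hi = (\<Sum>i\<in>Basis. c *\<^sub>R i)"
  have lohi: "lo \<bullet> i = - c" "hi \<bullet> i = c" if "i \<in> Basis" for i using that by (simp_all add: lo_def hi_def)
  have Fb: "F y \<in> cbox lo hi" if "y \<in> b" for y unfolding mem_box
  proof
    fix i :: 'a assume i: "i \<in> Basis"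
    show "lo \<bullet> i \<le> F y \<bullet> i \<and> F y \<bullet> i \<le> hi \<bullet> i"
      using Basis_le_norm[OF i, of "F y"] c(2)[OF that] lohi[OF i] by linarith
  qed
  \<comment> \<open>Only the part of \<open>A\<close> in a cube around the bounded image of
    \<open>b\<close> matters. It has finite measure, and the dyadic subdivision starts from that
    cube, so that all its pieces are cubes as well.\<close>
  define A' where "A' = A \<inter> cbox lo hi"
  have A': "A' \<in> sets borel" "A' \<subseteq> cbox lo hi" using assms(6) by (auto simp: A'_def)
  have lm: "A' \<in> lmeasurable"
    using A' bounded_set_imp_lmeasurable[of A'] bounded_subset[OF bounded_cbox A'(2)] by auto
  have P: "b \<inter> F -` A = b \<inter> F -` A'" using Fb by (auto simp: A'_def)
  define m where "m = measure lebesgue A'"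
  have "emeasure lborel (b \<inter> F -` A) \<le> ennreal (?C * m)"
  proof (rule ennreal_le_epsilon)
    fix d :: real assume d: "0 < d"
    have dC: "d / ?C > 0" using d C by simp
    show "emeasure lborel (b \<inter> F -` A) \<le> ennreal (?C * m) + ennreal d"
    proof (rule measurable_outer_intervals_bounded[OF lm A'(2) dC])
    fix D
    assume D: "countable D" "\<And>K. K \<in> D \<Longrightarrow> K \<subseteq> cbox lo hi \<and> K \<noteq> {} \<and> (\<exists>c d. K = cbox c d)"
      "pairwise (\<lambda>A B. interior A \<inter> interior B = {}) D"
      "\<And>u v. cbox u v \<in> D \<Longrightarrow> \<exists>n. \<forall>i \<in> Basis. v \<bullet> i - u \<bullet> i = (hi \<bullet> i - lo \<bullet> i)/2^n"
      "A' \<subseteq> \<Union>D" "\<Union>D \<in> lmeasurable" and D7': "measure lebesgue (\<Union>D) \<le> measure lebesgue A' + d / ?C"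
    have D7: "measure lebesgue (\<Union>D) \<le> m + d / ?C" using D7' by (simp add: m_def)
    define f where "f n = (if n \<in> to_nat_on D ` D then from_nat_into D n else {})" for n
    have fD: "f n \<in> D" if "n \<in> to_nat_on D ` D" for n using that D(1) by (auto simp: f_def)
    have fsurj: "\<exists>n. f n = K" if "K \<in> D" for K using that D(1) by (intro exI[of _ "to_nat_on D K"]) (auto simp: f_def)
    have finj: "f m \<noteq> f n" if "m \<in> to_nat_on D ` D" "n \<in> to_nat_on D ` D" "m \<noteq> n" for m n
      using that D(1) by (auto simp: f_def)
    have disj: "disjoint_family (\<lambda>n. interior (f n))" unfolding disjoint_family_on_def
    proof (intro ballI impI)
      fix m n :: nat assume mn: "m \<noteq> n"
      show "interior (f m) \<inter> interior (f n) = {}"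
      proof (cases "m \<in> to_nat_on D ` D \<and> n \<in> to_nat_on D ` D")
        case True
        then show ?thesis using pairwiseD[OF D(3) fD fD] finj mn by blast
      qed (auto simp: f_def)
    qed
    have each: "emeasure lborel (b \<inter> F -` f n) \<le> ennreal ?C * emeasure lborel (interior (f n))" for n
    proof (cases "n \<in> to_nat_on D ` D")
      case True
      obtain u v where uv: "f n = cbox u v" using D(2)[OF fD[OF True]] by blast
      obtain k where k: "\<And>i. i \<in> Basis \<Longrightarrow> v \<bullet> i - u \<bullet> i = (hi \<bullet> i - lo \<bullet> i)/2^k"
        using D(4)[of u v] fD[OF True] uv by auto
      have "(v - u) \<bullet> i = 2 * c / 2 ^ k" if "i \<in> Basis" for i
        using k[OF that] lohi[OF that] by (simp add: inner_diff_left)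
      from cube_preimage_measure[OF assms(3) exp this] c(1) show ?thesis by (simp add: uv interior_cbox)
    qed (simp add: f_def)
    have closedf: "closed (f n)" for n
    proof (cases "n \<in> to_nat_on D ` D")
      case True
      then show ?thesis using D(2)[OF fD[OF True]] by auto
    qed (simp add: f_def)
    have meas: "b \<inter> F -` f n \<in> sets lborel" for n using preimage_borel[OF assms(1,2) borel_closed[OF closedf]] by simp
    have "emeasure lborel (b \<inter> F -` A) \<le> emeasure lborel (\<Union>n. b \<inter> F -` f n)"
    proof (rule emeasure_mono)
      show "b \<inter> F -` A \<subseteq> (\<Union>n. b \<inter> F -` f n)"
      proof
        fix z assume "z \<in> b \<inter> F -` A"
        then have z: "z \<in> b" "F z \<in> A'" using P by auto
        then have "F z \<in> \<Union>D" using D(5) by blast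
        then obtain K where K: "K \<in> D" "F z \<in> K" by (rule UnionE)
        from fsurj[OF K(1)] obtain n where "f n = K" ..
        then show "z \<in> (\<Union>n. b \<inter> F -` f n)" using z(1) K(2) by blast
      qed
      show "(\<Union>n. b \<inter> F -` f n) \<in> sets lborel" by (rule sets.countable_UN) (use meas in blast)
    qed
    also have "\<dots> \<le> (\<Sum>n. emeasure lborel (b \<inter> F -` f n))" using meas by (intro emeasure_subadditive_countably) auto
    also have "\<dots> \<le> (\<Sum>n. ennreal ?C * emeasure lborel (interior (f n)))" by (intro suminf_le each) auto
    also have "\<dots> = ennreal ?C * (\<Sum>n. emeasure lborel (interior (f n)))" by (rule ennreal_suminf_cmult)
    also have "(\<Sum>n. emeasure lborel (interior (f n))) = emeasure lborel (\<Union>n. interior (f n))"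
      using disj by (intro suminf_emeasure) auto
    also have "\<dots> \<le> emeasure lebesgue (\<Union>D)"
    proof -
      have "(\<Union>n. interior (f n)) \<subseteq> \<Union>D"
      proof
        fix x assume "x \<in> (\<Union>n. interior (f n))"
        then obtain n where n: "x \<in> interior (f n)" by blast
        then have "n \<in> to_nat_on D ` D" by (auto simp: f_def split: if_splits)
        from fD[OF this] show "x \<in> \<Union>D" using n interior_subset[of "f n"] by blast
      qed
      then have "emeasure lebesgue (\<Union>n. interior (f n)) \<le> emeasure lebesgue (\<Union>D)"
        using D(6) by (intro emeasure_mono) auto
      moreover have "(\<Union>n. interior (f n)) \<in> sets borel" by auto
      ultimately show ?thesis by simp
    qed
    also have "\<dots> \<le> ennreal (m + d / ?C)" using D(6) D7 by (simp add: emeasure_eq_measure2 ennreal_leI)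
    finally have "emeasure lborel (b \<inter> F -` A) \<le> ennreal ?C * ennreal (m + d / ?C)" by (simp add: mult_left_mono)
    also have "\<dots> = ennreal (?C * (m + d / ?C))" using C d by (subst ennreal_mult) (auto simp: m_def)
    also have "?C * (m + d / ?C) = ?C * m + d" using C assms(3) by (simp add: distrib_left)
    also have "ennreal (?C * m + d) = ennreal (?C * m) + ennreal d"
      using C d by (intro ennreal_plus) (auto simp: m_def)
    finally show "emeasure lborel (b \<inter> F -` A) \<le> ennreal (?C * m) + ennreal d" .
    qed
  qed
  also have "ennreal (?C * m) = ennreal ?C * emeasure lborel A'"
  proof -
    have "emeasure lebesgue A' = ennreal m" using lm by (simp add: m_def emeasure_eq_measure2)
    then have "emeasure lborel A' = ennreal m" using A'(1) by simp
    then show ?thesis using C by (simp add: ennreal_mult m_def)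
  qed
  also have "\<dots> \<le> ennreal ?C * emeasure lborel A"
    using assms(6) by (intro mult_left_mono emeasure_mono) (auto simp: A'_def)
  finally show ?thesis .
qed

text \<open>In place of a change of variables an inequality suffices: the image measure under
  \<open>F\<close> is at most \<open>C\<close> times Lebesgue measure. It follows from continuity
  and the lower Lipschitz bound, without differentiating \<open>F\<close>.\<close>

locale expanding_ball =
  fixes F :: "real^'n \<Rightarrow> real^'n" and x :: "real^'n" and r :: real and y :: "real^'n" and s L :: real
  assumes cont: "continuous_on (ball x r) F" and L: "L > 0"
    and exp: "\<And>a b. a \<in> ball x r \<Longrightarrow> b \<in> ball x r \<Longrightarrow> norm (a - b) \<le> L * norm (F a - F b)"
    and into: "F ` ball x r \<subseteq> ball y s"
begin

definition C :: real where "C = (2 * L * DIM(real^'n)) ^ DIM(real^'n)"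

lemma C_nonneg: "C \<ge> 0" using L by (simp add: C_def)

lemma measure_le: "A \<in> sets borel \<Longrightarrow> emeasure lborel (ball x r \<inter> F -` A) \<le> ennreal C * emeasure lborel A"
  unfolding C_def by (rule preimage_measure_le[OF open_ball cont L exp bounded_subset[OF bounded_ball into]])

lemma AE_compose:
  assumes "AE z in lebesgue. z \<in> ball y s \<longrightarrow> P z"
  shows "AE z in lebesgue. z \<in> ball x r \<longrightarrow> P (F z)"
proof -
  have "AE z in lborel. z \<in> ball y s \<longrightarrow> P z" by (rule AE_lebesgue_lborel[OF assms])
  then obtain N where N: "{z \<in> space lborel. \<not> (z \<in> ball y s \<longrightarrow> P z)} \<subseteq> N" "emeasure lborel N = 0" "N \<in> sets lborel"
    by (rule AE_E)
  have "emeasure lborel (ball x r \<inter> F -` N) = 0" using measure_le[of N] N(2,3) by simp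
  moreover have "ball x r \<inter> F -` N \<in> sets borel" using preimage_borel[OF open_ball cont] N(3) by simp
  ultimately have "AE z in lborel. z \<notin> ball x r \<inter> F -` N" by (intro AE_not_in) (auto simp: null_sets_def)
  then have "AE z in lebesgue. z \<notin> ball x r \<inter> F -` N" by (rule AE_completion)
  then show ?thesis
  proof eventually_elim
    case (elim z)
    show ?case
    proof
      assume z: "z \<in> ball x r"
      have "F z \<in> ball y s" using into z by blast
      moreover have "F z \<notin> N" using z elim by blast
      ultimately show "P (F z)" using N(1) by auto
    qed
  qed
qed

lemma F_measurable: "F \<in> borel_measurable (lebesgue_on (ball x r))"
  by (rule continuous_imp_measurable_on_sets_lebesgue[OF cont]) simp

text \<open>A Lebesgue measurable function composed with a continuous one need not be measurable.
  Therefore \<open>w\<close> is first replaced by a Borel function, which is harmless since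
  \<open>F\<close> pulls null sets back to null sets.\<close>

lemma borel_rep:
  fixes w :: "real^'n \<Rightarrow> real"
  assumes "w \<in> borel_measurable (lebesgue_on (ball y s))"
  obtains w' where "w' \<in> borel_measurable borel" "AE z in lebesgue. indicator (ball y s) z * w z = w' z"
    "AE z in lebesgue. z \<in> ball x r \<longrightarrow> w' (F z) = w (F z)"
proof -
  have "(\<lambda>z. indicator (ball y s) z *\<^sub>R w z) \<in> borel_measurable lebesgue"
    using assms by (subst (asm) borel_measurable_restrict_space_iff) auto
  then have "\<exists>w'\<in>borel_measurable lborel. AE z in lborel. indicator (ball y s) z *\<^sub>R w z = w' z"
    by (rule completion_ex_borel_measurable_real)
  then obtain w' where w': "w' \<in> borel_measurable lborel" "AE z in lborel. indicator (ball y s) z *\<^sub>R w z = w' z" by blast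
  have ae: "AE z in lebesgue. indicator (ball y s) z * w z = w' z" using AE_completion[OF w'(2)] by simp
  then have "AE z in lebesgue. z \<in> ball y s \<longrightarrow> w' z = w z" by eventually_elim auto
  from AE_compose[OF this] that[of w'] w'(1) ae show ?thesis by simp
qed

lemma measurable_compose_F:
  fixes w :: "real^'n \<Rightarrow> real"
  assumes "w \<in> borel_measurable (lebesgue_on (ball y s))"
  shows "(\<lambda>z. w (F z)) \<in> borel_measurable (lebesgue_on (ball x r))"
proof (rule borel_rep[OF assms])
  fix w' assume w': "w' \<in> borel_measurable borel" "AE z in lebesgue. z \<in> ball x r \<longrightarrow> w' (F z) = w (F z)"
  show ?thesis by (rule measurable_lebesgue_on_AE[OF measurable_compose[OF F_measurable w'(1)] w'(2)]) simp
qed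

lemma integrable_compose:
  fixes w :: "real^'n \<Rightarrow> real"
  assumes "integrable (lebesgue_on (ball y s)) w"
  shows "integrable (lebesgue_on (ball x r)) (\<lambda>z. w (F z))"
    and "(LINT z|lebesgue_on (ball x r). \<bar>w (F z)\<bar>) \<le> C * (LINT z|lebesgue_on (ball y s). \<bar>w z\<bar>)"
proof -
  let ?b = "lebesgue_on (ball x r)" and ?S = "lebesgue_on (ball y s)"
  note wm = borel_measurable_integrable[OF assms]
  obtain w' where w': "w' \<in> borel_measurable borel" "AE z in lebesgue. indicator (ball y s) z * w z = w' z"
    "AE z in lebesgue. z \<in> ball x r \<longrightarrow> w' (F z) = w (F z)" by (rule borel_rep[OF wm])
  have le: "emeasure (distr ?b borel F) A \<le> ennreal C * emeasure lborel A" for A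
  proof (cases "A \<in> sets borel")
    case True
    have pb: "ball x r \<inter> F -` A \<in> sets borel" by (rule preimage_borel[OF open_ball cont True])
    have "emeasure (distr ?b borel F) A = emeasure ?b (F -` A \<inter> ball x r)"
      using emeasure_distr[OF F_measurable, of A] True by simp
    also have "\<dots> = emeasure lborel (ball x r \<inter> F -` A)" using pb by (simp add: emeasure_restrict_space Int_commute)
    finally show ?thesis using measure_le[OF True] by simp
  qed (simp add: emeasure_notin_sets)
  have N: "distr ?b borel F \<le> scale_measure (ennreal C) lborel"
    using le by (simp add: le_measure_iff space_scale_measure le_fun_def)
  have "(\<integral>\<^sup>+z. ennreal \<bar>w (F z)\<bar> \<partial>?b) = (\<integral>\<^sup>+z. ennreal \<bar>w' (F z)\<bar> \<partial>?b)"
    using w'(3) by (intro nn_integral_cong_AE) (simp add: AE_restrict_space_iff, auto elim: eventually_mono)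
  also have "\<dots> = (\<integral>\<^sup>+z. ennreal \<bar>w' z\<bar> \<partial>distr ?b borel F)"
    using w'(1) by (intro nn_integral_distr[symmetric] F_measurable) simp
  also have "\<dots> \<le> (\<integral>\<^sup>+z. ennreal \<bar>w' z\<bar> \<partial>scale_measure (ennreal C) lborel)"
    by (rule nn_integral_mono_measure[OF _ N]) simp
  also have "\<dots> = ennreal C * (\<integral>\<^sup>+z. ennreal \<bar>w' z\<bar> \<partial>lborel)" using w'(1) by (intro nn_integral_scale_measure) simp
  also have "(\<integral>\<^sup>+z. ennreal \<bar>w' z\<bar> \<partial>lborel) = (\<integral>\<^sup>+z. ennreal \<bar>w' z\<bar> \<partial>lebesgue)"
    by (rule nn_integral_completion[symmetric])
  also have "\<dots> = (\<integral>\<^sup>+z. ennreal \<bar>w z\<bar> * indicator (ball y s) z \<partial>lebesgue)"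
  proof (rule nn_integral_cong_AE)
    show "AE z in lebesgue. ennreal \<bar>w' z\<bar> = ennreal \<bar>w z\<bar> * indicator (ball y s) z" using w'(2)
    proof eventually_elim
      case (elim z)
      then show ?case by (cases "z \<in> ball y s") (auto simp flip: elim)
    qed
  qed
  also have "\<dots> = (\<integral>\<^sup>+z. ennreal \<bar>w z\<bar> \<partial>?S)" by (rule nn_integral_restrict_space[symmetric]) simp
  also have "\<dots> = ennreal (LINT z|?S. \<bar>w z\<bar>)" using assms by (intro nn_integral_eq_integral) auto
  also have "ennreal C * \<dots> = ennreal (C * (LINT z|?S. \<bar>w z\<bar>))" using C_nonneg by (simp add: ennreal_mult)
  finally have le: "(\<integral>\<^sup>+z. ennreal \<bar>w (F z)\<bar> \<partial>?b) \<le> ennreal (C * (LINT z|?S. \<bar>w z\<bar>))" .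
  show i: "integrable ?b (\<lambda>z. w (F z))" unfolding integrable_iff_bounded using measurable_compose_F[OF wm] le
    by (auto intro: le_less_trans)
  have "ennreal (LINT z|?b. \<bar>w (F z)\<bar>) = (\<integral>\<^sup>+z. ennreal \<bar>w (F z)\<bar> \<partial>?b)"
    using i by (intro nn_integral_eq_integral[symmetric]) auto
  with le have "ennreal (LINT z|?b. \<bar>w (F z)\<bar>) \<le> ennreal (C * (LINT z|?S. \<bar>w z\<bar>))" by simp
  then show "(LINT z|?b. \<bar>w (F z)\<bar>) \<le> C * (LINT z|?S. \<bar>w z\<bar>)" using C_nonneg by (subst (asm) ennreal_le_iff) auto
qed

lemma L1_conv_compose:
  assumes "L1_conv (lebesgue_on (ball y s)) w f"
  shows "L1_conv (lebesgue_on (ball x r)) (\<lambda>k z. w k (F z)) (\<lambda>z. f (F z))"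
proof (rule L1_convI_bound)
  note i = L1_convD(1,2)[OF assms]
  show "integrable (lebesgue_on (ball x r)) (\<lambda>z. w k (F z))" for k by (rule integrable_compose(1)[OF i(1)])
  show "integrable (lebesgue_on (ball x r)) (\<lambda>z. f (F z))" by (rule integrable_compose(1)[OF i(2)])
  show "(LINT z|lebesgue_on (ball x r). \<bar>w k (F z) - f (F z)\<bar>) \<le> C * (LINT z|lebesgue_on (ball y s). \<bar>w k z - f z\<bar>)" for k
    by (rule integrable_compose(2)[OF Bochner_Integration.integrable_diff[OF i]])
  show "(\<lambda>k. C * (LINT z|lebesgue_on (ball y s). \<bar>w k z - f z\<bar>)) \<longlonglongrightarrow> 0"
    using tendsto_mult_left[OF L1_convD(3)[OF assms], of C] by simp
qed

lemma Lp_ball_compose: "Lp_ball p y s w \<Longrightarrow> Lp_ball p x r (\<lambda>z. w (F z))"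
  using integrable_compose(1)[of "\<lambda>z. \<bar>w z\<bar> powr p"] measurable_compose_F[of w] by (simp add: Lp_ball_def)

end

definition expanding_loc :: "(real^'n) set \<Rightarrow> (real^'n \<Rightarrow> real^'n) \<Rightarrow> bool" where
  "expanding_loc X F \<longleftrightarrow> (\<forall>x\<in>X. \<exists>r>0. \<exists>L>0. \<forall>y\<in>ball x r. \<forall>z\<in>ball x r. norm (y - z) \<le> L * norm (F y - F z))"

lemma expanding_ball_small:
  assumes "open X" "continuous_on X F" "expanding_loc X F" "x \<in> X" "s > 0"
  obtains r L where "r > 0" "cball x r \<subseteq> X" "\<And>t. t \<le> r \<Longrightarrow> expanding_ball F x t (F x) s L"
proof -
  obtain r1 L where r1: "r1 > 0" "L > 0" "\<forall>y\<in>ball x r1. \<forall>z\<in>ball x r1. norm (y - z) \<le> L * norm (F y - F z)"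
    using assms(3,4) by (auto simp: expanding_loc_def)
  obtain r2 where r2: "r2 > 0" "cball x r2 \<subseteq> X" using assms(1,4) open_contains_cball by blast
  have "isCont F x" using assms(1,2,4) by (simp add: continuous_on_eq_continuous_at)
  then obtain r3 where r3: "r3 > 0" "\<And>y. dist y x < r3 \<Longrightarrow> dist (F y) (F x) < s"
    unfolding continuous_at_eps_delta using assms(5) by blast
  define r where "r = min r1 (min r2 r3)"
  show ?thesis
  proof (rule that[of r L])
    have "cball x r \<subseteq> cball x r2" by (rule subset_cball) (simp add: r_def)
    then show c: "cball x r \<subseteq> X" using r2(2) by blast
    show "expanding_ball F x t (F x) s L" if "t \<le> r" for t
    proof
      have sub: "ball x t \<subseteq> ball x r1" "ball x t \<subseteq> ball x r3" "ball x t \<subseteq> cball x r" using that by (auto simp: r_def)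
      show "continuous_on (ball x t) F" by (rule continuous_on_subset[OF assms(2)]) (use sub(3) c in blast)
      show "norm (a - b) \<le> L * norm (F a - F b)" if "a \<in> ball x t" "b \<in> ball x t" for a b
        using r1(3) sub(1) that by blast
      show "F ` ball x t \<subseteq> ball (F x) s"
      proof
        fix q assume "q \<in> F ` ball x t"
        then obtain p where p: "p \<in> ball x t" "q = F p" by blast
        have "p \<in> ball x r3" using sub(2) p(1) by blast
        then have "dist p x < r3" by (simp add: dist_commute)
        from r3(2)[OF this] show "q \<in> ball (F x) s" using p(2) by (simp add: dist_commute)
      qed
    qed (rule r1(2))
  qed (use r1 r2 r3 in \<open>auto simp: r_def\<close>)
qed

lemma expanding_ball_exists:
  assumes "open X" "open X'" "continuous_on X F" "F ` X \<subseteq> X'" "expanding_loc X F" "x \<in> X"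
  obtains r s L where "r > 0" "s > 0" "cball x r \<subseteq> X" "cball (F x) (2 * s) \<subseteq> X'" "\<And>t. t \<le> r \<Longrightarrow> expanding_ball F x t (F x) s L"
proof -
  have "F x \<in> X'" using assms(4,6) by blast
  then obtain s' where s': "s' > 0" "cball (F x) s' \<subseteq> X'" using assms(2) open_contains_cball by blast
  define s where "s = s' / 2"
  have s: "s > 0" "cball (F x) (2 * s) \<subseteq> X'" using s' by (auto simp: s_def)
  show ?thesis by (rule expanding_ball_small[OF assms(1,3,5,6) s(1)]) (rule that[OF _ s(1) _ s(2)])
qed

lemma Lp_loc_compose:
  assumes "open X" "open X'" "continuous_on X F" "F ` X \<subseteq> X'" "expanding_loc X F" "Lp_loc p X' w"
  shows "Lp_loc p X (\<lambda>x. w (F x))" unfolding Lp_loc_iff_ball[OF assms(1)]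
proof
  fix x assume x: "x \<in> X"
  show "\<exists>r>0. ball x r \<subseteq> X \<and> Lp_ball p x r (\<lambda>x. w (F x))"
  proof (rule expanding_ball_exists[OF assms(1-5) x])
    fix r s L assume a: "r > 0" "s > 0" "cball x r \<subseteq> X" "cball (F x) (2 * s) \<subseteq> X'"
      "\<And>t. t \<le> r \<Longrightarrow> expanding_ball F x t (F x) s L"
    interpret expanding_ball F x r "F x" s L by (rule a(5)) simp
    have "cball (F x) s \<subseteq> cball (F x) (2 * s)" using a(2) by (intro subset_cball) simp
    then have "Lp_ball p (F x) s w" using Lp_loc_imp_ball[OF assms(6) _ assms(2), of "F x" s] a(4) by blast
    from Lp_ball_compose[OF this] show ?thesis using a(1) order_trans[OF ball_subset_cball a(3)] by blast
  qed
qed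

lemma Linf_loc_compose:
  assumes "open X" "open X'" "continuous_on X F" "F ` X \<subseteq> X'" "expanding_loc X F" "Linf_loc X' w"
  shows "Linf_loc X (\<lambda>x. w (F x))" unfolding Linf_loc_def
proof (intro conjI ballI)
  show "(\<lambda>x. w (F x)) \<in> borel_measurable (lebesgue_on X)"
    by (rule Lp_loc_measurable[OF Lp_loc_compose[OF assms(1-5) Linf_loc_imp_Lp_loc[OF _ assms(2,6), of 1]]]) simp
  fix x assume x: "x \<in> X"
  have Fx: "F x \<in> X'" using assms(4) x by blast
  obtain r1 B where r1: "r1 > 0" "AE y in lebesgue. y \<in> ball (F x) r1 \<longrightarrow> \<bar>w y\<bar> \<le> B"
    using assms(6) Fx by (auto simp: Linf_loc_def)
  show "\<exists>r>0. \<exists>B. AE y in lebesgue. y \<in> ball x r \<longrightarrow> \<bar>w (F y)\<bar> \<le> B"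
  proof (rule expanding_ball_small[OF assms(1,3,5) x r1(1)])
    fix r L assume a: "r > 0" "\<And>t. t \<le> r \<Longrightarrow> expanding_ball F x t (F x) r1 L"
    interpret expanding_ball F x r "F x" r1 L by (rule a(2)) simp
    from AE_compose[OF r1(2)] show ?thesis using a(1) by blast
  qed
qed

section \<open>The chain rule\<close>

lemma C1_compose:
  fixes v :: "real^'n \<Rightarrow> real" and a :: "'n \<Rightarrow> real^'n \<Rightarrow> real"
  assumes "C1 v g" "\<And>m. C1 (a m) (G m)"
  shows "C1 (\<lambda>x. v (vec_lambda (\<lambda>m. a m x))) (\<lambda>i x. \<Sum>m\<in>UNIV. G m i x * g m (vec_lambda (\<lambda>m. a m x)))" unfolding C1_def
proof (intro conjI allI)
  let ?F = "\<lambda>x. vec_lambda (\<lambda>m. a m x)"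
  have cF: "continuous_on UNIV ?F" by (intro continuous_on_vec_lambda C1_continuous[OF assms(2)])
  {
    fix x
    let ?D = "\<lambda>h. vec_lambda (\<lambda>m. \<Sum>i\<in>UNIV. h $ i * G m i x)"
    have dF: "(?F has_derivative ?D) (at x)" unfolding has_derivative_componentwise_within[of ?F]
      using C1_has_derivative[OF assms(2), of _ x] by (auto simp: Basis_vec_def inner_axis)
    have "((\<lambda>x. v (?F x)) has_derivative (\<lambda>h. \<Sum>m\<in>UNIV. ?D h $ m * g m (?F x))) (at x)"
      by (rule has_derivative_compose[OF dF C1_has_derivative[OF assms(1)]])
    moreover have "(\<Sum>m\<in>UNIV. ?D h $ m * g m (?F x)) = (\<Sum>i\<in>UNIV. h $ i * (\<Sum>m\<in>UNIV. G m i x * g m (?F x)))" for h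
      by (simp add: sum_distrib_left sum_distrib_right mult.assoc) (rule sum.swap)
    ultimately show "((\<lambda>x. v (?F x)) has_derivative (\<lambda>h. \<Sum>i\<in>UNIV. h $ i * (\<Sum>m\<in>UNIV. G m i x * g m (?F x)))) (at x)"
      by simp
  }
  show "continuous_on UNIV (\<lambda>x. \<Sum>m\<in>UNIV. G m i x * g m (?F x))" for i
    by (intro continuous_on_sum continuous_on_mult C1_grad_continuous[OF assms(2)]
        continuous_on_compose2[OF C1_grad_continuous[OF assms(1)] cF]) auto
qed

lemma L1_conv_abs_diff: "L1_conv M s f \<Longrightarrow> L1_conv M (\<lambda>k x. \<bar>s k x - f x\<bar>) (\<lambda>x. 0)" by (auto simp: L1_conv_def)

lemma L1_conv_of_AE:
  assumes "finite_measure M" "AE x in M. (\<lambda>k. b k x) \<longlonglongrightarrow> c x" "\<And>k. b k \<in> borel_measurable M" "c \<in> borel_measurable M"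
    and "\<And>k. AE x in M. \<bar>b k x\<bar> \<le> B"
  shows "L1_conv M b c"
proof -
  interpret finite_measure M by fact
  have "L1_conv M (\<lambda>k x. 1) (\<lambda>x. 1)" by (simp add: L1_conv_def)
  from L1_conv_mult[OF this assms(2-5)] show ?thesis by simp
qed

text \<open>Here the inner map is approximated and the outer function stays fixed. The
  approximations have values in a fixed compact ball, on which \<open>v\<close> and its gradient are
  bounded, so convergence of \<open>Fk\<close> almost everywhere is enough.\<close>

lemma weak_deriv_chain_C1:
  fixes F :: "real^'n \<Rightarrow> real^'n"
  assumes "open X" "continuous_on X F" "\<And>m i. weak_deriv X [i] (\<lambda>x. F x $ m) (A m i)" "C1 v g"
  shows "weak_deriv X [i] (\<lambda>x. v (F x)) (\<lambda>x. \<Sum>m\<in>UNIV. g m (F x) * A m i x)"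
proof (rule weak_deriv_local[OF assms(1)])
  fix x assume x: "x \<in> X"
  obtain r1 where r1: "r1 > 0" "cball x r1 \<subseteq> X" using x assms(1) open_contains_cball by blast
  have "isCont F x" using assms(1,2) x by (simp add: continuous_on_eq_continuous_at)
  then obtain r2 where r2: "r2 > 0" "\<And>y. dist y x < r2 \<Longrightarrow> dist (F y) (F x) < 1"
    unfolding continuous_at_eps_delta by (metis zero_less_one)
  define r where "r = min r1 r2 / 2"
  have "cball x (2 * r) \<subseteq> cball x r1" by (rule subset_cball) (simp add: r_def)
  then have r: "r > 0" "cball x (2 * r) \<subseteq> X" "2 * r \<le> r2" using r1 r2(1) by (auto simp: r_def)
  define B where "B = norm (F x) + 1"
  have FB: "\<bar>F y $ m\<bar> \<le> B" if "y \<in> ball x (2 * r)" for y m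
  proof -
    have "dist y x < r2" using that r(3) by (simp add: dist_commute)
    from r2(2)[OF this] have "norm (F y) \<le> B"
      using norm_triangle_ineq[of "F x" "F y - F x"] by (simp add: B_def dist_norm)
    then show ?thesis using component_le_norm_cart[of "F y" m] by linarith
  qed
  let ?M = "lebesgue_on (ball x r)"
  interpret finite_measure ?M by (rule finite_measure_lebesgue_on_ball)
  have "\<forall>m. \<exists>p. (\<forall>k. C1 (fst p k) (snd p k)) \<and> L1_conv ?M (fst p) (\<lambda>x. F x $ m) \<and>
    (\<forall>i. L1_conv ?M (\<lambda>k. snd p k i) (A m i)) \<and> (\<forall>k. \<forall>x\<in>ball x r. \<bar>fst p k x\<bar> \<le> B)"
    by (intro allI weak_approx_ex[OF assms(1,3) r(1,2)] FB)
  from choice[OF this] obtain p where p: "\<forall>m. (\<forall>k. C1 (fst (p m) k) (snd (p m) k)) \<and> L1_conv ?M (fst (p m)) (\<lambda>x. F x $ m) \<and>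
    (\<forall>i. L1_conv ?M (\<lambda>k. snd (p m) k i) (A m i)) \<and> (\<forall>k. \<forall>x\<in>ball x r. \<bar>fst (p m) k x\<bar> \<le> B)" ..
  define a where "a m = fst (p m)" for m
  define G where "G m = snd (p m)" for m
  have a: "C1 (a m k) (G m k)" "L1_conv ?M (a m) (\<lambda>x. F x $ m)" "L1_conv ?M (\<lambda>k. G m k i) (A m i)"
    "y \<in> ball x r \<Longrightarrow> \<bar>a m k y\<bar> \<le> B" for m k i y using p[THEN spec, of m] by (auto simp: a_def G_def)
  \<comment> \<open>Summing the errors of all components yields a single subsequence along which
    every component converges almost everywhere.\<close>
  have "L1_conv ?M (\<lambda>k y. \<Sum>m\<in>UNIV. \<bar>a m k y - F y $ m\<bar>) (\<lambda>y. \<Sum>m\<in>(UNIV::'n set). 0)"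
    by (intro L1_conv_sum L1_conv_abs_diff a(2)) simp
  then obtain \<rho> where \<rho>: "strict_mono \<rho>" "AE y in ?M. (\<lambda>k. \<Sum>m\<in>UNIV. \<bar>a m (\<rho> k) y - F y $ m\<bar>) \<longlonglongrightarrow> (\<Sum>m\<in>(UNIV::'n set). 0)"
    by (rule L1_conv_AE_subseq)
  define Fk where "Fk k y = vec_lambda (\<lambda>m. a m (\<rho> k) y)" for k y
  have FkAE: "AE y in ?M. (\<lambda>k. Fk k y) \<longlonglongrightarrow> F y" using \<rho>(2)
  proof eventually_elim
    case (elim y)
    show ?case
    proof (rule vec_tendstoI)
      fix m
      have "(\<lambda>k. a m (\<rho> k) y - F y $ m) \<longlonglongrightarrow> 0"
      proof (rule Lim_null_comparison[OF always_eventually])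
        show "\<forall>k. norm (a m (\<rho> k) y - F y $ m) \<le> (\<Sum>m\<in>UNIV. \<bar>a m (\<rho> k) y - F y $ m\<bar>)"
          by (intro allI) (simp add: member_le_sum[of m UNIV "\<lambda>m. \<bar>a m (\<rho> _) y - F y $ m\<bar>"])
        show "(\<lambda>k. \<Sum>m\<in>UNIV. \<bar>a m (\<rho> k) y - F y $ m\<bar>) \<longlonglongrightarrow> 0" using elim by simp
      qed
      then show "(\<lambda>k. Fk k y $ m) \<longlonglongrightarrow> F y $ m" by (simp add: Fk_def LIM_zero_iff)
    qed
  qed
  define R where "R = real CARD('n) * B"
  have FkR: "norm (Fk k y) \<le> R" if "y \<in> ball x r" for k y
  proof -
    have "norm (Fk k y) \<le> (\<Sum>m\<in>UNIV. \<bar>Fk k y $ m\<bar>)" by (rule norm_le_l1_cart)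
    also have "\<dots> \<le> (\<Sum>m\<in>(UNIV::'n set). B)" by (intro sum_mono) (simp add: Fk_def a(4)[OF that])
    finally show ?thesis by (simp add: R_def)
  qed
  have bdd: "\<exists>K. \<forall>k y. y \<in> ball x r \<longrightarrow> \<bar>h (Fk k y)\<bar> \<le> K" if "continuous_on UNIV h" for h :: "real^'n \<Rightarrow> real"
  proof -
    have "compact (h ` cball 0 R)" by (rule compact_continuous_image[OF continuous_on_subset[OF that]]) auto
    then obtain K where K: "\<forall>z\<in>h ` cball 0 R. norm z \<le> K" using compact_imp_bounded bounded_iff by blast
    have "\<bar>h (Fk k y)\<bar> \<le> K" if "y \<in> ball x r" for k y using K FkR[OF that, of k] by simp
    then show ?thesis by blast
  qed
  have Fkc: "continuous_on UNIV (Fk k)" for k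
    unfolding Fk_def by (intro continuous_on_vec_lambda C1_continuous[OF a(1)])
  have hm: "(\<lambda>y. h (Fk k y)) \<in> borel_measurable ?M" "(\<lambda>y. h (F y)) \<in> borel_measurable ?M"
    if h: "continuous_on UNIV h" for h :: "real^'n \<Rightarrow> real" and k
  proof -
    show "(\<lambda>y. h (Fk k y)) \<in> borel_measurable ?M"
      by (rule continuous_on_measurable_lebesgue[OF continuous_on_compose2[OF h continuous_on_subset[OF Fkc]] open_ball]) auto
    have "ball x r \<subseteq> X" using r(1,2) by (auto simp: subset_eq)
    then show "(\<lambda>y. h (F y)) \<in> borel_measurable ?M"
      by (intro continuous_on_measurable_lebesgue[OF continuous_on_compose2[OF h continuous_on_subset[OF assms(2)]] open_ball]) auto
  qed
  have hAE: "AE y in ?M. (\<lambda>k. h (Fk k y)) \<longlonglongrightarrow> h (F y)" if h: "continuous_on UNIV h" for h :: "real^'n \<Rightarrow> real" using FkAE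
  proof eventually_elim
    case (elim y)
    have "isCont h (F y)" using h by (simp add: continuous_on_eq_continuous_at)
    then show ?case by (rule isCont_tendsto_compose[OF _ elim])
  qed
  have "weak_deriv (ball x r) [i] (\<lambda>x. v (F x)) (\<lambda>x. \<Sum>m\<in>UNIV. g m (F x) * A m i x)"
  proof (rule weak_deriv_L1_limit)
    show "weak_deriv (ball x r) [i] (\<lambda>y. v (Fk k y)) (\<lambda>y. \<Sum>m\<in>UNIV. g m (Fk k y) * G m (\<rho> k) i y)" for k
    proof -
      have "C1 (\<lambda>y. v (Fk k y)) (\<lambda>i y. \<Sum>m\<in>UNIV. G m (\<rho> k) i y * g m (Fk k y))"
        unfolding Fk_def by (rule C1_compose[OF assms(4)]) (rule a(1))
      from C1_weak_deriv[OF this open_ball, of x r i] show ?thesis by (simp add: mult.commute)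
    qed
    note vc = C1_continuous[OF assms(4), of UNIV]
    obtain K where K: "\<forall>k y. y \<in> ball x r \<longrightarrow> \<bar>v (Fk k y)\<bar> \<le> K" using bdd[OF vc] by blast
    show "L1_conv ?M (\<lambda>k y. v (Fk k y)) (\<lambda>y. v (F y))"
      using K by (intro L1_conv_of_AE[where B=K, OF finite_measure_axioms hAE[OF vc] hm(1)[OF vc] hm(2)[OF vc] AE_I2]) simp
    show "L1_conv ?M (\<lambda>k y. \<Sum>m\<in>UNIV. g m (Fk k y) * G m (\<rho> k) i y) (\<lambda>y. \<Sum>m\<in>UNIV. g m (F y) * A m i y)"
    proof (rule L1_conv_sum)
      fix m
      note gc = C1_grad_continuous[OF assms(4), of UNIV m]
      obtain K where K: "\<forall>k y. y \<in> ball x r \<longrightarrow> \<bar>g m (Fk k y)\<bar> \<le> K" using bdd[OF gc] by blast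
      show "L1_conv ?M (\<lambda>k y. g m (Fk k y) * G m (\<rho> k) i y) (\<lambda>y. g m (F y) * A m i y)"
        using K by (intro L1_conv_mult[where B=K, OF L1_conv_subseq[OF a(3) \<rho>(1)] hAE[OF gc] hm(1)[OF gc] hm(2)[OF gc] AE_I2]) simp
    qed simp
  qed
  then show "\<exists>U. open U \<and> x \<in> U \<and> weak_deriv U [i] (\<lambda>x. v (F x)) (\<lambda>x. \<Sum>m\<in>UNIV. g m (F x) * A m i x)"
    using r(1) by (intro exI[of _ "ball x r"] conjI) auto
qed

text \<open>Now the outer function is approximated, on a ball of the target. Convergence in the mean
  survives composition because \<open>F\<close> is expanding, and the factors \<open>A m i\<close>
  are essentially bounded.\<close>

lemma weak_deriv_chain:
  fixes F :: "real^'n \<Rightarrow> real^'n"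
  assumes "open X" "open X'" "continuous_on X F" "F ` X \<subseteq> X'" "expanding_loc X F"
    and A: "\<And>m i. weak_deriv X [i] (\<lambda>x. F x $ m) (A m i)" "\<And>m i. Linf_loc X (A m i)"
    and u: "\<And>i. weak_deriv X' [i] u (U i)"
  shows "weak_deriv X [i] (\<lambda>x. u (F x)) (\<lambda>x. \<Sum>m\<in>UNIV. A m i x * U m (F x))"
proof (rule weak_deriv_local[OF assms(1)])
  fix x assume x: "x \<in> X"
  obtain r1 s L where r1: "r1 > 0" "s > 0" "cball x r1 \<subseteq> X" "cball (F x) (2 * s) \<subseteq> X'"
    "\<And>t. t \<le> r1 \<Longrightarrow> expanding_ball F x t (F x) s L" using expanding_ball_exists[OF assms(1-5) x] by blast
  have "\<forall>m. \<exists>p. fst p > 0 \<and> (\<forall>q \<le> fst p. AE y in lebesgue. y \<in> ball x q \<longrightarrow> \<bar>A m i y\<bar> \<le> snd p)"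
  proof
    fix m
    show "\<exists>p. fst p > 0 \<and> (\<forall>q \<le> fst p. AE y in lebesgue. y \<in> ball x q \<longrightarrow> \<bar>A m i y\<bar> \<le> snd p)"
    proof (rule Linf_loc_obtain[OF A(2)[of m i] x])
      fix r B assume "r > 0" "\<And>s. s \<le> r \<Longrightarrow> AE y in lebesgue. y \<in> ball x s \<longrightarrow> \<bar>A m i y\<bar> \<le> B"
      then show ?thesis by (intro exI[of _ "(r, B)"]) auto
    qed
  qed
  from choice[OF this] obtain p where p: "\<forall>m. fst (p m) > 0 \<and> (\<forall>q \<le> fst (p m). AE y in lebesgue. y \<in> ball x q \<longrightarrow> \<bar>A m i y\<bar> \<le> snd (p m))" ..
  define r where "r = min r1 (Min (range (\<lambda>m. fst (p m))))"
  have r: "r > 0" "r \<le> r1" "r \<le> fst (p m)" for m using r1(1) p by (auto simp: r_def min_le_iff_disj)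
  interpret expanding_ball F x r "F x" s L by (rule r1(5)[OF r(2)])
  let ?M = "lebesgue_on (ball x r)"
  have AB: "AE y in ?M. \<bar>A m i y\<bar> \<le> snd (p m)" for m
    using p[THEN spec, of m] r(3)[of m] by (simp add: AE_restrict_space_iff)
  have bX: "ball x r \<subseteq> X" using r1(3) r(2) by (auto simp: subset_eq)
  have Am: "A m i \<in> borel_measurable ?M" for m
    by (rule measurable_lebesgue_on_mono[OF Linf_loc_measurable[OF A(2)] bX]) (use assms(1) in auto)
  show "\<exists>W. open W \<and> x \<in> W \<and> weak_deriv W [i] (\<lambda>x. u (F x)) (\<lambda>x. \<Sum>m\<in>UNIV. A m i x * U m (F x))"
  proof (rule weak_approx[OF assms(2) u r1(2,4)])
    fix v g
    assume v: "\<And>k. C1 (v k) (g k)" "L1_conv (lebesgue_on (ball (F x) s)) v u" "\<And>i. L1_conv (lebesgue_on (ball (F x) s)) (\<lambda>k. g k i) (U i)"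
    have "weak_deriv (ball x r) [i] (\<lambda>x. u (F x)) (\<lambda>x. \<Sum>m\<in>UNIV. A m i x * U m (F x))"
    proof (rule weak_deriv_L1_limit)
      show "weak_deriv (ball x r) [i] (\<lambda>x. v k (F x)) (\<lambda>x. \<Sum>m\<in>UNIV. A m i x * g k m (F x))" for k
        using weak_deriv_subset[OF weak_deriv_chain_C1[OF assms(1,3) A(1) v(1)] assms(1) open_ball bX]
        by (simp add: mult.commute)
      show "L1_conv ?M (\<lambda>k x. v k (F x)) (\<lambda>x. u (F x))" by (rule L1_conv_compose[OF v(2)])
      show "L1_conv ?M (\<lambda>k x. \<Sum>m\<in>UNIV. A m i x * g k m (F x)) (\<lambda>x. \<Sum>m\<in>UNIV. A m i x * U m (F x))"
        by (intro L1_conv_sum L1_conv_mult[OF L1_conv_compose[OF v(3)] _ Am Am AB]) auto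
    qed
    then show ?thesis using r(1) by (intro exI[of _ "ball x r"] conjI) auto
  qed
qed

section \<open>Sobolev functions of order two\<close>

lemma test_function_iter_partial: "test_function X \<phi> \<Longrightarrow> test_function X (iter_partial js \<phi>)"
  by (induction js) (auto intro: test_function_partial)

lemma test_function_zero_outside: "test_function X \<phi> \<Longrightarrow> x \<notin> X \<Longrightarrow> \<phi> x = 0"
  by (rule test_function_compact[of X \<phi>]) auto

lemma weak_deriv_iff:
  "weak_deriv X js u v \<longleftrightarrow> Lp_loc 1 X u \<and> Lp_loc 1 X v \<and> (\<forall>\<phi>. test_function X \<phi> \<longrightarrow>
      (LINT x|lebesgue. u x * iter_partial js \<phi> x) = (-1) ^ length js * (LINT x|lebesgue. v x * \<phi> x))"
proof -
  have e: "(LINT x:X|lebesgue. w x * \<psi> x) = (LINT x|lebesgue. w x * \<psi> x)" if t: "test_function X \<psi>" for \<psi> w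
  proof -
    have i: "indicator X x *\<^sub>R (w x * \<psi> x) = w x * \<psi> x" for x
      using test_function_zero_outside[OF t, of x] by (cases "x \<in> X") auto
    show ?thesis unfolding set_lebesgue_integral_def i ..
  qed
  show ?thesis unfolding weak_deriv_def using e[OF test_function_iter_partial] e by auto
qed

text \<open>Partial derivatives of test functions are test functions, so testing \<open>V i\<close>
  against the \<open>j\<close>-th derivative of \<phi> amounts to testing \<open>u\<close> against
  the second derivative. Order two is thereby reduced to two first-order statements, to which the
  rules above apply.\<close>

lemma sobolev_loc_2_iff:
  assumes "open X" "1 \<le> p"
  shows "sobolev_loc 2 p X u \<longleftrightarrow> Lp_loc p X u \<and>
    (\<exists>V H. (\<forall>i. weak_deriv X [i] u (V i) \<and> Lp_loc p X (V i)) \<and>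
      (\<forall>i j. weak_deriv X [j] (V i) (H i j) \<and> Lp_loc p X (H i j)))"
  (is "?L \<longleftrightarrow> ?R")
proof
  assume L: ?L
  have "\<forall>i. \<exists>v. weak_deriv X [i] u v \<and> Lp_loc p X v" using L by (auto simp: sobolev_loc_def)
  from choice[OF this] obtain V where V: "\<forall>i. weak_deriv X [i] u (V i) \<and> Lp_loc p X (V i)" ..
  have "\<forall>q. \<exists>v. weak_deriv X [fst q, snd q] u v \<and> Lp_loc p X v" using L by (auto simp: sobolev_loc_def)
  from choice[OF this] obtain H where H: "\<forall>q. weak_deriv X [fst q, snd q] u (H q) \<and> Lp_loc p X (H q)" ..
  have "weak_deriv X [j] (V i) (H (i, j))" for i j unfolding weak_deriv_iff
  proof (intro conjI allI impI)
    have w: "weak_deriv X [i] u (V i)" "weak_deriv X [i, j] u (H (i, j))" using V H[THEN spec, of "(i, j)"] by auto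
    then show "Lp_loc 1 X (V i)" "Lp_loc 1 X (H (i, j))" by (auto simp: weak_deriv_iff)
    fix \<phi> assume t: "test_function X \<phi>"
    have "(LINT x|lebesgue. u x * partial_deriv i (partial_deriv j \<phi>) x) = - (LINT x|lebesgue. V i x * partial_deriv j \<phi> x)"
      using w(1) test_function_partial[OF t, of j] by (simp add: weak_deriv_iff)
    moreover have "(LINT x|lebesgue. u x * partial_deriv i (partial_deriv j \<phi>) x) = (LINT x|lebesgue. H (i, j) x * \<phi> x)"
      using w(2) t by (simp add: weak_deriv_iff)
    ultimately show "(LINT x|lebesgue. V i x * iter_partial [j] \<phi> x) = (- 1) ^ length [j] * (LINT x|lebesgue. H (i, j) x * \<phi> x)"
      by simp
  qed
  then show ?R using L V H by (auto simp: sobolev_loc_def intro!: exI[of _ V] exI[of _ "\<lambda>i j. H (i, j)"])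
next
  assume ?R
  then obtain V H where Lu: "Lp_loc p X u" and V: "\<forall>i. weak_deriv X [i] u (V i) \<and> Lp_loc p X (V i)"
    and H: "\<forall>i j. weak_deriv X [j] (V i) (H i j) \<and> Lp_loc p X (H i j)" by blast
  have Lu1: "Lp_loc 1 X u" by (rule Lp_loc_imp_1[OF assms(2,1) Lu])
  show ?L unfolding sobolev_loc_def
  proof (intro conjI Lu allI impI)
    fix js :: "'a list" assume "length js \<le> 2"
    then consider "js = []" | i where "js = [i]" | i j where "js = [i, j]"
      by (cases js; cases "tl js"; cases "tl (tl js)") auto
    then show "\<exists>v. weak_deriv X js u v \<and> Lp_loc p X v"
    proof cases
      case 1
      then show ?thesis using Lu Lu1 by (intro exI[of _ u]) (simp add: weak_deriv_iff)
    next
      case 2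
      then show ?thesis using V by blast
    next
      case 3
      have "weak_deriv X [i, j] u (H i j)" unfolding weak_deriv_iff
      proof (intro conjI Lu1 allI impI)
        show "Lp_loc 1 X (H i j)" using H by (auto simp: weak_deriv_iff)
        fix \<phi> assume t: "test_function X \<phi>"
        have "(LINT x|lebesgue. u x * partial_deriv i (partial_deriv j \<phi>) x) = - (LINT x|lebesgue. V i x * partial_deriv j \<phi> x)"
          using V test_function_partial[OF t, of j] by (simp add: weak_deriv_iff)
        moreover have "(LINT x|lebesgue. V i x * partial_deriv j \<phi> x) = - (LINT x|lebesgue. H i j x * \<phi> x)"
          using H t by (simp add: weak_deriv_iff)
        ultimately show "(LINT x|lebesgue. u x * iter_partial [i, j] \<phi> x) = (- 1) ^ length [i, j] * (LINT x|lebesgue. H i j x * \<phi> x)"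
          by simp
      qed
      then show ?thesis using 3 H by blast
    qed
  qed
qed

lemma sobolev_loc_2I:
  assumes "open X" "1 \<le> p" "Lp_loc p X u" "\<And>i. weak_deriv X [i] u (V i)" "\<And>i. Lp_loc p X (V i)"
    "\<And>i j. weak_deriv X [j] (V i) (H i j)" "\<And>i j. Lp_loc p X (H i j)"
  shows "sobolev_loc 2 p X u" unfolding sobolev_loc_2_iff[OF assms(1,2)]
  by (intro conjI exI[of _ V] exI[of _ H] allI assms(3-7))

lemma sobolev_loc_2E:
  assumes "sobolev_loc 2 p X u" "open X" "1 \<le> p"
  obtains V H where "Lp_loc p X u" "\<And>i. weak_deriv X [i] u (V i)" "\<And>i. Lp_loc p X (V i)"
    "\<And>i j. weak_deriv X [j] (V i) (H i j)" "\<And>i j. Lp_loc p X (H i j)"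
proof -
  from assms(1)[unfolded sobolev_loc_2_iff[OF assms(2,3)]] obtain V H where
    a: "Lp_loc p X u" "\<forall>i. weak_deriv X [i] u (V i) \<and> Lp_loc p X (V i)"
    "\<forall>i j. weak_deriv X [j] (V i) (H i j) \<and> Lp_loc p X (H i j)" by blast
  show ?thesis by (rule that[of V H]) (use a in auto)
qed

lemma sobolev_loc_2_subset:
  assumes "sobolev_loc 2 p X u" "open X" "1 \<le> p" "U \<subseteq> X" "open U"
  shows "sobolev_loc 2 p U u"
proof (rule sobolev_loc_2E[OF assms(1-3)])
  fix V H
  assume a: "Lp_loc p X u" "\<And>i. weak_deriv X [i] u (V i)" "\<And>i. Lp_loc p X (V i)"
    "\<And>i j. weak_deriv X [j] (V i) (H i j)" "\<And>i j. Lp_loc p X (H i j)"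
  show ?thesis
    by (rule sobolev_loc_2I[OF assms(5,3) Lp_loc_subset[OF a(1) assms(4,5,2)] weak_deriv_subset[OF a(2) assms(2,5,4)]
          Lp_loc_subset[OF a(3) assms(4,5,2)] weak_deriv_subset[OF a(4) assms(2,5,4)] Lp_loc_subset[OF a(5) assms(4,5,2)]])
qed

lemma sobolev_loc_2_cong:
  assumes "sobolev_loc 2 p X u" "open X" "1 \<le> p" "\<And>x. x \<in> X \<Longrightarrow> u x = v x"
  shows "sobolev_loc 2 p X v"
proof (rule sobolev_loc_2E[OF assms(1-3)])
  fix V H
  assume a: "Lp_loc p X u" "\<And>i. weak_deriv X [i] u (V i)" "\<And>i. Lp_loc p X (V i)"
    "\<And>i j. weak_deriv X [j] (V i) (H i j)" "\<And>i j. Lp_loc p X (H i j)"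
  have ae: "AE x in lebesgue. x \<in> X \<longrightarrow> u x = v x" using assms(4) by (intro AE_I2) simp
  have ae': "AE x in lebesgue. x \<in> X \<longrightarrow> V i x = V i x" for i by simp
  show ?thesis
    by (rule sobolev_loc_2I[OF assms(2,3) Lp_loc_AE[OF assms(2) a(1) ae] weak_deriv_cong_AE[OF a(2) assms(2) ae ae'] a(3-5)])
qed

text \<open>The local gradients have to be glued first; by uniqueness the local second derivatives
  are then derivatives of the glued gradient and can be glued in turn.\<close>

lemma sobolev_loc_2_local:
  fixes u :: "real^'n \<Rightarrow> real"
  assumes "open X" "1 \<le> p" "\<And>x. x \<in> X \<Longrightarrow> \<exists>U. open U \<and> x \<in> U \<and> sobolev_loc 2 p U u"
  shows "sobolev_loc 2 p X u"
proof -
  have loc: "\<exists>U V H. open U \<and> x \<in> U \<and> U \<subseteq> X \<and> Lp_loc p U u \<and> (\<forall>i. weak_deriv U [i] u (V i) \<and> Lp_loc p U (V i)) \<and>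
      (\<forall>i j. weak_deriv U [j] (V i) (H i j) \<and> Lp_loc p U (H i j))" if x: "x \<in> X" for x
  proof -
    obtain U where U: "open U" "x \<in> U" "sobolev_loc 2 p U u" using assms(3)[OF x] by blast
    have "sobolev_loc 2 p (U \<inter> X) u" by (rule sobolev_loc_2_subset[OF U(3,1) assms(2)]) (use assms(1) U(1) in auto)
    then show ?thesis
    proof (rule sobolev_loc_2E[OF _ open_Int[OF U(1) assms(1)] assms(2)])
      fix V H assume "Lp_loc p (U \<inter> X) u" "\<And>i. weak_deriv (U \<inter> X) [i] u (V i)" "\<And>i. Lp_loc p (U \<inter> X) (V i)"
        "\<And>i j. weak_deriv (U \<inter> X) [j] (V i) (H i j)" "\<And>i j. Lp_loc p (U \<inter> X) (H i j)"
      then show ?thesis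
        using U(1,2) assms(1) x by (intro exI[of _ "U \<inter> X"] exI[of _ V] exI[of _ H] conjI allI) auto
    qed
  qed
  have "\<exists>v. weak_deriv X [i] u v" for i
  proof (rule weak_deriv_glue[OF assms(1)])
    fix x assume "x \<in> X"
    from loc[OF this] show "\<exists>U v. open U \<and> x \<in> U \<and> weak_deriv U [i] u v" by blast
  qed
  then have "\<forall>i. \<exists>v. weak_deriv X [i] u v" ..
  from choice[OF this] obtain V where V0: "\<forall>i. weak_deriv X [i] u (V i)" ..
  then have V: "weak_deriv X [i] u (V i)" for i ..
  have loc2: "\<exists>U H. open U \<and> x \<in> U \<and> U \<subseteq> X \<and> (\<forall>i. Lp_loc p U (V i)) \<and>
      (\<forall>i j. weak_deriv U [j] (V i) (H i j) \<and> Lp_loc p U (H i j))" if x: "x \<in> X" for x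
  proof -
    obtain U V' H where U: "open U" "x \<in> U" "U \<subseteq> X" and a: "\<forall>i. weak_deriv U [i] u (V' i) \<and> Lp_loc p U (V' i)"
      "\<forall>i j. weak_deriv U [j] (V' i) (H i j) \<and> Lp_loc p U (H i j)" using loc[OF x] by blast
    have ae: "AE y in lebesgue. y \<in> U \<longrightarrow> V' i y = V i y" for i
      by (rule weak_deriv_unique[OF U(1) _ weak_deriv_subset[OF V assms(1) U(1,3)]]) (use a in blast)
    have LV: "Lp_loc p U (V i)" for i by (rule Lp_loc_AE[OF U(1) _ ae]) (use a in blast)
    have wH: "weak_deriv U [j] (V i) (H i j)" for i j by (rule weak_deriv_cong_AE[OF _ U(1) ae]) (use a in auto)
    have LH: "Lp_loc p U (H i j)" for i j using a(2) by blast
    show ?thesis by (intro exI[of _ U] exI[of _ H] conjI allI U LV wH LH)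
  qed
  have LV: "Lp_loc p X (V i)" for i
  proof (rule Lp_loc_local[OF assms(1)])
    fix x assume "x \<in> X"
    from loc2[OF this] show "\<exists>U. open U \<and> x \<in> U \<and> Lp_loc p U (V i)" by blast
  qed
  have "\<exists>v. weak_deriv X [snd q] (V (fst q)) v" for q
  proof (rule weak_deriv_glue[OF assms(1)])
    fix x assume "x \<in> X"
    from loc2[OF this] show "\<exists>U v. open U \<and> x \<in> U \<and> weak_deriv U [snd q] (V (fst q)) v" by blast
  qed
  then have "\<forall>q. \<exists>v. weak_deriv X [snd q] (V (fst q)) v" ..
  from choice[OF this] obtain H where H0: "\<forall>q. weak_deriv X [snd q] (V (fst q)) (H q)" ..
  have H: "weak_deriv X [j] (V i) (H (i, j))" for i j using H0[THEN spec, of "(i, j)"] by simp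
  have LH: "Lp_loc p X (H (i, j))" for i j
  proof (rule Lp_loc_local[OF assms(1)])
    fix x assume "x \<in> X"
    from loc2[OF this] obtain U H' where U: "open U" "x \<in> U" "U \<subseteq> X" "weak_deriv U [j] (V i) (H' i j)" "Lp_loc p U (H' i j)" by blast
    have "Lp_loc p U (H (i, j))"
      by (rule Lp_loc_AE[OF U(1,5) weak_deriv_unique[OF U(1,4) weak_deriv_subset[OF H assms(1) U(1,3)]]])
    then show "\<exists>U. open U \<and> x \<in> U \<and> Lp_loc p U (H (i, j))" using U by blast
  qed
  have Lu: "Lp_loc p X u"
  proof (rule Lp_loc_local[OF assms(1)])
    fix x assume "x \<in> X"
    from loc[OF this] show "\<exists>U. open U \<and> x \<in> U \<and> Lp_loc p U u" by blast
  qed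
  show ?thesis by (rule sobolev_loc_2I[OF assms(1,2) Lu V LV H LH])
qed

lemma weak_deriv_add:
  assumes "open X" "weak_deriv X [i] u v" "weak_deriv X [i] u' v'"
  shows "weak_deriv X [i] (\<lambda>x. u x + u' x) (\<lambda>x. v x + v' x)" unfolding weak_deriv_1_iff[OF assms(1)]
proof (intro conjI allI impI)
  note d = weak_derivD[OF assms(2,1)] and d' = weak_derivD[OF assms(3,1)]
  show "Lp_loc 1 X (\<lambda>x. u x + u' x)" by (rule Lp_loc_add[OF _ assms(1) d(1) d'(1)]) simp
  show "Lp_loc 1 X (\<lambda>x. v x + v' x)" by (rule Lp_loc_add[OF _ assms(1) d(2) d'(2)]) simp
  fix \<phi> assume t: "test_function X \<phi>"
  note I = test_mult_integrable[OF _ _ assms(1)]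
  show "(LINT x|lebesgue. (u x + u' x) * partial_deriv i \<phi> x) = - (LINT x|lebesgue. (v x + v' x) * \<phi> x)"
    using d(3)[OF t] d'(3)[OF t] I[OF d(1) test_function_partial[OF t, of i]] I[OF d'(1) test_function_partial[OF t, of i]]
      I[OF d(2) t] I[OF d'(2) t] by (simp add: distrib_right)
qed

lemma weak_deriv_sum:
  assumes "open X" "finite I" "\<And>m. m \<in> I \<Longrightarrow> weak_deriv X [i] (u m) (v m)"
  shows "weak_deriv X [i] (\<lambda>x. \<Sum>m\<in>I. u m x) (\<lambda>x. \<Sum>m\<in>I. v m x)" using assms(2,3)
proof (induction I)
  case empty
  show ?case using Lp_loc_zero[OF assms(1)] by (simp add: weak_deriv_1_iff[OF assms(1)])
next
  case (insert a I)
  then show ?case using weak_deriv_add[OF assms(1), of i "u a" "v a"] by simp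
qed

section \<open>Locally Lipschitz Sobolev maps\<close>

definition loc_lip :: "(real^'n) set \<Rightarrow> (real^'n \<Rightarrow> real^'n) \<Rightarrow> bool" where
  "loc_lip X F \<longleftrightarrow> (\<forall>x\<in>X. \<exists>r>0. \<exists>L>0. \<forall>y\<in>ball x r. \<forall>z\<in>ball x r. norm (F y - F z) \<le> L * norm (y - z))"

text \<open>The Lipschitz condition makes first derivatives locally bounded. Without it the products
  of derivatives in the second-order chain rule could leave \<open>Lp_loc p\<close>.\<close>

definition reg :: "real \<Rightarrow> (real^'n) set \<Rightarrow> (real^'n \<Rightarrow> real^'n) \<Rightarrow> bool" where
  "reg p X F \<longleftrightarrow> (\<forall>i. sobolev_loc 2 p X (\<lambda>x. F x $ i)) \<and> loc_lip X F"

lemma regD: "reg p X F \<Longrightarrow> sobolev_loc 2 p X (\<lambda>x. F x $ i)" "reg p X F \<Longrightarrow> loc_lip X F" by (auto simp: reg_def)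

lemma loc_lip_continuous:
  assumes "loc_lip X F" "open X" shows "continuous_on X F" unfolding continuous_on_eq_continuous_at[OF assms(2)]
proof
  fix x assume "x \<in> X"
  then obtain r L where r: "r > 0" "L > 0" "\<forall>y\<in>ball x r. \<forall>z\<in>ball x r. norm (F y - F z) \<le> L * norm (y - z)"
    using assms(1) by (auto simp: loc_lip_def)
  have "L-lipschitz_on (ball x r) F" by (rule lipschitz_onI) (use r in \<open>auto simp: dist_norm\<close>)
  then have "continuous_on (ball x r) F" by (rule lipschitz_on_continuous_on)
  then show "isCont F x" using r(1) by (simp add: continuous_on_eq_continuous_at)
qed

lemma loc_lip_local:
  assumes "\<And>x. x \<in> X \<Longrightarrow> \<exists>U. open U \<and> x \<in> U \<and> loc_lip U F" shows "loc_lip X F" unfolding loc_lip_def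
proof
  fix x assume "x \<in> X"
  then obtain U where "x \<in> U" "loc_lip U F" using assms by blast
  then show "\<exists>r>0. \<exists>L>0. \<forall>y\<in>ball x r. \<forall>z\<in>ball x r. norm (F y - F z) \<le> L * norm (y - z)" by (simp add: loc_lip_def)
qed

lemma loc_lip_subset: "loc_lip X F \<Longrightarrow> U \<subseteq> X \<Longrightarrow> loc_lip U F" by (auto simp: loc_lip_def)

lemma loc_lip_cong:
  assumes "loc_lip X F" "open X" "\<And>x. x \<in> X \<Longrightarrow> F x = G x" shows "loc_lip X G" unfolding loc_lip_def
proof
  fix x assume x: "x \<in> X"
  then obtain r L where r: "r > 0" "L > 0" "\<forall>y\<in>ball x r. \<forall>z\<in>ball x r. norm (F y - F z) \<le> L * norm (y - z)"
    using assms(1) by (auto simp: loc_lip_def)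
  obtain s where s: "s > 0" "ball x s \<subseteq> X" using x assms(2) open_contains_ball by blast
  have "norm (G y - G z) \<le> L * norm (y - z)" if "y \<in> ball x (min r s)" "z \<in> ball x (min r s)" for y z
  proof -
    have yz: "y \<in> ball x r" "z \<in> ball x r" "y \<in> X" "z \<in> X" using that s(2) by auto
    have "norm (F y - F z) \<le> L * norm (y - z)" using r(3) yz(1,2) by blast
    then show ?thesis by (simp add: assms(3)[OF yz(3)] assms(3)[OF yz(4)])
  qed
  then show "\<exists>r>0. \<exists>L>0. \<forall>y\<in>ball x r. \<forall>z\<in>ball x r. norm (G y - G z) \<le> L * norm (y - z)"
    using r(1,2) s(1) by (intro exI[of _ "min r s"] exI[of _ L] conjI ballI) simp_all
qed

lemma loc_lip_comp:
  assumes "loc_lip X F" "loc_lip X' G" "open X" "F ` X \<subseteq> X'" shows "loc_lip X (\<lambda>x. G (F x))" unfolding loc_lip_def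
proof
  fix x assume x: "x \<in> X"
  then obtain r L where r: "r > 0" "L > 0" "\<forall>y\<in>ball x r. \<forall>z\<in>ball x r. norm (F y - F z) \<le> L * norm (y - z)"
    using assms(1) by (auto simp: loc_lip_def)
  have "F x \<in> X'" using x assms(4) by blast
  then obtain s M where s: "s > 0" "M > 0" "\<forall>y\<in>ball (F x) s. \<forall>z\<in>ball (F x) s. norm (G y - G z) \<le> M * norm (y - z)"
    using assms(2) by (auto simp: loc_lip_def)
  define t where "t = min r (s / L)"
  have t: "t > 0" using r s by (simp add: t_def)
  have Fs: "F y \<in> ball (F x) s" if "y \<in> ball x t" for y
  proof -
    have "norm (F x - F y) \<le> L * norm (x - y)" using r that by (auto simp: t_def)
    also have "\<dots> < L * (s / L)" using that r(2) by (intro mult_strict_left_mono) (auto simp: t_def dist_norm)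
    finally show ?thesis using r(2) by (simp add: dist_norm)
  qed
  have "norm (G (F y) - G (F z)) \<le> (M * L) * norm (y - z)" if "y \<in> ball x t" "z \<in> ball x t" for y z
  proof -
    have "norm (G (F y) - G (F z)) \<le> M * norm (F y - F z)" using s(3) Fs that by blast
    also have "\<dots> \<le> M * (L * norm (y - z))" using r(3) that s(2) by (intro mult_left_mono) (auto simp: t_def)
    finally show ?thesis by simp
  qed
  then show "\<exists>r>0. \<exists>L>0. \<forall>y\<in>ball x r. \<forall>z\<in>ball x r. norm (G (F y) - G (F z)) \<le> L * norm (y - z)"
    using t r(2) s(2) by (intro exI[of _ t] exI[of _ "M * L"] conjI ballI) simp_all
qed

lemma loc_lip_component:
  assumes "loc_lip X F" "x \<in> X"
  shows "\<exists>r>0. \<exists>L. \<forall>y\<in>ball x r. \<forall>z\<in>ball x r. \<bar>F y $ i - F z $ i\<bar> \<le> L * norm (y - z)"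
proof -
  obtain r L where r: "r > 0" "L > 0" "\<forall>y\<in>ball x r. \<forall>z\<in>ball x r. norm (F y - F z) \<le> L * norm (y - z)"
    using assms by (auto simp: loc_lip_def)
  have "\<bar>F y $ i - F z $ i\<bar> \<le> L * norm (y - z)" if "y \<in> ball x r" "z \<in> ball x r" for y z
  proof -
    have "\<bar>F y $ i - F z $ i\<bar> \<le> norm (F y - F z)" using component_le_norm_cart[of "F y - F z" i] by simp
    also have "\<dots> \<le> L * norm (y - z)" using r(3) that by blast
    finally show ?thesis .
  qed
  then show ?thesis using r(1) by blast
qed

text \<open>The chain rule is applied twice: to the function and to its first derivatives, which are
  bounded because the function is locally Lipschitz.\<close>

lemma sobolev_loc_2_compose:
  fixes F :: "real^'n \<Rightarrow> real^'n"
  assumes p: "1 \<le> p" and o: "open X" "open X'" and into: "F ` X \<subseteq> X'" and ex: "expanding_loc X F"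
    and F: "reg p X F" and u: "sobolev_loc 2 p X' u"
    and lip: "\<And>x. x \<in> X' \<Longrightarrow> \<exists>r>0. \<exists>L. \<forall>y\<in>ball x r. \<forall>z\<in>ball x r. \<bar>u y - u z\<bar> \<le> L * norm (y - z)"
  shows "sobolev_loc 2 p X (\<lambda>x. u (F x))"
proof (rule sobolev_loc_2E[OF u o(2) p])
  fix U HU
  assume U: "Lp_loc p X' u" "\<And>i. weak_deriv X' [i] u (U i)" "\<And>i. Lp_loc p X' (U i)"
    "\<And>i j. weak_deriv X' [j] (U i) (HU i j)" "\<And>i j. Lp_loc p X' (HU i j)"
  have cont: "continuous_on X F" by (rule loc_lip_continuous[OF regD(2)[OF F] o(1)])
  note Lc = Lp_loc_compose[OF o cont into ex] and Bc = Linf_loc_compose[OF o cont into ex]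
  have "\<forall>m. \<exists>q. (\<forall>i. weak_deriv X [i] (\<lambda>x. F x $ m) (fst q i)) \<and>
    (\<forall>i j. weak_deriv X [j] (fst q i) (snd q i j) \<and> Lp_loc p X (snd q i j))"
  proof
    fix m
    show "\<exists>q. (\<forall>i. weak_deriv X [i] (\<lambda>x. F x $ m) (fst q i)) \<and>
      (\<forall>i j. weak_deriv X [j] (fst q i) (snd q i j) \<and> Lp_loc p X (snd q i j))"
    proof (rule sobolev_loc_2E[OF regD(1)[OF F, of m] o(1) p])
      fix V H
      assume "\<And>i. weak_deriv X [i] (\<lambda>x. F x $ m) (V i)" "\<And>i j. weak_deriv X [j] (V i) (H i j)" "\<And>i j. Lp_loc p X (H i j)"
      then show ?thesis by (intro exI[of _ "(V, H)"]) simp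
    qed
  qed
  from choice[OF this] obtain q where q: "\<forall>m. (\<forall>i. weak_deriv X [i] (\<lambda>x. F x $ m) (fst (q m) i)) \<and>
    (\<forall>i j. weak_deriv X [j] (fst (q m) i) (snd (q m) i j) \<and> Lp_loc p X (snd (q m) i j))" ..
  define A where "A m = fst (q m)" for m
  define HA where "HA m = snd (q m)" for m
  have A: "weak_deriv X [i] (\<lambda>x. F x $ m) (A m i)" "weak_deriv X [j] (A m i) (HA m i j)" "Lp_loc p X (HA m i j)" for m i j
    using q by (auto simp: A_def HA_def)
  have Ab: "Linf_loc X (A m i)" for m i
    by (rule weak_deriv_lipschitz_bound[OF o(1) A(1)]) (rule loc_lip_component[OF regD(2)[OF F]])
  have Ub: "Linf_loc X' (U m)" for m by (rule weak_deriv_lipschitz_bound[OF o(2) U(2) lip])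
  have UFb: "Linf_loc X (\<lambda>x. U m (F x))" for m by (rule Bc[OF Ub])
  have p0: "0 \<le> p" using p by simp
  have d1: "weak_deriv X [i] (\<lambda>x. u (F x)) (\<lambda>x. \<Sum>m\<in>UNIV. A m i x * U m (F x))" for i
    by (rule weak_deriv_chain[OF o cont into ex A(1) Ab U(2)])
  have d2: "weak_deriv X [j] (\<lambda>x. U m (F x)) (\<lambda>x. \<Sum>l\<in>UNIV. A l j x * HU m l (F x))" for m j
    by (rule weak_deriv_chain[OF o cont into ex A(1) Ab U(4)])
  show ?thesis
  proof (rule sobolev_loc_2I[OF o(1) p Lc[OF U(1)] d1])
    show "Lp_loc p X (\<lambda>x. \<Sum>m\<in>UNIV. A m i x * U m (F x))" for i
      by (intro Linf_loc_imp_Lp_loc[OF p0 o(1)] Linf_loc_sum Linf_loc_mult Ab UFb) simp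
    show "weak_deriv X [j] (\<lambda>x. \<Sum>m\<in>UNIV. A m i x * U m (F x))
        (\<lambda>x. \<Sum>m\<in>UNIV. A m i x * (\<Sum>l\<in>UNIV. A l j x * HU m l (F x)) + U m (F x) * HA m i j x)" for i j
      by (intro weak_deriv_sum[OF o(1)] weak_deriv_mult[OF o(1) A(2) d2 Ab UFb]) simp
    show "Lp_loc p X (\<lambda>x. \<Sum>m\<in>UNIV. A m i x * (\<Sum>l\<in>UNIV. A l j x * HU m l (F x)) + U m (F x) * HA m i j x)" for i j
      by (intro Lp_loc_sum[OF p o(1)] Lp_loc_add[OF p o(1)] Lp_loc_mult_Linf[OF p0 o(1)] Ab UFb A(3) Lc U(5)) simp_all
  qed
qed

lemma reg_comp:
  assumes "1 \<le> p" "open X" "open X'" "F ` X \<subseteq> X'" "expanding_loc X F" "reg p X F" "reg p X' G"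
  shows "reg p X (\<lambda>x. G (F x))" unfolding reg_def
proof (intro conjI allI)
  show "sobolev_loc 2 p X (\<lambda>x. G (F x) $ i)" for i
    by (rule sobolev_loc_2_compose[OF assms(1-6) regD(1)[OF assms(7)] loc_lip_component[OF regD(2)[OF assms(7)]]])
  show "loc_lip X (\<lambda>x. G (F x))" by (rule loc_lip_comp[OF regD(2)[OF assms(6)] regD(2)[OF assms(7)] assms(2,4)])
qed

lemma reg_subset: "reg p X F \<Longrightarrow> open X \<Longrightarrow> 1 \<le> p \<Longrightarrow> U \<subseteq> X \<Longrightarrow> open U \<Longrightarrow> reg p U F"
  unfolding reg_def using sobolev_loc_2_subset loc_lip_subset by blast

lemma reg_cong:
  assumes "reg p X F" "open X" "1 \<le> p" "\<And>x. x \<in> X \<Longrightarrow> F x = G x" shows "reg p X G" unfolding reg_def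
proof (intro conjI allI)
  show "sobolev_loc 2 p X (\<lambda>x. G x $ i)" for i
    by (rule sobolev_loc_2_cong[OF regD(1)[OF assms(1)] assms(2,3)]) (simp add: assms(4))
  show "loc_lip X G" by (rule loc_lip_cong[OF regD(2)[OF assms(1)] assms(2,4)])
qed

lemma reg_local:
  assumes "open X" "1 \<le> p" "\<And>x. x \<in> X \<Longrightarrow> \<exists>U. open U \<and> x \<in> U \<and> reg p U F" shows "reg p X F" unfolding reg_def
proof (intro conjI allI)
  show "sobolev_loc 2 p X (\<lambda>x. F x $ i)" for i
  proof (rule sobolev_loc_2_local[OF assms(1,2)])
    fix x assume "x \<in> X"
    from assms(3)[OF this] obtain U where U: "open U" "x \<in> U" "reg p U F" by blast
    show "\<exists>U. open U \<and> x \<in> U \<and> sobolev_loc 2 p U (\<lambda>x. F x $ i)" by (intro exI[of _ U] conjI U regD(1)[OF U(3)])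
  qed
  show "loc_lip X F"
  proof (rule loc_lip_local)
    fix x assume "x \<in> X"
    from assms(3)[OF this] obtain U where U: "open U" "x \<in> U" "reg p U F" by blast
    show "\<exists>U. open U \<and> x \<in> U \<and> loc_lip U F" by (intro exI[of _ U] conjI U regD(2)[OF U(3)])
  qed
qed

section \<open>The class of embeddings\<close>

text \<open>Like \<open>LW2\<close>, but a property of \<open>F\<close> alone, with Lipschitz
  conditions on both directions in place of the two-sided bound. Openness of the image is built in,
  so that composition and gluing can do without invariance of domain.\<close>

definition LWemb :: "real \<Rightarrow> (real^'n) set \<Rightarrow> (real^'n \<Rightarrow> real^'n) \<Rightarrow> bool" where
  "LWemb p X F \<longleftrightarrow> 1 \<le> p \<and> open X \<and> open (F ` X) \<and> inj_on F X \<and> reg p X F \<and> reg p (F ` X) (inv_into X F)"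

lemma LWembD:
  assumes "LWemb p X F"
  shows "1 \<le> p" "open X" "open (F ` X)" "inj_on F X" "reg p X F" "reg p (F ` X) (inv_into X F)" "continuous_on X F"
  using assms loc_lip_continuous[of X F] by (auto simp: LWemb_def reg_def)

lemma LWembI:
  assumes "1 \<le> p" "open X" "reg p X F" "\<And>x. x \<in> X \<Longrightarrow> G (F x) = x" "open X'" "F ` X = X'" "reg p X' G"
  shows "LWemb p X F" unfolding LWemb_def
proof (intro conjI assms)
  show o: "open (F ` X)" using assms by simp
  show i: "inj_on F X" by (rule inj_on_inverseI[of _ G]) (rule assms(4))
  show "reg p (F ` X) (inv_into X F)" by (rule reg_cong[of p _ G]) (use assms o i in auto)
qed

text \<open>The Lipschitz bound of the inverse on a ball of the target is the lower bound for
  \<open>F\<close>; continuity brings a ball of the source into that ball.\<close>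

lemma LWemb_expanding:
  assumes "LWemb p X F" shows "expanding_loc X F" unfolding expanding_loc_def
proof
  note d = LWembD[OF assms]
  fix x assume x: "x \<in> X"
  then have "F x \<in> F ` X" by simp
  then obtain s L where s: "s > 0" "L > 0" "\<forall>y\<in>ball (F x) s. \<forall>z\<in>ball (F x) s. norm (inv_into X F y - inv_into X F z) \<le> L * norm (y - z)"
    using regD(2)[OF d(6)] unfolding loc_lip_def by blast
  have "isCont F x" using d(2,7) x by (simp add: continuous_on_eq_continuous_at)
  then obtain r1 where r1: "r1 > 0" "\<And>y. dist y x < r1 \<Longrightarrow> dist (F y) (F x) < s"
    unfolding continuous_at_eps_delta using s(1) by blast
  obtain r2 where r2: "r2 > 0" "ball x r2 \<subseteq> X" using x d(2) open_contains_ball by blast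
  have "norm (y - z) \<le> L * norm (F y - F z)" if "y \<in> ball x (min r1 r2)" "z \<in> ball x (min r1 r2)" for y z
  proof -
    have "y \<in> X" "z \<in> X" using that r2(2) by auto
    have "F y \<in> ball (F x) s" "F z \<in> ball (F x) s" using r1(2)[of y] r1(2)[of z] that by (auto simp: dist_commute)
    with s(3) have "norm (inv_into X F (F y) - inv_into X F (F z)) \<le> L * norm (F y - F z)" by blast
    then show ?thesis using \<open>y \<in> X\<close> \<open>z \<in> X\<close> d(4) by simp
  qed
  then show "\<exists>r>0. \<exists>L>0. \<forall>y\<in>ball x r. \<forall>z\<in>ball x r. norm (y - z) \<le> L * norm (F y - F z)"
    using s(2) r1(1) r2(1) by (intro exI[of _ "min r1 r2"] exI[of _ L] conjI ballI) simp_all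
qed

lemma LWemb_inv:
  assumes "LWemb p X F" shows "LWemb p (F ` X) (inv_into X F)"
proof -
  note d = LWembD[OF assms]
  show ?thesis
  proof (rule LWembI[OF d(1,3,6) _ d(2) _ d(5)])
    show "F (inv_into X F y) = y" if "y \<in> F ` X" for y using that by (rule f_inv_into_f)
    show "inv_into X F ` F ` X = X" by (rule inv_into_image_cancel[OF d(4) order_refl])
  qed
qed

lemma LWemb_subset:
  assumes "LWemb p X F" "U \<subseteq> X" "open U" shows "LWemb p U F"
proof -
  note d = LWembD[OF assms(1)] and d' = LWembD[OF LWemb_inv[OF assms(1)]]
  have e: "F ` U = F ` X \<inter> inv_into X F -` U" using assms(2) d(4) by (auto simp: f_inv_into_f)
  have o: "open (F ` U)" unfolding e by (rule continuous_open_preimage[OF d'(7) d(3) assms(3)])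
  have s: "F ` U \<subseteq> F ` X" using assms(2) by blast
  show ?thesis
    by (rule LWembI[OF d(1) assms(3) reg_subset[OF d(5,2,1) assms(2,3)] _ o refl reg_subset[OF d(6,3,1) s o]])
      (use assms(2) d(4) in auto)
qed

lemma LWemb_comp:
  assumes F: "LWemb p X F" and G: "LWemb p X' G" and s: "F ` X \<subseteq> X'" shows "LWemb p X (\<lambda>x. G (F x))"
proof -
  note d = LWembD[OF F] and d' = LWembD[OF G] and g = LWemb_subset[OF G s LWembD(3)[OF F]]
  note dg = LWembD[OF g] and gi = LWemb_inv[OF g]
  have im: "inv_into (F ` X) G ` (G ` F ` X) = F ` X" using dg(4) by (rule inv_into_image_cancel) simp
  show ?thesis
  proof (rule LWembI[OF d(1,2)])
    show "reg p X (\<lambda>x. G (F x))" by (rule reg_comp[OF d(1,2) d'(2) s LWemb_expanding[OF F] d(5) d'(5)])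
    show "reg p (G ` F ` X) (\<lambda>y. inv_into X F (inv_into (F ` X) G y))"
      by (rule reg_comp[OF d(1) dg(3) d(3) _ LWemb_expanding[OF gi] dg(6) d(6)]) (use im in simp)
    show "inv_into X F (inv_into (F ` X) G (G (F x))) = x" if "x \<in> X" for x using that d(4) dg(4) by simp
  qed (use dg(3) in \<open>auto simp: image_image\<close>)
qed

lemma LWemb_cong:
  assumes "LWemb p X F" "\<And>x. x \<in> X \<Longrightarrow> F x = G x" shows "LWemb p X G"
proof -
  note d = LWembD[OF assms(1)]
  show ?thesis
  proof (rule LWembI[OF d(1,2) reg_cong[OF d(5,2,1) assms(2)] _ d(3) _ d(6)])
    show "inv_into X F (G x) = x" if "x \<in> X" for x using inv_into_f_f[OF d(4) that] assms(2)[OF that] by simp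
    show "G ` X = F ` X" by (rule image_cong[OF refl]) (simp add: assms(2))
  qed
qed

text \<open>Regularity is local in the source and, since the images of the pieces are open, also in
  the target. Injectivity is the one global condition left to check; the maps that are glued from
  pieces below are treated in this way.\<close>

lemma LWemb_local:
  assumes "1 \<le> p" "inj_on F X" "\<And>x. x \<in> X \<Longrightarrow> \<exists>U. x \<in> U \<and> U \<subseteq> X \<and> LWemb p U F"
  shows "LWemb p X F"
proof -
  have o: "open X"
  proof (subst open_subopen, intro ballI)
    fix x assume "x \<in> X"
    from assms(3)[OF this] obtain U where U: "x \<in> U" "U \<subseteq> X" "LWemb p U F" by blast
    show "\<exists>T. open T \<and> x \<in> T \<and> T \<subseteq> X" by (intro exI[of _ U] conjI U LWembD(2)[OF U(3)])
  qed
  have o': "open (F ` X)"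
  proof (subst open_subopen, intro ballI)
    fix y assume "y \<in> F ` X"
    then obtain x where x: "x \<in> X" "y = F x" by blast
    from assms(3)[OF x(1)] obtain U where "x \<in> U" "U \<subseteq> X" "LWemb p U F" by blast
    then show "\<exists>T. open T \<and> y \<in> T \<and> T \<subseteq> F ` X" using LWembD(3)[of p U F] x(2) by (intro exI[of _ "F ` U"]) auto
  qed
  show ?thesis unfolding LWemb_def
  proof (intro conjI assms(1,2) o o')
    show "reg p X F"
    proof (rule reg_local[OF o assms(1)])
      fix x assume "x \<in> X"
      from assms(3)[OF this] obtain U where U: "x \<in> U" "LWemb p U F" by blast
      show "\<exists>U. open U \<and> x \<in> U \<and> reg p U F" by (intro exI[of _ U] conjI U LWembD(2,5)[OF U(2)])
    qed
    show "reg p (F ` X) (inv_into X F)"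
    proof (rule reg_local[OF o' assms(1)])
      fix y assume "y \<in> F ` X"
      then obtain x where x: "x \<in> X" "y = F x" by blast
      from assms(3)[OF x(1)] obtain U where U: "x \<in> U" "U \<subseteq> X" "LWemb p U F" by blast
      note d = LWembD[OF U(3)]
      have "inv_into U F z = inv_into X F z" if "z \<in> F ` U" for z
        using that assms(2) U(2) d(4) by (auto simp: inv_into_f_f subset_eq)
      from reg_cong[OF d(6,3,1) this] show "\<exists>U. open U \<and> y \<in> U \<and> reg p U (inv_into X F)"
        using d(3) U(1) x(2) by (intro exI[of _ "F ` U"]) auto
    qed
  qed
qed

lemma LWemb_imp_LW2:
  assumes "LWemb p X F" shows "LW2 p X (F ` X) F" unfolding LW2_def
proof (intro exI[of _ "inv_into X F"] conjI)
  note d = LWembD[OF assms]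
  have c': "continuous_on (F ` X) (inv_into X F)" by (rule loc_lip_continuous[OF regD(2)[OF d(6)] d(3)])
  show "homeomorphism X (F ` X) F (inv_into X F)"
    unfolding homeomorphism_def using d(4,7) c' by (auto simp: f_inv_into_f inv_into_image_cancel)
  show "sobolev_loc_map 2 p X (F ` X) F" using regD(1)[OF d(5)] by (simp add: sobolev_loc_map_def)
  show "sobolev_loc_map 2 p (F ` X) X (inv_into X F)" using regD(1)[OF d(6)] d(4) by (auto simp: sobolev_loc_map_def)
  show "locally_bilipschitz X F" unfolding locally_bilipschitz_def
  proof
    fix x assume x: "x \<in> X"
    obtain r1 L1 where 1: "r1 > 0" "L1 > 0" "\<forall>y\<in>ball x r1. \<forall>z\<in>ball x r1. norm (F y - F z) \<le> L1 * norm (y - z)"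
      using regD(2)[OF d(5)] x unfolding loc_lip_def by blast
    obtain r2 L2 where 2: "r2 > 0" "L2 > 0" "\<forall>y\<in>ball x r2. \<forall>z\<in>ball x r2. norm (y - z) \<le> L2 * norm (F y - F z)"
      using LWemb_expanding[OF assms] x unfolding expanding_loc_def by blast
    obtain r3 where 3: "r3 > 0" "ball x r3 \<subseteq> X" using x d(2) open_contains_ball by blast
    define L where "L = max 1 (max L1 L2)"
    define U where "U = ball x (min r1 (min r2 r3))"
    have "1 / L * norm (y - z) \<le> norm (F y - F z) \<and> norm (F y - F z) \<le> L * norm (y - z)" if "y \<in> U" "z \<in> U" for y z
    proof
      have "norm (F y - F z) \<le> L1 * norm (y - z)" using 1(3) that by (auto simp: U_def)
      also have "\<dots> \<le> L * norm (y - z)" by (intro mult_right_mono) (auto simp: L_def)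
      finally show "norm (F y - F z) \<le> L * norm (y - z)" .
      have "norm (y - z) \<le> L2 * norm (F y - F z)" using 2(3) that by (auto simp: U_def)
      also have "\<dots> \<le> L * norm (F y - F z)" by (intro mult_right_mono) (auto simp: L_def)
      finally show "1 / L * norm (y - z) \<le> norm (F y - F z)" by (simp add: L_def divide_le_eq mult.commute)
    qed
    moreover have "open U" "x \<in> U" "U \<subseteq> X" "1 \<le> L" using 1 2 3 by (auto simp: U_def L_def)
    ultimately show "\<exists>U L. open U \<and> x \<in> U \<and> U \<subseteq> X \<and> 1 \<le> L \<and>
        (\<forall>y\<in>U. \<forall>z\<in>U. 1 / L * norm (y - z) \<le> norm (F y - F z) \<and> norm (F y - F z) \<le> L * norm (y - z))" by blast
  qed
qed

text \<open>The lower bound in \<open>locally_bilipschitz\<close> makes \<open>g\<close> Lipschitz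
  on images of small open sets; by invariance of domain these contain balls of the target.\<close>

lemma LW2_imp_LWemb:
  assumes "LW2 p X X' F" "open X" "1 \<le> p" shows "LWemb p X F"
proof -
  obtain g where g: "homeomorphism X X' F g" and b: "locally_bilipschitz X F"
    and s: "sobolev_loc_map 2 p X X' F" "sobolev_loc_map 2 p X' X g" using assms(1) unfolding LW2_def by blast
  have h: "continuous_on X F" "F ` X = X'" "\<And>x. x \<in> X \<Longrightarrow> g (F x) = x" using g by (auto simp: homeomorphism_def)
  have inj: "inj_on F X" by (rule inj_on_inverseI[of _ g]) (rule h(3))
  have o': "open (F ` V)" if V: "V \<subseteq> X" "open V" for V
  proof -
    have c: "continuous_on V F" by (rule continuous_on_subset[OF h(1) V(1)])
    have i: "inj_on F V" by (rule inj_on_subset[OF inj V(1)])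
    show ?thesis by (rule invariance_of_domain[OF c V(2) i])
  qed
  have bl: "\<exists>U L. open U \<and> x \<in> U \<and> U \<subseteq> X \<and> 1 \<le> L \<and>
      (\<forall>y\<in>U. \<forall>z\<in>U. norm (y - z) \<le> L * norm (F y - F z) \<and> norm (F y - F z) \<le> L * norm (y - z))" if x: "x \<in> X" for x
  proof -
    from bspec[OF b[unfolded locally_bilipschitz_def] x] obtain U L where U: "open U \<and> x \<in> U \<and> U \<subseteq> X \<and> 1 \<le> L \<and>
      (\<forall>y\<in>U. \<forall>z\<in>U. (1 / L) * norm (y - z) \<le> norm (F y - F z) \<and> norm (F y - F z) \<le> L * norm (y - z))" by (elim exE)
    then have "(1 / L) * a \<le> c \<longleftrightarrow> a \<le> L * c" for a c by (simp add: divide_le_eq mult.commute)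
    with U show ?thesis by (intro exI[of _ U] exI[of _ L]) simp
  qed
  have lip: "loc_lip X F \<and> loc_lip X' g"
  proof
    show "loc_lip X F" unfolding loc_lip_def
    proof
      fix x assume "x \<in> X"
      from bl[OF this] obtain U L where U: "open U" "x \<in> U" "U \<subseteq> X" "1 \<le> L"
        "\<forall>y\<in>U. \<forall>z\<in>U. norm (y - z) \<le> L * norm (F y - F z) \<and> norm (F y - F z) \<le> L * norm (y - z)" by blast
      obtain r where r: "r > 0" "ball x r \<subseteq> U" using open_contains_ball U(1,2) by blast
      have "norm (F y - F z) \<le> L * norm (y - z)" if "y \<in> ball x r" "z \<in> ball x r" for y z
        using U(5) r(2) that by blast
      then show "\<exists>r>0. \<exists>L>0. \<forall>y\<in>ball x r. \<forall>z\<in>ball x r. norm (F y - F z) \<le> L * norm (y - z)"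
        using U(4) r(1) by (intro exI[of _ r] exI[of _ L] conjI ballI) auto
    qed
    show "loc_lip X' g" unfolding loc_lip_def
    proof
      fix y assume "y \<in> X'"
      then obtain x where x: "x \<in> X" "y = F x" using h(2) by blast
      from bl[OF x(1)] obtain U L where U: "open U" "x \<in> U" "U \<subseteq> X" "1 \<le> L"
        "\<forall>y\<in>U. \<forall>z\<in>U. norm (y - z) \<le> L * norm (F y - F z) \<and> norm (F y - F z) \<le> L * norm (y - z)" by blast
      have "open (F ` U)" by (rule o'[OF U(3,1)])
      moreover have "y \<in> F ` U" using U(2) x(2) by blast
      ultimately obtain r where r: "r > 0" "ball y r \<subseteq> F ` U" using open_contains_ball by blast
      have "norm (g a - g c) \<le> L * norm (a - c)" if acr: "a \<in> ball y r" "c \<in> ball y r" for a c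
      proof -
        obtain a' c' where ac: "a' \<in> U" "c' \<in> U" "a = F a'" "c = F c'" using acr r(2) by blast
        then have "norm (a' - c') \<le> L * norm (a - c)" using U(5) by blast
        moreover have "g a = a'" "g c = c'" using ac U(3) h(3) by auto
        ultimately show ?thesis by simp
      qed
      then show "\<exists>r>0. \<exists>L>0. \<forall>a\<in>ball y r. \<forall>c\<in>ball y r. norm (g a - g c) \<le> L * norm (a - c)"
        using r(1) U(4) by (intro exI[of _ r] exI[of _ L] conjI ballI) auto
    qed
  qed
  show ?thesis
  proof (rule LWembI[OF assms(3,2) _ h(3) _ h(2)])
    show "open X'" using o'[OF order_refl assms(2)] h(2) by simp
    show "reg p X F" "reg p X' g" using lip s by (auto simp: reg_def sobolev_loc_map_def)
  qed
qed

section \<open>Radial diffeomorphisms\<close>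

lemma C1_const: "C1 (\<lambda>x. c) (\<lambda>i x. 0)" by (auto simp: C1_def)

lemma C1_nth: "C1 (\<lambda>x::real^'n. x $ m) (\<lambda>i x. if i = m then 1 else 0)" unfolding C1_def
proof (intro conjI allI)
  fix x :: "real^'n"
  have "(\<lambda>h::real^'n. \<Sum>i\<in>UNIV. h $ i * (if i = m then 1 else 0)) = (\<lambda>h. h $ m)"
    by (auto simp: if_distrib[of "\<lambda>t. _ * t"] cong: if_cong)
  then show "((\<lambda>x. x $ m) has_derivative (\<lambda>h. \<Sum>i\<in>UNIV. h $ i * (if i = m then 1 else 0))) (at x)"
    using bounded_linear_imp_has_derivative[OF bounded_linear_vec_nth] by simp
qed auto

lemma C1_add:
  assumes "C1 u g" "C1 v h" shows "C1 (\<lambda>x. u x + v x) (\<lambda>i x. g i x + h i x)" unfolding C1_def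
proof (intro conjI allI)
  show "((\<lambda>x. u x + v x) has_derivative (\<lambda>d. \<Sum>i\<in>UNIV. d $ i * (g i x + h i x))) (at x)" for x
    using has_derivative_add[OF C1_has_derivative[OF assms(1), of x] C1_has_derivative[OF assms(2), of x]]
    by (simp add: distrib_left sum.distrib)
qed (intro continuous_on_add C1_grad_continuous[OF assms(1)] C1_grad_continuous[OF assms(2)])

lemma C1_comp_real:
  assumes "C1 u g" "\<And>t. (q has_real_derivative q' t) (at t)" "continuous_on UNIV q'"
  shows "C1 (\<lambda>x. q (u x)) (\<lambda>i x. q' (u x) * g i x)" unfolding C1_def
proof (intro conjI allI)
  fix x
  have "((\<lambda>x. q (u x)) has_derivative (\<lambda>d. q' (u x) * (\<Sum>i\<in>UNIV. d $ i * g i x))) (at x)"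
    by (rule has_derivative_compose[OF C1_has_derivative[OF assms(1)] assms(2)[unfolded has_field_derivative_def]])
  then show "((\<lambda>x. q (u x)) has_derivative (\<lambda>d. \<Sum>i\<in>UNIV. d $ i * (q' (u x) * g i x))) (at x)"
    by (simp add: sum_distrib_left mult_ac)
next
  fix i
  show "continuous_on UNIV (\<lambda>x. q' (u x) * g i x)" by (intro continuous_on_mult C1_grad_continuous[OF assms(1)]
        continuous_on_compose2[OF assms(3) C1_continuous[OF assms(1)]]) auto
qed

lemma reg_C2:
  assumes "1 \<le> p" "open X" "\<And>m. \<exists>g. C1 (\<lambda>x. F x $ m) g \<and> (\<forall>i. \<exists>h. C1 (g i) h)"
  shows "reg p X F" unfolding reg_def
proof (intro conjI allI)
  have p0: "0 \<le> p" using assms(1) by simp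
  from assms(3) have "\<forall>m. \<exists>g. C1 (\<lambda>x. F x $ m) g \<and> (\<forall>i. \<exists>h. C1 (g i) h)" ..
  from choice[OF this] obtain g where g0: "\<forall>m. C1 (\<lambda>x. F x $ m) (g m) \<and> (\<forall>i. \<exists>h. C1 (g m i) h)" ..
  then have g: "C1 (\<lambda>x. F x $ m) (g m)" for m by blast
  show "sobolev_loc 2 p X (\<lambda>x. F x $ m)" for m
  proof -
    have "\<forall>i. \<exists>h. C1 (g m i) h" using g0 by blast
    from choice[OF this] obtain h where "\<forall>i. C1 (g m i) (h i)" ..
    then have h: "C1 (g m i) (h i)" for i ..
    show ?thesis by (rule sobolev_loc_2I[OF assms(2,1) continuous_imp_Lp_loc[OF C1_continuous[OF g] assms(2) p0]
            C1_weak_deriv[OF g assms(2)] continuous_imp_Lp_loc[OF C1_grad_continuous[OF g] assms(2) p0]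
            C1_weak_deriv[OF h assms(2)] continuous_imp_Lp_loc[OF C1_grad_continuous[OF h] assms(2) p0]])
  qed
  show "loc_lip X F" unfolding loc_lip_def
  proof
    fix x assume "x \<in> X"
    have "\<exists>B. \<forall>y\<in>cball x 1. \<bar>g m i y\<bar> \<le> B" for m i
    proof -
      have "compact (g m i ` cball x 1)" by (rule compact_continuous_image[OF C1_grad_continuous[OF g] compact_cball])
      then obtain B where "\<forall>z\<in>g m i ` cball x 1. norm z \<le> B" using compact_imp_bounded bounded_iff by blast
      then show ?thesis by auto
    qed
    then have "\<forall>q. \<exists>B. \<forall>y\<in>cball x 1. \<bar>g (fst q) (snd q) y\<bar> \<le> B" by blast
    from choice[OF this] obtain B where B: "\<forall>q. \<forall>y\<in>cball x 1. \<bar>g (fst q) (snd q) y\<bar> \<le> B q" ..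
    define K where "K = (\<Sum>q\<in>UNIV. \<bar>B q\<bar>)"
    have K: "\<bar>g m i y\<bar> \<le> K" if "y \<in> ball x 1" for m i y
    proof -
      have "y \<in> cball x 1" using that by simp
      from bspec[OF B[THEN spec, of "(m, i)"] this] have "\<bar>g m i y\<bar> \<le> \<bar>B (m, i)\<bar>" by simp
      also have "\<dots> \<le> K" unfolding K_def by (rule member_le_sum) auto
      finally show ?thesis .
    qed
    have K0: "K \<ge> 0" by (simp add: K_def sum_nonneg)
    define L where "L = real CARD('a) * (real CARD('a) * K)"
    have "norm (F y - F z) \<le> (L + 1) * norm (y - z)" if yz: "y \<in> ball x 1" "z \<in> ball x 1" for y z
    proof -
      have "norm (F y - F z) \<le> (\<Sum>m\<in>UNIV. \<bar>(F y - F z) $ m\<bar>)" by (rule norm_le_l1_cart)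
      also have "\<dots> \<le> (\<Sum>m\<in>(UNIV::'a set). real CARD('a) * K * norm (y - z))"
      proof (rule sum_mono)
        fix m
        have "\<bar>F y $ m - F z $ m\<bar> \<le> real CARD('a) * K * norm (y - z)"
          by (rule C1_lipschitz_convex[OF C1_has_derivative[OF g] convex_ball K yz])
        then show "\<bar>(F y - F z) $ m\<bar> \<le> real CARD('a) * K * norm (y - z)" by simp
      qed
      also have "\<dots> = L * norm (y - z)" by (simp add: L_def)
      also have "\<dots> \<le> (L + 1) * norm (y - z)" by (intro mult_right_mono) auto
      finally show ?thesis .
    qed
    then show "\<exists>r>0. \<exists>L>0. \<forall>y\<in>ball x r. \<forall>z\<in>ball x r. norm (F y - F z) \<le> L * norm (y - z)"
      using K0 by (intro exI[of _ 1] exI[of _ "L + 1"] conjI ballI) (auto simp: L_def add_nonneg_pos)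
  qed
qed

lemma LWemb_similarity:
  assumes "1 \<le> p" "l \<noteq> 0" "open X" shows "LWemb p X (\<lambda>x. a + l *\<^sub>R (x - b))"
proof -
  have "reg p UNIV (\<lambda>x. a + l *\<^sub>R (x - b))" for a b :: "real^'a" and l
  proof (rule reg_C2[OF assms(1) open_UNIV])
    fix m
    have "C1 (\<lambda>x::real^'a. (a $ m - l * b $ m) + l * x $ m) (\<lambda>i x. 0 + (l * (if i = m then 1 else 0) + 0 * x $ m))"
      by (intro C1_add C1_mult C1_const C1_nth)
    then have "C1 (\<lambda>x::real^'a. (a + l *\<^sub>R (x - b)) $ m) (\<lambda>i x. l * (if i = m then 1 else 0))"
      by (simp add: algebra_simps)
    then show "\<exists>g. C1 (\<lambda>x. (a + l *\<^sub>R (x - b)) $ m) g \<and> (\<forall>i. \<exists>h. C1 (g i) h)" using C1_const by blast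
  qed
  then have "LWemb p UNIV (\<lambda>x. a + l *\<^sub>R (x - b))"
  proof (intro LWembI[where G="\<lambda>y. b + inverse l *\<^sub>R (y - a)" and X'=UNIV])
    show "range (\<lambda>x. a + l *\<^sub>R (x - b)) = UNIV"
    proof (rule surjI)
      show "a + l *\<^sub>R ((b + inverse l *\<^sub>R (y - a)) - b) = y" for y using assms(2) by simp
    qed
  qed (use assms in auto)
  then show ?thesis by (rule LWemb_subset) (use assms in auto)
qed

lemma LWemb_id: "1 \<le> p \<Longrightarrow> open X \<Longrightarrow> LWemb p X (\<lambda>x. x)" using LWemb_similarity[of p 1 X 0 0] by simp

section \<open>One-variable profile functions\<close>

definition c1 :: "(real \<Rightarrow> real) \<Rightarrow> bool" where
  "c1 f \<longleftrightarrow> (\<exists>f'. (\<forall>x. (f has_real_derivative f' x) (at x)) \<and> continuous_on UNIV f')"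

definition c2 :: "(real \<Rightarrow> real) \<Rightarrow> bool" where
  "c2 f \<longleftrightarrow> (\<exists>f'. (\<forall>x. (f has_real_derivative f' x) (at x)) \<and> c1 f')"

lemma c1I: "(\<And>x. (f has_real_derivative f' x) (at x)) \<Longrightarrow> continuous_on UNIV f' \<Longrightarrow> c1 f" by (auto simp: c1_def)

lemma c2I: "(\<And>x. (f has_real_derivative f' x) (at x)) \<Longrightarrow> c1 f' \<Longrightarrow> c2 f" by (auto simp: c2_def)

lemma DERIV_cont: "(\<And>x::real. (f has_real_derivative f' x) (at x)) \<Longrightarrow> continuous_on S f"
  by (meson DERIV_isCont continuous_at_imp_continuous_on)

lemma c1_continuous: "c1 f \<Longrightarrow> continuous_on S f" by (auto simp: c1_def intro: DERIV_cont)

lemma c2_c1: "c2 f \<Longrightarrow> c1 f" unfolding c2_def using c1I c1_continuous by blast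

lemma c1_const: "c1 (\<lambda>x. c)" by (rule c1I[of _ "\<lambda>x. 0"]) auto

lemma c1_ident: "c1 (\<lambda>x. x)" by (rule c1I[of _ "\<lambda>x. 1"]) auto

lemma c1_add: assumes "c1 f" "c1 g" shows "c1 (\<lambda>x. f x + g x)"
proof -
  obtain f' g' where "\<And>x. (f has_real_derivative f' x) (at x)" "continuous_on UNIV f'"
    "\<And>x. (g has_real_derivative g' x) (at x)" "continuous_on UNIV g'" using assms by (auto simp: c1_def)
  then show ?thesis by (intro c1I[of _ "\<lambda>x. f' x + g' x"] continuous_on_add DERIV_add)
qed

lemma c1_mult: assumes "c1 f" "c1 g" shows "c1 (\<lambda>x. f x * g x)"
proof -
  obtain f' g' where d: "\<And>x. (f has_real_derivative f' x) (at x)" "continuous_on UNIV f'"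
    "\<And>x. (g has_real_derivative g' x) (at x)" "continuous_on UNIV g'" using assms by (auto simp: c1_def)
  show ?thesis
  proof (rule c1I[of _ "\<lambda>x. f' x * g x + g' x * f x"])
    show "((\<lambda>x. f x * g x) has_real_derivative f' x * g x + g' x * f x) (at x)" for x by (rule DERIV_mult[OF d(1,3)])
    show "continuous_on UNIV (\<lambda>x. f' x * g x + g' x * f x)"
      by (intro continuous_on_add continuous_on_mult d(2,4) c1_continuous assms)
  qed
qed

lemma c1_inverse: assumes "c1 f" "\<And>x. f x \<noteq> 0" shows "c1 (\<lambda>x. inverse (f x))"
proof -
  obtain f' where d: "\<And>x. (f has_real_derivative f' x) (at x)" "continuous_on UNIV f'" using assms by (auto simp: c1_def)
  show ?thesis
  proof (rule c1I[of _ "\<lambda>x. - (f' x * (inverse (f x) * inverse (f x)))"])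
    show "((\<lambda>x. inverse (f x)) has_real_derivative - (f' x * (inverse (f x) * inverse (f x)))) (at x)" for x
      using d(1) assms(2) by (auto intro!: derivative_eq_intros)
    show "continuous_on UNIV (\<lambda>x. - (f' x * (inverse (f x) * inverse (f x))))"
      using assms(2) by (intro continuous_on_minus continuous_on_mult continuous_on_inverse d(2) DERIV_cont[OF d(1)]) auto
  qed
qed

lemma c1_comp: assumes "c1 f" "c1 g" shows "c1 (\<lambda>x. f (g x))"
proof -
  obtain f' g' where d: "\<And>x. (f has_real_derivative f' x) (at x)" "continuous_on UNIV f'"
    "\<And>x. (g has_real_derivative g' x) (at x)" "continuous_on UNIV g'" using assms by (auto simp: c1_def)
  show ?thesis
  proof (rule c1I[of _ "\<lambda>x. f' (g x) * g' x"])
    show "((\<lambda>x. f (g x)) has_real_derivative f' (g x) * g' x) (at x)" for x by (rule DERIV_chain2[OF d(1,3)])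
    show "continuous_on UNIV (\<lambda>x. f' (g x) * g' x)"
      by (intro continuous_on_mult d(4) continuous_on_compose2[OF d(2) c1_continuous[OF assms(2)]]) auto
  qed
qed

lemma c2_const: "c2 (\<lambda>x. c)" by (rule c2I[of _ "\<lambda>x. 0"]) (auto intro: c1_const)

lemma c2_ident: "c2 (\<lambda>x. x)" by (rule c2I[of _ "\<lambda>x. 1"]) (auto intro: c1_const)

lemma c2_add: assumes "c2 f" "c2 g" shows "c2 (\<lambda>x. f x + g x)"
proof -
  obtain f' g' where "\<And>x. (f has_real_derivative f' x) (at x)" "c1 f'"
    "\<And>x. (g has_real_derivative g' x) (at x)" "c1 g'" using assms by (auto simp: c2_def)
  then show ?thesis by (intro c2I[of _ "\<lambda>x. f' x + g' x"] c1_add DERIV_add)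
qed

lemma c2_mult: assumes "c2 f" "c2 g" shows "c2 (\<lambda>x. f x * g x)"
proof -
  obtain f' g' where d: "\<And>x. (f has_real_derivative f' x) (at x)" "c1 f'"
    "\<And>x. (g has_real_derivative g' x) (at x)" "c1 g'" using assms by (auto simp: c2_def)
  show ?thesis
  proof (rule c2I[of _ "\<lambda>x. f' x * g x + g' x * f x"])
    show "((\<lambda>x. f x * g x) has_real_derivative f' x * g x + g' x * f x) (at x)" for x by (rule DERIV_mult[OF d(1,3)])
    show "c1 (\<lambda>x. f' x * g x + g' x * f x)" by (intro c1_add c1_mult d(2,4) c2_c1 assms)
  qed
qed

lemma c2_inverse: assumes "c2 f" "\<And>x. f x \<noteq> 0" shows "c2 (\<lambda>x. inverse (f x))"
proof -
  obtain f' where d: "\<And>x. (f has_real_derivative f' x) (at x)" "c1 f'" using assms by (auto simp: c2_def)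
  show ?thesis
  proof (rule c2I[of _ "\<lambda>x. (- 1) * (f' x * (inverse (f x) * inverse (f x)))"])
    show "((\<lambda>x. inverse (f x)) has_real_derivative (- 1) * (f' x * (inverse (f x) * inverse (f x)))) (at x)" for x
      using d(1) assms(2) by (auto intro!: derivative_eq_intros)
    show "c1 (\<lambda>x. (- 1) * (f' x * (inverse (f x) * inverse (f x))))"
      by (intro c1_mult c1_const d(2) c1_inverse c2_c1 assms)
  qed
qed

lemma c2_comp: assumes "c2 f" "c2 g" shows "c2 (\<lambda>x. f (g x))"
proof -
  obtain f' g' where d: "\<And>x. (f has_real_derivative f' x) (at x)" "c1 f'"
    "\<And>x. (g has_real_derivative g' x) (at x)" "c1 g'" using assms by (auto simp: c2_def)
  show ?thesis
  proof (rule c2I[of _ "\<lambda>x. f' (g x) * g' x"])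
    show "((\<lambda>x. f (g x)) has_real_derivative f' (g x) * g' x) (at x)" for x by (rule DERIV_chain2[OF d(1,3)])
    show "c1 (\<lambda>x. f' (g x) * g' x)" by (intro c1_mult d(4) c1_comp[OF d(2)] c2_c1 assms)
  qed
qed

lemma c2_exp_cutoff: "c2 (exp_cutoff p)"
  by (rule c2I[OF has_derivative_exp_cutoff], rule c1I[OF has_derivative_exp_cutoff])
    (rule DERIV_cont[OF has_derivative_exp_cutoff])

lemma exp_cutoff_1_mono: "x \<le> y \<Longrightarrow> exp_cutoff 1 x \<le> exp_cutoff 1 y" by (auto simp: exp_cutoff_def frac_le)

lemma exp_cutoff_1_nonneg: "exp_cutoff 1 x \<ge> 0" by (simp add: exp_cutoff_def)

lemma exp_cutoff_1_pos: "x > 0 \<Longrightarrow> exp_cutoff 1 x > 0" by (simp add: exp_cutoff_def)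

lemma exp_cutoff_nonpos: "x \<le> 0 \<Longrightarrow> exp_cutoff p x = 0" by (simp add: exp_cutoff_def)

text \<open>The profile of a radial contraction: the plateau quotient of \<open>cutoff\<close>
  again, now in one variable, where monotonicity follows by cross-multiplication.\<close>

lemma c2_step:
  assumes "t < (T::real)" "0 < l" "l \<le> 1"
  obtains q where "c2 q" "mono q" "\<And>w. w \<le> t \<Longrightarrow> q w = l" "\<And>w. w \<ge> T \<Longrightarrow> q w = 1" "\<And>w. l \<le> q w" "\<And>w. q w \<le> 1"
proof -
  define N where "N w = exp_cutoff 1 (T + (- 1) * w) + exp_cutoff 1 (w + (- t))" for w
  have N: "N w > 0" for w
  proof (cases "w < T")
    case True
    then show ?thesis using exp_cutoff_1_pos[of "T + (- 1) * w"] exp_cutoff_1_nonneg[of "w + (- t)"] by (simp add: N_def)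
  next
    case False
    then show ?thesis using exp_cutoff_1_pos[of "w + (- t)"] exp_cutoff_1_nonneg[of "T + (- 1) * w"] assms(1) by (simp add: N_def)
  qed
  define E where "E w = exp_cutoff 1 (T + (- 1) * w) * inverse (N w)" for w
  have E01: "0 \<le> E w" "E w \<le> 1" for w
    using N[of w] exp_cutoff_1_nonneg[of "T + (- 1) * w"] exp_cutoff_1_nonneg[of "w + (- t)"]
    by (auto simp: E_def N_def divide_le_eq_1 simp flip: divide_inverse)
  have Emono: "E w' \<le> E w" if "w \<le> w'" for w w'
  proof -
    define a b a' b' where "a = exp_cutoff 1 (T + (- 1) * w)" and "b = exp_cutoff 1 (w + (- t))"
      and "a' = exp_cutoff 1 (T + (- 1) * w')" and "b' = exp_cutoff 1 (w' + (- t))"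
    have "a' \<le> a" "b \<le> b'" using that by (auto simp: a_def a'_def b_def b'_def intro: exp_cutoff_1_mono)
    moreover have "0 \<le> a'" "0 \<le> b" by (auto simp: a'_def b_def exp_cutoff_1_nonneg)
    ultimately have "a' * b \<le> a * b'" by (intro mult_mono) auto
    then have "a' * (a + b) \<le> a * (a' + b')" by (simp add: algebra_simps)
    moreover have "a + b > 0" "a' + b' > 0" using N[of w] N[of w'] by (auto simp: N_def a_def b_def a'_def b'_def)
    ultimately have "a' / (a' + b') \<le> a / (a + b)" by (simp add: divide_le_eq pos_le_divide_eq mult.commute)
    then show ?thesis by (simp add: E_def N_def a_def b_def a'_def b'_def divide_inverse)
  qed
  have cE: "c2 E" unfolding E_def N_def
    by (intro c2_mult c2_inverse c2_add c2_comp[OF c2_exp_cutoff] c2_const c2_ident) (use N in \<open>simp add: N_def less_imp_neq[THEN not_sym]\<close>)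
  define q where "q w = 1 + (- (1 - l)) * E w" for w
  show ?thesis
  proof (rule that[of q])
    show "c2 q" unfolding q_def by (intro c2_add c2_mult c2_const cE)
    show "mono q"
    proof (rule monoI)
      fix w w' :: real assume "w \<le> w'"
      from mult_left_mono[OF Emono[OF this], of "1 - l"] show "q w \<le> q w'" using assms(3) by (simp add: q_def algebra_simps)
    qed
    show "q w = l" if "w \<le> t" for w
    proof -
      have "E w = 1" using N[of w] that by (simp add: E_def N_def exp_cutoff_nonpos)
      then show ?thesis by (simp add: q_def)
    qed
    show "q w = 1" if "w \<ge> T" for w using that by (simp add: q_def E_def exp_cutoff_nonpos)
    show "l \<le> q w" for w
      using mult_left_mono[OF E01(2)[of w], of "1 - l"] assms(3) by (simp add: q_def algebra_simps)
    show "q w \<le> 1" for w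
      using mult_nonneg_nonneg[of "1 - l" "E w"] E01(1)[of w] assms(3) by (simp add: q_def algebra_simps)
  qed
qed

text \<open>A derivative bounded below forces at least linear growth, hence surjectivity by the
  intermediate value theorem and a Lipschitz inverse. The formula for the derivative of the inverse
  then yields one order of differentiability after the other.\<close>

lemma c2_inverse_function:
  assumes "\<And>v. (A has_real_derivative A' v) (at v)" "c1 A'" "m > 0" "\<And>v. A' v \<ge> m"
  obtains B where "c2 B" "\<And>v. B (A v) = v" "\<And>w. A (B w) = w"
proof -
  have lower: "m * (v' - v) \<le> A v' - A v" if vv: "v \<le> v'" for v v'
  proof (cases "v < v'")
    case True
    obtain z where "v < z" "z < v'" "A v' - A v = (v' - v) * A' z" using MVT2[OF True, of A A'] assms(1) by blast
    then show ?thesis using assms(4)[of z] vv by (simp add: mult.commute mult_left_mono)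
  qed (use vv in simp)
  have smono: "strict_mono A"
  proof (rule strict_monoI)
    fix v v' :: real assume "v < v'"
    then show "A v < A v'" using lower[of v v'] assms(3) mult_pos_pos[of m "v' - v"] by linarith
  qed
  then have inj: "inj A" by (rule strict_mono_imp_inj_on)
  have "\<exists>v. A v = w" for w
  proof -
    define a where "a = \<bar>w - A 0\<bar> / m"
    have a: "a \<ge> 0" "m * a = \<bar>w - A 0\<bar>" using assms(3) by (auto simp: a_def)
    have "A (- a) \<le> w" "w \<le> A a" using lower[of "- a" 0] lower[of 0 a] a by auto
    moreover have "\<forall>v. - a \<le> v \<and> v \<le> a \<longrightarrow> isCont A v" using DERIV_isCont[OF assms(1)] by blast
    ultimately show ?thesis using IVT[of A "- a" w a] a(1) by force
  qed
  then have surj: "surj A" by (metis surj_def)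
  define B where "B = inv A"
  have BA: "B (A v) = v" for v using inj by (simp add: B_def)
  have AB: "A (B w) = w" for w using surj by (simp add: B_def surj_f_inv_f)
  have Blip: "\<bar>B w - B w'\<bar> \<le> (1 / m) * \<bar>w - w'\<bar>" for w w' using lower[of "B w" "B w'"] lower[of "B w'" "B w"] assms(3)
    by (cases "B w \<le> B w'") (auto simp: AB field_simps abs_if)
  have "(1 / m)-lipschitz_on UNIV B"
    by (rule lipschitz_onI) (use Blip assms(3) in \<open>auto simp: dist_real_def\<close>)
  then have Bc: "isCont B w" for w using lipschitz_on_continuous_on continuous_on_eq_continuous_at open_UNIV by blast
  have A'0: "A' v \<noteq> 0" for v using assms(3) assms(4)[of v] by auto
  have dB: "(B has_real_derivative inverse (A' (B w))) (at w)" for w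
    by (rule DERIV_inverse_function[OF assms(1) A'0, of "w - 1" _ "w + 1"]) (use AB Bc in auto)
  have c1B: "c1 B"
  proof (rule c1I[OF dB])
    show "continuous_on UNIV (\<lambda>w. inverse (A' (B w)))"
      by (intro continuous_on_inverse continuous_on_compose2[OF c1_continuous[OF assms(2)] DERIV_cont[OF dB]])
        (use A'0 in auto)
  qed
  have "c2 B" by (rule c2I[OF dB]) (rule c1_inverse[OF c1_comp[OF assms(2) c1B] A'0])
  then show ?thesis by (rule that[OF _ BA AB])
qed

text \<open>The factor depends on the squared distance, which is smooth at the centre too.\<close>

lemma reg_radial:
  assumes "1 \<le> p" "c2 q" shows "reg p UNIV (\<lambda>x. c + q ((norm (x - c))\<^sup>2) *\<^sub>R (x - c))"
proof (rule reg_C2[OF assms(1) open_UNIV])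
  fix m
  from assms(2)[unfolded c2_def] obtain q' where q1: "\<forall>t. (q has_real_derivative q' t) (at t)" "c1 q'" by blast
  from q1(2)[unfolded c1_def] obtain q'' where q2: "\<forall>t. (q' has_real_derivative q'' t) (at t)" "continuous_on UNIV q''" by blast
  have q: "(q has_real_derivative q' t) (at t)" "(q' has_real_derivative q'' t) (at t)" "continuous_on UNIV q''" for t
    using q1 q2 by auto
  have q'c: "continuous_on UNIV q'" by (rule DERIV_cont[OF q(2)])
  let ?s = "\<lambda>x. (norm (x - c))\<^sup>2"
  define gs where "gs i x = partial_deriv i ?s x" for i x
  have s: "C1 ?s gs" unfolding gs_def[abs_def] by (rule smooth_C1[OF smooth_norm_sq])
  have s2: "C1 (gs i) (\<lambda>j. partial_deriv j (gs i))" for i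
    unfolding gs_def[abs_def] by (rule smooth_C1[OF smooth_partial[OF smooth_norm_sq]])
  have x: "C1 (\<lambda>x. x $ m + (- (c $ m))) (\<lambda>i x. (if i = m then 1 else 0) + 0)" by (intro C1_add C1_nth C1_const)
  note qs = C1_comp_real[OF s q(1) q'c] and q's = C1_comp_real[OF s q(2,3)]
  have F: "C1 (\<lambda>x. c $ m + q (?s x) * (x $ m + (- (c $ m))))
      (\<lambda>i x. 0 + (q (?s x) * ((if i = m then 1 else 0) + 0) + (q' (?s x) * gs i x) * (x $ m + (- (c $ m)))))"
    by (intro C1_add C1_const C1_mult qs x)
  have G: "\<exists>h. C1 (\<lambda>x. 0 + (q (?s x) * ((if i = m then 1 else 0) + 0) + (q' (?s x) * gs i x) * (x $ m + (- (c $ m))))) h" for i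
    by (rule exI, rule C1_add[OF C1_const[of 0] C1_add[OF C1_mult[OF qs C1_const[of "(if i = m then 1 else 0) + 0"]]
        C1_mult[OF C1_mult[OF q's s2[of i]] x]]])
  have eq: "(\<lambda>x. (c + q (?s x) *\<^sub>R (x - c)) $ m) = (\<lambda>x. c $ m + q (?s x) * (x $ m + (- (c $ m))))" by auto
  show "\<exists>g. C1 (\<lambda>x. (c + q (?s x) *\<^sub>R (x - c)) $ m) g \<and> (\<forall>i. \<exists>h. C1 (g i) h)"
    unfolding eq by (rule exI, rule conjI, rule F, rule allI, rule G)
qed

text \<open>The inverse of a radial map is radial; its factor comes from inverting the one-variable
  map \<open>A\<close> that describes how \<rho> transforms squared distances to
  \<open>c\<close>.\<close>

lemma radial_contraction:
  fixes c :: "real^'n"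
  assumes "1 \<le> p" "0 < t" "t < T" "0 < l" "l \<le> 1"
  obtains \<rho> \<rho>' where "\<And>x. \<rho>' (\<rho> x) = x" "\<And>x. \<rho> (\<rho>' x) = x" "LWemb p UNIV \<rho>" "LWemb p UNIV \<rho>'"
    "\<And>x. x \<in> cball c t \<Longrightarrow> \<rho> x = c + l *\<^sub>R (x - c)" "\<And>x. x \<notin> ball c T \<Longrightarrow> \<rho> x = x"
proof -
  have tT: "t\<^sup>2 < T\<^sup>2" using assms by (intro power_strict_mono) auto
  obtain q where q: "c2 q" "mono q" "\<And>w. w \<le> t\<^sup>2 \<Longrightarrow> q w = l" "\<And>w. w \<ge> T\<^sup>2 \<Longrightarrow> q w = 1" "\<And>w. l \<le> q w" "\<And>w. q w \<le> 1"
    using c2_step[OF tT assms(4,5)] by blast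
  have q0: "q w > 0" for w using q(5)[of w] assms(4) by linarith
  obtain q' where q': "\<And>w. (q has_real_derivative q' w) (at w)" "c1 q'" using q(1) by (auto simp: c2_def)
  have q'pos: "q' w \<ge> 0" for w
    using mono_on_imp_deriv_nonneg[of UNIV q "q' w" w] q(2) q'(1) by (simp add: mono_def mono_on_def)
  \<comment> \<open>On negative arguments, which squared distances never take, the profile is
    constant. This keeps the derivative of \<open>A\<close> bounded below on the whole line, as the
    inverse function lemma requires.\<close>
  have q'0: "q' w = 0" if "w < 0" for w
  proof -
    have "((\<lambda>w. l) has_real_derivative 0) (at w)" by simp
    then have "(q has_real_derivative 0) (at w)"
    proof (rule has_field_derivative_transform_within_open[of _ _ _ "{..<0}"])
      show "l = q x" if "x \<in> {..<0}" for x
      proof -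
        have "x < 0" using that by simp
        then have "x \<le> t\<^sup>2" using zero_le_power2[of t] by linarith
        from q(3)[OF this] show ?thesis by simp
      qed
    qed (use that in auto)
    then show ?thesis using DERIV_unique q'(1) by blast
  qed
  define A where "A v = v * (q v * q v)" for v
  define A' where "A' v = 1 * (q v * q v) + (q' v * q v + q' v * q v) * v" for v
  have dA: "(A has_real_derivative A' v) (at v)" for v unfolding A_def A'_def by (intro DERIV_mult DERIV_ident q'(1))
  have cA': "c1 A'" unfolding A'_def by (intro c1_add c1_mult c1_const c1_ident c2_c1[OF q(1)] q'(2))
  have A'm: "A' v \<ge> l * l" for v
  proof -
    have "l * l \<le> q v * q v" using q(5)[of v] assms(4) by (intro mult_mono) auto
    moreover have "(q' v * q v + q' v * q v) * v \<ge> 0" using q'pos[of v] q0[of v] q'0[of v] by (cases "v < 0") auto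
    ultimately show ?thesis unfolding A'_def mult_1 by linarith
  qed
  obtain B where B: "c2 B" "\<And>v. B (A v) = v" "\<And>w. A (B w) = w"
    using c2_inverse_function[OF dA cA' mult_pos_pos[OF assms(4,4)] A'm] by blast
  define Q where "Q w = inverse (q (B w))" for w
  have cQ: "c2 Q" unfolding Q_def using q0 by (intro c2_inverse c2_comp[OF q(1) B(1)]) (metis less_irrefl)
  define \<rho> where "\<rho> x = c + q ((norm (x - c))\<^sup>2) *\<^sub>R (x - c)" for x
  define \<rho>' where "\<rho>' x = c + Q ((norm (x - c))\<^sup>2) *\<^sub>R (x - c)" for x
  have 1: "\<rho>' (\<rho> x) = x" for x
  proof -
    have "(norm (\<rho> x - c))\<^sup>2 = A ((norm (x - c))\<^sup>2)"
      by (simp add: \<rho>_def A_def power_mult_distrib power2_eq_square)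
    then show ?thesis
      using q0[of "(norm (x - c))\<^sup>2"] by (simp add: \<rho>'_def Q_def B(2)) (simp add: \<rho>_def)
  qed
  have 2: "\<rho> (\<rho>' y) = y" for y
  proof -
    let ?w = "(norm (y - c))\<^sup>2"
    have "(norm (\<rho>' y - c))\<^sup>2 = (Q ?w)\<^sup>2 * ?w" by (simp add: \<rho>'_def power_mult_distrib)
    also have "\<dots> = (Q ?w)\<^sup>2 * A (B ?w)" by (simp add: B(3))
    also have "\<dots> = (Q ?w * q (B ?w))\<^sup>2 * B ?w" unfolding A_def by (simp add: power2_eq_square)
    also have "\<dots> = B ?w" using q0[of "B ?w"] by (simp add: Q_def)
    finally show ?thesis using q0[of "B ?w"] by (simp add: \<rho>_def) (simp add: \<rho>'_def Q_def)
  qed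
  have r: "reg p UNIV \<rho>" "reg p UNIV \<rho>'" unfolding \<rho>_def \<rho>'_def by (intro reg_radial assms(1) q(1) cQ)+
  have s: "range \<rho> = UNIV" "range \<rho>' = UNIV" using 1 2 by (metis surjI)+
  show ?thesis
  proof (rule that[OF 1 2])
    show "LWemb p UNIV \<rho>" by (rule LWembI[OF assms(1) open_UNIV r(1) 1 open_UNIV s(1) r(2)])
    show "LWemb p UNIV \<rho>'" by (rule LWembI[OF assms(1) open_UNIV r(2) 2 open_UNIV s(2) r(1)])
    show "\<rho> x = c + l *\<^sub>R (x - c)" if "x \<in> cball c t" for x
    proof -
      have "(norm (x - c))\<^sup>2 \<le> t\<^sup>2" using that by (intro power_mono) (auto simp: dist_norm norm_minus_commute)
      then show ?thesis by (simp add: \<rho>_def q(3))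
    qed
    show "\<rho> x = x" if "x \<notin> ball c T" for x
    proof -
      have "T\<^sup>2 \<le> (norm (x - c))\<^sup>2" using that assms by (intro power_mono) (auto simp: dist_norm norm_minus_commute)
      then show ?thesis by (simp add: \<rho>_def q(4))
    qed
  qed
qed

section \<open>Self-similar maps\<close>

lemma smooth_scale:
  fixes a :: "real^'n"
  assumes "smooth \<phi>"
  shows "smooth (\<lambda>x. \<phi> (t *\<^sub>R (x - a)))"
    and "partial_deriv i (\<lambda>x. \<phi> (t *\<^sub>R (x - a))) x = t * partial_deriv i \<phi> (t *\<^sub>R (x - a))"
proof -
  have d: "((\<lambda>x. \<psi> (t *\<^sub>R (x - a))) has_derivative (\<lambda>h. frechet_derivative \<psi> (at (t *\<^sub>R (x - a))) (t *\<^sub>R h))) (at x)"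
    if "\<psi> differentiable at (t *\<^sub>R (x - a))" for \<psi> :: "real^'n \<Rightarrow> real" and x
  proof (rule has_derivative_compose[of "\<lambda>x. t *\<^sub>R (x - a)"])
    show "((\<lambda>x. t *\<^sub>R (x - a)) has_derivative (\<lambda>h. t *\<^sub>R h)) (at x)" by (auto intro!: derivative_eq_intros)
    show "(\<psi> has_derivative frechet_derivative \<psi> (at (t *\<^sub>R (x - a)))) (at (t *\<^sub>R (x - a)))"
      using that frechet_derivative_works by blast
  qed
  have p: "partial_deriv i (\<lambda>x. \<psi> (t *\<^sub>R (x - a))) x = t * partial_deriv i \<psi> (t *\<^sub>R (x - a))"
    if "\<psi> differentiable at (t *\<^sub>R (x - a))" for \<psi> :: "real^'n \<Rightarrow> real" and x i
    using that linear_frechet_derivative[OF that]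
    by (subst partial_deriv_eq[OF d[OF that]]) (simp add: partial_deriv_def linear_cmul)
  \<comment> \<open>The constant \<open>c\<close> collects the factors \<open>t\<close> produced by
    successive derivatives.\<close>
  have "smooth_upto n \<psi> \<Longrightarrow> smooth_upto n (\<lambda>x. c * \<psi> (t *\<^sub>R (x - a)))" for n \<psi> c
  proof (induction n arbitrary: \<psi> c)
    case 0
    have "(\<lambda>x. \<psi> (t *\<^sub>R (x - a))) differentiable at x" for x using d[of \<psi> x] 0 by (auto simp: differentiable_def)
    then show ?case by (simp add: differentiable_mult)
  next
    case (Suc n)
    have df: "\<psi> differentiable at x" for x using Suc.prems by simp
    have dc: "(\<lambda>x. \<psi> (t *\<^sub>R (x - a))) differentiable at x" for x using d[OF df] by (auto simp: differentiable_def)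
    have "partial_deriv i (\<lambda>x. c * \<psi> (t *\<^sub>R (x - a))) = (\<lambda>x. (c * t) * partial_deriv i \<psi> (t *\<^sub>R (x - a)))" for i
    proof
      fix x
      have "partial_deriv i (\<lambda>x. c :: real) x = 0" by (simp add: partial_deriv_def)
      then show "partial_deriv i (\<lambda>x. c * \<psi> (t *\<^sub>R (x - a))) x = (c * t) * partial_deriv i \<psi> (t *\<^sub>R (x - a))"
        using partial_deriv_mult[of "\<lambda>x. c" x "\<lambda>x. \<psi> (t *\<^sub>R (x - a))" i] dc by (simp add: p[OF df])
    qed
    then show ?case using Suc dc by (auto intro!: differentiable_mult)
  qed
  from this[of _ \<phi> 1] show "smooth (\<lambda>x. \<phi> (t *\<^sub>R (x - a)))" using assms by (simp add: smooth_iff_upto)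
  show "partial_deriv i (\<lambda>x. \<phi> (t *\<^sub>R (x - a))) x = t * partial_deriv i \<phi> (t *\<^sub>R (x - a))"
    by (rule p[OF smooth_differentiable[OF assms]])
qed

lemma AE_lebesgue_neq: "AE x in lebesgue. x \<noteq> (a :: 'a :: euclidean_space)"
  by (rule AE_completion) (rule AE_lborel_singleton)

text \<open>Test functions are cut off near \<open>a\<close> at scale 1/N. The gradient of the
  cutoff is of size N on a ball of measure of order N^-n, so for bounded \<open>u\<close> the error
  is of order N^(1-n), which tends to 0 as n \<ge> 2.\<close>

lemma weak_deriv_remove_point:
  fixes u v :: "real^'n \<Rightarrow> real"
  assumes n: "CARD('n) \<ge> 2" and O: "open X" "a \<in> X" and w: "weak_deriv (X - {a}) [i] u v"
    and uv: "Linf_loc X u" "Lp_loc 1 X v"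
  shows "weak_deriv X [i] u v" unfolding weak_deriv_1_iff[OF O(1)]
proof (intro conjI allI impI)
  show u1: "Lp_loc 1 X u" by (rule Linf_loc_imp_Lp_loc[OF _ O(1) uv(1)]) simp
  show "Lp_loc 1 X v" by fact
  fix \<phi> assume t: "test_function X \<phi>"
  let ?c0 = "cutoff 1 2 (0::real^'n)"
  define ct where "ct k x = ?c0 (real (Suc k) *\<^sub>R (x - a))" for k x
  have c0: "smooth ?c0" by (rule smooth_cutoff) auto
  have sm: "smooth (ct k)" for k unfolding ct_def by (rule smooth_scale(1)[OF c0])
  have pct: "partial_deriv i (ct k) x = real (Suc k) * partial_deriv i ?c0 (real (Suc k) *\<^sub>R (x - a))" for k x
    unfolding ct_def by (rule smooth_scale(2)[OF c0])
  \<comment> \<open>The support has radius 2 and lies in the open ball of radius 3, whence the radii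
    \<open>3 / real (Suc k)\<close> below.\<close>
  have c0t: "test_function (ball 0 3) ?c0"
  proof (rule test_function_I[OF c0 compact_cball])
    show "cball (0::real^'n) 2 \<subseteq> ball 0 3" by auto
    show "?c0 x = 0" if "x \<notin> cball 0 2" for x using that by (intro cutoff_eq_0) auto
  qed
  obtain M where M: "M > 0" "\<And>x. \<bar>partial_deriv i ?c0 x\<bar> \<le> M"
    using test_function_bounded[OF test_function_partial[OF c0t]] by blast
  obtain B\<phi> where B\<phi>: "B\<phi> > 0" "\<And>x. \<bar>\<phi> x\<bar> \<le> B\<phi>" using test_function_bounded[OF t] by blast
  obtain r B where rB: "r > 0" "B \<ge> 0" "\<And>s. s \<le> r \<Longrightarrow> AE y in lebesgue. y \<in> ball a s \<longrightarrow> \<bar>u y\<bar> \<le> B"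
    using Linf_loc_obtain[OF uv(1) O(2)] by blast
  have ct1: "ct k x = 1" if "norm (x - a) \<le> 1 / real (Suc k)" for k x
  proof -
    have "real (Suc k) * norm (x - a) \<le> 1" using that by (simp add: field_simps del: of_nat_Suc)
    then have "norm (real (Suc k) *\<^sub>R (x - a) - 0) \<le> 1" by (simp only: norm_scaleR diff_0_right abs_of_nat)
    then show ?thesis unfolding ct_def by (intro cutoff_eq_1) auto
  qed
  have ct0: "ct k x = 0" if "norm (x - a) \<ge> 2 / real (Suc k)" for k x
  proof -
    have "real (Suc k) * norm (x - a) \<ge> 2" using that by (simp add: field_simps del: of_nat_Suc)
    then have "norm (real (Suc k) *\<^sub>R (x - a) - 0) \<ge> 2" by (simp only: norm_scaleR diff_0_right abs_of_nat)
    then show ?thesis unfolding ct_def by (intro cutoff_eq_0) auto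
  qed
  have pct0: "partial_deriv i (ct k) x = 0" if "x \<notin> ball a (3 / real (Suc k))" for k x
  proof -
    have "real (Suc k) * norm (x - a) \<ge> 3"
      using that by (simp add: field_simps dist_norm norm_minus_commute del: of_nat_Suc)
    then have "real (Suc k) *\<^sub>R (x - a) \<notin> ball 0 3"
      by (simp only: mem_ball dist_0_norm norm_scaleR abs_of_nat not_less)
    then show ?thesis using test_function_zero_outside[OF test_function_partial[OF c0t]] by (simp add: pct del: of_nat_Suc)
  qed
  have tk: "test_function (X - {a}) (\<lambda>x. \<phi> x * (1 - ct k x))" for k
  proof (rule test_function_compact[OF t])
    fix K assume K: "compact K" "K \<subseteq> X" "\<And>x. x \<notin> K \<Longrightarrow> \<phi> x = 0"
    show ?thesis
    proof (rule test_function_I)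
      show "smooth (\<lambda>x. \<phi> x * (1 - ct k x))"
        by (intro smooth_mult smooth_diff smooth_const sm test_function_smooth[OF t])
      show "compact (K - ball a (1 / real (Suc k)))" by (rule compact_diff[OF K(1) open_ball])
      show "K - ball a (1 / real (Suc k)) \<subseteq> X - {a}" using K(2) by auto
      show "\<phi> x * (1 - ct k x) = 0" if "x \<notin> K - ball a (1 / real (Suc k))" for x
      proof (cases "x \<in> K")
        case True
        then have "norm (x - a) \<le> 1 / real (Suc k)" using that by (auto simp: dist_norm norm_minus_commute)
        then show ?thesis by (simp add: ct1)
      qed (simp add: K(3))
    qed
  qed
  have Oa: "open (X - {a})" using O(1) by (simp add: open_delete)
  note I = test_mult_integrable[OF _ _ O(1)]
  have smd: "smooth (\<lambda>x. 1 - ct k x)" for k by (intro smooth_diff smooth_const sm)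
  \<comment> \<open>\<open>A k + D k = E k\<close> is the weak derivative identity for the truncated
    test function. \<open>A\<close> and \<open>D\<close> converge to the two integrals of the claim,
    and \<open>E\<close>, which contains the derivative of the cutoff, to 0.\<close>
  define E where "E k = (LINT x|lebesgue. u x * (\<phi> x * partial_deriv i (ct k) x))" for k
  define A where "A k = (LINT x|lebesgue. (u x * partial_deriv i \<phi> x) * (1 - ct k x))" for k
  define D where "D k = (LINT x|lebesgue. (v x * \<phi> x) * (1 - ct k x))" for k
  have iE: "integrable lebesgue (\<lambda>x. u x * (\<phi> x * partial_deriv i (ct k) x))" for k
    by (rule I[OF u1 test_function_mult[OF t smooth_partial[OF sm]]])
  have iA: "integrable lebesgue (\<lambda>x. (u x * partial_deriv i \<phi> x) * (1 - ct k x))" for k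
    using I[OF u1 test_function_mult[OF test_function_partial[OF t] smd]] by (simp add: mult.assoc)
  have eq: "A k + D k = E k" for k
  proof -
    have pd: "partial_deriv i (\<lambda>x. \<phi> x * (1 - ct k x)) x = \<phi> x * (- partial_deriv i (ct k) x) + partial_deriv i \<phi> x * (1 - ct k x)" for x
    proof -
      have "partial_deriv i (\<lambda>x. 1 - ct k x) x = - partial_deriv i (ct k) x"
        unfolding partial_deriv_def using smooth_differentiable[OF sm, of k x]
        by (intro partial_deriv_eq[unfolded partial_deriv_def]) (auto intro!: derivative_eq_intros simp: frechet_derivative_works)
      then show ?thesis
        by (subst partial_deriv_mult[OF smooth_differentiable[OF test_function_smooth[OF t]] smooth_differentiable[OF smd]]) simp
    qed
    have "(LINT x|lebesgue. u x * partial_deriv i (\<lambda>x. \<phi> x * (1 - ct k x)) x) =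
        (LINT x|lebesgue. (u x * partial_deriv i \<phi> x) * (1 - ct k x) - u x * (\<phi> x * partial_deriv i (ct k) x))"
      by (rule Bochner_Integration.integral_cong[OF refl]) (subst pd, simp add: algebra_simps)
    also have "\<dots> = A k - E k" unfolding A_def E_def by (rule Bochner_Integration.integral_diff[OF iA iE])
    finally have "A k - E k = - (LINT x|lebesgue. v x * (\<phi> x * (1 - ct k x)))"
      using weak_derivD(3)[OF w Oa tk] by simp
    then show ?thesis by (simp add: D_def mult.assoc)
  qed
  have lim: "(\<lambda>k. LINT x|lebesgue. g x * (1 - ct k x)) \<longlonglongrightarrow> (LINT x|lebesgue. g x)" if g: "integrable lebesgue g" for g
  proof (rule integral_dominated_convergence[where w = "\<lambda>x. \<bar>g x\<bar>"])
    show "g \<in> borel_measurable lebesgue" using g by simp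
    show "(\<lambda>x. g x * (1 - ct k x)) \<in> borel_measurable lebesgue" for k
    proof -
      have "(\<lambda>x. 1 - ct k x) \<in> borel_measurable borel"
        by (rule borel_measurable_continuous_onI) (rule smooth_continuous[OF smd])
      then have "(\<lambda>x. 1 - ct k x) \<in> borel_measurable lebesgue" by (intro measurable_completion) simp
      then show ?thesis using g by simp
    qed
    show "integrable lebesgue (\<lambda>x. \<bar>g x\<bar>)" using g by simp
    show "AE x in lebesgue. (\<lambda>k. g x * (1 - ct k x)) \<longlonglongrightarrow> g x" using AE_lebesgue_neq[of a]
    proof eventually_elim
      case (elim x)
      then have x: "norm (x - a) > 0" by simp
      obtain N where N: "2 / norm (x - a) < real N" using reals_Archimedean2 by blast
      have "g x * (1 - ct k x) = g x" if "k \<ge> N" for k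
      proof -
        have "2 / norm (x - a) \<le> real (Suc k)" using N that by linarith
        then have "2 / real (Suc k) \<le> norm (x - a)" using x by (simp add: field_simps del: of_nat_Suc)
        then show ?thesis by (simp add: ct0)
      qed
      then have "eventually (\<lambda>k. g x = g x * (1 - ct k x)) sequentially" unfolding eventually_sequentially by metis
      then show ?case by (rule Lim_transform_eventually[OF tendsto_const])
    qed
    have "\<bar>1 - ct k x\<bar> \<le> 1" for k x
      unfolding ct_def using cutoff_bounds[of 1 2 "0::real^'n" "real (Suc k) *\<^sub>R (x - a)"] by auto
    then show "AE x in lebesgue. norm (g x * (1 - ct k x)) \<le> \<bar>g x\<bar>" for k
      by (intro AE_I2) (simp add: abs_mult mult_left_le)
  qed
  have "(\<lambda>k. A k + D k) \<longlonglongrightarrow> (LINT x|lebesgue. u x * partial_deriv i \<phi> x) + (LINT x|lebesgue. v x * \<phi> x)"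
    unfolding A_def D_def by (intro tendsto_add lim I[OF u1 test_function_partial[OF t]] I[OF uv(2) t])
  moreover have "E \<longlonglongrightarrow> 0"
  proof -
    define Z where "Z = B * B\<phi> * M * (3 ^ CARD('n) * measure lborel (ball (0::real^'n) 1))"
    have "\<bar>E k\<bar> \<le> Z * (1 / real (Suc k))" if k: "3 / r \<le> real k" for k
    proof -
      let ?N = "real (Suc k)"
      have N: "?N > 0" "3 / ?N \<le> r" using k rB(1) by (auto simp: field_simps)
      have "\<bar>E k\<bar> \<le> (LINT x|lebesgue. \<bar>u x * (\<phi> x * partial_deriv i (ct k) x)\<bar>)"
        unfolding E_def using Bochner_Integration.integral_norm_bound[of lebesgue "\<lambda>x. u x * (\<phi> x * partial_deriv i (ct k) x)"] by simp
      also have "\<dots> \<le> (LINT x|lebesgue. (B * (B\<phi> * (?N * M))) * indicator (ball a (3 / ?N)) x)"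
      proof (rule integral_mono_AE)
        show "integrable lebesgue (\<lambda>x. \<bar>u x * (\<phi> x * partial_deriv i (ct k) x)\<bar>)" using iE by simp
        show "integrable lebesgue (\<lambda>x. (B * (B\<phi> * (?N * M))) * indicator (ball a (3 / ?N)) x)"
          by (intro Bochner_Integration.integrable_mult_right integrable_real_indicator)
            (use emeasure_lborel_ball_finite[of a "3 / (1 + real k)"] in \<open>auto simp: top.not_eq_extremum\<close>)
        show "AE x in lebesgue. \<bar>u x * (\<phi> x * partial_deriv i (ct k) x)\<bar> \<le> (B * (B\<phi> * (?N * M))) * indicator (ball a (3 / ?N)) x"
          using rB(3)[OF N(2)]
        proof eventually_elim
          case (elim x)
          show ?case
          proof (cases "x \<in> ball a (3 / ?N)")
            case True
            have "\<bar>partial_deriv i (ct k) x\<bar> \<le> ?N * M" using M N by (simp add: pct abs_mult mult_left_mono del: of_nat_Suc)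
            then have "\<bar>u x\<bar> * (\<bar>\<phi> x\<bar> * \<bar>partial_deriv i (ct k) x\<bar>) \<le> B * (B\<phi> * (?N * M))"
              using elim True B\<phi> rB M N by (intro mult_mono) auto
            then show ?thesis using True by (simp add: abs_mult del: mem_ball of_nat_Suc)
          qed (simp add: pct0 del: of_nat_Suc)
        qed
      qed
      also have "\<dots> = (B * (B\<phi> * (?N * M))) * ((3 / ?N) ^ CARD('n) * measure lborel (ball (0::real^'n) 1))"
        using content_ball_conv_unit_ball[of "3 / ?N" a] N by (simp del: of_nat_Suc)
      also have "\<dots> = Z * (?N * (1 / ?N) ^ CARD('n))" by (simp add: Z_def power_divide del: of_nat_Suc)
      \<comment> \<open>Only two of the n factors 1/N are kept: one cancels N and the other tends to
        0.\<close>
      also have "\<dots> \<le> Z * (?N * (1 / ?N) ^ 2)"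
        using rB(2) B\<phi>(1) M(1) n N by (intro mult_left_mono power_decreasing) (auto simp: Z_def)
      also have "\<dots> = Z * (1 / ?N)" using N by (simp add: power2_eq_square del: of_nat_Suc)
      finally show ?thesis .
    qed
    then have "\<forall>k\<ge>nat \<lceil>3 / r\<rceil>. norm (E k) \<le> Z * (1 / real (Suc k))" by (auto simp: nat_le_iff ceiling_le_iff)
    then have "eventually (\<lambda>k. norm (E k) \<le> Z * (1 / real (Suc k))) sequentially"
      unfolding eventually_sequentially by blast
    moreover have "(\<lambda>k. Z * (1 / real (Suc k))) \<longlonglongrightarrow> Z * 0"
      by (intro tendsto_mult tendsto_const LIMSEQ_inverse_real_of_nat[unfolded inverse_eq_divide])
    ultimately show ?thesis using Lim_null_comparison[of E "\<lambda>k. Z * (1 / real (Suc k))"] by simp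
  qed
  ultimately have "(LINT x|lebesgue. u x * partial_deriv i \<phi> x) + (LINT x|lebesgue. v x * \<phi> x) = 0"
    using LIMSEQ_unique unfolding eq by blast
  then show "(LINT x|lebesgue. u x * partial_deriv i \<phi> x) = - (LINT x|lebesgue. v x * \<phi> x)" by linarith
qed

lemma nn_integral_lebesgue_affine:
  fixes t :: "'a::euclidean_space"
  assumes "f \<in> borel_measurable lebesgue" "c \<noteq> 0"
  shows "(\<integral>\<^sup>+x. f x \<partial>lebesgue) = ennreal (\<bar>c\<bar> ^ DIM('a)) * (\<integral>\<^sup>+x. f (t + c *\<^sub>R x) \<partial>lebesgue)"
proof -
  let ?T = "\<lambda>x::'a. t + (\<Sum>j\<in>Basis. (c * (x \<bullet> j)) *\<^sub>R j)"
  have T: "?T x = t + c *\<^sub>R x" for x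
    unfolding scaleR_scaleR[symmetric] scaleR_sum_right[symmetric] euclidean_representation ..
  have m: "?T \<in> lebesgue \<rightarrow>\<^sub>M lebesgue" by (rule lebesgue_affine_measurable) (rule assms(2))
  have "(\<integral>\<^sup>+x. f x \<partial>lebesgue) = (\<integral>\<^sup>+x. f x \<partial>density (distr lebesgue lebesgue ?T) (\<lambda>_. (\<Prod>j\<in>(Basis::'a set). \<bar>c\<bar>)))"
    using lebesgue_affine_euclidean[of "\<lambda>_. c" t] assms(2) by simp
  also have "\<dots> = (\<integral>\<^sup>+x. ennreal (\<bar>c\<bar> ^ DIM('a)) * f x \<partial>distr lebesgue lebesgue ?T)"
    using assms(1) by (subst nn_integral_density) auto
  also have "\<dots> = (\<integral>\<^sup>+x. ennreal (\<bar>c\<bar> ^ DIM('a)) * f (?T x) \<partial>lebesgue)"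
    using assms(1) m by (subst nn_integral_distr) auto
  also have "\<dots> = ennreal (\<bar>c\<bar> ^ DIM('a)) * (\<integral>\<^sup>+x. f (?T x) \<partial>lebesgue)"
    using measurable_compose[OF m assms(1)] by (subst nn_integral_cmult) auto
  finally show ?thesis unfolding T .
qed

text \<open>Under the similarity \<open>h\<close> grows by 1/l while volume shrinks by l^n, so the
  integral of \<open>\<bar>h\<bar> powr p\<close> over successive shells decays by the factor
  l^(n-p). This is where p < n enters.\<close>

lemma self_similar_Lp:
  fixes h :: "real^'n \<Rightarrow> real" and a :: "real^'n"
  assumes p: "1 \<le> p" "p < real CARD('n)" and l: "0 < l" "l < 1" and s: "0 < t" "t < s"
    and hm: "h \<in> borel_measurable lebesgue" and hp: "Lp_loc p (ball a s - {a}) h"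
    and ss: "AE x in lebesgue. x \<in> ball a s - {a} \<longrightarrow> l * h (a + l *\<^sub>R (x - a)) = h x"
  shows "Lp_loc p (ball a t) h"
proof -
  define S where "S x = a + l *\<^sub>R (x - a)" for x :: "real^'n"
  \<comment> \<open>Truncated balls rather than single shells: they increase to the punctured ball,
    and \<open>B (Suc k)\<close> is covered by \<open>B 1\<close> and the similar image of
    \<open>B k\<close>.\<close>
  define B where "B k = {x :: real^'n. l ^ k * t < norm (x - a) \<and> norm (x - a) \<le> t}" for k :: nat
  define g where "g x = ennreal (\<bar>h x\<bar> powr p)" for x
  define J where "J k = (\<integral>\<^sup>+x. g x * indicator (B k) x \<partial>lebesgue)" for k
  define q where "q = l powr (real CARD('n) - p)"
  have q: "0 < q" "q < 1" using l p by (auto simp: q_def powr_def mult_less_0_iff)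
  have "open {x :: real^'n. l ^ k * t < norm (x - a)}" for k by (intro open_Collect_less continuous_intros)
  moreover have "closed {x :: real^'n. norm (x - a) \<le> t}" by (intro closed_Collect_le continuous_intros)
  ultimately have Bm: "B k \<in> sets lebesgue" for k
    unfolding B_def Collect_conj_eq by (intro sets.Int) (auto simp: sets_completionI_sets)
  have gm: "g \<in> borel_measurable lebesgue" unfolding g_def using hm by measurable
  have gBm: "(\<lambda>x. g x * indicator (B k) x) \<in> borel_measurable lebesgue" for k using gm Bm by measurable
  have nS: "norm (S x - a) = l * norm (x - a)" for x using l by (simp add: S_def)
  have J1: "J 1 < \<infinity>"
  proof -
    let ?K = "cball a t - ball a (l * t)"
    have "compact ?K" by (rule compact_diff[OF compact_cball open_ball])
    moreover have "?K \<subseteq> ball a s - {a}" using s l by auto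
    ultimately have "set_integrable lebesgue ?K (\<lambda>x. \<bar>h x\<bar> powr p)" using hp by (auto simp: Lp_loc_def)
    then have "(\<integral>\<^sup>+x. ennreal (norm (indicator ?K x *\<^sub>R (\<bar>h x\<bar> powr p))) \<partial>lebesgue) < \<infinity>"
      by (auto simp: set_integrable_def integrable_iff_bounded)
    moreover have "J 1 \<le> (\<integral>\<^sup>+x. ennreal (norm (indicator ?K x *\<^sub>R (\<bar>h x\<bar> powr p))) \<partial>lebesgue)" unfolding J_def
      by (rule nn_integral_mono) (auto simp: g_def B_def indicator_def dist_norm norm_minus_commute)
    ultimately show ?thesis by (rule le_less_trans[rotated])
  qed
  have step: "J (Suc k) \<le> J 1 + ennreal q * J k" for k
  proof -
    have Sk: "S ` B k \<in> sets lebesgue"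
    proof -
      have "S ` B k = {x. l ^ Suc k * t < norm (x - a)} \<inter> {x. norm (x - a) \<le> l * t}"
      proof (intro set_eqI iffI)
        fix x assume x: "x \<in> {x. l ^ Suc k * t < norm (x - a)} \<inter> {x. norm (x - a) \<le> l * t}"
        let ?y = "a + (1 / l) *\<^sub>R (x - a)"
        have "x = S ?y" using l by (simp add: S_def)
        moreover have "norm (?y - a) = norm (x - a) / l" using l by simp
        then have "?y \<in> B k" unfolding B_def mem_Collect_eq using x l s by (simp only:) (auto simp: field_simps)
        ultimately show "x \<in> S ` B k" by blast
      qed (use l in \<open>auto simp: B_def nS mult.assoc\<close>)
      moreover have "open {x :: real^'n. l ^ Suc k * t < norm (x - a)}" "closed {x :: real^'n. norm (x - a) \<le> l * t}"
        by (intro open_Collect_less closed_Collect_le continuous_intros)+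
      ultimately show ?thesis by (auto simp: sets_completionI_sets)
    qed
    have "J (Suc k) \<le> (\<integral>\<^sup>+x. g x * indicator (B 1) x + g x * indicator (S ` B k) x \<partial>lebesgue)" unfolding J_def
    proof (rule nn_integral_mono)
      fix x
      have "x \<in> S ` B k" if "x \<in> B (Suc k)" "x \<notin> B 1"
      proof
        let ?y = "a + (1 / l) *\<^sub>R (x - a)"
        show "x = S ?y" using l by (simp add: S_def)
        have "norm (?y - a) = norm (x - a) / l" using l by simp
        then show "?y \<in> B k" unfolding B_def mem_Collect_eq using that l s
          by (simp only:) (auto simp: B_def field_simps)
      qed
      then show "g x * indicator (B (Suc k)) x \<le> g x * indicator (B 1) x + g x * indicator (S ` B k) x"
        by (cases "x \<in> B (Suc k)"; cases "x \<in> B 1"; cases "x \<in> S ` B k") auto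
    qed
    also have "\<dots> = J 1 + (\<integral>\<^sup>+x. g x * indicator (S ` B k) x \<partial>lebesgue)"
      unfolding J_def using gBm gm Sk by (intro nn_integral_add) auto
    also have "(\<integral>\<^sup>+x. g x * indicator (S ` B k) x \<partial>lebesgue) = ennreal q * J k"
    proof -
      have inj: "inj S" using l by (auto simp: S_def inj_on_def)
      have "(\<integral>\<^sup>+x. g x * indicator (S ` B k) x \<partial>lebesgue) =
          ennreal (\<bar>l\<bar> ^ CARD('n)) * (\<integral>\<^sup>+x. g (a - l *\<^sub>R a + l *\<^sub>R x) * indicator (S ` B k) (a - l *\<^sub>R a + l *\<^sub>R x) \<partial>lebesgue)"
        using nn_integral_lebesgue_affine[of "\<lambda>x. g x * indicator (S ` B k) x" l "a - l *\<^sub>R a"] gm Sk l by simp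
      also have "(\<integral>\<^sup>+x. g (a - l *\<^sub>R a + l *\<^sub>R x) * indicator (S ` B k) (a - l *\<^sub>R a + l *\<^sub>R x) \<partial>lebesgue) =
          (\<integral>\<^sup>+x. ennreal (l powr (- p)) * (g x * indicator (B k) x) \<partial>lebesgue)"
      proof (rule nn_integral_cong_AE)
        show "AE x in lebesgue. g (a - l *\<^sub>R a + l *\<^sub>R x) * indicator (S ` B k) (a - l *\<^sub>R a + l *\<^sub>R x) =
          ennreal (l powr (- p)) * (g x * indicator (B k) x)" using ss
        proof eventually_elim
          case (elim x)
          have S: "a - l *\<^sub>R a + l *\<^sub>R x = S x" by (simp add: S_def algebra_simps)
          have i: "S x \<in> S ` B k \<longleftrightarrow> x \<in> B k" using inj by (auto simp: inj_def)
          show ?case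
          proof (cases "x \<in> B k")
            case True
            moreover have "0 < l ^ k * t" using l s by simp
            ultimately have "0 < norm (x - a)" "norm (x - a) \<le> t" unfolding B_def mem_Collect_eq by linarith+
            then have "x \<in> ball a s - {a}" using s by (auto simp: dist_norm norm_minus_commute)
            then have "h x = l * h (S x)" using elim by (simp add: S_def)
            then have "\<bar>h (S x)\<bar> = inverse l * \<bar>h x\<bar>" using l by (simp add: abs_mult)
            then have "\<bar>h (S x)\<bar> powr p = l powr (- p) * \<bar>h x\<bar> powr p"
              using l by (simp add: powr_mult powr_minus inverse_powr)
            then show ?thesis unfolding S using True l by (simp add: i g_def ennreal_mult)
          qed (simp add: S i)
        qed
      qed
      also have "\<dots> = ennreal (l powr (- p)) * J k" unfolding J_def using gBm by (rule nn_integral_cmult)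
      also have "ennreal (\<bar>l\<bar> ^ CARD('n)) * (ennreal (l powr (- p)) * J k) = ennreal q * J k"
      proof -
        have "\<bar>l\<bar> ^ CARD('n) * l powr (- p) = q"
          using l by (simp add: q_def powr_diff powr_minus powr_realpow divide_inverse)
        then show ?thesis by (simp add: mult.assoc[symmetric] ennreal_mult[symmetric])
      qed
      finally show ?thesis .
    qed
    finally show ?thesis .
  qed
  obtain j1 where j1: "J 1 = ennreal j1" "j1 \<ge> 0" using J1 by (cases "J 1") auto
  \<comment> \<open>The fixed point of x \<mapsto> j1 + q x, which the recursion
    \<open>step\<close>, starting from 0, never exceeds.\<close>
  define M where "M = j1 / (1 - q)"
  have M: "M \<ge> 0" "j1 + q * M = M" using j1 q by (auto simp: M_def field_simps)
  have Jb: "J k \<le> ennreal M" for k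
  proof (induction k)
    case 0
    have "B 0 = {}" by (auto simp: B_def)
    then show ?case by (simp add: J_def)
  next
    case (Suc k)
    have "J (Suc k) \<le> ennreal j1 + ennreal q * ennreal M"
      using step[of k] Suc by (metis j1(1) add_left_mono mult_left_mono order_trans zero_le)
    also have "\<dots> = ennreal M" using M j1 q by (simp add: ennreal_mult[symmetric] ennreal_plus[symmetric] del: ennreal_plus)
    finally show ?case .
  qed
  have inc: "incseq (\<lambda>k x. g x * indicator (B k) x)"
  proof (rule incseq_SucI, rule le_funI)
    fix k x
    have "B k \<subseteq> B (Suc k)"
    proof
      fix x assume x: "x \<in> B k"
      have "l ^ Suc k * t \<le> l ^ k * t" using l s by (intro mult_right_mono power_decreasing) auto
      then show "x \<in> B (Suc k)" using x by (auto simp: B_def simp del: power_Suc)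
    qed
    then show "g x * indicator (B k) x \<le> g x * indicator (B (Suc k)) x"
      by (intro mult_left_mono) (auto simp: indicator_def)
  qed
  have "(\<integral>\<^sup>+x. (SUP k. g x * indicator (B k) x) \<partial>lebesgue) \<le> ennreal M"
    unfolding nn_integral_monotone_convergence_SUP[OF inc gBm] using Jb by (auto simp: J_def intro: SUP_least)
  moreover have "(\<integral>\<^sup>+x. g x * indicator (ball a t) x \<partial>lebesgue) \<le> (\<integral>\<^sup>+x. (SUP k. g x * indicator (B k) x) \<partial>lebesgue)"
  proof (rule nn_integral_mono_AE)
    show "AE x in lebesgue. g x * indicator (ball a t) x \<le> (SUP k. g x * indicator (B k) x)"
      using AE_lebesgue_neq[of a]
    proof eventually_elim
      case (elim x)
      show ?case
      proof (cases "x \<in> ball a t")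
        case True
        obtain k where "l ^ k < norm (x - a) / t"
          using real_arch_pow_inv[of "norm (x - a) / t" l] l s elim by auto
        then have "x \<in> B k" using True s by (auto simp: B_def dist_norm norm_minus_commute field_simps)
        then show ?thesis using True by (intro SUP_upper2[of k]) auto
      qed simp
    qed
  qed
  ultimately have "(\<integral>\<^sup>+x. g x * indicator (ball a t) x \<partial>lebesgue) \<le> ennreal M" by (rule order_trans[rotated])
  then have fin: "(\<integral>\<^sup>+x. g x * indicator (ball a t) x \<partial>lebesgue) < \<infinity>" by (rule le_less_trans) simp
  have "integrable lebesgue (\<lambda>x. indicator (ball a t) x * \<bar>h x\<bar> powr p)"
  proof (rule integrableI_bounded)
    have "(\<lambda>x. \<bar>h x\<bar> powr p) \<in> borel_measurable lebesgue" using hm by measurable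
    then show "(\<lambda>x. indicator (ball a t) x * \<bar>h x\<bar> powr p) \<in> borel_measurable lebesgue"
      by (intro borel_measurable_times borel_measurable_indicator) auto
    have "(\<integral>\<^sup>+x. ennreal (norm (indicator (ball a t) x * \<bar>h x\<bar> powr p)) \<partial>lebesgue) = (\<integral>\<^sup>+x. g x * indicator (ball a t) x \<partial>lebesgue)"
      by (rule nn_integral_cong) (auto simp: g_def indicator_def)
    then show "(\<integral>\<^sup>+x. ennreal (norm (indicator (ball a t) x * \<bar>h x\<bar> powr p)) \<partial>lebesgue) < \<infinity>" using fin by simp
  qed
  then have L: "Lp_ball p a t h"
    unfolding Lp_ball_def using hm by (simp add: integrable_lebesgue_on_iff measurable_restrict_space1 scaleR_conv_of_real)
  show ?thesis unfolding Lp_loc_iff_ball[OF open_ball]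
  proof
    fix x assume "x \<in> ball a t"
    then obtain r where "r > 0" "ball x r \<subseteq> ball a t" using open_contains_ball[of "ball a t"] open_ball[of a t] by blast
    then show "\<exists>r>0. ball x r \<subseteq> ball a t \<and> Lp_ball p x r h" using Lp_ball_mono[OF L] by blast
  qed
qed

text \<open>By self-similarity a pair of points at comparable distance from \<open>a\<close> is
  rescaled into a fixed compact annulus. If one point is much closer to \<open>a\<close>, then
  \<open>norm (x - y)\<close> is comparable to the larger distance from \<open>a\<close>, which
  controls the distances of both values from \<open>c\<close>.\<close>

lemma self_similar_lipschitz:
  fixes F :: "real^'n \<Rightarrow> real^'n"
  assumes lip: "loc_lip (ball a s - {a}) F" and l: "0 < l" "l < 1" and s: "0 < t" "t < s"
    and ss: "\<And>x. x \<in> ball a s \<Longrightarrow> F (a + l *\<^sub>R (x - a)) = c + l *\<^sub>R (F x - c)"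
  shows "\<exists>L>0. \<forall>x\<in>cball a t. \<forall>y\<in>cball a t. norm (F x - F y) \<le> L * norm (x - y)"
proof -
  \<comment> \<open>Two generations of shells, so that a point of the outer one and a point at most
    one generation deeper are rescaled together.\<close>
  let ?A = "cball a t - ball a (l * (l * t))"
  have A: "compact ?A" by (rule compact_diff[OF compact_cball open_ball])
  have k2: "0 < l * (l * t)" using l s by simp
  have As: "?A \<subseteq> ball a s - {a}" using s k2 by auto
  have "open (ball a s - {a})" by (simp add: open_delete)
  then have Fc: "continuous_on ?A F" using loc_lip_continuous[OF lip] As continuous_on_subset by blast
  \<comment> \<open>The time parameter of this notion runs over a single point; compactness then
    turns local constants into one constant on the annulus.\<close>
  have "local_lipschitz {0::real} ?A (\<lambda>t. F)"
  proof (rule local_lipschitzI)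
    fix t0 x assume "x \<in> ?A"
    then obtain r L where r: "r > 0" "L > 0" "\<forall>y\<in>ball x r. \<forall>z\<in>ball x r. norm (F y - F z) \<le> L * norm (y - z)"
      using lip As unfolding loc_lip_def by blast
    have b: "cball x (r / 2) \<subseteq> ball x r" using r(1) by auto
    show "\<exists>u>0. \<exists>L. \<forall>ta\<in>cball t0 u \<inter> {0}. L-lipschitz_on (cball x u \<inter> ?A) F"
    proof (rule exI[of _ "r / 2"], rule conjI[OF _ exI[of _ L]], use r in simp, rule ballI)
      show "L-lipschitz_on (cball x (r / 2) \<inter> ?A) F"
      proof (rule lipschitz_onI)
        fix y z assume "y \<in> cball x (r / 2) \<inter> ?A" "z \<in> cball x (r / 2) \<inter> ?A"
        then have "y \<in> ball x r" "z \<in> ball x r" using b by blast+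
        then have "norm (F y - F z) \<le> L * norm (y - z)" using r(3) by blast
        then show "dist (F y) (F z) \<le> L * dist y z" by (simp only: dist_norm)
      qed (use r in simp)
    qed
  qed
  then obtain L0 where L0: "\<And>t. t \<in> {0::real} \<Longrightarrow> L0-lipschitz_on ?A F"
    using local_lipschitz_compact_implies_lipschitz[where X = ?A and T = "{0::real}" and f = "\<lambda>t. F"] A by auto
  have L0: "norm (F x - F y) \<le> L0 * norm (x - y)" if "x \<in> ?A" "y \<in> ?A" for x y
    using lipschitz_onD[OF L0[of 0] that] by (simp add: dist_norm)
  have "compact ((\<lambda>x. F x - c) ` ?A)" by (rule compact_continuous_image[OF continuous_on_diff[OF Fc continuous_on_const] A])
  then have "bounded ((\<lambda>x. F x - c) ` ?A)" by (rule compact_imp_bounded)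
  then obtain M where M: "M > 0" "\<And>x. x \<in> ?A \<Longrightarrow> norm (F x - c) \<le> M" unfolding bounded_pos by blast
  \<comment> \<open>The second entry serves pairs in distant shells: there
    \<open>norm (x - y)\<close> is at least \<open>l ^ k * (l * t * (1 - l))\<close>, while the
    values differ by at most \<open>2 * M * l ^ k\<close>.\<close>
  define L where "L = max L0 (2 * M / (l * t * (1 - l)))"
  define I where "I k x = a + l ^ k *\<^sub>R (x - a)" for k :: nat and x
  have Ik: "F (I k x) = c + l ^ k *\<^sub>R (F x - c)" if "x \<in> cball a t" for k x
  proof (induction k)
    case 0
    show ?case by (simp add: I_def)
  next
    case (Suc k)
    have "norm (I k x - a) \<le> norm (x - a)"
      using l power_le_one[of l k] by (simp add: I_def mult_left_le_one_le)
    then have "I k x \<in> ball a s" using that s by (auto simp: dist_norm norm_minus_commute)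
    moreover have "I (Suc k) x = a + l *\<^sub>R (I k x - a)" by (simp add: I_def)
    ultimately show ?case using ss[of "I k x"] Suc by simp
  qed
  have sc: "\<exists>z \<in> cball a t. x = I k z \<and> norm (z - a) = norm (x - a) / l ^ k" if "norm (x - a) \<le> l ^ k * t" for x k
  proof (rule bexI[of _ "a + (1 / l ^ k) *\<^sub>R (x - a)"])
    have "norm (a + (1 / l ^ k) *\<^sub>R (x - a) - a) = norm (x - a) / l ^ k" using l by simp
    moreover have "norm (x - a) / l ^ k \<le> t" using that l by (simp add: field_simps)
    ultimately show "a + (1 / l ^ k) *\<^sub>R (x - a) \<in> cball a t"
      and "x = I k (a + (1 / l ^ k) *\<^sub>R (x - a)) \<and> norm (a + (1 / l ^ k) *\<^sub>R (x - a) - a) = norm (x - a) / l ^ k"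
      using l by (auto simp: I_def dist_norm norm_minus_commute)
  qed
  have level: "\<exists>k. l ^ Suc k * t < norm (x - a) \<and> norm (x - a) \<le> l ^ k * t" if mem: "x \<in> cball a t" and ne: "x \<noteq> a" for x
  proof -
    obtain k where "l ^ k < norm (x - a) / t" using real_arch_pow_inv[of "norm (x - a) / t" l] l s ne by auto
    then have k: "l ^ k * t < norm (x - a)" using s by (simp add: field_simps)
    define m where "m = (LEAST k. l ^ k * t < norm (x - a))"
    have m: "l ^ m * t < norm (x - a)" unfolding m_def by (rule LeastI[of _ k]) (rule k)
    have "m \<noteq> 0" using m mem by (cases m) (auto simp: dist_norm norm_minus_commute)
    then obtain m' where m': "m = Suc m'" by (cases m) auto
    have "\<not> l ^ m' * t < norm (x - a)" using not_less_Least[of m' "\<lambda>k. l ^ k * t < norm (x - a)"] m' by (simp add: m_def)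
    then show ?thesis using m m' by (intro exI[of _ m']) auto
  qed
  \<comment> \<open>\<open>a\<close> is fixed by the similarity of the source, so its value is fixed
    by that of the target.\<close>
  have Fa: "F a = c"
  proof -
    have "F a = c + l *\<^sub>R (F a - c)" using ss[of a] s by simp
    then have "F a - c = l *\<^sub>R (F a - c)" by (metis add.commute diff_eq_eq)
    then have "(1 - l) *\<^sub>R (F a - c) = 0" by (simp add: algebra_simps)
    then show ?thesis using l by simp
  qed
  have bd: "norm (F x - c) \<le> l ^ k * M" if "norm (x - a) \<le> l ^ k * t" for x k
  proof (cases "x = a")
    case False
    have kt: "l ^ k * t \<le> t" using l s power_le_one[of l k] by (simp add: mult_left_le_one_le)
    then have "x \<in> cball a t" using that by (auto simp: dist_norm norm_minus_commute)
    from level[OF this False] obtain j where j: "l ^ Suc j * t < norm (x - a)" "norm (x - a) \<le> l ^ j * t" by blast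
    have "k \<le> j"
    proof (rule ccontr)
      assume "\<not> k \<le> j"
      then have "l ^ k \<le> l ^ Suc j" using l by (intro power_decreasing) auto
      then have "l ^ k * t \<le> l ^ Suc j * t" using s by (intro mult_right_mono) auto
      then show False using that j by linarith
    qed
    obtain z where z: "z \<in> cball a t" "x = I j z" "norm (z - a) = norm (x - a) / l ^ j" using sc[OF j(2)] by blast
    have "l * t < norm (z - a)" unfolding z(3) using j(1) l by (simp add: field_simps)
    moreover have "l * (l * t) \<le> l * t" using l s by (simp add: mult_left_le_one_le)
    ultimately have "z \<in> ?A" using z(1) by (auto simp: dist_norm norm_minus_commute)
    then have "norm (F z - c) \<le> M" by (rule M(2))
    moreover have "F x - c = l ^ j *\<^sub>R (F z - c)" using Ik[OF z(1)] z(2) by simp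
    ultimately have "norm (F x - c) \<le> l ^ j * M" using l by (simp add: mult_left_mono)
    also have "\<dots> \<le> l ^ k * M" using \<open>k \<le> j\<close> l M(1) by (intro mult_right_mono power_decreasing) auto
    finally show ?thesis .
  qed (use Fa M l in simp)
  have main: "norm (F x - F y) \<le> L * norm (x - y)"
    if xy: "x \<in> cball a t" "y \<in> cball a t" "x \<noteq> a" "norm (y - a) \<le> norm (x - a)" for x y
  proof -
    obtain k where k: "l ^ Suc k * t < norm (x - a)" "norm (x - a) \<le> l ^ k * t" using level[OF xy(1,3)] by blast
    have yk: "norm (y - a) \<le> l ^ k * t" using k(2) xy(4) by linarith
    show ?thesis
    proof (cases "norm (y - a) < l * (l ^ Suc k * t)")
      case True
      have "norm (x - a) \<le> norm (x - y) + norm (y - a)" using norm_triangle_ineq[of "x - y" "y - a"] by simp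
      then have "l ^ k * (l * t * (1 - l)) \<le> norm (x - y)" using True k(1) by (simp add: algebra_simps)
      moreover have pos: "0 < l * t * (1 - l)" using l s by simp
      ultimately have "l ^ k \<le> norm (x - y) / (l * t * (1 - l))" by (simp add: pos_le_divide_eq)
      then have "2 * M * l ^ k \<le> 2 * M * (norm (x - y) / (l * t * (1 - l)))" using M(1) by (intro mult_left_mono) auto
      also have "\<dots> \<le> L * norm (x - y)" unfolding L_def
        by (simp only: times_divide_eq_right times_divide_eq_left[symmetric]) (intro mult_right_mono, auto)
      finally have 1: "2 * M * l ^ k \<le> L * norm (x - y)" .
      have "norm (F x - F y) \<le> norm (F x - c) + norm (F y - c)"
        using norm_triangle_ineq4[of "F x - c" "F y - c"] by simp
      then show ?thesis using bd[OF k(2)] bd[OF yk] 1 by (simp add: mult.commute mult.left_commute)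
    next
      case False
      obtain z where z: "z \<in> cball a t" "x = I k z" "norm (z - a) = norm (x - a) / l ^ k" using sc[OF k(2)] by blast
      obtain w where w: "w \<in> cball a t" "y = I k w" "norm (w - a) = norm (y - a) / l ^ k" using sc[OF yk] by blast
      have "l * (l * t) \<le> norm (w - a)" unfolding w(3) using False l by (simp add: field_simps)
      moreover have "norm (w - a) \<le> norm (z - a)" using w(3) z(3) xy(4) l by (simp add: divide_right_mono)
      ultimately have "z \<in> ?A" "w \<in> ?A" using z(1) w(1) by (auto simp: dist_norm norm_minus_commute)
      then have "norm (F z - F w) \<le> L0 * norm (z - w)" by (rule L0)
      also have "\<dots> \<le> L * norm (z - w)" unfolding L_def by (intro mult_right_mono) auto
      finally have "l ^ k * norm (F z - F w) \<le> l ^ k * (L * norm (z - w))" using l by (intro mult_left_mono) auto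
      moreover have "F x - F y = l ^ k *\<^sub>R (F z - F w)" using Ik[OF z(1), of k] Ik[OF w(1), of k] z(2) w(2) by (simp add: scaleR_diff_right)
      moreover have "x - y = l ^ k *\<^sub>R (z - w)" unfolding z(2) w(2) I_def by (simp add: scaleR_diff_right)
      ultimately show ?thesis using l by (simp add: mult.left_commute)
    qed
  qed
  have Lpos: "L > 0" using M l s by (simp add: L_def less_max_iff_disj)
  show ?thesis
  proof (intro exI[of _ L] conjI ballI Lpos)
    fix x y assume xy: "x \<in> cball a t" "y \<in> cball a t"
    consider "x = a" "y = a" | "x \<noteq> a" "norm (y - a) \<le> norm (x - a)" | "y \<noteq> a" "norm (x - a) \<le> norm (y - a)"
      by (cases "norm (y - a) \<le> norm (x - a)") force+
    then show "norm (F x - F y) \<le> L * norm (x - y)"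
    proof cases
      case 2 then show ?thesis using main[OF xy] by blast
    next
      case 3 then show ?thesis using main[OF xy(2,1)] by (simp add: norm_minus_commute)
    qed simp
  qed
qed

lemma weak_deriv_cmult:
  assumes "open X" "weak_deriv X [i] u v"
  shows "weak_deriv X [i] (\<lambda>x. c * u x) (\<lambda>x. c * v x)" unfolding weak_deriv_1_iff[OF assms(1)]
proof (intro conjI allI impI)
  note d = weak_derivD[OF assms(2,1)]
  have c: "Linf_loc X (\<lambda>x. c)" by (rule continuous_imp_Linf_loc[OF continuous_on_const assms(1)])
  show "Lp_loc 1 X (\<lambda>x. c * u x)" by (rule Lp_loc_mult_Linf[OF _ assms(1) c d(1)]) simp
  show "Lp_loc 1 X (\<lambda>x. c * v x)" by (rule Lp_loc_mult_Linf[OF _ assms(1) c d(2)]) simp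
  fix \<phi> assume t: "test_function X \<phi>"
  show "(LINT x|lebesgue. (c * u x) * partial_deriv i \<phi> x) = - (LINT x|lebesgue. (c * v x) * \<phi> x)"
    using d(3)[OF t] by (simp add: mult.assoc)
qed

lemma weak_deriv_scale:
  assumes "open X" "l > 0" "\<And>x. x \<in> X \<Longrightarrow> a + l *\<^sub>R (x - a) \<in> X" "\<And>i. weak_deriv X [i] w (W i)"
  shows "weak_deriv X [i] (\<lambda>x. w (a + l *\<^sub>R (x - a))) (\<lambda>x. l * W i (a + l *\<^sub>R (x - a)))"
proof -
  let ?S = "\<lambda>x. a + l *\<^sub>R (x - a)" and ?A = "\<lambda>m i (x::real^'a). if i = m then l else 0"
  have S: "LWemb 1 X ?S" by (rule LWemb_similarity[OF _ _ assms(1)]) (use assms(2) in auto)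
  have C: "C1 (\<lambda>x. ?S x $ m) (\<lambda>i. ?A m i)" for m
  proof -
    have "C1 (\<lambda>x::real^'a. (a $ m - l * a $ m) + l * x $ m) (\<lambda>i x. 0 + (l * (if i = m then 1 else 0) + 0 * x $ m))"
      by (intro C1_add C1_const C1_mult C1_nth)
    moreover have "(\<lambda>x::real^'a. (a $ m - l * a $ m) + l * x $ m) = (\<lambda>x. ?S x $ m)" by (auto simp: algebra_simps)
    moreover have "(\<lambda>i (x::real^'a). 0 + (l * (if i = m then 1 else 0) + 0 * x $ m)) = (\<lambda>i. ?A m i)" by auto
    ultimately show ?thesis by simp
  qed
  have "weak_deriv X [i] (\<lambda>x. w (?S x)) (\<lambda>x. \<Sum>m\<in>UNIV. ?A m i x * W m (?S x))"
  proof (rule weak_deriv_chain[OF assms(1,1) LWembD(7)[OF S] _ LWemb_expanding[OF S] _ _ assms(4)])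
    show "?S ` X \<subseteq> X" using assms(3) by blast
    show "weak_deriv X [i] (\<lambda>x. ?S x $ m) (?A m i)" for m i by (rule C1_weak_deriv[OF C assms(1)])
    show "Linf_loc X (?A m i)" for m i by (rule continuous_imp_Linf_loc[OF continuous_on_const assms(1)])
  qed
  moreover have "(\<Sum>m\<in>UNIV. ?A m i x * W m (?S x)) = l * W i (?S x)" for x
  proof -
    have "(\<Sum>m\<in>UNIV. ?A m i x * W m (?S x)) = (\<Sum>m\<in>UNIV. if i = m then l * W m (?S x) else 0)" by (rule sum.cong) auto
    then show ?thesis by simp
  qed
  ultimately show ?thesis by simp
qed

text \<open>Values off \<open>X\<close> are irrelevant for a weak derivative; the value 0 makes it
  measurable on the whole space, as the change of scale in \<open>self_similar_Lp\<close>
  demands.\<close>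

lemma weak_deriv_zero_extension:
  assumes "open X" "weak_deriv X [i] u v"
  shows "(\<lambda>x. indicator X x * v x) \<in> borel_measurable lebesgue" "weak_deriv X [i] u (\<lambda>x. indicator X x * v x)"
proof -
  show "(\<lambda>x. indicator X x * v x) \<in> borel_measurable lebesgue"
    using Lp_loc_measurable[OF weak_derivD(2)[OF assms(2,1)]] assms(1)
    by (subst (asm) borel_measurable_restrict_space_iff) auto
  show "weak_deriv X [i] u (\<lambda>x. indicator X x * v x)" by (rule weak_deriv_cong_AE[OF assms(2,1)]) (auto intro: AE_I2)
qed

text \<open>Differentiating the self-similarity relation shows, by uniqueness of weak derivatives,
  that the gradient is invariant under the similarity and that second derivatives grow by 1/l. The
  gradient stays bounded, the second derivatives are integrable to the power \<open>p\<close>, and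
  then the puncture is removed from the first-order identities for the function and for its
  gradient.\<close>

lemma self_similar_reg:
  fixes F :: "real^'n \<Rightarrow> real^'n"
  assumes p: "1 \<le> p" "p < real CARD('n)" and l: "0 < l" "l < 1" and s: "0 < s" and F: "reg p (ball a s - {a}) F"
    and ss: "\<And>x. x \<in> ball a s \<Longrightarrow> F (a + l *\<^sub>R (x - a)) = c + l *\<^sub>R (F x - c)"
  shows "reg p (ball a s) F"
proof -
  define t where "t = s / 2"
  have t: "0 < t" "t < s" using s by (auto simp: t_def)
  let ?P = "ball a s - {a}" and ?Q = "ball a t" and ?S = "\<lambda>x. a + l *\<^sub>R (x - a)"
  have P: "open ?P" "open (?Q - {a})" "?Q - {a} \<subseteq> ?P" using t by (auto simp: open_delete)
  have n2: "CARD('n) \<ge> 2" using p by linarith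
  have aQ: "a \<in> ?Q" using t by simp
  obtain L where L: "L > 0" "\<forall>x\<in>cball a t. \<forall>y\<in>cball a t. norm (F x - F y) \<le> L * norm (x - y)"
    using self_similar_lipschitz[OF regD(2)[OF F] l t ss] by blast
  have SP: "?S x \<in> ?P" if "x \<in> ?P" for x
  proof -
    have "norm (?S x - a) = l * norm (x - a)" using l by simp
    also have "\<dots> \<le> norm (x - a)" using l by (simp add: mult_left_le_one_le)
    finally show ?thesis using that l by (auto simp: dist_norm norm_minus_commute)
  qed
  have "reg p ?Q F" unfolding reg_def
  proof (intro conjI allI)
    show lF: "loc_lip ?Q F" unfolding loc_lip_def
    proof
      fix x assume "x \<in> ?Q"
      then obtain r where r: "r > 0" "ball x r \<subseteq> ?Q" using open_contains_ball[of ?Q] open_ball[of a t] by blast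
      then have "ball x r \<subseteq> cball a t" by auto
      then show "\<exists>r>0. \<exists>L>0. \<forall>y\<in>ball x r. \<forall>z\<in>ball x r. norm (F y - F z) \<le> L * norm (y - z)" using r(1) L by blast
    qed
    fix m
    let ?u = "\<lambda>x. F x $ m"
    show "sobolev_loc 2 p ?Q ?u"
    proof (rule sobolev_loc_2E[OF regD(1)[OF F] P(1) p(1)])
      fix V H
      assume V: "\<And>i. weak_deriv ?P [i] ?u (V i)" and H: "\<And>i j. weak_deriv ?P [j] (V i) (H i j)"
        and Hp: "\<And>i j. Lp_loc p ?P (H i j)"
      define V' where "V' i x = indicator ?P x * V i x" for i x
      define H' where "H' i j x = indicator ?P x * H i j x" for i j x
      have V'm: "V' i \<in> borel_measurable lebesgue" and V'd: "weak_deriv ?P [i] ?u (V' i)" for i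
        unfolding V'_def[abs_def] using weak_deriv_zero_extension[OF P(1) V] by auto
      have H'm: "H' i j \<in> borel_measurable lebesgue" for i j
        unfolding H'_def[abs_def] using weak_deriv_zero_extension(1)[OF P(1) H] by auto
      have H'd: "weak_deriv ?P [j] (V' i) (H' i j)" for i j
        by (rule weak_deriv_cong_AE[OF H P(1)]) (auto simp: V'_def H'_def intro: AE_I2)
      have H'p: "Lp_loc p ?P (H' i j)" for i j
        by (rule Lp_loc_AE[OF P(1) Hp[of i j]]) (auto simp: H'_def intro: AE_I2)
      have Vb: "AE y in lebesgue. y \<in> ?Q - {a} \<longrightarrow> \<bar>V' i y\<bar> \<le> L" for i
      proof (rule weak_deriv_lipschitz_AE[OF P(2), of ?u V'])
        show "weak_deriv (?Q - {a}) [i] ?u (V' i)" for i by (rule weak_deriv_subset[OF V'd P(1,2,3)])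
        fix x assume "x \<in> ?Q - {a}"
        then obtain r where r: "r > 0" "ball x r \<subseteq> ?Q" using open_contains_ball[of ?Q] open_ball[of a t] by blast
        have "\<bar>?u y - ?u z\<bar> \<le> L * norm (y - z)" if "y \<in> ball x r" "z \<in> ball x r" for y z
        proof -
          have "y \<in> cball a t" "z \<in> cball a t" using that r(2) by auto
          then have "norm (F y - F z) \<le> L * norm (y - z)" using L(2) by blast
          moreover have "\<bar>?u y - ?u z\<bar> \<le> norm (F y - F z)" using component_le_norm_cart[of "F y - F z" m] by simp
          ultimately show ?thesis by linarith
        qed
        then show "\<exists>r>0. \<forall>y\<in>ball x r. \<forall>z\<in>ball x r. \<bar>?u y - ?u z\<bar> \<le> L * norm (y - z)" using r(1) by blast
      qed
      have Vinf: "Linf_loc ?Q (V' i)" for i unfolding Linf_loc_def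
      proof (intro conjI ballI)
        show "V' i \<in> borel_measurable (lebesgue_on ?Q)" by (rule measurable_restrict_space1[OF V'm])
        fix x assume "x \<in> ?Q"
        then obtain r where r: "r > 0" "ball x r \<subseteq> ?Q" using open_contains_ball[of ?Q] open_ball[of a t] by blast
        have "AE y in lebesgue. y \<in> ball x r \<longrightarrow> \<bar>V' i y\<bar> \<le> L"
          using Vb[of i] AE_lebesgue_neq[of a] by eventually_elim (use r(2) in blast)
        then show "\<exists>r>0. \<exists>B. AE y in lebesgue. y \<in> ball x r \<longrightarrow> \<bar>V' i y\<bar> \<le> B" using r(1) by blast
      qed
      have VS: "AE x in lebesgue. x \<in> ?P \<longrightarrow> V' i (?S x) = V' i x" for i
      proof -
        have 1: "weak_deriv ?P [i] (\<lambda>x. ?u (?S x)) (\<lambda>x. l * V' i (?S x))"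
          by (rule weak_deriv_scale[OF P(1) l(1) SP V'd])
        have 2: "weak_deriv ?P [i] (\<lambda>x. (c $ m - l * c $ m) + l * ?u x) (\<lambda>x. 0 + l * V' i x)"
          by (rule weak_deriv_add[OF P(1) C1_weak_deriv[OF C1_const P(1)] weak_deriv_cmult[OF P(1) V'd]])
        have 3: "weak_deriv ?P [i] (\<lambda>x. ?u (?S x)) (\<lambda>x. 0 + l * V' i x)"
        proof (rule weak_deriv_cong_AE[OF 2 P(1) AE_I2 AE_I2])
          show "y \<in> ?P \<longrightarrow> (c $ m - l * c $ m) + l * ?u y = ?u (?S y)" for y
            using ss[of y] by (auto simp: right_diff_distrib)
        qed simp
        show ?thesis using weak_deriv_unique[OF P(1) 1 3] l by simp
      qed
      have HS: "AE x in lebesgue. x \<in> ?P \<longrightarrow> l * H' i j (?S x) = H' i j x" for i j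
      proof -
        have 1: "weak_deriv ?P [j] (\<lambda>x. V' i (?S x)) (\<lambda>x. l * H' i j (?S x))"
          by (rule weak_deriv_scale[OF P(1) l(1) SP H'd])
        have 3: "weak_deriv ?P [j] (V' i) (\<lambda>x. l * H' i j (?S x))"
          by (rule weak_deriv_cong_AE[OF 1 P(1) VS]) (rule AE_I2, simp)
        show ?thesis by (rule weak_deriv_unique[OF P(1) 3 H'd])
      qed
      have HpQ: "Lp_loc p ?Q (H' i j)" for i j by (rule self_similar_Lp[OF p l t H'm H'p HS])
      have uc: "continuous_on ?Q ?u" by (intro continuous_intros loc_lip_continuous[OF lF open_ball])
      show ?thesis
      proof (rule sobolev_loc_2I[OF open_ball p(1)])
        show "Lp_loc p ?Q ?u" using continuous_imp_Lp_loc[OF uc open_ball] p(1) by simp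
        show "Lp_loc p ?Q (V' i)" for i using Linf_loc_imp_Lp_loc[OF _ open_ball Vinf] p(1) by simp
        show "Lp_loc p ?Q (H' i j)" for i j by (rule HpQ)
        show "weak_deriv ?Q [i] ?u (V' i)" for i
        proof (rule weak_deriv_remove_point[OF n2 open_ball aQ weak_deriv_subset[OF V'd P(1,2,3)]])
          show "Linf_loc ?Q ?u" by (rule continuous_imp_Linf_loc[OF uc open_ball])
          show "Lp_loc 1 ?Q (V' i)" by (rule Linf_loc_imp_Lp_loc[OF _ open_ball Vinf]) simp
        qed
        show "weak_deriv ?Q [j] (V' i) (H' i j)" for i j
          by (rule weak_deriv_remove_point[OF n2 open_ball aQ weak_deriv_subset[OF H'd P(1,2,3)] Vinf
                Lp_loc_imp_1[OF p(1) open_ball HpQ]])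
      qed
    qed
  qed
  note Qr = this
  show ?thesis
  proof (rule reg_local[OF open_ball p(1)])
    fix x assume "x \<in> ball a s"
    then show "\<exists>U. open U \<and> x \<in> U \<and> reg p U F" using P(1) F Qr aQ by (cases "x = a") (blast intro: open_ball)+
  qed
qed

section \<open>Conjugation and self-similar extension\<close>

text \<open>The inverse is carried along and no topology is involved: regularity is stated
  separately by \<open>LWemb\<close>, while this locale records which sets are preserved.\<close>

locale support_bij =
  fixes \<rho> \<rho>' :: "'a \<Rightarrow> 'a" and S :: "'a set"
  assumes inv1: "\<rho>' (\<rho> x) = x" and inv2: "\<rho> (\<rho>' x) = x" and off: "x \<notin> S \<Longrightarrow> \<rho> x = x"
begin

lemma off': "x \<notin> S \<Longrightarrow> \<rho>' x = x" using inv1[of x] off[of x] by simp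

text \<open>A point of \<open>S\<close> cannot leave \<open>S\<close>: off \<open>S\<close> the
  inverse is the identity, so the point would equal its image.\<close>

lemma pres: "S \<subseteq> T \<Longrightarrow> \<rho> x \<in> T \<longleftrightarrow> x \<in> T"
proof -
  assume S: "S \<subseteq> T"
  show ?thesis
  proof (cases "x \<in> S")
    case True
    have "\<rho> x \<in> S"
    proof (rule ccontr)
      assume "\<rho> x \<notin> S"
      then have "x = \<rho> x" using off'[of "\<rho> x"] inv1[of x] by simp
      then show False using \<open>\<rho> x \<notin> S\<close> True by simp
    qed
    then show ?thesis using True S by blast
  qed (simp add: off)
qed

lemma pres': "S \<subseteq> T \<Longrightarrow> \<rho>' x \<in> T \<longleftrightarrow> x \<in> T" using pres[of T "\<rho>' x"] by (simp add: inv2)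

lemma image: "S \<subseteq> T \<Longrightarrow> \<rho> ` T = T" "S \<subseteq> T \<Longrightarrow> \<rho>' ` T = T"
proof -
  assume S: "S \<subseteq> T"
  have "x \<in> \<rho> ` T" if "x \<in> T" for x
    by (rule image_eqI[of _ _ "\<rho>' x"]) (use S that in \<open>simp_all add: inv2 pres'\<close>)
  then show "\<rho> ` T = T" using pres[OF S] by blast
  have "x \<in> \<rho>' ` T" if "x \<in> T" for x
    by (rule image_eqI[of _ _ "\<rho> x"]) (use S that in \<open>simp_all add: inv1 pres\<close>)
  then show "\<rho>' ` T = T" using pres'[OF S] by blast
qed

lemma swap: "support_bij \<rho>' \<rho> S" by unfold_locales (simp_all add: inv1 inv2 off')

end

text \<open>The conjugate of \<rho> by \<open>k\<close> lives on the image of \<open>Q\<close>, the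
  identity off the image of \<open>K\<close>. Both sets are open, the second because
  \<open>K\<close> is compact; together they cover the space, and the two maps agree on the
  overlap.\<close>

lemma LWemb_conjugate_extension:
  fixes k :: "real^'n \<Rightarrow> real^'n"
  assumes k: "LWemb p Q k" and \<rho>: "LWemb p UNIV \<rho>" "LWemb p UNIV \<rho>'" and sb: "support_bij \<rho> \<rho>' K" and K: "compact K" "K \<subseteq> Q"
  obtains \<Psi> \<Psi>' where "support_bij \<Psi> \<Psi>' (k ` K)" "LWemb p UNIV \<Psi>" "LWemb p UNIV \<Psi>'"
    "\<And>x. x \<in> Q \<Longrightarrow> \<Psi> (k x) = k (\<rho> x)" "\<And>x. x \<in> Q \<Longrightarrow> \<Psi>' (k x) = k (\<rho>' x)"
proof -
  note d = LWembD[OF k]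
  define ki where "ki = inv_into Q k"
  have ki: "ki (k x) = x" if "x \<in> Q" for x using inv_into_f_f[OF d(4) that] by (simp add: ki_def)
  define T where "T \<rho> x = (if x \<in> k ` Q then k (\<rho> (ki x)) else x)" for \<rho> :: "real^'n \<Rightarrow> real^'n" and x
  have Tk: "T \<rho> (k x) = k (\<rho> x)" if "x \<in> Q" for x \<rho> using that ki by (simp add: T_def)
  have inv: "T \<rho>' (T \<rho> x) = x" if sb: "support_bij \<rho> \<rho>' K" for \<rho> \<rho>' x
  proof (cases "x \<in> k ` Q")
    case True
    then obtain z where z: "x = k z" "z \<in> Q" by blast
    have "\<rho> z \<in> Q" using support_bij.pres[OF sb K(2)] z by blast
    then show ?thesis using z by (simp add: Tk support_bij.inv1[OF sb])
  qed (simp add: T_def)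
  have off: "T \<rho> x = x" if sb: "support_bij \<rho> \<rho>' K" and x: "x \<notin> k ` K" for \<rho> \<rho>' x
  proof (cases "x \<in> k ` Q")
    case True
    then obtain z where z: "x = k z" "z \<in> Q" by blast
    then have "z \<notin> K" using x by blast
    then show ?thesis using z by (simp add: Tk support_bij.off[OF sb])
  qed (simp add: T_def)
  have lw: "LWemb p UNIV (T \<rho>)" if sb: "support_bij \<rho> \<rho>' K" and \<rho>: "LWemb p UNIV \<rho>" for \<rho> \<rho>'
  proof (rule LWemb_local[OF d(1)])
    show "inj (T \<rho>)" by (rule inj_on_inverseI[of _ "T \<rho>'"]) (rule inv[OF sb])
    fix x :: "real^'n"
    show "\<exists>U. x \<in> U \<and> U \<subseteq> UNIV \<and> LWemb p U (T \<rho>)"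
    proof (cases "x \<in> k ` K")
      case True
      have 1: "LWemb p (k ` Q) ki" unfolding ki_def by (rule LWemb_inv[OF k])
      have 2: "LWemb p (k ` Q) (\<lambda>x. \<rho> (ki x))" by (rule LWemb_comp[OF 1 \<rho>]) simp
      have 3: "(\<lambda>x. \<rho> (ki x)) ` (k ` Q) \<subseteq> Q" using support_bij.pres[OF sb K(2)] ki by auto
      have "LWemb p (k ` Q) (T \<rho>)" by (rule LWemb_cong[OF LWemb_comp[OF 2 k 3]]) (simp add: T_def)
      moreover have "x \<in> k ` Q" using True K(2) by blast
      ultimately show ?thesis by (intro exI[of _ "k ` Q"] conjI subset_UNIV)
    next
      case False
      have "compact (k ` K)" by (rule compact_continuous_image[OF continuous_on_subset[OF d(7) K(2)] K(1)])
      then have o: "open (- (k ` K))" by (simp add: compact_imp_closed open_Compl)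
      have "LWemb p (- (k ` K)) (T \<rho>)" by (rule LWemb_cong[OF LWemb_id[OF d(1) o]]) (use off[OF sb] in simp)
      moreover have "x \<in> - (k ` K)" using False by simp
      ultimately show ?thesis by (intro exI[of _ "- (k ` K)"] conjI subset_UNIV)
    qed
  qed
  note sb' = support_bij.swap[OF sb]
  show ?thesis
  proof (rule that[of "T \<rho>" "T \<rho>'"])
    show "support_bij (T \<rho>) (T \<rho>') (k ` K)" by unfold_locales (auto intro: inv[OF sb] inv[OF sb'] off[OF sb])
  qed (use lw[OF sb \<rho>(1)] lw[OF sb' \<rho>(2)] Tk in auto)
qed

lemma radial_contraction_bij:
  fixes c :: "real^'n"
  assumes "1 \<le> p" "0 < t" "t < T" "0 < l" "l \<le> 1"
  obtains \<rho> \<rho>' where "support_bij \<rho> \<rho>' (ball c T)" "LWemb p UNIV \<rho>" "LWemb p UNIV \<rho>'"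
    "\<And>x. x \<in> cball c t \<Longrightarrow> \<rho> x = c + l *\<^sub>R (x - c)"
proof (rule radial_contraction[OF assms, of c])
  fix \<rho> \<rho>' :: "real^'n \<Rightarrow> real^'n"
  assume a: "\<And>x. \<rho>' (\<rho> x) = x" "\<And>x. \<rho> (\<rho>' x) = x" "LWemb p UNIV \<rho>" "LWemb p UNIV \<rho>'"
    "\<And>x. x \<in> cball c t \<Longrightarrow> \<rho> x = c + l *\<^sub>R (x - c)" "\<And>x. x \<notin> ball c T \<Longrightarrow> \<rho> x = x"
  show ?thesis by (rule that[of \<rho> \<rho>', OF support_bij.intro[OF a(1,2,6)] a(3,4,5)])
qed

section \<open>Nested similar copies and self-similar extension\<close>

definition sim :: "'a::real_vector \<Rightarrow> real \<Rightarrow> 'a \<Rightarrow> 'a" where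
  "sim a t x = a + t *\<^sub>R (x - a)"

lemma sim_sim [simp]: "sim a t (sim a u x) = sim a (t * u) x" by (simp add: sim_def)
lemma sim_1 [simp]: "sim a 1 x = x" by (simp add: sim_def)
lemma sim_self [simp]: "sim a t a = a" by (simp add: sim_def)
lemma sim_eq_self: "t \<noteq> 0 \<Longrightarrow> sim a t x = a \<longleftrightarrow> x = a" by (simp add: sim_def)

lemma dist_sim: "t \<ge> 0 \<Longrightarrow> dist a (sim a t x) = t * dist a (x :: 'a::real_normed_vector)"
  by (simp add: sim_def dist_norm norm_minus_commute)

text \<open>For nested copies this is the number of images of \<open>X\<close>, under positive
  powers of the similarity, that contain \<open>x\<close>. If \<open>a\<close> lies in
  \<open>X\<close>, no index qualifies at \<open>a\<close> itself; \<open>spiral\<close> therefore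
  treats \<open>a\<close> separately.\<close>

definition depth :: "'a::real_normed_vector \<Rightarrow> real \<Rightarrow> 'a set \<Rightarrow> 'a \<Rightarrow> nat" where
  "depth a l X x = (LEAST i. sim a (1 / l ^ i) x \<notin> sim a l ` X)"

text \<open>The self-similar extension of \<open>F0\<close>: it satisfies \<open>F (sim a l x) = sim b l (F x)\<close> for \<open>x\<close> in \<open>X\<close>
  and agrees with \<open>F0\<close> outside the first copy of \<open>X\<close>.\<close>

definition spiral :: "'a::real_normed_vector \<Rightarrow> real \<Rightarrow> 'a set \<Rightarrow> 'a \<Rightarrow> ('a \<Rightarrow> 'a) \<Rightarrow> 'a \<Rightarrow> 'a" where
  "spiral a l X b F0 x =
     (if x = a then b else sim b (l ^ depth a l X x) (F0 (sim a (1 / l ^ depth a l X x) x)))"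

locale nest =
  fixes C X :: "'a::real_normed_vector set" and a :: 'a and l :: real
  assumes l: "0 < l" "l < 1" and XC: "X \<subseteq> C" and aX: "a \<in> X" and bX: "bounded X" and rX: "sim a l ` X \<subseteq> X"
begin

lemma simX: "z \<in> X \<Longrightarrow> sim a (l ^ i) z \<in> X" using rX by (induction i) (auto simp: sim_sim[symmetric] simp del: sim_sim)

lemma simrX: "z \<in> X \<Longrightarrow> sim a (l ^ Suc i) z \<in> sim a l ` X"
  using simX[of z i] by (auto intro!: image_eqI[of _ _ "sim a (l ^ i) z"])

text \<open>Otherwise the images of \<open>x\<close> under ever larger dilations about
  \<open>a\<close> would all lie in the bounded set \<open>X\<close>.\<close>

lemma depth_ex: assumes "x \<noteq> a" shows "\<exists>i. sim a (1 / l ^ i) x \<notin> sim a l ` X"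
proof (rule ccontr)
  assume "\<not> ?thesis"
  then have *: "sim a (1 / l ^ i) x \<in> X" for i using rX by blast
  obtain M where M: "\<And>z. z \<in> X \<Longrightarrow> dist a z \<le> M" using bX unfolding bounded_any_center[of _ a] by blast
  have d: "dist a x > 0" using assms by simp
  have "M \<ge> 0" using M[OF aX] by simp
  then obtain i where i: "l ^ i < dist a x / (M + 1)" using real_arch_pow_inv[of "dist a x / (M + 1)" l] d l by auto
  have "dist a (sim a (1 / l ^ i) x) = dist a x / l ^ i" using l by (subst dist_sim) auto
  moreover have "dist a x / l ^ i > M" 
  proof -
    have "l ^ i * M \<le> l ^ i * (M + 1)" using l by (intro mult_left_mono) auto
    also have "\<dots> < dist a x" using i \<open>M \<ge> 0\<close> by (simp add: pos_less_divide_eq)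
    finally show ?thesis using l by (simp add: pos_less_divide_eq mult.commute)
  qed
  ultimately show False using M[OF *[of i]] by linarith
qed

lemma depth: assumes "x \<noteq> a" shows "sim a (1 / l ^ depth a l X x) x \<notin> sim a l ` X"
  unfolding depth_def by (rule LeastI_ex[OF depth_ex[OF assms]])

lemma depth_less: "i < depth a l X x \<Longrightarrow> sim a (1 / l ^ i) x \<in> sim a l ` X"
  unfolding depth_def using not_less_Least by blast

lemma depth_pos:
  assumes "x \<noteq> a" "depth a l X x = Suc i" shows "sim a (1 / l ^ Suc i) x \<in> X - sim a l ` X"
proof -
  obtain z where z: "z \<in> X" "sim a (1 / l ^ i) x = sim a l z" using depth_less[of i x] assms(2) by auto
  have "sim a (1 / l ^ Suc i) x = sim a (1 / l) (sim a (1 / l ^ i) x)" by simp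
  also have "\<dots> = z" unfolding z(2) using l by simp
  finally show ?thesis using z(1) depth[OF assms(1)] assms(2) by simp
qed

text \<open>A point of depth 0 may lie anywhere outside the first copy, so membership in
  \<open>X\<close> is asked only for positive depth.\<close>

lemma depth_eqI:
  assumes "w \<notin> sim a l ` X" "i > 0 \<Longrightarrow> w \<in> X" shows "depth a l X (sim a (l ^ i) w) = i" unfolding depth_def
proof (rule Least_equality)
  show "sim a (1 / l ^ i) (sim a (l ^ i) w) \<notin> sim a l ` X" using assms(1) l by simp
  fix j assume j: "sim a (1 / l ^ j) (sim a (l ^ i) w) \<notin> sim a l ` X"
  show "i \<le> j"
  proof (rule ccontr)
    assume "\<not> i \<le> j"
    then obtain m where m: "i = j + Suc m" using less_imp_Suc_add[of j i] by auto
    have "sim a (1 / l ^ j) (sim a (l ^ i) w) = sim a (l ^ Suc m) w" using l by (simp add: m power_add)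
    then show False using j simrX[OF assms(2), of m] m by simp
  qed
qed

lemma spiral_outer: "x \<in> C - sim a l ` X \<Longrightarrow> spiral a l X b F0 x = F0 x"
proof -
  assume x: "x \<in> C - sim a l ` X"
  then have "x \<noteq> a" using aX by (auto simp: image_iff intro: bexI[of _ a])
  moreover have "depth a l X x = 0" using depth_eqI[of x 0] x by simp
  ultimately show ?thesis by (simp add: spiral_def)
qed

lemma spiral_sim: assumes "x \<in> X" shows "spiral a l X b F0 (sim a l x) = sim b l (spiral a l X b F0 x)"
proof (cases "x = a")
  case False
  let ?i = "depth a l X x" and ?w = "sim a (1 / l ^ depth a l X x) x"
  have w: "sim a (l ^ ?i) ?w = x" using l by simp
  have "?w \<in> X" using depth_pos[OF False] assms by (cases ?i) auto
  then have "depth a l X (sim a (l ^ Suc ?i) ?w) = Suc ?i" by (intro depth_eqI depth[OF False])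
  moreover have s: "sim a (l ^ Suc ?i) ?w = sim a l x" using l by simp
  ultimately have "depth a l X (sim a l x) = Suc ?i" by simp
  moreover have "sim a l x \<noteq> a" using False l by (simp add: sim_eq_self)
  ultimately show ?thesis using False l by (simp add: spiral_def)
qed (simp add: spiral_def)

lemma spiral_sim_pow: "x \<in> X \<Longrightarrow> spiral a l X b F0 (sim a (l ^ i) x) = sim b (l ^ i) (spiral a l X b F0 x)"
proof (induction i)
  case (Suc i)
  have "sim a (l ^ Suc i) x = sim a l (sim a (l ^ i) x)" by simp
  then show ?case using spiral_sim[OF simX[OF Suc.prems, of i]] Suc by simp
qed simp

end

text \<open>\<open>F0\<close> sends the first shell into the first shell of the target, so the
  spiral map preserves depth, and the spiral map of \<open>G0\<close> undoes exactly as many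
  similarities as were applied.\<close>

lemma spiral_inverse:
  assumes "nest C X a l" "nest C' X' b l"
    and F0: "\<And>x. x \<in> C - sim a l ` X \<Longrightarrow> F0 x \<in> C' - sim b l ` X' \<and> G0 (F0 x) = x"
    and F1: "\<And>x. x \<in> X - sim a l ` X \<Longrightarrow> F0 x \<in> X'" and x: "x \<in> C"
  shows "spiral a l X b F0 x \<in> C'" "spiral b l X' a G0 (spiral a l X b F0 x) = x"
proof -
  interpret N: nest C X a l by fact
  interpret N': nest C' X' b l by fact
  have "spiral a l X b F0 x \<in> C' \<and> spiral b l X' a G0 (spiral a l X b F0 x) = x"
  proof (cases "x = a")
    case True
    then show ?thesis using N'.aX N'.XC by (auto simp: spiral_def)
  next
    case False
    define i where "i = depth a l X x"
    define w where "w = sim a (1 / l ^ i) x"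
    have xw: "x = sim a (l ^ i) w" using N.l by (simp add: w_def)
    have wr: "w \<notin> sim a l ` X" unfolding w_def i_def by (rule N.depth[OF False])
    have wX: "w \<in> X" if "i > 0" using that N.depth_pos[OF False] unfolding w_def i_def by (cases "depth a l X x") auto
    have wC: "w \<in> C" using wX N.XC x by (cases "i = 0") (auto simp: w_def)
    have F0w: "F0 w \<in> C' - sim b l ` X'" "G0 (F0 w) = w" using F0[of w] wC wr by auto
    have F1w: "i > 0 \<Longrightarrow> F0 w \<in> X'" using F1 wX wr by blast
    have y: "spiral a l X b F0 x = sim b (l ^ i) (F0 w)" using False by (simp add: spiral_def i_def w_def)
    have d: "depth b l X' (sim b (l ^ i) (F0 w)) = i" using F0w F1w by (intro N'.depth_eqI) auto
    have "F0 w \<noteq> b" using F0w(1) N'.aX by (auto simp: image_iff intro: bexI[of _ b])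
    then have yb: "sim b (l ^ i) (F0 w) \<noteq> b" using N.l by (simp add: sim_eq_self)
    have "sim b (l ^ i) (F0 w) \<in> C'"
    proof (cases "i = 0")
      case False
      then show ?thesis using N'.simX[OF F1w, of i] N'.XC by auto
    qed (use F0w in simp)
    moreover have "spiral b l X' a G0 (sim b (l ^ i) (F0 w)) = x"
      unfolding spiral_def d using yb N.l F0w(2) xw by simp
    ultimately show ?thesis unfolding y by blast
  qed
  then show "spiral a l X b F0 x \<in> C'" "spiral b l X' a G0 (spiral a l X b F0 x) = x" by auto
qed

section \<open>Collars\<close>

text \<open>The situation after the hole has been shrunk: \<open>E\<close> is the inner domain,
  where nothing is known of \<open>f\<close>, and \<open>b\<close> is the hole in the image. The
  factor 20 leaves room for the motions of the target in \<open>compression\<close>, which take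
  place in the ball of radius 8 R/20 about \<open>c\<close>.\<close>

locale collar =
  fixes p :: real and D E :: "(real^'n) set" and f fi :: "real^'n \<Rightarrow> real^'n" and c :: "real^'n" and R :: real and b :: "(real^'n) set"
  assumes p: "1 \<le> p" and D: "open D" "bounded D" and E: "open E" "E \<noteq> {}" "closure E \<subseteq> D"
    and R: "R > 0" and b: "open b" "closure b \<subseteq> ball c (R / 20)"
    and hom: "homeomorphism (closure D - E) (cball c R - b) f fi"
    and fD: "f ` frontier D = sphere c R" and fE: "f ` frontier E = frontier b"
    and lw: "LWemb p (interior (closure D - E)) f"
begin

definition d :: real where "d = R / 20"
definition A where "A = closure D - E"
definition B0 where "B0 = ball c R - closure b"
text \<open>Level 0 on the inner domain makes the sublevel sets \<open>V\<close> and
  \<open>W\<close>, for positive levels, preimages of open and closed balls with \<open>E\<close>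
  filled in. They stand in for concentric balls inside \<open>D\<close>.\<close>

definition lev where "lev x = (if x \<in> E then 0 else dist c (f x))"
definition V where "V s = {x \<in> closure D. lev x < s}"
definition W where "W s = {x \<in> closure D. lev x \<le> s}"

lemma d: "d > 0" "R = 20 * d" "closure b \<subseteq> ball c d" using R b by (auto simp: d_def)

lemma fin: "x \<in> A \<Longrightarrow> f x \<in> cball c R - b" and fi_in: "y \<in> cball c R - b \<Longrightarrow> fi y \<in> A"
  and fif: "x \<in> A \<Longrightarrow> fi (f x) = x" and ffi: "y \<in> cball c R - b \<Longrightarrow> f (fi y) = y"
  and fc: "continuous_on A f" and fic: "continuous_on (cball c R - b) fi"
  using hom unfolding homeomorphism_def A_def by blast+

lemma f_inj: assumes "x \<in> A" "x' \<in> A" "f x = f x'" shows "x = x'"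
proof -
  have "x = fi (f x)" by (simp only: fif[OF assms(1)])
  also have "\<dots> = x'" unfolding assms(3) by (rule fif[OF assms(2)])
  finally show ?thesis .
qed

lemma ED: "E \<subseteq> D" "E \<subseteq> closure E" using E(3) closure_subset by blast+

lemma frontier_E: "x \<in> closure E \<Longrightarrow> x \<notin> E \<Longrightarrow> f x \<in> closure b"
proof -
  assume "x \<in> closure E" "x \<notin> E"
  then have "f x \<in> f ` frontier E" using E(1) by (auto simp: frontier_def interior_open)
  then show ?thesis unfolding fE by (simp add: frontier_def)
qed

lemma clE: "x \<in> closure E \<Longrightarrow> lev x < d" using frontier_E[of x] d by (auto simp: lev_def)

lemma frD: assumes "x \<in> closure D" "x \<notin> D" shows "x \<in> A" "dist c (f x) = R" "lev x = R"
proof -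
  have "x \<in> frontier D" using assms D(1) by (simp add: frontier_def interior_open)
  then have s: "f x \<in> sphere c R" using fD by blast
  show "x \<in> A" using assms ED by (auto simp: A_def)
  show "dist c (f x) = R" "lev x = R" using s assms ED by (auto simp: lev_def)
qed

lemma closed_A: "closed A" unfolding A_def using E(1) by (simp add: closed_Diff)
lemma compact_A: "compact A"
  using closed_A bounded_subset[OF bounded_closure[OF D(2)], of A] by (auto simp: A_def compact_eq_bounded_closed)

lemma V_D: "s \<le> R \<Longrightarrow> V s \<subseteq> D" using frD by (force simp: V_def)

lemma open_V: assumes "0 < s" "s \<le> R" shows "open (V s)"
proof -
  have "closed (A \<inter> f -` (- ball c s))" by (rule continuous_closed_preimage[OF fc closed_A]) auto
  moreover have "V s = D - (A \<inter> f -` (- ball c s))"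
    using V_D[OF assms(2)] assms(1) closure_subset[of D] by (auto simp: V_def lev_def A_def)
  ultimately show ?thesis using D(1) by (simp add: open_Diff)
qed

lemma lev_A: "x \<in> A \<Longrightarrow> lev x = dist c (f x)" by (simp add: A_def lev_def)
lemma A_D: "A \<subseteq> closure D" by (auto simp: A_def)

lemma compact_W: assumes "d \<le> s" shows "compact (W s)"
proof -
  have "closed (A \<inter> f -` cball c s)" by (rule continuous_closed_preimage[OF fc closed_A]) auto
  moreover have "W s = closure E \<union> (A \<inter> f -` cball c s)"
  proof (intro set_eqI iffI)
    fix x assume x: "x \<in> W s"
    then have "x \<in> closure D" "lev x \<le> s" by (auto simp: W_def)
    then show "x \<in> closure E \<union> (A \<inter> f -` cball c s)" using ED(2) lev_A[of x] by (cases "x \<in> E") (auto simp: A_def)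
  next
    fix x assume "x \<in> closure E \<union> (A \<inter> f -` cball c s)"
    then show "x \<in> W s"
    proof
      assume x: "x \<in> closure E"
      then have "x \<in> closure D" using E(3) closure_subset[of D] by blast
      then show ?thesis using clE[OF x] assms by (simp add: W_def)
    next
      assume "x \<in> A \<inter> f -` cball c s"
      then show ?thesis using lev_A[of x] A_D by (auto simp: W_def)
    qed
  qed
  ultimately have "closed (W s)" by (simp add: closed_Un)
  moreover have "bounded (W s)" using bounded_subset[OF bounded_closure[OF D(2)]] by (auto simp: W_def)
  ultimately show ?thesis by (simp add: compact_eq_bounded_closed)
qed

lemma V_W: "s \<le> t \<Longrightarrow> V s \<subseteq> W t" "s \<le> t \<Longrightarrow> V s \<subseteq> V t" "s < t \<Longrightarrow> W s \<subseteq> V t" "s \<le> t \<Longrightarrow> W s \<subseteq> W t" by (auto simp: V_def W_def)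

lemma DE: "open (D - closure E)" "D - closure E \<subseteq> A"
  using D(1) ED closure_subset[of D] by (auto simp: A_def open_Diff)

lemma lwD: "LWemb p (D - closure E) f"
  by (rule LWemb_subset[OF lw interior_maximal DE(1)]) (use DE in \<open>auto simp: A_def\<close>)

lemma B0_in: "B0 \<subseteq> cball c R - b" using closure_subset[of b] by (auto simp: B0_def)

text \<open>The boundaries of \<open>D\<close> and \<open>E\<close> already attain the values on the
  outer sphere and on the boundary of the hole, so by injectivity no other point does.\<close>

lemma f_B0: "x \<in> D - closure E \<Longrightarrow> f x \<in> B0"
proof -
  assume x: "x \<in> D - closure E"
  then have xA: "x \<in> A" using DE by blast
  have "f x \<notin> sphere c R"
  proof
    assume "f x \<in> sphere c R"
    then obtain x' where x': "x' \<in> frontier D" "f x = f x'" using fD by blast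
    have "x' \<in> closure D" "x' \<notin> D" using x'(1) D(1) by (auto simp: frontier_def interior_open)
    then have "x' \<in> A" by (rule frD(1))
    then have "x = x'" by (rule f_inj[OF xA _ x'(2)])
    then show False using \<open>x' \<notin> D\<close> x by simp
  qed
  moreover have "f x \<notin> closure b"
  proof
    assume "f x \<in> closure b"
    then have "f x \<in> f ` frontier E" unfolding fE using fin[OF xA] b(1) by (simp add: frontier_def interior_open)
    then obtain x' where x': "x' \<in> frontier E" "f x = f x'" by blast
    have e: "x' \<in> closure E" "x' \<notin> E" using x'(1) E(1) by (auto simp: frontier_def interior_open)
    then have "x' \<in> A" using E(3) closure_subset[of D] by (auto simp: A_def)
    then have "x = x'" by (rule f_inj[OF xA _ x'(2)])
    then show False using e x by simp
  qed
  ultimately show ?thesis using fin[OF xA] by (auto simp: B0_def)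
qed

lemma fi_D: "y \<in> B0 \<Longrightarrow> fi y \<in> D - closure E"
proof -
  assume y: "y \<in> B0"
  then have y': "y \<in> cball c R - b" using B0_in by blast
  have a: "fi y \<in> A" "f (fi y) = y" using fi_in[OF y'] ffi[OF y'] by auto
  have "fi y \<in> D" using frD(2)[of "fi y"] a y by (auto simp: A_def B0_def)
  moreover have "fi y \<notin> closure E" using frontier_E[of "fi y"] a y by (auto simp: A_def B0_def)
  ultimately show ?thesis by blast
qed

lemma fif_B0: "y \<in> B0 \<Longrightarrow> f (fi y) = y" using ffi B0_in by blast

lemma lwfi: "LWemb p B0 fi"
proof -
  have "f ` (D - closure E) = B0"
  proof
    show "f ` (D - closure E) \<subseteq> B0" using f_B0 by blast
    show "B0 \<subseteq> f ` (D - closure E)"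
    proof
      fix y assume y: "y \<in> B0"
      show "y \<in> f ` (D - closure E)" by (rule image_eqI[of _ _ "fi y"]) (use fi_D[OF y] fif_B0[OF y] in auto)
    qed
  qed
  then have "LWemb p B0 (inv_into (D - closure E) f)" using LWemb_inv[OF lwD] by simp
  then show ?thesis
  proof (rule LWemb_cong)
    fix y assume y: "y \<in> B0"
    have "inv_into (D - closure E) f (f (fi y)) = fi y" by (rule inv_into_f_f[OF LWembD(4)[OF lwD] fi_D[OF y]])
    then show "inv_into (D - closure E) f y = fi y" using fif_B0[OF y] by simp
  qed
qed

text \<open>A point \<open>q'\<close> of \<open>V (2 * d)\<close> is chosen beyond the point of
  \<open>W d\<close> farthest from \<open>a\<close>. A round ball about \<open>a\<close> can then
  contain a sublevel set slightly larger than \<open>W d\<close> and still miss the preimage of a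
  whole ball about \<open>q = f q'\<close>. That preimage is the free patch which
  \<open>compression\<close> exchanges for \<open>E\<close>.\<close>

lemma geometry:
  obtains a R1 R3 s1 s2 q \<eta> where "a \<in> V d" "0 < R1" "R1 < R3" "d < s1" "s1 < s2" "s2 < 2 * d"
    "W s2 \<subseteq> ball a R1" "0 < \<eta>" "\<eta> \<le> d" "cball q \<eta> \<inter> cball c s2 = {}" "cball q \<eta> \<subseteq> ball c (2 * d)"
    "\<And>x. x \<in> A \<Longrightarrow> x \<in> ball a R3 \<Longrightarrow> f x \<notin> cball q \<eta>"
proof -
  obtain a where a: "a \<in> E" using E(2) by blast
  then have aV: "a \<in> V d" using ED d(1) closure_subset[of D] by (auto simp: V_def lev_def)
  have Wne: "W d \<noteq> {}" using aV V_W(1)[of d d] by auto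
  have "continuous_on (W d) (dist a)" by (intro continuous_intros)
  from continuous_attains_sup[OF compact_W[OF order_refl] Wne this]
  obtain y where y: "y \<in> W d" "\<And>z. z \<in> W d \<Longrightarrow> dist a z \<le> dist a y" by blast
  define R0 where "R0 = dist a y"
  have R0: "R0 > 0"
  proof -
    have "open (V d)" using d by (intro open_V) auto
    then obtain e where e: "e > 0" "ball a e \<subseteq> V d" using openE[OF _ aV] by metis
    obtain z where z: "dist a z = e / 2" using vector_choose_dist[of "e / 2" a] e(1) by auto
    then have "z \<in> ball a e" using e(1) by simp
    then have "z \<in> W d" using e(2) V_W(1)[of d d] by blast
    then have "e / 2 \<le> dist a y" using y(2)[of z] z by simp
    then show ?thesis unfolding R0_def using e(1) by linarith
  qed
  have y2: "y \<in> V (2 * d)" using y(1) d(1) V_W(3)[of d "2 * d"] by auto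
  have "open (V (2 * d))" using d by (intro open_V) auto
  then obtain e where e: "e > 0" "ball y e \<subseteq> V (2 * d)" using openE[OF _ y2] by metis
  \<comment> \<open>Moving from the farthest point \<open>y\<close> away from \<open>a\<close> by
    \<open>e / 2\<close> stays in \<open>V (2 * d)\<close> and gains distance from \<open>a\<close>;
    the radii \<open>R1\<close> and \<open>R3\<close> are placed in this gap.\<close>
  define q' where "q' = y + (e / (2 * R0)) *\<^sub>R (y - a)"
  have nya: "norm (y - a) = R0" by (simp add: R0_def dist_norm norm_minus_commute)
  have "dist y q' = e / 2" using R0 e(1) by (simp add: q'_def dist_norm nya)
  then have q'V: "q' \<in> V (2 * d)" using e by auto
  have "q' - a = (1 + e / (2 * R0)) *\<^sub>R (y - a)" by (simp add: q'_def algebra_simps)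
  then have "norm (q' - a) = (1 + e / (2 * R0)) * R0" using R0 e(1) nya by simp
  also have "\<dots> = R0 + e / 2" using R0 by (simp add: distrib_right)
  finally have daq: "dist a q' = R0 + e / 2" by (simp add: dist_norm norm_minus_commute)
  define R1 where "R1 = R0 + e / 8"
  define R3 where "R3 = R0 + e / 4"
  have R13: "0 < R1" "R1 < R3" "R3 < dist a q'" using R0 e(1) daq by (auto simp: R1_def R3_def)
  have q'W: "q' \<notin> W d" using y(2)[of q'] daq e(1) by (auto simp: R0_def)
  have q'C: "q' \<in> closure D" using q'V by (simp add: V_def)
  have q'A: "q' \<in> A" using q'W q'C d(1) by (auto simp: A_def W_def lev_def)
  \<comment> \<open>Off \<open>ball a R1\<close> the level attains a minimum \<open>m\<close>, which
    exceeds \<open>d\<close> because \<open>W d\<close> lies within distance \<open>R0\<close> of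
    \<open>a\<close>. Hence sublevel sets slightly above \<open>d\<close> still fit into
    \<open>ball a R1\<close>.\<close>
  let ?K = "A \<inter> - ball a R1"
  have K: "compact ?K" by (rule compact_Int_closed[OF compact_A]) auto
  have Kne: "?K \<noteq> {}" using q'A R13 by force
  have "continuous_on ?K (\<lambda>x. dist c (f x))" by (intro continuous_intros continuous_on_subset[OF fc]) auto
  from continuous_attains_inf[OF K Kne this] obtain x0 where x0: "x0 \<in> ?K" "\<And>x. x \<in> ?K \<Longrightarrow> dist c (f x0) \<le> dist c (f x)" by blast
  define m where "m = dist c (f x0)"
  have m: "m > d"
  proof (rule ccontr)
    assume "\<not> m > d"
    then have "x0 \<in> W d" using x0(1) A_D lev_A[of x0] by (auto simp: W_def m_def)
    then show False using y(2)[of x0] x0(1) e(1) by (auto simp: R1_def R0_def)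
  qed
  define s2 where "s2 = d + min (m - d) d / 2"
  define s1 where "s1 = (d + s2) / 2"
  have s: "d < s1" "s1 < s2" "s2 < 2 * d" "s2 < m" 
  proof -
    have "s2 \<le> d + (m - d) / 2" "s2 \<le> d + d / 2" "d < s2" using m d(1) by (auto simp: s2_def)
    then show "d < s1" "s1 < s2" "s2 < 2 * d" "s2 < m" using m d(1) by (auto simp: s1_def field_simps)
  qed
  have W2: "W s2 \<subseteq> ball a R1"
  proof
    fix x assume x: "x \<in> W s2"
    show "x \<in> ball a R1"
    proof (cases "x \<in> E")
      case True
      then have "x \<in> W d" using x d(1) by (auto simp: W_def lev_def)
      then show ?thesis using y(2)[of x] e(1) by (auto simp: R1_def R0_def)
    next
      case False
      then have xA: "x \<in> A" using x by (auto simp: A_def W_def)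
      show ?thesis
      proof (rule ccontr)
        assume "x \<notin> ball a R1"
        then have "m \<le> dist c (f x)" using x0(2)[of x] xA by (auto simp: m_def)
        then show False using x s(4) lev_A[OF xA] by (auto simp: W_def)
      qed
    qed
  qed
  define q where "q = f q'"
  have "q' \<notin> W s2" using W2 R13 by auto
  then have q: "s2 < dist c q" "dist c q < 2 * d" using q'V q'C lev_A[OF q'A] by (auto simp: W_def V_def q_def)
  have qin: "q \<in> cball c R - b" unfolding q_def by (rule fin[OF q'A])
  obtain \<delta> where \<delta>: "\<delta> > 0" "\<And>z. z \<in> cball c R - b \<Longrightarrow> dist z q < \<delta> \<Longrightarrow> dist (fi z) (fi q) < dist a q' - R3"
  proof -
    have "dist a q' - R3 > 0" using R13 by simp
    then show ?thesis using fic qin that unfolding continuous_on_iff by blast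
  qed
  \<comment> \<open>Small enough that the ball about \<open>q\<close> avoids
    \<open>cball c s2\<close>, stays in \<open>ball c (2 * d)\<close>, and is taken by
    \<open>fi\<close> so close to \<open>q'\<close> that it misses \<open>ball a R3\<close>.\<close>
  define \<eta> where "\<eta> = min (min (\<delta> / 2) ((dist c q - s2) / 2)) (min ((2 * d - dist c q) / 2) d)"
  have \<eta>: "\<eta> > 0" "\<eta> < \<delta>" "\<eta> < dist c q - s2" "\<eta> < 2 * d - dist c q" "\<eta> \<le> d"
  proof -
    have "\<eta> \<le> min (\<delta> / 2) ((dist c q - s2) / 2)" "\<eta> \<le> min ((2 * d - dist c q) / 2) d"
      by (simp_all only: \<eta>_def min.cobounded1 min.cobounded2)
    then have le: "2 * \<eta> \<le> \<delta>" "2 * \<eta> \<le> dist c q - s2" "2 * \<eta> \<le> 2 * d - dist c q" by auto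
    have le4: "\<eta> \<le> d" unfolding \<eta>_def by (rule order_trans[OF min.cobounded2 min.cobounded2])
    show pos: "\<eta> > 0" unfolding \<eta>_def using \<delta>(1) q d(1) by simp
    show "\<eta> < \<delta>" using le(1) pos by linarith
    show "\<eta> < dist c q - s2" using le(2) pos by linarith
    show "\<eta> < 2 * d - dist c q" using le(3) pos by linarith
    show "\<eta> \<le> d" by (rule le4)
  qed
  show ?thesis
  proof (rule that[OF aV R13(1,2) s(1,2,3) W2 \<eta>(1,5)])
    show "cball q \<eta> \<inter> cball c s2 = {}"
    proof -
      have False if "dist q x \<le> \<eta>" "dist c x \<le> s2" for x
        using dist_triangle[of c q x] that \<eta>(3) by (simp add: dist_commute)
      then show ?thesis by auto
    qed
    show "cball q \<eta> \<subseteq> ball c (2 * d)"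
    proof
      fix x assume "x \<in> cball q \<eta>"
      then show "x \<in> ball c (2 * d)" using dist_triangle[of c x q] \<eta>(4) by simp
    qed
    show "f x \<notin> cball q \<eta>" if xA: "x \<in> A" and xb: "x \<in> ball a R3" for x
    proof
      assume "f x \<in> cball q \<eta>"
      then have "dist (f x) q < \<delta>" using \<eta>(2) by (simp add: dist_commute)
      then have "dist (fi (f x)) (fi q) < dist a q' - R3" using \<delta>(2) fin[OF xA] by blast
      then have "dist x q' < dist a q' - R3" by (simp add: q_def fif[OF xA] fif[OF q'A])
      then show False using dist_triangle[of a q' x] xb by simp
    qed
  qed
qed

text \<open>The unknown set \<open>E\<close> prevents a direct contraction. The map \<open>g\<close>
  trades \<open>E\<close> for the patch \<open>Z\<close> over \<open>cball q \<eta>\<close>: it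
  opens the patch wide enough to take in the place of the hole, and what surrounded \<open>E\<close>
  then surrounds a small set in the interior of \<open>D\<close>. Seen through \<open>g\<close>, the
  compression becomes a global map \<open>h2\<close> that fixes a neighbourhood of this set and
  shrinks the rest. The ball about \<open>a\<close> avoids \<open>Z\<close>, so \<open>g\<close> is
  at hand on all of it off \<open>closure E\<close>.\<close>

lemma compression:
  obtains a R1 R3 s1 s2 k where "a \<in> V d" "0 < R1" "R1 < R3" "d < s1" "s1 < s2" "s2 < 2 * d"
    "W s2 \<subseteq> ball a R1" "LWemb p (ball a R3) k" "k ` ball a R3 \<subseteq> V s1" "\<And>x. x \<in> V d \<Longrightarrow> k x = x"
proof (rule geometry)
  fix a R1 R3 s1 s2 q \<eta>
  assume g: "a \<in> V d" "0 < R1" "R1 < R3" "d < s1" "s1 < s2" "s2 < 2 * d"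
    "W s2 \<subseteq> ball a R1" "0 < \<eta>" "\<eta> \<le> d" "cball q \<eta> \<inter> cball c s2 = {}" "cball q \<eta> \<subseteq> ball c (2 * d)"
    and gf: "\<And>x. x \<in> A \<Longrightarrow> x \<in> ball a R3 \<Longrightarrow> f x \<notin> cball q \<eta>"
  have "q \<in> cball q \<eta>" using g(8) by simp
  then have "q \<in> ball c (2 * d)" using g(11) by blast
  then have dq: "dist c q < 2 * d" by simp
  have VO: "V d \<subseteq> ball a R3" using V_W(1)[of d s2] g by force
  \<comment> \<open>\<open>h\<close> inflates \<open>cball q \<eta>\<close> to
    \<open>cball q (5 * d)\<close>, which contains the hole; points off the small ball are thus
    moved off the hole. As \<open>dist c q < 2 * d\<close>, everything happens within
    \<open>ball c (8 * d)\<close>.\<close>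
  obtain \<rho> h where sb: "support_bij \<rho> h (ball q (6 * d))" and hL: "LWemb p UNIV h"
    and \<rho>: "\<And>x. x \<in> cball q (5 * d) \<Longrightarrow> \<rho> x = q + (\<eta> / (5 * d)) *\<^sub>R (x - q)"
  proof (rule radial_contraction_bij[OF p, of "5 * d" "6 * d" "\<eta> / (5 * d)" q])
    show "0 < 5 * d" "5 * d < 6 * d" "0 < \<eta> / (5 * d)" "\<eta> / (5 * d) \<le> 1" using d g by auto
  qed (use that in blast)
  interpret H: support_bij \<rho> h "ball q (6 * d)" by fact
  have b6: "ball q (6 * d) \<subseteq> ball c (8 * d)"
  proof
    fix x assume "x \<in> ball q (6 * d)"
    then show "x \<in> ball c (8 * d)" using dist_triangle[of c x q] dq by simp
  qed
  then have b6R: "ball q (6 * d) \<subseteq> ball c R" using d by auto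
  have hq: "h x \<notin> cball q (5 * d)" if "x \<notin> cball q \<eta>" for x
  proof
    assume hx: "h x \<in> cball q (5 * d)"
    have "x = q + (\<eta> / (5 * d)) *\<^sub>R (h x - q)" using \<rho>[OF hx] H.inv2[of x] by simp
    from arg_cong[OF this, of "\<lambda>v. norm (v - q)"]
    have "norm (x - q) = \<eta> / (5 * d) * norm (h x - q)" using g(8) d(1) by simp
    also have "\<dots> \<le> \<eta> / (5 * d) * (5 * d)" using hx g d by (intro mult_left_mono) (auto simp: dist_norm norm_minus_commute)
    finally show False using that d by (auto simp: dist_norm norm_minus_commute)
  qed
  have b5: "closure b \<subseteq> cball q (5 * d)"
  proof
    fix x assume "x \<in> closure b"
    then have "dist c x < d" using d(3) by auto
    then have "dist q x \<le> 5 * d" using dist_triangle[of q x c] dq d(1) dist_commute[of q c] by linarith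
    then show "x \<in> cball q (5 * d)" by simp
  qed
  have hB: "h x \<in> B0" if "x \<in> ball c R" "x \<notin> cball q \<eta>" for x
    using H.pres'[OF b6R, of x] hq[OF that(2)] that(1) b5 by (auto simp: B0_def)
  have sq: "ball c s1 \<inter> cball q \<eta> = {}" using g(5,10) by fastforce
  have hs1: "h x \<in> B0" if "x \<in> ball c s1" for x
  proof (rule hB)
    show "x \<in> ball c R" using that d(1,2) g(5,6) by simp
    show "x \<notin> cball q \<eta>" using sq that by blast
  qed
  have s1: "0 < s1" using g d by linarith
  \<comment> \<open>\<open>h\<close> moves all of \<open>ball c s1\<close> off the hole, so that
    \<open>fi\<close> can be applied to every point of the image: \<open>U\<close> is the region
    around the hole, transported into \<open>D\<close> with the hole filled in.\<close>
  define q1 where "q1 = fi (h c)"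
  define U where "U = fi ` (h ` ball c s1)"
  have hl1: "LWemb p (ball c s1) h" by (rule LWemb_subset[OF hL subset_UNIV open_ball])
  have fih: "LWemb p (ball c s1) (\<lambda>y. fi (h y))" by (rule LWemb_comp[OF hl1 lwfi]) (use hs1 in blast)
  have Uo: "open U" using LWembD(3)[OF fih] by (simp add: U_def image_image)
  have q1U: "q1 \<in> U" using s1 by (auto simp: q1_def U_def)
  have UD: "U \<subseteq> D" using fi_D hs1 by (auto simp: U_def)
  obtain e where e: "e > 0" "ball q1 e \<subseteq> U" using openE[OF Uo q1U] by metis
  have "bounded (D \<union> ball a R3)" using D(2) by simp
  then obtain r where r: "D \<union> ball a R3 \<subseteq> ball q1 r" using bounded_subset_ballD by blast
  define M where "M = max r 2"
  have M: "D \<subseteq> ball q1 M" "ball a R3 \<subseteq> ball q1 M" "M \<ge> 2" using r by (auto simp: M_def)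
  \<comment> \<open>\<open>ball q1 M\<close> contains \<open>D\<close> and the ball about
    \<open>a\<close>, and scaling by \<mu> takes it into \<open>ball q1 e\<close>, a part of
    \<open>U\<close>. \<open>M\<close> is at least 2 in order to contain the support of
    \<rho>2.\<close>
  define \<mu> where "\<mu> = min (1 / 2) (e / M)"
  have \<mu>: "0 < \<mu>" "\<mu> \<le> 1" "\<mu> * M \<le> e"
  proof -
    show "0 < \<mu>" "\<mu> \<le> 1" using e(1) M(3) by (auto simp: \<mu>_def)
    have "\<mu> \<le> e / M" by (simp add: \<mu>_def)
    then show "\<mu> * M \<le> e" using M(3) by (simp add: pos_le_divide_eq)
  qed
  obtain \<rho>2 \<rho>3 where sb2: "support_bij \<rho>2 \<rho>3 (ball q1 2)" and L3: "LWemb p UNIV \<rho>3"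
    and \<rho>2: "\<And>x. x \<in> cball q1 1 \<Longrightarrow> \<rho>2 x = q1 + \<mu> *\<^sub>R (x - q1)"
    by (rule radial_contraction_bij[OF p, of 1 2 \<mu> q1]) (use \<mu> in auto)
  interpret H2: support_bij \<rho>2 \<rho>3 "ball q1 2" by fact
  \<comment> \<open>The inverse of a contraction by \<mu> near \<open>q1\<close>, followed by the
    contraction by \<mu> everywhere: the two cancel on \<open>ball q1 \<mu>\<close>, while the whole
    of \<open>ball q1 M\<close> is taken into \<open>U\<close>.\<close>
  define h2 where "h2 x = q1 + \<mu> *\<^sub>R (\<rho>3 x - q1)" for x
  have h2L: "LWemb p UNIV h2"
    unfolding h2_def by (rule LWemb_comp[OF L3 LWemb_similarity[OF p _ open_UNIV]]) (use \<mu> in auto)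
  have h2inj: "h2 x = h2 y \<Longrightarrow> x = y" for x y using LWembD(4)[OF h2L] by (simp add: inj_def)
  have h2id: "h2 x = x" if "x \<in> ball q1 \<mu>" for x
  proof -
    let ?z = "q1 + (1 / \<mu>) *\<^sub>R (x - q1)"
    have "norm (?z - q1) = norm (x - q1) / \<mu>" using \<mu> by simp
    also have "\<dots> \<le> 1" using that \<mu> by (simp add: dist_norm norm_minus_commute)
    finally have "?z \<in> cball q1 1" by (simp add: dist_norm norm_minus_commute)
    then have "\<rho>2 ?z = x" using \<rho>2 \<mu> by simp
    then have "\<rho>3 x = ?z" using H2.inv1[of ?z] by simp
    then show ?thesis using \<mu> by (simp add: h2_def)
  qed
  have h2U: "h2 x \<in> U" if "x \<in> ball q1 M" for x
  proof -
    have "ball q1 2 \<subseteq> ball q1 M" using M(3) by auto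
    then have "\<rho>3 x \<in> ball q1 M" using H2.pres' that by blast
    then have "norm (\<rho>3 x - q1) < M" by (simp add: dist_norm norm_minus_commute)
    then have "norm (h2 x - q1) < \<mu> * M" using \<mu> by (simp add: h2_def)
    then show ?thesis using e(2) \<mu>(3) by (auto simp: dist_norm norm_minus_commute)
  qed
  obtain \<delta> where \<delta>: "\<delta> > 0" "\<And>y. y \<in> ball c s1 \<Longrightarrow> dist y c < \<delta> \<Longrightarrow> dist (fi (h y)) (fi (h c)) < \<mu>"
  proof -
    have "c \<in> ball c s1" using s1 by simp
    then show ?thesis using LWembD(7)[OF fih] \<mu>(1) that unfolding continuous_on_iff by blast
  qed
  define d' where "d' = min d (\<delta> / 2)"
  have d': "0 < d'" "d' \<le> d" using d \<delta> by (auto simp: d'_def)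
  have fihd: "fi (h y) \<in> ball q1 \<mu>" if "y \<in> cball c d'" for y
  proof -
    have "y \<in> ball c s1" "dist y c < \<delta>" using that d' g \<delta>(1) by (auto simp: d'_def dist_commute)
    then show ?thesis using \<delta>(2)[of y] by (simp add: q1_def dist_commute)
  qed
  \<comment> \<open>\<theta> shrinks the hole so far that \<open>fi \<circ> h\<close> takes it into
    \<open>ball q1 \<mu>\<close>, where \<open>h2\<close> is the identity.\<close>
  obtain \<theta> \<theta>' where sb3: "support_bij \<theta> \<theta>' (ball c s1)" and \<theta>L: "LWemb p UNIV \<theta>"
    and \<theta>: "\<And>x. x \<in> cball c d \<Longrightarrow> \<theta> x = c + (d' / d) *\<^sub>R (x - c)"
    by (rule radial_contraction_bij[OF p, of d s1 "d' / d" c]) (use d d' g in auto)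
  interpret T: support_bij \<theta> \<theta>' "ball c s1" by fact
  have s1R: "ball c s1 \<subseteq> ball c R" using g d by auto
  have \<theta>d: "\<theta> x \<in> cball c d'" if "x \<in> ball c d" for x
  proof -
    have "norm (\<theta> x - c) = d' / d * norm (x - c)" using \<theta>[of x] that d d' by simp
    also have "\<dots> \<le> d' / d * d" using that d d' by (intro mult_left_mono) (auto simp: dist_norm norm_minus_commute)
    finally show ?thesis using d by (simp add: dist_norm norm_minus_commute)
  qed
  have \<theta>q: "\<theta> x \<notin> cball q \<eta>" if "x \<notin> cball q \<eta>" for x
  proof (cases "x \<in> ball c s1")
    case True
    then have "\<theta> x \<in> ball c s1" using T.pres by blast
    then show ?thesis using sq by blast
  qed (use that T.off in simp)
  have mB: "h (\<theta> x) \<in> B0" if "x \<in> B0" "x \<notin> cball q \<eta>" for x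
    using hB[OF _ \<theta>q[OF that(2)]] T.pres[OF s1R, of x] that(1) by (simp add: B0_def)
  define Z where "Z = A \<inter> f -` cball q \<eta>"
  define G where "G = - closure E - Z"
  have "closed Z" unfolding Z_def by (rule continuous_closed_preimage[OF fc closed_A]) auto
  then have Go: "open G" by (simp add: G_def open_Diff open_Compl)
  have DG: "x \<in> D - closure E" "f x \<in> B0" "f x \<notin> cball q \<eta>" "x \<in> A" if "x \<in> D" "x \<in> G" for x
  proof -
    show x: "x \<in> D - closure E" using that by (auto simp: G_def)
    then show "f x \<in> B0" and xA: "x \<in> A" using f_B0 DE by blast+
    then show "f x \<notin> cball q \<eta>" using that by (auto simp: G_def Z_def)
  qed
  \<comment> \<open>Both \<theta> and \<open>h\<close> are the identity beyond level
    \<open>8 * d\<close>, so this formula is the identity near the boundary of \<open>D\<close> and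
    continues to the exterior.\<close>
  define g where "g x = (if x \<in> D then fi (h (\<theta> (f x))) else x)" for x
  have gD: "g x \<in> D" if "x \<in> D" "x \<in> G" for x using fi_D[OF mB[OF DG(2,3)[OF that]]] that(1) by (simp add: g_def)
  have fg: "f (g x) = h (\<theta> (f x))" if "x \<in> D" "x \<in> G" for x
    using fif_B0[OF mB[OF DG(2,3)[OF that]]] that(1) by (simp add: g_def)
  have mcan: "x = y" if "x \<in> D" "x \<in> G" "y \<in> D" "y \<in> G" "h (\<theta> (f x)) = h (\<theta> (f y))" for x y
  proof -
    have "\<theta> (f x) = \<theta> (f y)" using arg_cong[OF that(5), of \<rho>] by (simp add: H.inv2)
    from arg_cong[OF this, of \<theta>'] have "f x = f y" by (simp add: T.inv1)
    then show ?thesis by (rule f_inj[OF DG(4)[OF that(1,2)] DG(4)[OF that(3,4)]])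
  qed
  have ginj: "inj_on g G"
  proof (rule inj_onI)
    fix x y assume xy: "x \<in> G" "y \<in> G" "g x = g y"
    show "x = y"
    proof (cases "x \<in> D"; cases "y \<in> D")
      assume a: "x \<in> D" "y \<in> D"
      then show ?thesis using mcan[OF a(1) xy(1) a(2) xy(2)] fg[OF a(1) xy(1)] fg[OF a(2) xy(2)] xy(3) by simp
    next
      assume "x \<in> D" "y \<notin> D"
      then show ?thesis using gD[of x] xy by (simp add: g_def)
    next
      assume "x \<notin> D" "y \<in> D"
      then show ?thesis using gD[of y] xy by (simp add: g_def)
    qed (use xy in \<open>simp add: g_def\<close>)
  qed
  have d8: "d \<le> 8 * d" "8 * d < R" using d by auto
  have gL: "LWemb p G g"
  proof (rule LWemb_local[OF p ginj])
    fix x assume x: "x \<in> G"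
    show "\<exists>U. x \<in> U \<and> U \<subseteq> G \<and> LWemb p U g"
    proof (cases "x \<in> D")
      case True
      let ?U = "D \<inter> G"
      have 0: "open ?U" using D(1) Go by auto
      have 1: "LWemb p ?U f" by (rule LWemb_subset[OF lwD _ 0]) (use DG in blast)
      have 2: "LWemb p ?U (\<lambda>x. \<theta> (f x))" by (rule LWemb_comp[OF 1 \<theta>L]) simp
      have 3: "LWemb p ?U (\<lambda>x. h (\<theta> (f x)))" by (rule LWemb_comp[OF 2 hL]) simp
      have 4: "LWemb p ?U (\<lambda>x. fi (h (\<theta> (f x))))" by (rule LWemb_comp[OF 3 lwfi]) (use mB DG in blast)
      have "LWemb p ?U g" by (rule LWemb_cong[OF 4]) (simp add: g_def)
      moreover have "x \<in> ?U" using True x by blast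
      ultimately show ?thesis by (intro exI[of _ ?U] conjI Int_lower2)
    next
      case False
      let ?U = "- W (8 * d)"
      have "closed (W (8 * d))" by (rule compact_imp_closed[OF compact_W[OF d8(1)]])
      then have o: "open ?U" by (simp add: open_Compl)
      have gU: "g y = y" if y: "y \<in> ?U" for y
      proof (cases "y \<in> D")
        case True
        then have "y \<in> closure D" "\<not> lev y \<le> 8 * d" using closure_subset[of D] y by (auto simp: W_def)
        then have yA: "y \<in> A" and fy: "dist c (f y) > 8 * d" using d(1) by (auto simp: lev_def A_def split: if_splits)
        have "f y \<notin> ball c s1" using fy g d by auto
        then have "\<theta> (f y) = f y" by (rule T.off)
        moreover have "f y \<notin> ball q (6 * d)" using fy b6 by auto
        then have "h (f y) = f y" by (rule H.off')
        ultimately show ?thesis using True fif[OF yA] by (simp add: g_def)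
      qed (simp add: g_def)
      have "?U \<subseteq> G"
      proof -
        have "x \<in> W (8 * d)" if "x \<in> closure E" for x
          using clE[OF that] that E(3) closure_subset[of D] d8 by (auto simp: W_def)
        moreover have "x \<in> W (8 * d)" if "x \<in> Z" for x
        proof -
          have "dist c (f x) < 2 * d" "x \<in> A" using that g(11) by (auto simp: Z_def)
          then show ?thesis using lev_A[of x] A_D d(1) by (auto simp: W_def)
        qed
        ultimately show ?thesis by (auto simp: G_def)
      qed
      moreover have "x \<in> ?U" using frD(3)[of x] False d8 by (auto simp: W_def)
      moreover have "LWemb p ?U g" by (rule LWemb_cong[OF LWemb_id[OF p o]]) (use gU in simp)
      ultimately show ?thesis by (intro exI[of _ ?U] conjI)
    qed
  qed
  define gi where "gi = inv_into G g"
  have gig: "gi (g x) = x" if "x \<in> G" for x unfolding gi_def by (rule inv_into_f_f[OF ginj that])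
  let ?O = "ball a R3"
  have OG: "x \<in> G" if "x \<in> ?O - closure E" for x using that gf by (auto simp: G_def Z_def)
  have gM: "g x \<in> ball q1 M" if "x \<in> ?O - closure E" for x
    using gD[OF _ OG[OF that]] M that by (cases "x \<in> D") (auto simp: g_def)
  have key: "\<exists>y \<in> V s1 \<inter> G. g y = h2 (g x)" if x: "x \<in> ?O - closure E" for x
  proof -
    have "h2 (g x) \<in> U" by (rule h2U[OF gM[OF x]])
    then obtain w where w: "w \<in> ball c s1" "h2 (g x) = fi (h w)" by (auto simp: U_def)
    define w' where "w' = \<theta>' w"
    have w': "w' \<in> ball c s1" "\<theta> w' = w" using T.pres'[OF order_refl, of w] w(1) by (simp_all add: w'_def T.inv2 del: mem_ball)
    \<comment> \<open>Points coming from the filled-in hole are fixed by \<open>h2\<close>, so by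
      injectivity \<open>g x\<close> itself would be such a point, and \<open>f x\<close> would lie
      in the closed hole.\<close>
    have "w' \<notin> closure b"
    proof
      assume wb: "w' \<in> closure b"
      then have "w \<in> cball c d'" using \<theta>d[of w'] d(3) w'(2) by auto
      then have hw: "h2 (fi (h w)) = fi (h w)" using h2id fihd by blast
      have gx: "g x = fi (h w)" by (rule h2inj) (simp only: hw w(2))
      have "g x \<in> D" unfolding gx using fi_D[OF hs1[OF w(1)]] by blast
      then have xD: "x \<in> D" by (auto simp: g_def split: if_splits)
      have "h (\<theta> (f x)) = h w" using fg[OF xD OG[OF x]] gx fif_B0[OF hs1[OF w(1)]] by simp
      from arg_cong[OF this, of \<rho>] have "\<theta> (f x) = w" by (simp add: H.inv2)
      then have "f x = w'" using T.inv1[of "f x"] by (simp add: w'_def)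
      then show False using DG(2)[OF xD OG[OF x]] wb by (simp add: B0_def)
    qed
    then have wB: "w' \<in> B0" using w'(1) s1R by (auto simp: B0_def)
    let ?y = "fi w'"
    have y: "?y \<in> D - closure E" "f ?y = w'" using fi_D[OF wB] fif_B0[OF wB] by auto
    have "?y \<in> G" using y w'(1) sq by (auto simp: G_def Z_def)
    moreover have "?y \<in> V s1" using y w'(1) DE lev_A[of ?y] closure_subset[of D] by (auto simp: V_def)
    moreover have "g ?y = h2 (g x)" using y w'(2) w(2) by (simp add: g_def)
    ultimately show ?thesis by blast
  qed
  define k where "k x = (if x \<in> closure E then x else gi (h2 (g x)))" for x
  have kx: "k x \<in> V s1" "k x \<in> G" "g (k x) = h2 (g x)" if x: "x \<in> ?O - closure E" for x
  proof -
    obtain y where y: "y \<in> V s1" "y \<in> G" "g y = h2 (g x)" using key[OF x] by blast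
    then have "k x = y" using x gig[OF y(2)] by (simp add: k_def)
    then show "k x \<in> V s1" "k x \<in> G" "g (k x) = h2 (g x)" using y by auto
  qed
  have kd: "k x = x" if x: "x \<in> V d" for x
  proof (cases "x \<in> closure E")
    case False
    have dR: "d \<le> R" using d by simp
    have xO: "x \<in> ?O - closure E" using x VO False by blast
    have xD: "x \<in> D" using x V_D[OF dR] by blast
    have "f x \<in> ball c d" using x lev_A[OF DG(4)[OF xD OG[OF xO]]] by (auto simp: V_def)
    then have "g x \<in> ball q1 \<mu>" using fihd[OF \<theta>d] xD by (simp add: g_def)
    then have "h2 (g x) = g x" by (rule h2id)
    then show ?thesis using False gig[OF OG[OF xO]] by (simp add: k_def)
  qed (simp add: k_def)
  have kE: "k x = x" if "x \<in> closure E" for x using that by (simp add: k_def)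
  have kinj: "inj_on k ?O"
  proof (rule inj_onI)
    fix x y assume xy: "x \<in> ?O" "y \<in> ?O" "k x = k y"
    show "x = y"
    proof (cases "x \<in> closure E"; cases "y \<in> closure E")
      assume a: "x \<notin> closure E" "y \<notin> closure E"
      then have "h2 (g x) = h2 (g y)" using kx(3)[of x] kx(3)[of y] a xy by simp
      then have "g x = g y" by (rule h2inj)
      then show ?thesis using inj_onD[OF ginj, of x y] OG a xy by blast
    next
      assume a: "x \<in> closure E" "y \<notin> closure E"
      then show ?thesis using kx(2)[of y] kE[of x] xy by (auto simp: G_def)
    next
      assume a: "x \<notin> closure E" "y \<in> closure E"
      then show ?thesis using kx(2)[of x] kE[of y] xy by (auto simp: G_def)
    qed (use xy kE in simp)
  qed
  have dR: "0 < d" "d \<le> R" using d by auto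
  have kL: "LWemb p ?O k"
  proof (rule LWemb_local[OF p kinj])
    fix x assume x: "x \<in> ?O"
    show "\<exists>U. x \<in> U \<and> U \<subseteq> ?O \<and> LWemb p U k"
    proof (cases "x \<in> closure E")
      case True
      have "x \<in> V d" using clE[OF True] True E(3) closure_subset[of D] by (auto simp: V_def)
      moreover have "LWemb p (V d) k" by (rule LWemb_cong[OF LWemb_id[OF p open_V[OF dR]]]) (use kd in simp)
      ultimately show ?thesis by (intro exI[of _ "V d"] conjI VO)
    next
      case False
      let ?U = "?O - closure E"
      have o: "open ?U" by (simp add: open_Diff)
      have 1: "LWemb p ?U g" by (rule LWemb_subset[OF gL _ o]) (use OG in blast)
      have 2: "LWemb p ?U (\<lambda>x. h2 (g x))" by (rule LWemb_comp[OF 1 h2L]) simp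
      have 3: "LWemb p (g ` G) gi" unfolding gi_def by (rule LWemb_inv[OF gL])
      have 4: "LWemb p ?U (\<lambda>x. gi (h2 (g x)))"
      proof (rule LWemb_comp[OF 2 3])
        show "(\<lambda>x. h2 (g x)) ` ?U \<subseteq> g ` G"
        proof
          fix z assume "z \<in> (\<lambda>x. h2 (g x)) ` ?U"
          then obtain x where "x \<in> ?U" "z = h2 (g x)" by (elim imageE)
          then show "z \<in> g ` G" using kx(2,3)[of x] by (intro image_eqI[of _ _ "k x"]) auto
        qed
      qed
      have "LWemb p ?U k" by (rule LWemb_cong[OF 4]) (simp add: k_def)
      moreover have "x \<in> ?U" using x False by blast
      ultimately show ?thesis by (intro exI[of _ ?U] conjI Diff_subset)
    qed
  qed
  have kO: "k ` ?O \<subseteq> V s1"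
  proof
    fix z assume "z \<in> k ` ?O"
    then obtain x where x: "x \<in> ?O" "z = k x" by blast
    show "z \<in> V s1"
    proof (cases "x \<in> closure E")
      case True
      then have "lev x < s1" "x \<in> closure D" using clE[OF True] g E(3) closure_subset[of D] by auto
      then show ?thesis using x True by (simp add: V_def k_def)
    qed (use kx(1)[of x] x in simp)
  qed
  show ?thesis by (rule that[OF g(1-7) kL kO kd])
qed

end

lemma compact_in_smaller_ball:
  fixes c :: "'a::metric_space"
  assumes "compact T" "T \<subseteq> ball c s" "(d::real) < s"
  obtains s0 where "d \<le> s0" "s0 < s" "T \<subseteq> cball c s0"
proof (cases "T = {}")
  case True
  then show ?thesis using that[of d] assms by simp
next
  case False
  have "continuous_on T (dist c)" by (intro continuous_intros)
  from continuous_attains_sup[OF assms(1) False this] obtain y where y: "y \<in> T" "\<And>z. z \<in> T \<Longrightarrow> dist c z \<le> dist c y" by blast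
  show ?thesis
  proof (rule that[of "max d (dist c y)"])
    show "max d (dist c y) < s" using assms(2,3) y(1) by auto
    show "T \<subseteq> cball c (max d (dist c y))" using y(2) by (fastforce simp: le_max_iff_disj)
  qed simp
qed

lemma support_bij_mono: "support_bij \<rho> \<rho>' S \<Longrightarrow> S \<subseteq> T \<Longrightarrow> support_bij \<rho> \<rho>' T" unfolding support_bij_def by blast

lemma LWemb_sim: "1 \<le> p \<Longrightarrow> t \<noteq> 0 \<Longrightarrow> open X \<Longrightarrow> LWemb p X (sim a t)"
  using LWemb_similarity[of p t X a a] by (simp add: sim_def[abs_def])

lemma LWemb_nbhd: "LWemb p U F \<Longrightarrow> x \<in> U \<Longrightarrow> U \<subseteq> X \<Longrightarrow> \<exists>U. x \<in> U \<and> U \<subseteq> X \<and> LWemb p U F" by blast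

section \<open>Extension of a homeomorphism from the collar\<close>

context collar
begin

text \<open>The neighbourhood of the boundary on which nothing changes is delivered as the
  complement of a compact sublevel set \<open>W s\<close>.\<close>

lemma extension:
  assumes pn: "p < real CARD('n)"
  obtains F s where "compact (W s)" "W s \<subseteq> D" "E \<subseteq> W s"
    "\<And>x. x \<in> closure D \<Longrightarrow> x \<notin> W s \<Longrightarrow> F x = f x" "continuous_on (closure D) F"
    "F ` closure D = cball c R" "inj_on F (closure D)" "LWemb p (interior (closure D)) F"
proof (rule compression)
  fix a R1 R3 s1 s2 k
  assume g: "a \<in> V d" "0 < R1" "R1 < R3" "d < s1" "s1 < s2" "s2 < 2 * d" "W s2 \<subseteq> ball a R1"
    and kL: "LWemb p (ball a R3) k" and kO: "k ` ball a R3 \<subseteq> V s1" and kd: "\<And>x. x \<in> V d \<Longrightarrow> k x = x"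
  define R2 where "R2 = (R1 + R3) / 2"
  define t2 where "t2 = (s1 + s2) / 2"
  have r: "R1 < R2" "R2 < R3" "s1 < t2" "t2 < s2" "0 < s1" "s1 < R" "s2 < R" using g d by (auto simp: R2_def t2_def)
  let ?O = "ball a R3" and ?X = "V s1" and ?Y = "ball c s1"
  have CD: "D \<subseteq> closure D" by (rule closure_subset)
  have EC: "closure E \<subseteq> closure D" using E(3) CD by blast
  have EV: "closure E \<subseteq> V d" using clE EC by (auto simp: V_def)
  have VX: "V d \<subseteq> ?X" "?X \<subseteq> W s2" using V_W(2)[of d s1] V_W(1)[of s1 s2] g by auto
  have XR: "?X \<subseteq> ball a R1" using VX g(7) by blast
  have XO: "?X \<subseteq> ?O" using XR g(3) by force
  have XD: "?X \<subseteq> D" by (rule V_D) (use r in simp)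
  have Xo: "open ?X" by (rule open_V) (use r in auto)
  have kinj: "x = y" if "x \<in> ?O" "y \<in> ?O" "k x = k y" for x y using inj_onD[OF LWembD(4)[OF kL] that(3,1,2)] .
  have kE: "k x \<notin> closure E" if x: "x \<in> ?O" "x \<notin> closure E" for x
  proof
    assume kx: "k x \<in> closure E"
    then have "k (k x) = k x" using kd EV by blast
    moreover have "k x \<in> ?O" using kx EV VX XO by blast
    ultimately have "k x = x" using kinj x(1) by blast
    then show False using kx x by simp
  qed
  have oV: "open (V d)" by (rule open_V) (use d in auto)
  obtain e where e: "e > 0" "ball a e \<subseteq> V d" using openE[OF oV g(1)] by metis
  \<comment> \<open>\<open>l * R1 \<le> e\<close> takes \<open>?X\<close> into \<open>V d\<close>,
    where \<open>k\<close> is the identity; \<open>l \<le> 1 / 2\<close> takes \<open>?Y\<close>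
    into \<open>ball c d\<close>, as \<open>s1 < 2 * d\<close>. One ratio has to serve on both
    sides.\<close>
  define l where "l = min (1 / 2) (e / R1)"
  have l: "0 < l" "l < 1" "l \<le> 1 / 2" "l * R1 \<le> e"
  proof -
    show "0 < l" using e(1) g(2) by (simp add: l_def)
    show le: "l \<le> 1 / 2" unfolding l_def by (rule min.cobounded1)
    show "l < 1" using le by linarith
    have "l \<le> e / R1" by (simp add: l_def)
    then show "l * R1 \<le> e" using g(2) by (simp add: pos_le_divide_eq)
  qed
  have rV: "sim a l x \<in> V d" if "x \<in> ?X" for x
  proof -
    have "dist a (sim a l x) = l * dist a x" using l by (intro dist_sim) simp
    also have "\<dots> < l * R1" using XR that l(1) by (intro mult_strict_left_mono) auto
    finally show ?thesis using l(4) e(2) by auto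
  qed
  have rY: "sim c l y \<in> ball c d" if "y \<in> ?Y" for y
  proof -
    have "dist c (sim c l y) = l * dist c y" using l by (intro dist_sim) simp
    also have "\<dots> \<le> 1 / 2 * dist c y" using l by (intro mult_right_mono) auto
    finally show ?thesis using that g by simp
  qed
  have dY: "ball c d \<subseteq> ?Y" using g(4) by auto
  obtain \<rho> \<rho>i where rb: "support_bij \<rho> \<rho>i (ball a R2)" and rL: "LWemb p UNIV \<rho>" "LWemb p UNIV \<rho>i"
    and \<rho>: "\<And>x. x \<in> cball a R1 \<Longrightarrow> \<rho> x = a + l *\<^sub>R (x - a)"
    by (rule radial_contraction_bij[OF p g(2) r(1), of l a]) (use l in auto)
  let ?K = "cball a R2" and ?K' = "cball c t2" and ?Q = "ball c s2"
  have KO: "?K \<subseteq> ?O" "?K' \<subseteq> ?Q" using r by auto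
  obtain \<Psi> \<Psi>i where Sb: "support_bij \<Psi> \<Psi>i (k ` ?K)" and SL: "LWemb p UNIV \<Psi>" "LWemb p UNIV \<Psi>i"
    and Sk: "\<And>x. x \<in> ?O \<Longrightarrow> \<Psi> (k x) = k (\<rho> x)" and "\<And>x. x \<in> ?O \<Longrightarrow> \<Psi>i (k x) = k (\<rho>i x)"
    by (rule LWemb_conjugate_extension[OF kL rL support_bij_mono[OF rb ball_subset_cball] compact_cball KO(1)], rule that) blast+
  interpret S: support_bij \<Psi> \<Psi>i "k ` ?K" by fact
  have KX: "k ` ?K \<subseteq> ?X" using KO(1) kO by blast
  have \<Psi>r: "\<Psi> (k x) = sim a l x" if x: "x \<in> ?X" for x
  proof -
    have "x \<in> cball a R1" using XR x by force
    then have "\<rho> x = sim a l x" using \<rho> by (simp add: sim_def)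
    then show ?thesis using Sk XO x kd[OF rV[OF x]] by auto
  qed
  \<comment> \<open>The formula \<open>f (k (fi y))\<close> makes no sense over the hole. Since
    \<open>k\<close> is the identity on \<open>V d\<close>, it yields the identity on
    \<open>ball c d\<close> off the closed hole and so extends over it.\<close>
  define kap where "kap y = (if y \<in> ball c d then y else f (k (fi y)))" for y
  have fiW: "fi y \<in> D - closure E" "f (fi y) = y" "lev (fi y) = dist c y" if "y \<in> B0" for y
  proof -
    show x: "fi y \<in> D - closure E" and "f (fi y) = y" using fi_D fif_B0 that by auto
    then show "lev (fi y) = dist c y" using lev_A[of "fi y"] DE(2) by auto
  qed
  have QB: "y \<in> B0" if "y \<in> ?Q" "y \<notin> closure b" for y using that r by (simp add: B0_def)
  have fiO: "fi y \<in> ?O" if "y \<in> ?Q" "y \<notin> closure b" for y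
  proof -
    have "fi y \<in> W s2" using fiW[OF QB[OF that]] that CD by (auto simp: W_def)
    then show ?thesis using g(3,7) by force
  qed
  have kapd: "kap y = y" if "y \<in> ball c d" for y using that by (simp only: kap_def if_True)
  have kap1: "kap y = f (k (fi y))" if y: "y \<in> ?Q" "y \<notin> closure b" for y
  proof (cases "y \<in> ball c d")
    case True
    have "fi y \<in> V d" using fiW[OF QB[OF y]] True CD by (auto simp: V_def)
    then show ?thesis using kd kapd[OF True] fiW(2)[OF QB[OF y]] by simp
  qed (simp only: kap_def if_False)
  have kfi: "k (fi y) \<in> D - closure E" "k (fi y) \<in> ?X" if y: "y \<in> ?Q" "y \<notin> closure b" for y
  proof -
    show "k (fi y) \<in> ?X" using fiO[OF y] kO by blast
    then show "k (fi y) \<in> D - closure E" using XD kE[OF fiO[OF y]] fiW(1)[OF QB[OF y]] by blast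
  qed
  have kapB: "kap y \<in> B0" "kap y \<in> ?Y" if y: "y \<in> ?Q" "y \<notin> closure b" for y
  proof -
    show "kap y \<in> B0" unfolding kap1[OF y] by (rule f_B0[OF kfi(1)[OF y]])
    have "lev (k (fi y)) = dist c (f (k (fi y)))" using lev_A DE(2) kfi(1)[OF y] by blast
    then show "kap y \<in> ?Y" unfolding kap1[OF y] using kfi(2)[OF y] by (simp add: V_def)
  qed
  have bd: "y \<in> ball c d" if "y \<in> closure b" for y using d(3) that by blast
  have kapY: "kap y \<in> ?Y" if y: "y \<in> ?Q" for y
  proof (cases "y \<in> closure b")
    case True
    then have "kap y = y" "y \<in> ball c d" using kapd bd by auto
    then show ?thesis using dY by auto
  qed (rule kapB(2)[OF y])
  have kapinj: "inj_on kap ?Q"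
  proof (rule inj_onI)
    fix y z assume yz: "y \<in> ?Q" "z \<in> ?Q" "kap y = kap z"
    show "y = z"
    proof (cases "y \<in> closure b"; cases "z \<in> closure b")
      assume a: "y \<notin> closure b" "z \<notin> closure b"
      have "f (k (fi y)) = f (k (fi z))" using yz kap1[OF yz(1) a(1)] kap1[OF yz(2) a(2)] by simp
      then have "k (fi y) = k (fi z)" using f_inj kfi(1)[OF yz(1) a(1)] kfi(1)[OF yz(2) a(2)] DE(2) by blast
      then have "fi y = fi z" by (rule kinj[OF fiO[OF yz(1) a(1)] fiO[OF yz(2) a(2)]])
      from arg_cong[OF this, of f] show ?thesis
        by (simp only: fiW(2)[OF QB[OF yz(1) a(1)]] fiW(2)[OF QB[OF yz(2) a(2)]])
    next
      assume a: "y \<in> closure b" "z \<notin> closure b"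
      then show ?thesis using kapB(1)[OF yz(2) a(2)] kapd[OF bd[OF a(1)]] yz(3) by (simp add: B0_def)
    next
      assume a: "y \<notin> closure b" "z \<in> closure b"
      then show ?thesis using kapB(1)[OF yz(1) a(1)] kapd[OF bd[OF a(2)]] yz(3) by (simp add: B0_def)
    next
      assume a: "y \<in> closure b" "z \<in> closure b"
      then show ?thesis using yz(3) by (simp only: kapd[OF bd[OF a(1)]] kapd[OF bd[OF a(2)]])
    qed
  qed
  have kapL: "LWemb p ?Q kap"
  proof (rule LWemb_local[OF p kapinj])
    fix y assume y: "y \<in> ?Q"
    show "\<exists>U. y \<in> U \<and> U \<subseteq> ?Q \<and> LWemb p U kap"
    proof (cases "y \<in> closure b")
      case True
      show ?thesis
      proof (rule LWemb_nbhd)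
        show "LWemb p (ball c d) kap" by (rule LWemb_cong[OF LWemb_id[OF p open_ball]]) (use kapd in simp)
        show "y \<in> ball c d" by (rule bd[OF True])
        show "ball c d \<subseteq> ?Q" using g by auto
      qed
    next
      case False
      let ?U = "?Q - closure b"
      have o: "open ?U" by (simp add: open_Diff)
      have 1: "LWemb p ?U fi" by (rule LWemb_subset[OF lwfi _ o]) (use QB in blast)
      have 2: "LWemb p ?U (\<lambda>y. k (fi y))" by (rule LWemb_comp[OF 1 kL]) (use fiO in blast)
      have 3: "LWemb p ?U (\<lambda>y. f (k (fi y)))" by (rule LWemb_comp[OF 2 lwD]) (use kfi(1) in blast)
      show ?thesis by (rule LWemb_nbhd[OF LWemb_cong[OF 3]]) (use y False kap1 in auto)
    qed
  qed
  obtain \<sigma> \<sigma>i where sb: "support_bij \<sigma> \<sigma>i (ball c t2)" and sL: "LWemb p UNIV \<sigma>" "LWemb p UNIV \<sigma>i"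
    and \<sigma>: "\<And>x. x \<in> cball c s1 \<Longrightarrow> \<sigma> x = c + l *\<^sub>R (x - c)"
    by (rule radial_contraction_bij[OF p r(5,3), of l c]) (use l in auto)
  obtain \<Phi> \<Phi>i where Pb: "support_bij \<Phi> \<Phi>i (kap ` ?K')" and PL: "LWemb p UNIV \<Phi>" "LWemb p UNIV \<Phi>i"
    and Pk: "\<And>y. y \<in> ?Q \<Longrightarrow> \<Phi> (kap y) = kap (\<sigma> y)" and "\<And>y. y \<in> ?Q \<Longrightarrow> \<Phi>i (kap y) = kap (\<sigma>i y)"
    by (rule LWemb_conjugate_extension[OF kapL sL support_bij_mono[OF sb ball_subset_cball] compact_cball KO(2)], rule that) blast+
  interpret P: support_bij \<Phi> \<Phi>i "kap ` ?K'" by fact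
  have YQ: "?Y \<subseteq> ?Q" using g by auto
  have KY: "kap ` ?K' \<subseteq> ?Y" using KO(2) kapY by blast
  have YB: "?Y \<subseteq> cball c R" using r by auto
  have KB: "kap ` ?K' \<subseteq> cball c R" using KY YB by blast
  have \<Phi>r: "\<Phi> (kap y) = sim c l y" if y: "y \<in> ?Y" for y
  proof -
    have "y \<in> cball c s1" using y by auto
    then have "\<sigma> y = sim c l y" using \<sigma> by (simp add: sim_def)
    moreover have "y \<in> ?Q" using YQ y by blast
    ultimately show ?thesis using Pk kapd[OF rY[OF y]] by simp
  qed
  \<comment> \<open>The compressions of the two sides correspond under \<open>f\<close>; this is the
    relation that closes the seams.\<close>
  have kapf: "kap (f u) = f (k u)" if u: "u \<in> ?X" "u \<notin> E" for u
  proof (cases "u \<in> closure E")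
    case True
    have "kap (f u) = f u" by (rule kapd[OF bd[OF frontier_E[OF True u(2)]]])
    moreover have "k u = u" using kd EV True by blast
    ultimately show ?thesis by simp
  next
    case False
    have uD: "u \<in> D - closure E" using u XD False by blast
    then have uA: "u \<in> A" using DE by blast
    have "f u \<in> ?Q" using u(1) lev_A[OF uA] g by (simp add: V_def)
    moreover have "f u \<notin> closure b" using f_B0[OF uD] by (simp add: B0_def)
    ultimately show ?thesis using kap1[of "f u"] fif[OF uA] by simp
  qed
  have fX: "f u \<in> ?Y" if "u \<in> ?X" "u \<notin> E" for u using that lev_A[of u] by (auto simp: V_def A_def)
  have kEE: "k u = u" "\<Psi> u = sim a l u" if u: "u \<in> V d" for u
  proof -
    show 1: "k u = u" by (rule kd[OF u])
    show "\<Psi> u = sim a l u" using \<Psi>r[of u] 1 u VX by auto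
  qed
  define F0 where "F0 x = \<Phi> (f (\<Psi>i x))" for x
  define G0 where "G0 y = \<Psi> (fi (\<Phi>i y))" for y
  have KC: "k ` ?K \<subseteq> closure D" "k ` ?K \<subseteq> D" using KX XD CD by blast+
  \<comment> \<open>A point off the first copy of \<open>?X\<close> is carried by
    \<open>\<Psi>i\<close> off \<open>V d\<close>, because \<Psi> is the similarity there; hence
    \<open>f\<close> is defined at the result.\<close>
  have Fz: "\<Psi>i x \<in> A" "f (\<Psi>i x) \<in> cball c R - b" "F0 x \<in> cball c R - sim c l ` ?Y" "G0 (F0 x) = x"
    if x: "x \<in> closure D - sim a l ` ?X" for x
  proof -
    define z where "z = \<Psi>i x"
    have xz: "\<Psi> z = x" by (simp add: z_def S.inv2)
    have zC: "z \<in> closure D" unfolding z_def using S.pres'[OF KC(1)] x by blast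
    have zV: "z \<notin> V d"
    proof
      assume z: "z \<in> V d"
      then have "x = sim a l z" using kEE(2)[OF z] xz by simp
      then show False using x z VX by blast
    qed
    have zk: "z \<noteq> k u" if u: "u \<in> ?X" for u
    proof
      assume "z = k u"
      then have "x = sim a l u" using \<Psi>r[OF u] xz by simp
      then show False using x u by blast
    qed
    have zA: "z \<in> A" using zC zV EV ED by (auto simp: A_def)
    then show "\<Psi>i x \<in> A" by (simp add: z_def)
    have fz: "f z \<in> cball c R - b" by (rule fin[OF zA])
    then show "f (\<Psi>i x) \<in> cball c R - b" by (simp add: z_def)
    have Fx: "F0 x = \<Phi> (f z)" by (simp add: F0_def z_def)
    have "F0 x \<noteq> sim c l w" if w: "w \<in> ?Y" for w
    proof
      assume "F0 x = sim c l w"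
      then have "\<Phi> (f z) = \<Phi> (kap w)" using Fx \<Phi>r[OF w] by simp
      from arg_cong[OF this, of \<Phi>i] have fw: "f z = kap w" by (simp add: P.inv1)
      have wQ: "w \<in> ?Q" using w YQ by blast
      show False
      proof (cases "w \<in> closure b")
        case True
        then have "f z \<in> ball c d" using fw kapd bd by simp
        then have "z \<in> V d" using lev_A[OF zA] zC by (simp add: V_def)
        then show False using zV by simp
      next
        case False
        have "z = k (fi w)" using f_inj[OF zA, of "k (fi w)"] fw kap1[OF wQ False] kfi(1)[OF wQ False] DE(2) by auto
        moreover have "fi w \<in> ?X" using fiW[OF QB[OF wQ False]] w CD by (auto simp: V_def)
        ultimately show False using zk by blast
      qed
    qed
    moreover have "F0 x \<in> cball c R" unfolding Fx using P.pres[OF KB] fz by blast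
    ultimately show "F0 x \<in> cball c R - sim c l ` ?Y" by blast
    show "G0 (F0 x) = x" by (simp only: G0_def Fx P.inv1 fif[OF zA] xz)
  qed
  have Gz: "G0 y \<in> closure D - sim a l ` ?X \<and> F0 (G0 y) = y" "\<Phi>i y \<in> cball c R - b"
    if y: "y \<in> cball c R - sim c l ` ?Y" for y
  proof -
    define v where "v = \<Phi>i y"
    have yv: "\<Phi> v = y" by (simp add: v_def P.inv2)
    have vB: "v \<in> cball c R" unfolding v_def using P.pres'[OF KB] y by blast
    have vk: "v \<noteq> kap w" if w: "w \<in> ?Y" for w
    proof
      assume "v = kap w"
      then have "y = sim c l w" using \<Phi>r[OF w] yv by simp
      then show False using y w by blast
    qed
    have vd: "v \<notin> ball c d" using vk[of v] kapd[of v] dY by auto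
    have vA: "v \<in> cball c R - b" using vB vd bd closure_subset[of b] by blast
    then show "\<Phi>i y \<in> cball c R - b" by (simp add: v_def)
    define z where "z = fi v"
    have z: "z \<in> A" "f z = v" using fi_in[OF vA] ffi[OF vA] by (auto simp: z_def)
    have Gy: "G0 y = \<Psi> z" by (simp add: G0_def v_def z_def)
    have "\<Psi> z \<noteq> sim a l u" if u: "u \<in> ?X" for u
    proof
      assume "\<Psi> z = sim a l u"
      then have "\<Psi> z = \<Psi> (k u)" using \<Psi>r[OF u] by simp
      from arg_cong[OF this, of \<Psi>i] have zu: "z = k u" by (simp add: S.inv1)
      have "u \<notin> E"
      proof
        assume uE: "u \<in> E"
        then have "k u = u" using kd EV ED by blast
        then show False using zu uE z(1) by (simp add: A_def)
      qed
      then show False using vk[OF fX[OF u]] kapf[OF u] z(2) zu by simp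
    qed
    moreover have "\<Psi> z \<in> closure D" using S.pres[OF KC(1)] z(1) A_D by blast
    moreover have "F0 (\<Psi> z) = y" by (simp only: F0_def S.inv1 z(2) yv)
    ultimately show "G0 y \<in> closure D - sim a l ` ?X \<and> F0 (G0 y) = y" unfolding Gy by blast
  qed
  have FX: "F0 x \<in> ?Y" if x: "x \<in> ?X - sim a l ` ?X" for x
  proof -
    have "x \<in> closure D - sim a l ` ?X" using x XD CD by blast
    then have A: "\<Psi>i x \<in> A" by (rule Fz(1))
    have "\<Psi>i x \<in> ?X" using S.pres'[OF KX] x by blast
    then have "f (\<Psi>i x) \<in> ?Y" by (rule fX) (use A in \<open>simp add: A_def\<close>)
    then show ?thesis unfolding F0_def using P.pres[OF KY] by blast
  qed
  have GY: "G0 y \<in> ?X" if y: "y \<in> ?Y - sim c l ` ?Y" for y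
  proof -
    have y': "y \<in> cball c R - sim c l ` ?Y" using y YB by blast
    have v: "\<Phi>i y \<in> cball c R - b" by (rule Gz(2)[OF y'])
    have "\<Phi>i y \<in> ?Y" using P.pres'[OF KY] y by blast
    then have "fi (\<Phi>i y) \<in> ?X" using lev_A[OF fi_in[OF v]] ffi[OF v] fi_in[OF v] A_D by (auto simp: V_def)
    then show ?thesis unfolding G0_def using S.pres[OF KX] by blast
  qed
  have N: "nest (closure D) ?X a l"
  proof
    show "?X \<subseteq> closure D" using XD CD by blast
    show "a \<in> ?X" using g(1) VX by blast
    show "bounded ?X" using XR bounded_subset[OF bounded_ball] by blast
    show "sim a l ` ?X \<subseteq> ?X" using rV VX by blast
  qed (use l in auto)
  have N': "nest (cball c R) ?Y c l"
  proof
    show "sim c l ` ?Y \<subseteq> ?Y" using rY dY by blast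
  qed (use l YB r in auto)
  interpret N: nest "closure D" ?X a l by (rule N)
  interpret N': nest "cball c R" ?Y c l by (rule N')
  define F where "F = spiral a l ?X c F0"
  define G where "G = spiral c l ?Y a G0"
  have FG: "F x \<in> cball c R" "G (F x) = x" if "x \<in> closure D" for x unfolding F_def G_def
    by (rule spiral_inverse[where ?F0.0 = F0 and ?G0.0 = G0, OF N N' conjI[OF Fz(3,4)] FX that]; assumption)+
  have GF: "G y \<in> closure D" "F (G y) = y" if "y \<in> cball c R" for y unfolding F_def G_def
    by (rule spiral_inverse[where ?F0.0 = G0 and ?G0.0 = F0, OF N' N Gz(1) GY that]; assumption)+
  have Fa: "F a = c" "G c = a" by (simp_all add: F_def G_def spiral_def)
  have Finj: "inj_on F (closure D)" by (rule inj_on_inverseI[of _ G]) (rule FG(2))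
  have Fim: "F ` closure D = cball c R"
  proof
    show "cball c R \<subseteq> F ` closure D"
    proof
      fix y assume y: "y \<in> cball c R"
      show "y \<in> F ` closure D" by (rule image_eqI[where f = F, OF GF(2)[OF y, symmetric] GF(1)[OF y]])
    qed
  qed (use FG in blast)
  \<comment> \<open>The supports of \<Psi> and \<Phi> are compact below level \<open>s1\<close>,
    hence lie below some smaller level \<open>s\<close>. Between \<open>s\<close> and
    \<open>s1\<close> the map is still \<open>f\<close>, and this margin makes the shells
    overlap.\<close>
  obtain s where s: "d \<le> s" "s < s1" "k ` ?K \<subseteq> W s" "kap ` ?K' \<subseteq> cball c s"
  proof -
    have Kc: "compact (k ` ?K)" by (rule compact_continuous_image[OF continuous_on_subset[OF LWembD(7)[OF kL] KO(1)] compact_cball])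
    have K'c: "compact (kap ` ?K')" by (rule compact_continuous_image[OF continuous_on_subset[OF LWembD(7)[OF kapL] KO(2)] compact_cball])
    let ?T = "k ` ?K \<inter> - E"
    have Tc: "compact ?T" by (rule compact_Int_closed[OF Kc]) (use E(1) in \<open>simp add: closed_Compl\<close>)
    have TA: "?T \<subseteq> A" using KC(1) by (auto simp: A_def)
    have "compact (f ` ?T \<union> kap ` ?K')"
      by (rule compact_Un[OF compact_continuous_image[OF continuous_on_subset[OF fc TA] Tc] K'c])
    moreover have "f ` ?T \<union> kap ` ?K' \<subseteq> ?Y" using KY fX KX by blast
    ultimately obtain s where s: "d \<le> s" "s < s1" "f ` ?T \<union> kap ` ?K' \<subseteq> cball c s"
      by (rule compact_in_smaller_ball[OF _ _ g(4)])
    have "k ` ?K \<subseteq> W s"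
    proof
      fix x assume x: "x \<in> k ` ?K"
      then have "x \<in> closure D" using KC(1) by blast
      moreover have "lev x \<le> s"
      proof (cases "x \<in> E")
        case True
        then show ?thesis using s(1) d(1) by (simp add: lev_def)
      next
        case False
        then have "x \<in> ?T" using x by blast
        then have "f x \<in> cball c s" using s(3) by blast
        then show ?thesis using False by (simp add: lev_def)
      qed
      ultimately show "x \<in> W s" by (simp add: W_def)
    qed
    then show ?thesis using that s by blast
  qed
  have sX: "W s \<subseteq> ?X" "V d \<subseteq> W s" using V_W(3)[OF s(2)] V_W(1)[OF s(1)] by auto
  have sE: "closure E \<subseteq> W s" using EV sX by blast
  have F0f: "F0 x = f x" if x: "x \<in> closure D" "x \<notin> W s" for x
  proof -
    have xA: "x \<in> A" using x sE ED by (auto simp: A_def)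
    have "x \<notin> k ` ?K" using x s(3) by blast
    then have "\<Psi>i x = x" by (rule S.off')
    moreover have "f x \<notin> cball c s" using x lev_A[OF xA] by (simp add: W_def)
    then have "f x \<notin> kap ` ?K'" using s(4) by blast
    then have "\<Phi> (f x) = f x" by (rule P.off)
    ultimately show ?thesis by (simp add: F0_def)
  qed
  have Frr: "F x = F0 x" if "x \<in> closure D" "x \<notin> sim a l ` ?X" for x
    unfolding F_def by (rule N.spiral_outer) (use that in blast)
  have rXs: "sim a l ` ?X \<subseteq> W s" using rV sX by blast
  have Ff: "F x = f x" if x: "x \<in> closure D" "x \<notin> W s" for x using Frr[OF x(1)] F0f[OF x] rXs x(2) by auto
  \<comment> \<open>By definition this holds off the copy of \<open>?X\<close>. In the rim between
    the copies of \<open>W s\<close> and \<open>?X\<close> the self-similar rule gives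
    \<open>sim c l (f u)\<close>, and \<open>kapf\<close> identifies this with the value of
    \<open>F0\<close>.\<close>
  have FF0: "F x = F0 x" if x: "x \<in> closure D" "x \<notin> sim a l ` W s" for x
  proof (cases "x \<in> sim a l ` ?X")
    case True
    then obtain u where u: "u \<in> ?X" "x = sim a l u" by blast
    have us: "u \<notin> W s" using u x by blast
    have uE: "u \<notin> E" using us sE ED by blast
    have uC: "u \<in> closure D" using u XD CD by blast
    have "F x = sim c l (F u)" unfolding u(2) F_def by (rule N.spiral_sim[OF u(1)])
    also have "\<dots> = sim c l (f u)" by (simp only: Ff[OF uC us])
    also have "\<dots> = \<Phi> (f (k u))" using \<Phi>r[OF fX[OF u(1) uE]] kapf[OF u(1) uE] by simp
    also have "k u = \<Psi>i x" using S.inv1[of "k u"] \<Psi>r[OF u(1)] u(2) by simp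
    finally show ?thesis by (simp add: F0_def)
  qed (rule Frr[OF x(1)])
  \<comment> \<open>An open set that reaches across the seam. Together with the similar copies of
    its part in \<open>?X\<close> it covers \<open>D\<close> without \<open>a\<close>, which leaves
    a single point to be treated separately.\<close>
  define W0 where "W0 = D - sim a l ` W s"
  have Wc: "compact (W s)" by (rule compact_W[OF s(1)])
  have "compact (sim a l ` W s)"
    unfolding sim_def by (rule compact_continuous_image[OF _ Wc]) (intro continuous_intros)
  then have W0o: "open W0" unfolding W0_def using D(1) by (simp add: open_Diff compact_imp_closed)
  have lF0: "LWemb p W0 F"
  proof -
    have in1: "\<Psi>i x \<in> D - closure E" if x: "x \<in> W0" for x
    proof -
      have "\<Psi>i x \<in> D" using S.pres'[OF KC(2)] x by (auto simp: W0_def)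
      moreover have "\<Psi>i x \<notin> closure E"
      proof
        assume z: "\<Psi>i x \<in> closure E"
        then have "\<Psi> (\<Psi>i x) = sim a l (\<Psi>i x)" using kEE(2) EV by blast
        then have "x = sim a l (\<Psi>i x)" by (simp add: S.inv2)
        then show False using x z sE by (auto simp: W0_def)
      qed
      ultimately show ?thesis by blast
    qed
    have 1: "LWemb p W0 \<Psi>i" by (rule LWemb_subset[OF SL(2) subset_UNIV W0o])
    have 2: "LWemb p W0 (\<lambda>x. f (\<Psi>i x))" by (rule LWemb_comp[OF 1 lwD]) (use in1 in blast)
    have 3: "LWemb p W0 (\<lambda>x. \<Phi> (f (\<Psi>i x)))" by (rule LWemb_comp[OF 2 PL(1)]) simp
    show ?thesis
    proof (rule LWemb_cong[OF 3])
      fix x assume "x \<in> W0"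
      then have "F x = F0 x" using CD by (intro FF0) (auto simp: W0_def)
      then show "\<Phi> (f (\<Psi>i x)) = F x" by (simp add: F0_def)
    qed
  qed
  have aW: "a \<notin> W0" unfolding W0_def using g(1) sX by (auto intro!: image_eqI[of _ _ a])
  have Da: "open (D - {a})" using D(1) by (simp add: open_delete)
  have aD: "a \<in> D" using g(1) VX XD by blast
  have lFa: "LWemb p (D - {a}) F"
  proof (rule LWemb_local[OF p inj_on_subset[OF Finj]])
    show "D - {a} \<subseteq> closure D" using CD by blast
    fix x assume x: "x \<in> D - {a}"
    define i where "i = depth a l ?X x"
    define w where "w = sim a (1 / l ^ i) x"
    have xw: "x = sim a (l ^ i) w" using l by (simp add: w_def)
    have wr: "w \<notin> sim a l ` ?X" unfolding w_def i_def by (rule N.depth) (use x in blast)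
    then have wr': "w \<notin> sim a l ` W s" using sX(1) by blast
    show "\<exists>U. x \<in> U \<and> U \<subseteq> D - {a} \<and> LWemb p U F"
    proof (cases i)
      case 0
      have "x \<in> W0" using x wr' xw 0 by (simp add: W0_def)
      then show ?thesis by (intro LWemb_nbhd[OF lF0]) (use aW in \<open>auto simp: W0_def\<close>)
    next
      case (Suc j)
      have wX: "w \<in> ?X" unfolding w_def using N.depth_pos[of x j] x Suc by (auto simp: i_def)
      let ?P = "W0 \<inter> ?X"
      have wP: "w \<in> ?P" using wX wr' XD by (auto simp: W0_def)
      have Po: "open ?P" using W0o Xo by blast
      have t0: "l ^ i \<noteq> 0" using l by simp
      have t1: "1 / l ^ i \<noteq> 0" using l by simp
      \<comment> \<open>A neighbourhood of \<open>x\<close> on which \<open>F\<close> is obtained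
        from its restriction to \<open>?P\<close> by the \<open>i\<close>-th powers of the two
        similarities.\<close>
      let ?U = "sim a (l ^ i) ` ?P"
      have Uo: "open ?U" by (rule LWembD(3)[OF LWemb_sim[OF p t0 Po]])
      have 1: "LWemb p ?U (sim a (1 / l ^ i))" by (rule LWemb_sim[OF p t1 Uo])
      have bk: "sim a (1 / l ^ i) (sim a (l ^ i) z) = z" for z using l(1) by simp
      have 2: "LWemb p ?U (\<lambda>x. F (sim a (1 / l ^ i) x))" by (rule LWemb_comp[OF 1 lF0]) (use bk in auto)
      have 3: "LWemb p ?U (\<lambda>x. sim c (l ^ i) (F (sim a (1 / l ^ i) x)))"
        by (rule LWemb_comp[OF 2 LWemb_sim[OF p t0 open_UNIV]]) simp
      have 4: "LWemb p ?U F"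
      proof (rule LWemb_cong[OF 3])
        fix x assume "x \<in> ?U"
        then obtain z where z: "z \<in> ?P" "x = sim a (l ^ i) z" by blast
        have "F x = sim c (l ^ i) (F z)" unfolding z(2) F_def using N.spiral_sim_pow z(1) by blast
        then show "sim c (l ^ i) (F (sim a (1 / l ^ i) x)) = F x" unfolding z(2) bk by simp
      qed
      show ?thesis
      proof (rule LWemb_nbhd[OF 4])
        show "x \<in> ?U" using wP xw by blast
        show "?U \<subseteq> D - {a}"
        proof
          fix x assume "x \<in> ?U"
          then obtain z where z: "z \<in> ?P" "x = sim a (l ^ i) z" by blast
          have za: "z \<noteq> a" and zX: "z \<in> ?X" using z(1) aW by blast+
          have "x \<noteq> a" unfolding z(2) sim_eq_self[OF t0] by (rule za)
          moreover have "x \<in> ?X" unfolding z(2) by (rule N.simX[OF zX])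
          ultimately show "x \<in> D - {a}" using XD by blast
        qed
      qed
    qed
  qed
  have sphere: "F x \<in> sphere c R \<longleftrightarrow> x \<notin> D" if x: "x \<in> closure D" for x
  proof
    assume "x \<notin> D"
    then have "dist c (f x) = R" "x \<notin> W s" using frD[OF x] s r by (auto simp: W_def)
    then show "F x \<in> sphere c R" using Ff[OF x] by simp
  next
    assume "F x \<in> sphere c R"
    then obtain x' where x': "x' \<in> frontier D" "F x = f x'" using fD by blast
    have x'C: "x' \<in> closure D" "x' \<notin> D" using x'(1) D(1) by (auto simp: frontier_def interior_open)
    have "x' \<notin> W s" using frD(3)[OF x'C] s r by (auto simp: W_def)
    then have "F x = F x'" using Ff[OF x'C(1)] x'(2) by simp
    then have "x = x'" by (rule inj_onD[OF Finj _ x x'C(1)])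
    then show "x \<notin> D" using x'C(2) by simp
  qed
  have FD: "F ` D = ball c R"
  proof
    show "F ` D \<subseteq> ball c R"
    proof
      fix y assume "y \<in> F ` D"
      then obtain x where x: "x \<in> D" "y = F x" by blast
      then have xC: "x \<in> closure D" using CD by blast
      show "y \<in> ball c R" using FG(1)[OF xC] sphere[OF xC] x by auto
    qed
    show "ball c R \<subseteq> F ` D"
    proof
      fix y assume y: "y \<in> ball c R"
      then have yB: "y \<in> cball c R" by simp
      have "F (G y) \<notin> sphere c R" using GF(2)[OF yB] y by auto
      then have "G y \<in> D" using sphere[OF GF(1)[OF yB]] by blast
      then show "y \<in> F ` D" by (rule image_eqI[where f = F, OF GF(2)[OF yB, symmetric]])
    qed
  qed
  have FDa: "F ` (D - {a}) = ball c R - {c}"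
  proof -
    have "F ` (D - {a}) = F ` D - F ` {a}"
      by (rule inj_on_image_set_diff[OF inj_on_subset[OF Finj CD]]) (use aD in auto)
    then show ?thesis using FD Fa by simp
  qed
  have lGa: "LWemb p (ball c R - {c}) G"
  proof -
    have "LWemb p (ball c R - {c}) (inv_into (D - {a}) F)" using LWemb_inv[OF lFa] unfolding FDa .
    then show ?thesis
    proof (rule LWemb_cong)
      fix y assume "y \<in> ball c R - {c}"
      then have "y \<in> F ` (D - {a})" unfolding FDa .
      then obtain x where x: "x \<in> D - {a}" "y = F x" by blast
      have "inv_into (D - {a}) F (F x) = x" by (rule inv_into_f_f[OF LWembD(4)[OF lFa] x(1)])
      moreover have "G (F x) = x" by (rule FG(2)) (use x CD in blast)
      ultimately show "inv_into (D - {a}) F y = G y" using x by simp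
    qed
  qed
  obtain e1 where e1: "e1 > 0" "ball a e1 \<subseteq> ?X" using openE[OF Xo N.aX] by metis
  \<comment> \<open>\<open>F\<close> and its inverse are both self-similar about their centres with
    ratio \<open>l\<close>, so one regularity result serves both directions.\<close>
  have rF: "reg p (ball a e1) F"
  proof (rule self_similar_reg[OF p pn l(1,2) e1(1)])
    show "reg p (ball a e1 - {a}) F"
    proof (rule reg_subset[OF LWembD(5)[OF lFa] Da p])
      show "ball a e1 - {a} \<subseteq> D - {a}" using e1(2) XD by blast
    qed (simp add: open_delete)
    show "F (a + l *\<^sub>R (x - a)) = c + l *\<^sub>R (F x - c)" if "x \<in> ball a e1" for x
      using N.spiral_sim[of x c F0] that e1(2) unfolding F_def[symmetric] by (auto simp: sim_def)
  qed
  have rG: "reg p (ball c s1) G"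
  proof (rule self_similar_reg[OF p pn l(1,2) r(5)])
    show "reg p (ball c s1 - {c}) G"
    proof (rule reg_subset[OF LWembD(5)[OF lGa] _ p])
      show "ball c s1 - {c} \<subseteq> ball c R - {c}" using r by auto
    qed (simp_all add: open_delete)
    show "G (c + l *\<^sub>R (y - c)) = a + l *\<^sub>R (G y - a)" if "y \<in> ball c s1" for y
      using N'.spiral_sim[OF that, of a G0] unfolding G_def[symmetric] by (simp add: sim_def)
  qed
  have lFD: "LWemb p D F"
  proof (rule LWembI[OF p D(1) _ _ open_ball FD])
    show "reg p D F"
    proof (rule reg_local[OF D(1) p])
      fix x assume x: "x \<in> D"
      show "\<exists>U. open U \<and> x \<in> U \<and> reg p U F"
      proof (cases "x = a")
        case True
        then show ?thesis by (intro exI[of _ "ball a e1"] conjI rF) (use e1 in auto)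
      qed (intro exI[of _ "D - {a}"] conjI Da LWembD(5)[OF lFa], use x in simp)
    qed
    show "reg p (ball c R) G"
    proof (rule reg_local[OF open_ball p])
      fix y assume y: "y \<in> ball c R"
      show "\<exists>U. open U \<and> y \<in> U \<and> reg p U G"
      proof (cases "y = c")
        case True
        then show ?thesis by (intro exI[of _ "ball c s1"] conjI rG) (use r in auto)
      qed (intro exI[of _ "ball c R - {c}"] conjI LWembD(2,5)[OF lGa], use y in simp)
    qed
    show "G (F x) = x" if "x \<in> D" for x using FG(2) CD that by blast
  qed
  have Ws: "closed (W s)" by (rule compact_imp_closed[OF Wc])
  show ?thesis
  proof (rule that[OF Wc _ _ Ff _ Fim Finj])
    show "W s \<subseteq> D" using sX XD by blast
    show "E \<subseteq> W s" using sE ED by blast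
    show "continuous_on (closure D) F"
    proof -
      have un: "D \<union> (closure D - W s) = closure D" using CD sX XD by blast
      have "continuous_on (D \<union> (closure D - W s)) F"
      proof (rule continuous_on_Un_local_open)
        show "openin (top_of_set (D \<union> (closure D - W s))) D" unfolding un by (rule open_subset[OF CD D(1)])
        show "openin (top_of_set (D \<union> (closure D - W s))) (closure D - W s)"
          unfolding un using openin_open_Int[of "- W s" "closure D"] Ws by (simp add: open_Compl Diff_eq)
        show "continuous_on D F" by (rule LWembD(7)[OF lFD])
        have "continuous_on (closure D - W s) f"
          by (rule continuous_on_subset[OF fc]) (use sE ED in \<open>auto simp: A_def\<close>)
        then show "continuous_on (closure D - W s) F" by (rule continuous_on_eq) (use Ff in auto)
      qed
      then show ?thesis unfolding un .
    qed
    show "LWemb p (interior (closure D)) F"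
    proof (rule LWemb_local[OF p inj_on_subset[OF Finj interior_subset]])
      fix x assume x: "x \<in> interior (closure D)"
      have Di: "D \<subseteq> interior (closure D)" by (rule interior_maximal[OF CD D(1)])
      show "\<exists>U. x \<in> U \<and> U \<subseteq> interior (closure D) \<and> LWemb p U F"
      proof (cases "x \<in> D")
        case True
        then show ?thesis by (intro LWemb_nbhd[OF lFD] Di)
      next
        case False
        \<comment> \<open>The interior of the closure may a priori be larger than \<open>D\<close>.
          Its further points have level \<open>R\<close>, where \<open>F\<close> is
          \<open>f\<close>, and \<open>f\<close> is regular in the interior of the collar.\<close>
        let ?U = "interior (closure D) - W s"
        have o: "open ?U" using Ws by (simp add: open_Diff)
        have "?U \<subseteq> closure D - E" using interior_subset[of "closure D"] sE ED by blast
        then have "?U \<subseteq> interior (closure D - E)" by (rule interior_maximal[OF _ o])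
        then have "LWemb p ?U f" by (rule LWemb_subset[OF lw _ o])
        then have "LWemb p ?U F" by (rule LWemb_cong) (use Ff interior_subset[of "closure D"] in auto)
        then show ?thesis by (rule LWemb_nbhd) (use x False sX XD in auto)
      qed
    qed
  qed
qed

end

section \<open>Reduction to a small hole\<close>

theorem theorem1p3:
  fixes p :: real and D1 D2 :: "(real^'n) set" and c1 c2 :: "real^'n" and r1 r2 :: real
    and f :: "real^'n \<Rightarrow> real^'n"
  assumes "1 \<le> p" and "p < real CARD('n)"
    and "jordan_domain D1" and "jordan_domain D2" and "closure D1 \<subseteq> D2"
    and "r1 > 0" and "r2 > 0" and "closure (ball c1 r1) \<subseteq> ball c2 r2"
    and "LW2_closed p (closure D2 - D1) (closure (ball c2 r2) - ball c1 r1) f"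
    and "f ` frontier D1 = frontier (ball c1 r1)" and "f ` frontier D2 = frontier (ball c2 r2)"
  shows "\<exists>F N. LW2_closed p (closure D2) (closure (ball c2 r2)) F \<and>
           open N \<and> frontier D2 \<subseteq> N \<and>
           N \<inter> closure D2 \<subseteq> closure D2 - D1 \<and> (\<forall>x \<in> N \<inter> closure D2. F x = f x)"
proof -
  have cb: "closure (ball c2 r2) = cball c2 r2" "closure (ball c1 r1) = cball c1 r1" using assms(6,7) by auto
  obtain gg where gg: "homeomorphism (closure D2 - D1) (cball c2 r2 - ball c1 r1) f gg"
    and lw: "LW2 p (interior (closure D2 - D1)) (f ` interior (closure D2 - D1)) f"
    using assms(9) unfolding LW2_closed_def cb by blast
  have lwf: "LWemb p (interior (closure D2 - D1)) f" by (rule LW2_imp_LWemb[OF lw open_interior assms(1)])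
  have "cball c1 r1 \<subseteq> ball c2 r2" using assms(8) cb by simp
  \<comment> \<open>This lower bound for \<open>t\<close> makes it positive.\<close>
  moreover have "r2 / 2 < r2" using assms(7) by simp
  ultimately obtain t where t: "r2 / 2 \<le> t" "t < r2" "cball c1 r1 \<subseteq> cball c2 t"
    by (rule compact_in_smaller_ball[OF compact_cball])
  define T where "T = (t + r2) / 2"
  have tT: "0 < t" "t < T" "T < r2" using t assms(7) by (auto simp: T_def)
  \<comment> \<open>The factor 1/40 brings the closed inner ball, contained in
    \<open>cball c2 t\<close>, within distance \<open>r2 / 40\<close> of \<open>c2\<close>, well
    inside the radius \<open>r2 / 20\<close> that \<open>collar\<close> requires, and \<rho> is the
    identity near the outer sphere.\<close>
  obtain \<rho> \<rho>' where sb: "support_bij \<rho> \<rho>' (ball c2 T)" and \<rho>L: "LWemb p UNIV \<rho>" "LWemb p UNIV \<rho>'"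
    and \<rho>: "\<And>x. x \<in> cball c2 t \<Longrightarrow> \<rho> x = c2 + (1 / 40) *\<^sub>R (x - c2)"
    by (rule radial_contraction_bij[OF assms(1) tT(1,2), of "1 / 40" c2]) auto
  interpret H: support_bij \<rho> \<rho>' "ball c2 T" by fact
  have inj: "inj_on \<rho> S" for S by (rule inj_on_inverseI[of _ \<rho>']) (rule H.inv1)
  have c: "continuous_on S \<rho>" "continuous_on S \<rho>'" for S
    using continuous_on_subset[OF LWembD(7)[OF \<rho>L(1)]] continuous_on_subset[OF LWembD(7)[OF \<rho>L(2)]] by auto
  have TB: "ball c2 T \<subseteq> cball c2 r2" using tT by auto
  let ?b = "\<rho> ` ball c1 r1"
  have bo: "open ?b" by (rule LWembD(3)[OF LWemb_subset[OF \<rho>L(1) subset_UNIV open_ball]])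
  have bcl: "closure ?b = \<rho> ` cball c1 r1"
  proof
    have "compact (\<rho> ` cball c1 r1)" by (rule compact_continuous_image[OF c(1) compact_cball])
    then show "closure ?b \<subseteq> \<rho> ` cball c1 r1" by (intro closure_minimal image_mono compact_imp_closed) auto
    have "\<rho> ` closure (ball c1 r1) \<subseteq> closure ?b" by (rule image_closure_subset[OF c(1) closed_closure closure_subset])
    then show "\<rho> ` cball c1 r1 \<subseteq> closure ?b" using cb by simp
  qed
  have bfr: "frontier ?b = \<rho> ` frontier (ball c1 r1)"
  proof -
    have "frontier ?b = \<rho> ` cball c1 r1 - ?b" unfolding frontier_def bcl interior_open[OF bo] ..
    also have "\<dots> = \<rho> ` (cball c1 r1 - ball c1 r1)" by (rule inj_on_image_set_diff[OF inj[of UNIV], symmetric]) auto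
    also have "cball c1 r1 - ball c1 r1 = frontier (ball c1 r1)" using cb by (simp add: frontier_def interior_open)
    finally show ?thesis .
  qed
  have fr2: "frontier (ball c2 r2) = sphere c2 r2" using assms(7) by simp
  \<comment> \<open>An empty \<open>D1\<close> would have an empty boundary, whose image could not
    be a sphere of positive radius.\<close>
  have fr1: "D1 \<noteq> {}"
  proof
    assume "D1 = {}"
    then have "frontier (ball c1 r1) = {}" using assms(10) by simp
    then show False using assms(6) by simp
  qed
  interpret K: collar p D2 D1 "\<rho> \<circ> f" "gg \<circ> \<rho>'" c2 r2 ?b
  proof
    show "1 \<le> p" "r2 > 0" "closure D1 \<subseteq> D2" "D1 \<noteq> {}" "open ?b" by (fact assms fr1 bo)+
    show "open D2" "bounded D2" "open D1" using assms(3,4) by (auto simp: jordan_domain_def)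
    show "closure ?b \<subseteq> ball c2 (r2 / 20)" unfolding bcl
    proof
      fix y assume "y \<in> \<rho> ` cball c1 r1"
      then obtain x where x: "x \<in> cball c1 r1" "y = \<rho> x" by blast
      then have x2: "x \<in> cball c2 t" using t by blast
      have "norm (y - c2) = norm (x - c2) / 40" unfolding x(2) \<rho>[OF x2] by simp
      moreover have "norm (x - c2) \<le> t" using x2 by (simp add: dist_norm norm_minus_commute)
      ultimately have "norm (y - c2) < r2 / 20" using t assms(7) by linarith
      then show "y \<in> ball c2 (r2 / 20)" by (simp add: dist_norm norm_minus_commute)
    qed
    show "homeomorphism (closure D2 - D1) (cball c2 r2 - ?b) (\<rho> \<circ> f) (gg \<circ> \<rho>')"
    proof (rule homeomorphism_compose[OF gg])
      have im: "\<rho> ` (cball c2 r2 - ball c1 r1) = cball c2 r2 - ?b"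
        using inj_on_image_set_diff[OF inj[of UNIV], of "cball c2 r2" "ball c1 r1"] H.image(1)[OF TB] by simp
      have im': "\<rho>' ` (cball c2 r2 - ?b) = cball c2 r2 - ball c1 r1"
        unfolding im[symmetric] by (simp add: image_image H.inv1)
      show "homeomorphism (cball c2 r2 - ball c1 r1) (cball c2 r2 - ?b) \<rho> \<rho>'"
        unfolding homeomorphism_def by (intro conjI ballI H.inv1 H.inv2 im im' c)
    qed
    show "(\<rho> \<circ> f) ` frontier D2 = sphere c2 r2"
    proof -
      have "\<rho> ` sphere c2 r2 = sphere c2 r2"
      proof -
        have "\<rho> x = x" if "x \<in> sphere c2 r2" for x by (rule H.off) (use that tT in auto)
        then show ?thesis by force
      qed
      then show ?thesis unfolding image_comp[symmetric] assms(11) fr2 .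
    qed
    show "(\<rho> \<circ> f) ` frontier D1 = frontier ?b" unfolding image_comp[symmetric] assms(10) bfr ..
    show "LWemb p (interior (closure D2 - D1)) (\<rho> \<circ> f)"
      unfolding comp_def by (rule LWemb_comp[OF lwf \<rho>L(1) subset_UNIV])
  qed
  show ?thesis
  proof (rule K.extension[OF assms(2)])
    fix F s
    assume W: "compact (K.W s)" "K.W s \<subseteq> D2" "D1 \<subseteq> K.W s"
      and Ff: "\<And>x. x \<in> closure D2 \<Longrightarrow> x \<notin> K.W s \<Longrightarrow> F x = (\<rho> \<circ> f) x" and Fc: "continuous_on (closure D2) F"
      and F: "F ` closure D2 = cball c2 r2" "inj_on F (closure D2)" and FL: "LWemb p (interior (closure D2)) F"
    \<comment> \<open>Near the boundary of \<open>D2\<close> the extension is \<rho> after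
      \<open>f\<close>, so undoing \<rho> restores \<open>f\<close> exactly.\<close>
    let ?F = "\<lambda>x. \<rho>' (F x)" and ?N = "- K.W s"
    have "LW2_closed p (closure D2) (closure (ball c2 r2)) ?F" unfolding LW2_closed_def cb
    proof
      have "compact (closure D2)" using assms(4) by (simp add: jordan_domain_def compact_closure)
      moreover have "continuous_on (closure D2) ?F" by (rule continuous_on_compose2[OF c(2) Fc]) auto
      moreover have "?F ` closure D2 = cball c2 r2" using H.image(2)[OF TB] F(1) by (simp add: image_image[symmetric])
      moreover have "inj_on ?F (closure D2)"
      proof (rule inj_onI)
        fix x y assume xy: "x \<in> closure D2" "y \<in> closure D2" "\<rho>' (F x) = \<rho>' (F y)"
        from arg_cong[OF xy(3), of \<rho>] have "F x = F y" by (simp add: H.inv2)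
        then show "x = y" by (rule inj_onD[OF F(2) _ xy(1,2)])
      qed
      ultimately show "\<exists>g. homeomorphism (closure D2) (cball c2 r2) ?F g" by (rule homeomorphism_compact)
      show "LW2 p (interior (closure D2)) (?F ` interior (closure D2)) ?F"
        by (rule LWemb_imp_LW2[OF LWemb_comp[OF FL \<rho>L(2) subset_UNIV]])
    qed
    moreover have "open ?N" using compact_imp_closed[OF W(1)] by (simp add: open_Compl)
    moreover have "frontier D2 \<subseteq> ?N" using W(2) K.D(1) by (auto simp: frontier_def interior_open)
    moreover have "?N \<inter> closure D2 \<subseteq> closure D2 - D1" using W(3) by blast
    moreover have "\<forall>x \<in> ?N \<inter> closure D2. ?F x = f x"
    proof
      fix x assume "x \<in> ?N \<inter> closure D2"
      then have "F x = \<rho> (f x)" using Ff[of x] by simp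
      then show "?F x = f x" by (simp add: H.inv1)
    qed
    ultimately show ?thesis by (intro exI[of _ ?F] exI[of _ ?N] conjI)
  qed
qed

end
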